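(* Suppose that $P_S=S\times\mathcal O$ and $\bar P=\bar M\times\mathcal O$ are trivial principal $\mathcal O$-bundles, and let $A\in\Omega^1(S,\mathfrak o)$ be the one-form determining a principal connection on $P_S$. Then the momentum map $\mathbf J_R(f)=[f^*\Theta_{\bar P}]$ associated to the right action of $\mathcal{A}ut_{\rm vol}(P_S)$ on $\operatorname{Emb}_{\mathcal O}(P_S,T^*\bar P)$ has the expression $$\mathbf J_R(f)=\left(\left[\boldsymbol{P_Q}^*\Theta_{\bar M}+\kappa_\theta^*\Theta_{\mathcal O}-\theta^{-1}\kappa_\theta\cdot A\right],\ \theta^{-1}\kappa_\theta\right)\in\left(\Omega^1(S)/\mathbf d\mathcal F(S)\right)\times\mathcal F(S,\mathfrak o^* ),$$ where the embedding $f$ is written as $f(x,g)=(\boldsymbol{P_Q}(x),\kappa_\theta(x)g)$ and $\Theta_{\bar M}$, $\Theta_{\mathcal O}$ are the canonical one-forms on $T^*\bar M$, $T^*\mathcal O$.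
   Context: $\mathcal O$ is a compact Lie group with Lie algebra $\mathfrak o$ and $S$ a compact manifold with volume form $\mu_S$; $\mathcal O$ acts on $S\times\mathcal O$ and $\bar M\times\mathcal O$ by right multiplication on the second factor, and on $T^*\bar P=T^*\bar M\times T^*\mathcal O$ by cotangent lift: for $\kappa\in T^*_h\mathcal O$, $\kappa g\in T^*_{hg}\mathcal O$ is $\langle\kappa g,v\rangle=\langle\kappa,vg^{-1}\rangle$. $\Theta_{\bar P}$ is the canonical one-form on $T^*\bar P$ and the symplectic form is $-\mathbf d\Theta_{\bar P}$. $\operatorname{Emb}_{\mathcal O}(P_S,T^*\bar P)$ is the space of $\mathcal O$-equivariant embeddings; each such embedding is of the form $f(x,g)=(\boldsymbol{P_Q}(x),\kappa_\theta(x)g)$ with $\boldsymbol{P_Q}:S\to T^*\bar M$ covering a map $\boldsymbol Q:S\to\bar M$ and $\kappa_\theta:S\to T^*\mathcal O$ covering $\theta:S\to\mathcal O$. $\theta^{-1}\kappa_\theta:S\to\mathfrak o^*$ is $\langle\theta^{-1}\kappa_\theta(x),\xi\rangle=\langle\kappa_\theta(x),\theta(x)\xi\rangle$, and $\theta^{-1}\kappa_\theta\cdot A$ is the one-form on $S$ obtained by contracting $\mathfrak o^*$ with $\mathfrak o$. The symplectic form on $\operatorname{Emb}_{\mathcal O}(P_S,T^*\bar P)$ is $\bar\omega(f)(u_f,v_f)=\int_{P_S}(-\mathbf d\Theta_{\bar P})(f(p))(u_f(p),v_f(p))\,\mu_{P_S}$ with $\mu_{P_S}=\mu_S\wedge\mu_{\mathcal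 O}$, $\mu_{\mathcal O}$ the normalized Haar measure. $\mathcal{A}ut_{\rm vol}(P_S)$ is the group of $\mathcal O$-equivariant diffeomorphisms of $P_S$ inducing a $\mu_S$-preserving diffeomorphism of $S$, acting by $f\mapsto f\circ\psi$; the dual of its Lie algebra (equivariant vector fields with divergence-free projection to $S$) is $\mathfrak{aut}_{\rm vol}(P_S)^*=\Omega^1_{\mathcal O}(P_S)/\mathbf d\mathcal F_{\mathcal O}(P_S)$ ($\mathcal O$-invariant one-forms modulo differentials of $\mathcal O$-invariant functions), paired by $\langle[\alpha],U\rangle=\int_{P_S}\alpha(U)\mu_{P_S}$. The connection determined by $A$ is $\mathcal A(v_x,\xi_g)=\operatorname{Ad}_{g^{-1}}(A(v_x)+\xi_gg^{-1})$. It induces the identification $\Omega^1_{\mathcal O}(P_S)\to\Omega^1(S)\times\mathcal F(S,\mathfrak o^* )$, $\alpha\mapsto(\bar\alpha,\bar\lambda)$, with $\bar\alpha(x)(v_x)=\alpha(x,e)(v_x,-A(v_x))$ and $\bar\lambda(x)\cdot\xi=\alpha(x,e)(0_x,\xi)$, and hence $\mathfrak{aut}_{\rm vol}(P_S)^*\simeq(\Omega^1(S)/\mathbf d\mathcal F(S))\times\mathcal F(S,\mathfrak o^* )$, which is the identification used in the claim. *)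

theory Defs
  imports "HOL-Analysis.Analysis" "HOL-Algebra.Group"
begin

section \<open>Smooth manifolds\<close>

text \<open>Smooth maps between open subsets of finite-dimensional normed spaces: all iterated
  directional derivatives exist and are continuous.\<close>

primrec ck_on ::
  "nat \<Rightarrow> 'a::real_normed_vector set \<Rightarrow> ('a \<Rightarrow> 'b::real_normed_vector) \<Rightarrow> bool" where
  "ck_on 0 X f \<longleftrightarrow> continuous_on X f"
| "ck_on (Suc k) X f \<longleftrightarrow> (\<forall>x\<in>X. f differentiable (at x)) \<and>
     (\<forall>v. ck_on k X (\<lambda>x. frechet_derivative f (at x) v))"

definition smooth_on :: "'a::real_normed_vector set \<Rightarrow> ('a \<Rightarrow> 'b::real_normed_vector) \<Rightarrow> bool" where
  "smooth_on X f \<longleftrightarrow> open X \<and> (\<forall>k. ck_on k X f)"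

text \<open>A manifold is given by an atlas. The model space is an arbitrary finite-dimensional
  normed space (instead of a type of class \<open>euclidean_space\<close>), so that dimension 0 is not
  excluded and \<open>'e \<times> ('e \<Rightarrow>\<^sub>L real)\<close> is a model space for the cotangent bundle.\<close>

type_synonym ('a, 'e) chart = "'a set \<times> ('a \<Rightarrow> 'e)"
type_synonym ('a, 'e) atlas = "('a, 'e) chart set"

definition points :: "('a, 'e) atlas \<Rightarrow> 'a set" where
  "points M = (\<Union>c\<in>M. fst c)"

definition chart_inv :: "('a, 'e) chart \<Rightarrow> 'e \<Rightarrow> 'a" where
  "chart_inv c = inv_into (fst c) (snd c)"

definition mtop :: "('a, 'e::real_normed_vector) atlas \<Rightarrow> 'a topology" where
  "mtop M = topology (\<lambda>W. W \<subseteq> points M \<and> (\<forall>c\<in>M. open (snd c ` (fst c \<inter> W))))"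

definition smooth_manifold :: "('a, 'e::real_normed_vector) atlas \<Rightarrow> bool" where
  "smooth_manifold M \<longleftrightarrow>
     (\<exists>B::'e set. finite B \<and> span B = UNIV) \<and>
     (\<forall>c\<in>M. inj_on (snd c) (fst c) \<and> open (snd c ` fst c)) \<and>
     (\<forall>c\<in>M. \<forall>d\<in>M. smooth_on (snd c ` (fst c \<inter> fst d)) (snd d \<circ> chart_inv c)) \<and>
     Hausdorff_space (mtop M) \<and> second_countable (mtop M)"

definition prod_mfd :: "('a, 'e) atlas \<Rightarrow> ('b, 'f) atlas \<Rightarrow> ('a \<times> 'b, 'e \<times> 'f) atlas" where
  "prod_mfd M N = (\<lambda>(c, d). (fst c \<times> fst d, map_prod (snd c) (snd d))) ` (M \<times> N)"

definition real_line :: "(real, real) atlas" where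
  "real_line = {(UNIV, id)}"

definition smooth_map ::
  "('a, 'e::real_normed_vector) atlas \<Rightarrow> ('b, 'f::real_normed_vector) atlas \<Rightarrow> ('a \<Rightarrow> 'b) \<Rightarrow> bool" where
  "smooth_map M N F \<longleftrightarrow> continuous_map (mtop M) (mtop N) F \<and>
     (\<forall>c\<in>M. \<forall>d\<in>N. smooth_on (snd c ` {x \<in> fst c. F x \<in> fst d}) (snd d \<circ> F \<circ> chart_inv c))"

definition smooth_fun :: "('a, 'e::real_normed_vector) atlas \<Rightarrow> ('a \<Rightarrow> real) \<Rightarrow> bool" where
  "smooth_fun M g \<longleftrightarrow> (\<forall>c\<in>M. smooth_on (snd c ` fst c) (g \<circ> chart_inv c))"

definition smooth_near :: "('a, 'e::real_normed_vector) atlas \<Rightarrow> 'a \<Rightarrow> ('a \<Rightarrow> real) \<Rightarrow> bool" where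
  "smooth_near M x g \<longleftrightarrow> (\<exists>W. openin (mtop M) W \<and> x \<in> W \<and>
     (\<forall>c\<in>M. smooth_on (snd c ` (fst c \<inter> W)) (g \<circ> chart_inv c)))"

section \<open>Tangent vectors\<close>

text \<open>A tangent vector is a derivation on the functions that are smooth near its base point.
  It is extended by 0 to all other functions, so that equal derivations are equal as HOL
  functions; linear combinations are pointwise.\<close>

type_synonym 'a tvec = "('a \<Rightarrow> real) \<Rightarrow> real"

definition coord_vec ::
  "('a, 'e::real_normed_vector) atlas \<Rightarrow> ('a, 'e) chart \<Rightarrow> 'a \<Rightarrow> 'e \<Rightarrow> 'a tvec" where
  "coord_vec M c x w = (\<lambda>g. if smooth_near M x g
     then frechet_derivative (g \<circ> chart_inv c) (at (snd c x)) w else 0)"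

definition tangent_space :: "('a, 'e::real_normed_vector) atlas \<Rightarrow> 'a \<Rightarrow> 'a tvec set" where
  "tangent_space M x = {coord_vec M c x w | c w. c \<in> M \<and> x \<in> fst c}"

definition coord_rep ::
  "('a, 'e::real_normed_vector) atlas \<Rightarrow> ('a, 'e) chart \<Rightarrow> 'a \<Rightarrow> 'a tvec \<Rightarrow> 'e" where
  "coord_rep M c x v = (THE w. coord_vec M c x w = v)"

text \<open>\<open>tmap N F x\<close> is the tangent map at \<open>x\<close> of a smooth map \<open>F\<close> into \<open>N\<close>.\<close>

definition tmap :: "('b, 'f::real_normed_vector) atlas \<Rightarrow> ('a \<Rightarrow> 'b) \<Rightarrow> 'a \<Rightarrow> 'a tvec \<Rightarrow> 'b tvec" where
  "tmap N F x v = (\<lambda>g. if smooth_near N (F x) g then v (g \<circ> F) else 0)"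

definition velocity :: "('a, 'e::real_normed_vector) atlas \<Rightarrow> (real \<Rightarrow> 'a) \<Rightarrow> real \<Rightarrow> 'a tvec" where
  "velocity M \<gamma> t = (\<lambda>g. if smooth_near M (\<gamma> t) g then deriv (g \<circ> \<gamma>) t else 0)"

text \<open>The vector \<open>(v, w)\<close> at \<open>(x, y)\<close> under \<open>T(M \<times> N) = TM \<times> TN\<close>.\<close>

definition tpair ::
  "('a, 'e::real_normed_vector) atlas \<Rightarrow> ('b, 'f::real_normed_vector) atlas \<Rightarrow> 'a \<times> 'b
     \<Rightarrow> 'a tvec \<Rightarrow> 'b tvec \<Rightarrow> ('a \<times> 'b) tvec" where
  "tpair M N z v w = (\<lambda>h.
     tmap (prod_mfd M N) (\<lambda>x. (x, snd z)) (fst z) v h +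
     tmap (prod_mfd M N) (\<lambda>y. (fst z, y)) (snd z) w h)"

definition smooth_vector_field ::
  "('a, 'e::real_normed_vector) atlas \<Rightarrow> ('a \<Rightarrow> 'a tvec) \<Rightarrow> bool" where
  "smooth_vector_field M X \<longleftrightarrow> (\<forall>x\<in>points M. X x \<in> tangent_space M x) \<and>
     (\<forall>c\<in>M. smooth_on (snd c ` fst c) (\<lambda>y. coord_rep M c (chart_inv c y) (X (chart_inv c y))))"

section \<open>Differential forms and cotangent bundles\<close>

text \<open>Covectors vanish outside the tangent space and one-forms vanish outside the manifold,
  so that equality of one-forms is equality of HOL functions.\<close>

type_synonym 'a covec = "'a tvec \<Rightarrow> real"

definition cotangent_space :: "('a, 'e::real_normed_vector) atlas \<Rightarrow> 'a \<Rightarrow> 'a covec set" where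
  "cotangent_space M x = {p.
     (\<forall>u\<in>tangent_space M x. \<forall>v\<in>tangent_space M x. \<forall>a b.
        p (\<lambda>g. a * u g + b * v g) = a * p u + b * p v) \<and>
     (\<forall>v. v \<notin> tangent_space M x \<longrightarrow> p v = 0)}"

definition oneform :: "('a, 'e::real_normed_vector) atlas \<Rightarrow> ('a \<Rightarrow> 'a covec) \<Rightarrow> bool" where
  "oneform M \<alpha> \<longleftrightarrow>
     (\<forall>x\<in>points M. \<alpha> x \<in> cotangent_space M x) \<and>
     (\<forall>x. x \<notin> points M \<longrightarrow> \<alpha> x = (\<lambda>_. 0)) \<and>
     (\<forall>c\<in>M. \<forall>w. smooth_on (snd c ` fst c)
        (\<lambda>y. \<alpha> (chart_inv c y) (coord_vec M c (chart_inv c y) w)))"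

definition differential :: "('a, 'e::real_normed_vector) atlas \<Rightarrow> ('a \<Rightarrow> real) \<Rightarrow> 'a \<Rightarrow> 'a covec" where
  "differential M h x v = (if x \<in> points M \<and> v \<in> tangent_space M x then v h else 0)"

definition pullback ::
  "('a, 'e::real_normed_vector) atlas \<Rightarrow> ('b, 'f::real_normed_vector) atlas \<Rightarrow> ('a \<Rightarrow> 'b)
     \<Rightarrow> ('b \<Rightarrow> 'b covec) \<Rightarrow> 'a \<Rightarrow> 'a covec" where
  "pullback M N F \<alpha> x v =
     (if x \<in> points M \<and> v \<in> tangent_space M x then \<alpha> (F x) (tmap N F x v) else 0)"

text \<open>The formula \<open>d\<alpha>(\<partial>\<^sub>a, \<partial>\<^sub>b) = \<partial>\<^sub>a (\<alpha> \<partial>\<^sub>b) - \<partial>\<^sub>b (\<alpha> \<partial>\<^sub>a)\<close> for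
  constant coordinate fields; for smooth \<open>\<alpha>\<close> it does not depend on the chart.\<close>

definition ext_deriv ::
  "('a, 'e::real_normed_vector) atlas \<Rightarrow> ('a \<Rightarrow> 'a covec) \<Rightarrow> 'a \<Rightarrow> 'a tvec \<Rightarrow> 'a tvec \<Rightarrow> real" where
  "ext_deriv M \<alpha> x u v =
     (let c = (SOME c. c \<in> M \<and> x \<in> fst c); a = coord_rep M c x u; b = coord_rep M c x v;
          D = (\<lambda>w. frechet_derivative
                 (\<lambda>y. \<alpha> (chart_inv c y) (coord_vec M c (chart_inv c y) w)) (at (snd c x)))
      in D b a - D a b)"

definition cotangent_mfd ::
  "('a, 'e::real_normed_vector) atlas \<Rightarrow> ('a \<times> 'a covec, 'e \<times> ('e \<Rightarrow>\<^sub>L real)) atlas" where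
  "cotangent_mfd M = (\<lambda>c. ({(q, p). q \<in> fst c \<and> p \<in> cotangent_space M q},
     \<lambda>(q, p). (snd c q, Blinfun (\<lambda>w. p (coord_vec M c q w))))) ` M"

definition canonical_form ::
  "('a, 'e::real_normed_vector) atlas \<Rightarrow> ('a \<times> 'a covec) \<Rightarrow> ('a \<times> 'a covec) covec" where
  "canonical_form M z w =
     (if z \<in> points (cotangent_mfd M) \<and> w \<in> tangent_space (cotangent_mfd M) z
      then snd z (tmap M fst z w) else 0)"

text \<open>The cotangent lift of a diffeomorphism \<open>R\<close> of \<open>M\<close> with inverse \<open>R'\<close>.\<close>

definition cot_lift ::
  "('a, 'e::real_normed_vector) atlas \<Rightarrow> ('a \<Rightarrow> 'a) \<Rightarrow> ('a \<Rightarrow> 'a) \<Rightarrow> ('a \<times> 'a covec) \<Rightarrow> ('a \<times> 'a covec)" where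
  "cot_lift M R R' z = (R (fst z),
     \<lambda>w. if w \<in> tangent_space M (R (fst z)) then snd z (tmap M R' (R (fst z)) w) else 0)"

text \<open>The identification \<open>T\<^sup>*M \<times> T\<^sup>*N = T\<^sup>*(M \<times> N)\<close>.\<close>

definition cot_pair ::
  "('a, 'e::real_normed_vector) atlas \<Rightarrow> ('b, 'f::real_normed_vector) atlas
     \<Rightarrow> ('a \<times> 'a covec) \<Rightarrow> ('b \<times> 'b covec) \<Rightarrow> (('a \<times> 'b) \<times> ('a \<times> 'b) covec)" where
  "cot_pair M N p \<kappa> = ((fst p, fst \<kappa>),
     \<lambda>w. if w \<in> tangent_space (prod_mfd M N) (fst p, fst \<kappa>)
         then snd p (tmap M fst (fst p, fst \<kappa>) w) + snd \<kappa> (tmap N snd (fst p, fst \<kappa>) w) else 0)"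

section \<open>Volume forms\<close>

text \<open>A form of degree \<open>n\<close> takes its arguments from the first \<open>n\<close> entries of a sequence of
  tangent vectors.\<close>

definition alternating_form ::
  "('a, 'e::real_normed_vector) atlas \<Rightarrow> 'a \<Rightarrow> nat \<Rightarrow> ((nat \<Rightarrow> 'a tvec) \<Rightarrow> real) \<Rightarrow> bool" where
  "alternating_form M x n \<omega> \<longleftrightarrow>
     (\<forall>ws ws'. (\<forall>i<n. ws i = ws' i) \<longrightarrow> \<omega> ws = \<omega> ws') \<and>
     (\<forall>ws. (\<forall>i<n. ws i \<in> tangent_space M x) \<longrightarrow>
        (\<forall>i<n. \<forall>u\<in>tangent_space M x. \<forall>v\<in>tangent_space M x. \<forall>a b.
           \<omega> (ws(i := (\<lambda>g. a * u g + b * v g))) = a * \<omega> (ws(i := u)) + b * \<omega> (ws(i := v))) \<and>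
        (\<forall>i<n. \<forall>j<n. i \<noteq> j \<and> ws i = ws j \<longrightarrow> \<omega> ws = 0))"

definition coord_density ::
  "('a, 'e::real_normed_vector) atlas \<Rightarrow> ('a \<Rightarrow> (nat \<Rightarrow> 'a tvec) \<Rightarrow> real)
     \<Rightarrow> ('a, 'e) chart \<Rightarrow> (nat \<Rightarrow> 'e) \<Rightarrow> 'e \<Rightarrow> real" where
  "coord_density M \<mu> c bs y = \<mu> (chart_inv c y) (\<lambda>i. coord_vec M c (chart_inv c y) (bs i))"

definition volume_form ::
  "('a, 'e::real_normed_vector) atlas \<Rightarrow> ('a \<Rightarrow> (nat \<Rightarrow> 'a tvec) \<Rightarrow> real) \<Rightarrow> bool" where
  "volume_form M \<mu> \<longleftrightarrow>
     (\<forall>x\<in>points M. alternating_form M x (dim (UNIV::'e set)) (\<mu> x) \<and>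
        (\<exists>ws. (\<forall>i<dim (UNIV::'e set). ws i \<in> tangent_space M x) \<and> \<mu> x ws \<noteq> 0)) \<and>
     (\<forall>c\<in>M. \<forall>bs. smooth_on (snd c ` fst c) (coord_density M \<mu> c bs))"

definition borel_of :: "'a topology \<Rightarrow> 'a measure" where
  "borel_of X = sigma (topspace X) {W. openin X W}"

text \<open>Integration against the volume form \<open>\<mu>\<close>, with respect to the orientation defined by
  \<open>\<mu>\<close> itself, is integration against a measure \<open>\<nu>\<close>. It is the unique Borel measure which in each
  chart, and for each basis \<open>bs\<close> of the model space, has density \<open>\<bar>\<mu>(\<partial>\<^sub>1,\<dots>,\<partial>\<^sub>n)\<bar>\<close>
  with respect to Lebesgue measure in the linear coordinates given by \<open>bs\<close>.\<close>

definition volume_measure ::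
  "('a, 'e::real_normed_vector) atlas \<Rightarrow> ('a \<Rightarrow> (nat \<Rightarrow> 'a tvec) \<Rightarrow> real) \<Rightarrow> 'a measure \<Rightarrow> bool" where
  "volume_measure M \<mu> \<nu> \<longleftrightarrow>
     sets \<nu> = sets (borel_of (mtop M)) \<and>
     (\<forall>c\<in>M. \<forall>bs::nat \<Rightarrow> 'e. \<forall>B\<in>sets \<nu>.
        let n = dim (UNIV::'e set); lin = (\<lambda>a. \<Sum>i<n. a i *\<^sub>R bs i) in
        inj_on bs {..<n} \<and> independent (bs ` {..<n}) \<and> B \<subseteq> fst c \<longrightarrow>
        emeasure \<nu> B = (\<integral>\<^sup>+ a. ennreal \<bar>coord_density M \<mu> c bs (lin a)\<bar> * indicator (snd c ` B) (lin a)
                          \<partial>(\<Pi>\<^sub>M i\<in>{..<n}. lborel)))"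

text \<open>The condition \<open>\<pounds>\<^sub>u \<mu> = 0\<close>, written with the coordinate expression
  \<open>(\<pounds>\<^sub>u \<mu>)(\<partial>\<^sub>1,\<dots>,\<partial>\<^sub>n) = u(\<mu>(\<partial>\<^sub>1,\<dots>,\<partial>\<^sub>n)) + \<Sum>\<^sub>i \<mu>(\<partial>\<^sub>1,\<dots>,-[u,\<partial>\<^sub>i],\<dots>,\<partial>\<^sub>n)\<close>,
  where \<open>-[u,\<partial>\<^sub>i]\<close> is the derivative in direction \<open>i\<close> of the components of \<open>u\<close>.\<close>

definition divergence_free ::
  "('a, 'e::real_normed_vector) atlas \<Rightarrow> ('a \<Rightarrow> (nat \<Rightarrow> 'a tvec) \<Rightarrow> real) \<Rightarrow> ('a \<Rightarrow> 'a tvec) \<Rightarrow> bool" where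
  "divergence_free M \<mu> u \<longleftrightarrow> smooth_vector_field M u \<and>
     (\<forall>c\<in>M. \<forall>y\<in>snd c ` fst c. \<forall>bs.
        let uc = (\<lambda>z. coord_rep M c (chart_inv c z) (u (chart_inv c z))) in
        frechet_derivative (coord_density M \<mu> c bs) (at y) (uc y) +
        (\<Sum>i<dim (UNIV::'e set).
           coord_density M \<mu> c (bs(i := frechet_derivative uc (at y) (bs i))) y) = 0)"

section \<open>Lie groups and trivial principal bundles\<close>

definition lie_group :: "'g monoid \<Rightarrow> ('g, 'h::real_normed_vector) atlas \<Rightarrow> bool" where
  "lie_group G K \<longleftrightarrow> group G \<and> smooth_manifold K \<and> carrier G = points K \<and>
     smooth_map (prod_mfd K K) K (\<lambda>(g, h). g \<otimes>\<^bsub>G\<^esub> h) \<and> smooth_map K K (\<lambda>g. inv\<^bsub>G\<^esub> g)"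

definition lie_alg :: "'g monoid \<Rightarrow> ('g, 'h::real_normed_vector) atlas \<Rightarrow> 'g tvec set" where
  "lie_alg G K = tangent_space K \<one>\<^bsub>G\<^esub>"

definition lie_alg_dual :: "'g monoid \<Rightarrow> ('g, 'h::real_normed_vector) atlas \<Rightarrow> 'g covec set" where
  "lie_alg_dual G K = cotangent_space K \<one>\<^bsub>G\<^esub>"

definition normalized_haar :: "'g monoid \<Rightarrow> ('g, 'h::real_normed_vector) atlas \<Rightarrow> 'g measure \<Rightarrow> bool" where
  "normalized_haar G K \<nu> \<longleftrightarrow> sets \<nu> = sets (borel_of (mtop K)) \<and> emeasure \<nu> (points K) = 1 \<and>
     (\<forall>g\<in>carrier G. \<forall>B\<in>sets \<nu>. emeasure \<nu> ((\<lambda>h. g \<otimes>\<^bsub>G\<^esub> h) ` B) = emeasure \<nu> B)"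

definition lie_alg_oneform ::
  "('a, 'e::real_normed_vector) atlas \<Rightarrow> 'g monoid \<Rightarrow> ('g, 'h::real_normed_vector) atlas
     \<Rightarrow> ('a \<Rightarrow> 'a tvec \<Rightarrow> 'g tvec) \<Rightarrow> bool" where
  "lie_alg_oneform S G K A \<longleftrightarrow>
     (\<forall>x\<in>points S. \<forall>u\<in>tangent_space S x. A x u \<in> lie_alg G K \<and>
        (\<forall>v\<in>tangent_space S x. \<forall>a b.
           A x (\<lambda>g. a * u g + b * v g) = (\<lambda>g. a * A x u g + b * A x v g))) \<and>
     (\<forall>l\<in>lie_alg_dual G K. \<forall>c\<in>S. \<forall>w. smooth_on (snd c ` fst c)
        (\<lambda>y. l (A (chart_inv c y) (coord_vec S c (chart_inv c y) w))))"

definition ract :: "'g monoid \<Rightarrow> 'g \<Rightarrow> 'a \<times> 'g \<Rightarrow> 'a \<times> 'g" where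
  "ract G g p = (fst p, snd p \<otimes>\<^bsub>G\<^esub> g)"

definition cot_ract_group ::
  "'g monoid \<Rightarrow> ('g, 'h::real_normed_vector) atlas \<Rightarrow> 'g \<Rightarrow> 'g \<times> 'g covec \<Rightarrow> 'g \<times> 'g covec" where
  "cot_ract_group G K g = cot_lift K (\<lambda>h. h \<otimes>\<^bsub>G\<^esub> g) (\<lambda>h. h \<otimes>\<^bsub>G\<^esub> inv\<^bsub>G\<^esub> g)"

definition cot_ract ::
  "('a, 'e::real_normed_vector) atlas \<Rightarrow> 'g monoid \<Rightarrow> ('g, 'h::real_normed_vector) atlas \<Rightarrow> 'g
     \<Rightarrow> ('a \<times> 'g) \<times> ('a \<times> 'g) covec \<Rightarrow> ('a \<times> 'g) \<times> ('a \<times> 'g) covec" where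
  "cot_ract M G K g = cot_lift (prod_mfd M K) (ract G g) (ract G (inv\<^bsub>G\<^esub> g))"

text \<open>Equivariant embeddings of \<open>S \<times> G\<close> into \<open>T\<^sup>*(M \<times> G)\<close>.\<close>

definition emb_equiv ::
  "('x, 'e::real_normed_vector) atlas \<Rightarrow> ('m, 'k::real_normed_vector) atlas \<Rightarrow> 'g monoid
     \<Rightarrow> ('g, 'h::real_normed_vector) atlas
     \<Rightarrow> ('x \<times> 'g \<Rightarrow> ('m \<times> 'g) \<times> ('m \<times> 'g) covec) set" where
  "emb_equiv S M G K = {f.
     smooth_map (prod_mfd S K) (cotangent_mfd (prod_mfd M K)) f \<and>
     embedding_map (mtop (prod_mfd S K)) (mtop (cotangent_mfd (prod_mfd M K))) f \<and>
     (\<forall>p\<in>points (prod_mfd S K).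
        inj_on (tmap (cotangent_mfd (prod_mfd M K)) f p) (tangent_space (prod_mfd S K) p)) \<and>
     (\<forall>p\<in>points (prod_mfd S K). \<forall>g\<in>carrier G. f (ract G g p) = cot_ract M G K g (f p))}"

section \<open>The group of volume preserving automorphisms and its Lie algebra\<close>

definition base_map :: "'g monoid \<Rightarrow> ('x \<times> 'g \<Rightarrow> 'x \<times> 'g) \<Rightarrow> 'x \<Rightarrow> 'x" where
  "base_map G \<psi> x = fst (\<psi> (x, \<one>\<^bsub>G\<^esub>))"

definition Aut_vol ::
  "('x, 'e::real_normed_vector) atlas \<Rightarrow> ('x \<Rightarrow> (nat \<Rightarrow> 'x tvec) \<Rightarrow> real) \<Rightarrow> 'g monoid
     \<Rightarrow> ('g, 'h::real_normed_vector) atlas \<Rightarrow> ('x \<times> 'g \<Rightarrow> 'x \<times> 'g) set" where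
  "Aut_vol S \<mu> G K = {\<psi>.
     smooth_map (prod_mfd S K) (prod_mfd S K) \<psi> \<and>
     bij_betw \<psi> (points (prod_mfd S K)) (points (prod_mfd S K)) \<and>
     smooth_map (prod_mfd S K) (prod_mfd S K) (inv_into (points (prod_mfd S K)) \<psi>) \<and>
     (\<forall>p\<in>points (prod_mfd S K). \<forall>g\<in>carrier G. \<psi> (ract G g p) = ract G g (\<psi> p)) \<and>
     (\<forall>x\<in>points S. \<forall>ws. (\<forall>i<dim (UNIV::'e set). ws i \<in> tangent_space S x) \<longrightarrow>
        \<mu> (base_map G \<psi> x) (\<lambda>i. tmap S (base_map G \<psi>) x (ws i)) = \<mu> x ws)}"

definition base_field ::
  "('x, 'e::real_normed_vector) atlas \<Rightarrow> 'g monoid \<Rightarrow> ('x \<times> 'g \<Rightarrow> ('x \<times> 'g) tvec) \<Rightarrow> 'x \<Rightarrow> 'x tvec" where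
  "base_field S G U x = tmap S fst (x, \<one>\<^bsub>G\<^esub>) (U (x, \<one>\<^bsub>G\<^esub>))"

definition aut_vol ::
  "('x, 'e::real_normed_vector) atlas \<Rightarrow> ('x \<Rightarrow> (nat \<Rightarrow> 'x tvec) \<Rightarrow> real) \<Rightarrow> 'g monoid
     \<Rightarrow> ('g, 'h::real_normed_vector) atlas \<Rightarrow> ('x \<times> 'g \<Rightarrow> ('x \<times> 'g) tvec) set" where
  "aut_vol S \<mu> G K = {U. smooth_vector_field (prod_mfd S K) U \<and>
     (\<forall>p\<in>points (prod_mfd S K). \<forall>g\<in>carrier G.
        U (ract G g p) = tmap (prod_mfd S K) (ract G g) p (U p)) \<and>
     divergence_free S \<mu> (base_field S G U)}"

subsection \<open>The dual of the Lie algebra\<close>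

definition inv_oneform ::
  "('x, 'e::real_normed_vector) atlas \<Rightarrow> 'g monoid \<Rightarrow> ('g, 'h::real_normed_vector) atlas
     \<Rightarrow> ('x \<times> 'g \<Rightarrow> ('x \<times> 'g) covec) \<Rightarrow> bool" where
  "inv_oneform S G K \<alpha> \<longleftrightarrow> oneform (prod_mfd S K) \<alpha> \<and>
     (\<forall>g\<in>carrier G. pullback (prod_mfd S K) (prod_mfd S K) (ract G g) \<alpha> = \<alpha>)"

definition inv_fun ::
  "('x, 'e::real_normed_vector) atlas \<Rightarrow> 'g monoid \<Rightarrow> ('g, 'h::real_normed_vector) atlas
     \<Rightarrow> ('x \<times> 'g \<Rightarrow> real) \<Rightarrow> bool" where
  "inv_fun S G K h \<longleftrightarrow> smooth_fun (prod_mfd S K) h \<and>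
     (\<forall>p\<in>points (prod_mfd S K). \<forall>g\<in>carrier G. h (ract G g p) = h p)"

text \<open>The class of \<open>\<alpha>\<close> in invariant one-forms modulo differentials of invariant functions.\<close>

definition inv_class ::
  "('x, 'e::real_normed_vector) atlas \<Rightarrow> 'g monoid \<Rightarrow> ('g, 'h::real_normed_vector) atlas
     \<Rightarrow> ('x \<times> 'g \<Rightarrow> ('x \<times> 'g) covec) \<Rightarrow> ('x \<times> 'g \<Rightarrow> ('x \<times> 'g) covec) set" where
  "inv_class S G K \<alpha> = {\<beta>. inv_oneform S G K \<beta> \<and> (\<exists>h. inv_fun S G K h \<and>
     (\<forall>p v. \<beta> p v = \<alpha> p v + differential (prod_mfd S K) h p v))}"

definition aut_vol_dual ::
  "('x, 'e::real_normed_vector) atlas \<Rightarrow> 'g monoid \<Rightarrow> ('g, 'h::real_normed_vector) atlas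
     \<Rightarrow> ('x \<times> 'g \<Rightarrow> ('x \<times> 'g) covec) set set" where
  "aut_vol_dual S G K = {inv_class S G K \<alpha> | \<alpha>. inv_oneform S G K \<alpha>}"

definition pairing ::
  "'x measure \<Rightarrow> 'g measure \<Rightarrow> ('x \<times> 'g \<Rightarrow> ('x \<times> 'g) covec) set
     \<Rightarrow> ('x \<times> 'g \<Rightarrow> ('x \<times> 'g) tvec) \<Rightarrow> real" where
  "pairing \<nu>S \<nu>G C U = (THE r. \<exists>\<alpha>\<in>C. r = (\<integral>p. \<alpha> p (U p) \<partial>(\<nu>S \<Otimes>\<^sub>M \<nu>G)))"

text \<open>The class of \<open>\<alpha>\<close> in \<open>\<Omega>\<^sup>1(S) / dF(S)\<close>.\<close>

definition oneform_class ::
  "('a, 'e::real_normed_vector) atlas \<Rightarrow> ('a \<Rightarrow> 'a covec) \<Rightarrow> ('a \<Rightarrow> 'a covec) set" where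
  "oneform_class S \<alpha> = {\<beta>. oneform S \<beta> \<and> (\<exists>h. smooth_fun S h \<and>
     (\<forall>x v. \<beta> x v = \<alpha> x v + differential S h x v))}"

definition oneform_quotient ::
  "('a, 'e::real_normed_vector) atlas \<Rightarrow> ('a \<Rightarrow> 'a covec) set set" where
  "oneform_quotient S = {oneform_class S \<alpha> | \<alpha>. oneform S \<alpha>}"

text \<open>Smooth maps from \<open>S\<close> to the dual of the Lie algebra (extensional, as with \<open>restrict\<close>).\<close>

definition dual_funs ::
  "('x, 'e::real_normed_vector) atlas \<Rightarrow> 'g monoid \<Rightarrow> ('g, 'h::real_normed_vector) atlas
     \<Rightarrow> ('x \<Rightarrow> 'g covec) set" where
  "dual_funs S G K = {l. l \<in> points S \<rightarrow>\<^sub>E lie_alg_dual G K \<and>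
     (\<forall>\<xi>\<in>lie_alg G K. smooth_fun S (\<lambda>x. l x \<xi>))}"

text \<open>The identification determined by the connection
  \<open>\<A>(v\<^sub>x, \<xi>\<^sub>g) = Ad\<^bsub>g\<^sup>-\<^sup>1\<^esub> (A(v\<^sub>x) + \<xi>\<^sub>g g\<^sup>-\<^sup>1)\<close>, for which
  \<open>(v\<^sub>x, - A(v\<^sub>x))\<close> is the horizontal lift of \<open>v\<^sub>x\<close> to \<open>(x, e)\<close>.\<close>

definition bar_form ::
  "('x, 'e::real_normed_vector) atlas \<Rightarrow> 'g monoid \<Rightarrow> ('g, 'h::real_normed_vector) atlas
     \<Rightarrow> ('x \<Rightarrow> 'x tvec \<Rightarrow> 'g tvec) \<Rightarrow> ('x \<times> 'g \<Rightarrow> ('x \<times> 'g) covec) \<Rightarrow> 'x \<Rightarrow> 'x covec" where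
  "bar_form S G K A \<alpha> x v = (if x \<in> points S \<and> v \<in> tangent_space S x
     then \<alpha> (x, \<one>\<^bsub>G\<^esub>) (tpair S K (x, \<one>\<^bsub>G\<^esub>) v (\<lambda>g. - A x v g)) else 0)"

definition bar_fun ::
  "('x, 'e::real_normed_vector) atlas \<Rightarrow> 'g monoid \<Rightarrow> ('g, 'h::real_normed_vector) atlas
     \<Rightarrow> ('x \<times> 'g \<Rightarrow> ('x \<times> 'g) covec) \<Rightarrow> 'x \<Rightarrow> 'g covec" where
  "bar_fun S G K \<alpha> = (\<lambda>x\<in>points S. \<lambda>\<xi>. if \<xi> \<in> lie_alg G K
     then \<alpha> (x, \<one>\<^bsub>G\<^esub>) (tpair S K (x, \<one>\<^bsub>G\<^esub>) (\<lambda>_. 0) \<xi>) else 0)"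

definition dual_ident ::
  "('x, 'e::real_normed_vector) atlas \<Rightarrow> 'g monoid \<Rightarrow> ('g, 'h::real_normed_vector) atlas
     \<Rightarrow> ('x \<Rightarrow> 'x tvec \<Rightarrow> 'g tvec) \<Rightarrow> ('x \<times> 'g \<Rightarrow> ('x \<times> 'g) covec) set
     \<Rightarrow> ('x \<Rightarrow> 'x covec) set \<times> ('x \<Rightarrow> 'g covec)" where
  "dual_ident S G K A C =
     (THE z. \<exists>\<alpha>\<in>C. z = (oneform_class S (bar_form S G K A \<alpha>), bar_fun S G K \<alpha>))"

section \<open>The momentum map\<close>

definition sympl_form_emb ::
  "'x measure \<Rightarrow> 'g measure \<Rightarrow> ('m, 'k::real_normed_vector) atlas \<Rightarrow> ('g, 'h::real_normed_vector) atlas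
     \<Rightarrow> ('x \<times> 'g \<Rightarrow> ('m \<times> 'g) \<times> ('m \<times> 'g) covec)
     \<Rightarrow> ('x \<times> 'g \<Rightarrow> (('m \<times> 'g) \<times> ('m \<times> 'g) covec) tvec)
     \<Rightarrow> ('x \<times> 'g \<Rightarrow> (('m \<times> 'g) \<times> ('m \<times> 'g) covec) tvec) \<Rightarrow> real" where
  "sympl_form_emb \<nu>S \<nu>G M K f u v =
     (\<integral>p. - ext_deriv (cotangent_mfd (prod_mfd M K)) (canonical_form (prod_mfd M K)) (f p) (u p) (v p)
        \<partial>(\<nu>S \<Otimes>\<^sub>M \<nu>G))"

definition smooth_curve_in ::
  "('a, 'e::real_normed_vector) atlas \<Rightarrow> ('b, 'f::real_normed_vector) atlas \<Rightarrow> ('a \<Rightarrow> 'b) set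
     \<Rightarrow> (real \<Rightarrow> 'a \<Rightarrow> 'b) \<Rightarrow> bool" where
  "smooth_curve_in M N X F \<longleftrightarrow>
     (\<forall>t. F t \<in> X) \<and> smooth_map (prod_mfd real_line M) N (\<lambda>(t, p). F t p)"

text \<open>\<open>d\<langle>J, U\<rangle> = \<omega>(U\<^sub>E, \<cdot>)\<close> for every \<open>U\<close> in the Lie algebra, where \<open>U\<^sub>E(f) = Tf \<circ> U\<close>. The
  first clause on \<open>U\<close> says that this \<open>U\<^sub>E\<close> is the infinitesimal generator of the right action
  \<open>f \<mapsto> f \<circ> \<psi>\<close>. Tangent vectors \<open>v\<^sub>f\<close> to the space of embeddings are velocities of smooth curves
  of embeddings, and the differential is evaluated along such curves.\<close>

definition momentum_map ::
  "('x, 'e::real_normed_vector) atlas \<Rightarrow> ('x \<Rightarrow> (nat \<Rightarrow> 'x tvec) \<Rightarrow> real) \<Rightarrow> 'x measure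
     \<Rightarrow> ('m, 'k::real_normed_vector) atlas
     \<Rightarrow> 'g monoid \<Rightarrow> ('g, 'h::real_normed_vector) atlas \<Rightarrow> 'g measure
     \<Rightarrow> (('x \<times> 'g \<Rightarrow> ('m \<times> 'g) \<times> ('m \<times> 'g) covec) \<Rightarrow> ('x \<times> 'g \<Rightarrow> ('x \<times> 'g) covec) set) \<Rightarrow> bool" where
  "momentum_map S \<mu> \<nu>S M G K \<nu>G J \<longleftrightarrow>
     (let PS = prod_mfd S K; TP = cotangent_mfd (prod_mfd M K); E = emb_equiv S M G K;
          gen = (\<lambda>U f p. tmap TP f p (U p)) in
     (\<forall>f\<in>E. J f \<in> aut_vol_dual S G K) \<and>
     (\<forall>U\<in>aut_vol S \<mu> G K.
        (\<forall>\<psi>. smooth_curve_in PS PS (Aut_vol S \<mu> G K) \<psi> \<and>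
             (\<forall>p\<in>points PS. \<psi> 0 p = p \<and> velocity PS (\<lambda>t. \<psi> t p) 0 = U p) \<longrightarrow>
             (\<forall>f\<in>E. \<forall>p\<in>points PS. velocity TP (\<lambda>t. (f \<circ> \<psi> t) p) 0 = gen U f p)) \<and>
        (\<forall>F. smooth_curve_in PS TP E F \<longrightarrow>
             ((\<lambda>t. pairing \<nu>S \<nu>G (J (F t)) U) has_real_derivative
              sympl_form_emb \<nu>S \<nu>G M K (F 0) (gen U (F 0)) (\<lambda>p. velocity TP (\<lambda>t. F t p) 0)) (at 0))))"

definition J_R ::
  "('x, 'e::real_normed_vector) atlas \<Rightarrow> ('m, 'k::real_normed_vector) atlas \<Rightarrow> 'g monoid
     \<Rightarrow> ('g, 'h::real_normed_vector) atlas \<Rightarrow> ('x \<times> 'g \<Rightarrow> ('m \<times> 'g) \<times> ('m \<times> 'g) covec)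
     \<Rightarrow> ('x \<times> 'g \<Rightarrow> ('x \<times> 'g) covec) set" where
  "J_R S M G K f = inv_class S G K
     (pullback (prod_mfd S K) (cotangent_mfd (prod_mfd M K)) f (canonical_form (prod_mfd M K)))"

text \<open>\<open>left_triv S G K \<kappa>\<close> is \<open>\<theta>\<^sup>-\<^sup>1 \<kappa>\<^sub>\<theta>\<close>, where \<open>\<theta> = fst \<circ> \<kappa>\<close>.\<close>

definition left_triv ::
  "('x, 'e::real_normed_vector) atlas \<Rightarrow> 'g monoid \<Rightarrow> ('g, 'h::real_normed_vector) atlas
     \<Rightarrow> ('x \<Rightarrow> 'g \<times> 'g covec) \<Rightarrow> 'x \<Rightarrow> 'g covec" where
  "left_triv S G K \<kappa> = (\<lambda>x\<in>points S. \<lambda>\<xi>. if \<xi> \<in> lie_alg G K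
     then snd (\<kappa> x) (tmap K (\<lambda>k. fst (\<kappa> x) \<otimes>\<^bsub>G\<^esub> k) \<one>\<^bsub>G\<^esub> \<xi>) else 0)"

definition contract ::
  "('x, 'e::real_normed_vector) atlas \<Rightarrow> ('x \<Rightarrow> 'g covec) \<Rightarrow> ('x \<Rightarrow> 'x tvec \<Rightarrow> 'g tvec) \<Rightarrow> 'x \<Rightarrow> 'x covec" where
  "contract S l A x v = (if x \<in> points S \<and> v \<in> tangent_space S x then l x (A x v) else 0)"

end

theory Submission
  imports Defs
begin

text \<open>
  Writing \<open>\<pi>\<close> for the projection of \<open>T\<^sup>*P\<close>, the pullback of the canonical form is
  \<open>(f\<^sup>*\<Theta>)\<^sub>p v = \<langle>f p, T(\<pi> \<circ> f) v\<rangle>\<close>. It is right invariant for equivariant \<open>f\<close>, because the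
  cotangent lift is dual to the tangent map.

  Momentum map: along a curve \<open>F\<^sub>t\<close> of embeddings with velocity \<open>v\<close>, Cartan's formula gives
  \<open>d/dt (F\<^sub>t\<^sup>*\<Theta>)(U) = d\<Theta>(v, TF U) + U(\<Theta>(v))\<close>. The function \<open>\<Theta>(v)\<close> is invariant, so its derivative along \<open>U\<close>
  is the derivative of a function on \<open>S\<close> along the divergence free base field of \<open>U\<close>, and it integrates to 0
  by the divergence theorem. The same argument shows that the pairing does not depend on the representative.
  By invariance all integrands are functions on \<open>S\<close>; of the Haar measure only the total mass 1 is needed.

  Expression of the momentum: \<open>f\<^sup>*\<Theta>\<close> is evaluated on \<open>(v, - A v)\<close> and on \<open>(0, \<xi>)\<close> at \<open>(x, e)\<close>. The group component
  of \<open>\<pi> \<circ> f\<close> is \<open>(x, g) \<mapsto> \<theta>(x) g\<close>, whose tangent map at \<open>(x, e)\<close> is \<open>(v, \<xi>) \<mapsto> T\<theta> v + \<theta>(x) \<xi>\<close>.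
\<close>

section \<open>Calculus on finite-dimensional normed spaces\<close>

text \<open>The model spaces carry a norm but neither an inner product nor a fixed basis. Calculus
  therefore runs through a reconstruction \<open>x = (\<Sum>b\<in>B. l b x *\<^sub>R b)\<close>:
  \<open>ck_on\<close> controls derivatives in constant directions, and a direction that varies is
  expanded along \<open>B\<close>. Tangent vectors are derivations of smooth germs and return 0 on
  every other function; the cutoffs of the divergence theorem are only C1, so a separate derivative
  \<open>field_deriv\<close> acts on them. C1 is enough because integration by parts differentiates
  once. The volume measure is known only on subsets of chart domains, and cutoffs bring each
  integral into one chart; the Hausdorff axiom lets a function supported in a chart box extend by 0.
  \<open>pairing\<close> and \<open>dual_ident\<close> are definite descriptions over the
  representatives of a class, so each is computed only after independence of the representative. The
  sign in the momentum equation comes from the symplectic form -d\<Theta>: d\<Theta>(v, TF U) is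
  -d\<Theta>(TF U, v), with the generator in the first slot.\<close>

definition findim :: "'a::real_normed_vector itself \<Rightarrow> bool" where
  "findim _ \<longleftrightarrow> (\<exists>B::'a set. finite B \<and> span B = UNIV)"

text \<open>Only the reconstruction identity and boundedness of the functionals are recorded: the
  first expands a linear map along \<open>B\<close>, the second lets coordinates be composed with
  smooth maps.\<close>

definition coords :: "'a::real_normed_vector set \<Rightarrow> ('a \<Rightarrow> 'a \<Rightarrow> real) \<Rightarrow> bool" where
  "coords B l \<longleftrightarrow> finite B \<and> (\<forall>b. bounded_linear (l b)) \<and> (\<forall>x. (\<Sum>b\<in>B. l b x *\<^sub>R b) = x)"

text \<open>Equivalence of norms in finite dimension: on the compact sphere of coefficient families
  with absolute sum 1 the norm of the combination attains a minimum, which independence makes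
  positive. Homogeneity carries the bound \<open>1/m\<close> to all coefficients.\<close>

lemma norm_combination_lower_bound:
  fixes B :: "'a::real_normed_vector set"
  assumes "finite B" "independent B"
  shows "\<exists>C>0. \<forall>u. (\<Sum>b\<in>B. \<bar>u b\<bar>) \<le> C * norm (\<Sum>b\<in>B. u b *\<^sub>R b)"
proof -
  \<comment> \<open>Coefficients are functions on the whole type; pinning them to 0 off
    \<open>B\<close> makes the product of intervals compact by Tychonoff's theorem.\<close>
  define Y where "Y = (PiE UNIV (\<lambda>b. if b \<in> B then {-1..1} else {0}) :: ('a \<Rightarrow> real) set)"
  define X where "X = Y \<inter> {u. (\<Sum>b\<in>B. \<bar>u b\<bar>) = 1}"
  have "compactin (product_topology (\<lambda>_. euclidean) UNIV) Y"
    unfolding Y_def by (subst compactin_PiE) auto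
  then have "compact Y"
    by (simp add: euclidean_product_topology)
  moreover have cont: "continuous_on UNIV (\<lambda>u::'a \<Rightarrow> real. u b)" for b
    by (rule continuous_on_product_coordinates)
  have contB: "continuous_on UNIV (\<lambda>u::'a \<Rightarrow> real. \<bar>u b\<bar>)" for b
    by (intro continuous_on_rabs cont)
  have "continuous_on UNIV (\<lambda>u::'a \<Rightarrow> real. \<Sum>b\<in>B. \<bar>u b\<bar>)"
    by (intro continuous_on_sum contB)
  then have "closed {u::'a \<Rightarrow> real. (\<Sum>b\<in>B. \<bar>u b\<bar>) = 1}"
    by (rule closed_Collect_eq[OF _ continuous_on_const])
  ultimately have "compact X" unfolding X_def by (rule compact_Int_closed)
  have contn: "continuous_on X (\<lambda>u. norm (\<Sum>b\<in>B. u b *\<^sub>R b))"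
    by (intro continuous_on_norm continuous_on_sum continuous_on_scaleR continuous_on_const
        continuous_on_subset[OF cont]) auto
  have scaled: "(\<lambda>b. if b \<in> B then u b / (\<Sum>b\<in>B. \<bar>u b\<bar>) else 0) \<in> X" if "(\<Sum>b\<in>B. \<bar>u b\<bar>) > 0" for u
  proof -
    have "\<bar>u b\<bar> \<le> (\<Sum>b\<in>B. \<bar>u b\<bar>)" if "b \<in> B" for b
      using assms(1) that by (intro member_le_sum) auto
    then have "\<bar>u b / (\<Sum>b\<in>B. \<bar>u b\<bar>)\<bar> \<le> 1" if "b \<in> B" for b
      using that \<open>_ > 0\<close> by (simp add: abs_divide)
    then have "u b / (\<Sum>b\<in>B. \<bar>u b\<bar>) \<in> {-1..1}" if "b \<in> B" for b
      using that by (metis abs_le_iff atLeastAtMost_iff minus_le_iff)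
    moreover have "(\<Sum>b\<in>B. \<bar>if b \<in> B then u b / (\<Sum>b\<in>B. \<bar>u b\<bar>) else 0\<bar>) = (\<Sum>b\<in>B. \<bar>u b\<bar> / (\<Sum>b\<in>B. \<bar>u b\<bar>))"
      using that by (intro sum.cong) (auto simp: abs_divide)
    then have "(\<Sum>b\<in>B. \<bar>if b \<in> B then u b / (\<Sum>b\<in>B. \<bar>u b\<bar>) else 0\<bar>) = 1"
      using that by (simp add: sum_divide_distrib[symmetric])
    ultimately show ?thesis by (auto simp: X_def Y_def PiE_def)
  qed
  show ?thesis
  proof (cases "X = {}")
    case True
    have "(\<Sum>b\<in>B. \<bar>u b\<bar>) \<le> 0" for u :: "'a \<Rightarrow> real"
      using scaled[of u] True by (meson empty_iff not_le)
    then show ?thesis by (intro exI[of _ 1]) (auto intro: order_trans[OF _ norm_ge_zero])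
  next
    case False
    obtain w where w: "w \<in> X" "\<And>u. u \<in> X \<Longrightarrow> norm (\<Sum>b\<in>B. w b *\<^sub>R b) \<le> norm (\<Sum>b\<in>B. u b *\<^sub>R b)"
      using continuous_attains_inf[OF \<open>compact X\<close> False contn] by auto
    define m where "m = norm (\<Sum>b\<in>B. w b *\<^sub>R b)"
    have "m \<noteq> 0"
    proof
      assume "m = 0"
      then have "\<forall>b\<in>B. w b = 0"
        using assms unfolding m_def by (auto simp: independent_explicit_module)
      then show False using w(1) by (auto simp: X_def)
    qed
    then have "m > 0" by (simp add: m_def)
    have "(\<Sum>b\<in>B. \<bar>u b\<bar>) \<le> (1/m) * norm (\<Sum>b\<in>B. u b *\<^sub>R b)" for u
    proof (cases "(\<Sum>b\<in>B. \<bar>u b\<bar>) > 0")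
      case True
      define s where "s = (\<Sum>b\<in>B. \<bar>u b\<bar>)"
      have "m \<le> norm (\<Sum>b\<in>B. (if b \<in> B then u b / s else 0) *\<^sub>R b)"
        using w(2)[OF scaled[OF True]] by (simp add: m_def s_def)
      also have "(\<Sum>b\<in>B. (if b \<in> B then u b / s else 0) *\<^sub>R b) = (1/s) *\<^sub>R (\<Sum>b\<in>B. u b *\<^sub>R b)"
        by (simp add: scaleR_sum_right cong: sum.cong)
      finally show ?thesis using True \<open>m > 0\<close>
        by (simp add: s_def[symmetric] field_simps)
    next
      case False
      then show ?thesis using \<open>m > 0\<close>
        by (smt (verit) divide_nonneg_pos mult_nonneg_nonneg norm_ge_zero)
    qed
    then show ?thesis using \<open>m > 0\<close> by (intro exI[of _ "1/m"]) auto
  qed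
qed

text \<open>Coordinate functionals on a finite-dimensional space are automatically continuous: the
  constant \<open>C\<close> of the norm comparison is an operator bound for each of them.\<close>

lemma coords_representation:
  fixes B :: "'a::real_normed_vector set"
  assumes "finite B" "independent B" "span B = UNIV"
  shows "coords B (\<lambda>b x. representation B x b)"
proof -
  obtain C where C: "C > 0" "\<And>u. (\<Sum>b\<in>B. \<bar>u b\<bar>) \<le> C * norm (\<Sum>b\<in>B. u b *\<^sub>R b)"
    using norm_combination_lower_bound[OF assms(1,2)] by auto
  have rep: "(\<Sum>b\<in>B. representation B x b *\<^sub>R b) = x" for x
    using assms by (intro sum_representation_eq) auto
  have "bounded_linear (\<lambda>x. representation B x b)" for b
  proof (rule bounded_linear_intro[where K=C])
    show "representation B (x + y) b = representation B x b + representation B y b" for x y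
      using assms by (simp add: representation_add)
    show "representation B (r *\<^sub>R x) b = r *\<^sub>R representation B x b" for r x
      using assms by (simp add: representation_scale)
    show "norm (representation B x b) \<le> norm x * C" for x
    proof (cases "b \<in> B")
      case True
      have "\<bar>representation B x b\<bar> \<le> (\<Sum>b\<in>B. \<bar>representation B x b\<bar>)"
        using assms True by (intro member_le_sum) auto
      also have "\<dots> \<le> C * norm x" using C(2)[of "representation B x"] rep by simp
      finally show ?thesis by (simp add: mult.commute)
    next
      case False
      then have "representation B x b = 0" using representation_ne_zero[of B x b] by auto
      then show ?thesis using C(1) by simp
    qed
  qed
  then show ?thesis using rep assms(1) by (auto simp: coords_def)
qed

lemma findim_basis:
  assumes "findim TYPE('a::real_normed_vector)"
  obtains B :: "'a::real_normed_vector set" where "finite B" "independent B" "span B = UNIV"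
proof -
  obtain D :: "'a set" where D: "finite D" "span D = UNIV" using assms by (auto simp: findim_def)
  obtain B where "B \<subseteq> D" "independent B" "D \<subseteq> span B"
    using maximal_independent_subset by metis
  then show thesis using D that[of B]
    by (metis finite_subset span_minimal subspace_span top.extremum_uniqueI)
qed

lemma findim_coords:
  assumes "findim TYPE('a::real_normed_vector)"
  obtains B :: "'a::real_normed_vector set" and l where "coords B l"
  using findim_basis[OF assms] coords_representation by metis

lemma coords_linear_expand:
  assumes "coords B l" "linear f"
  shows "f x = (\<Sum>b\<in>B. l b x *\<^sub>R f b)"
proof -
  have "f x = f (\<Sum>b\<in>B. l b x *\<^sub>R b)" using assms by (simp add: coords_def)
  also have "\<dots> = (\<Sum>b\<in>B. l b x *\<^sub>R f b)"
    using assms(2) by (simp add: linear_sum linear_scale)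
  finally show ?thesis .
qed

text \<open>The expansion along \<open>B\<close> writes the map as a finite sum of bounded
  functionals times fixed vectors.\<close>

lemma findim_linear_bounded:
  fixes f :: "'a::real_normed_vector \<Rightarrow> 'b::real_normed_vector"
  assumes "findim TYPE('a)" "linear f"
  shows "bounded_linear f"
proof -
  obtain B :: "'a set" and l where Bl: "coords B l" using findim_coords[OF assms(1)] .
  have "bounded_linear (\<lambda>x. \<Sum>b\<in>B. l b x *\<^sub>R f b)"
    using Bl by (intro bounded_linear_sum bounded_linear_scaleR_const) (auto simp: coords_def)
  moreover have "f = (\<lambda>x. \<Sum>b\<in>B. l b x *\<^sub>R f b)"
    by (rule ext) (rule coords_linear_expand[OF Bl assms(2)])
  ultimately show ?thesis by metis
qed

lemma findim_real: "findim TYPE(real)"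
  unfolding findim_def by (intro exI[of _ Basis]) (simp add: span_Basis del: Basis_real_def)

lemma findim_prod:
  assumes "findim TYPE('a::real_normed_vector)" "findim TYPE('b::real_normed_vector)"
  shows "findim TYPE('a::real_normed_vector \<times> 'b::real_normed_vector)"
proof -
  obtain A :: "'a set" and B :: "'b set" where AB: "finite A" "span A = UNIV" "finite B" "span B = UNIV"
    using assms by (auto simp: findim_def)
  let ?C = "(\<lambda>a. (a, 0)) ` A \<union> (\<lambda>b. (0, b)) ` B"
  have l1: "linear (\<lambda>a::'a. (a, 0::'b))" and l2: "linear (\<lambda>b::'b. (0::'a, b))"
    by (auto intro!: linearI)
  have "(a, b) \<in> span ?C" for a b
  proof -
    have "(a, 0) \<in> span ((\<lambda>a. (a, 0::'b)) ` A)"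
      using AB linear_span_image[OF l1, of A] by auto
    then have "(a, 0) \<in> span ?C" using span_mono[of "(\<lambda>a. (a, 0::'b)) ` A" ?C] by blast
    moreover have "(0, b) \<in> span ((\<lambda>b. (0::'a, b)) ` B)"
      using AB linear_span_image[OF l2, of B] by auto
    then have "(0, b) \<in> span ?C" using span_mono[of "(\<lambda>b. (0::'a, b)) ` B" ?C] by blast
    ultimately have "(a, 0) + (0, b) \<in> span ?C" by (rule span_add)
    then show ?thesis by simp
  qed
  then show ?thesis unfolding findim_def using AB by (intro exI[of _ ?C]) auto
qed

text \<open>The coordinate functionals of the space span its dual, with the values of
  \<open>f\<close> on \<open>B\<close> as coefficients.\<close>

lemma findim_dual:
  assumes "findim TYPE('a::real_normed_vector)"
  shows "findim TYPE('a::real_normed_vector \<Rightarrow>\<^sub>L real)"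
proof -
  obtain B :: "'a set" and l where Bl: "coords B l" using findim_coords[OF assms] .
  let ?C = "(\<lambda>b. Blinfun (l b)) ` B"
  have "f \<in> span ?C" for f
  proof -
    have "f = (\<Sum>b\<in>B. f b *\<^sub>R Blinfun (l b))"
    proof (rule blinfun_eqI)
      fix x
      have "f x = (\<Sum>b\<in>B. l b x *\<^sub>R f b)"
        by (rule coords_linear_expand[OF Bl]) (simp add: bounded_linear.linear blinfun.bounded_linear_right)
      then show "f x = (\<Sum>b\<in>B. f b *\<^sub>R Blinfun (l b)) x"
        using Bl by (simp add: blinfun.sum_left blinfun.scaleR_left coords_def bounded_linear_Blinfun_apply mult.commute)
    qed
    moreover have "(\<Sum>b\<in>B. f b *\<^sub>R Blinfun (l b)) \<in> span ?C"
      by (intro span_sum span_scale span_base) auto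
    ultimately show ?thesis by simp
  qed
  then show ?thesis unfolding findim_def using Bl by (intro exI[of _ ?C]) (auto simp: coords_def)
qed

section \<open>Frechet derivatives and maps of class Ck\<close>

abbreviation fd where "fd f x v \<equiv> frechet_derivative f (at x) v"

lemma has_derivative_fd: "f differentiable (at x) \<Longrightarrow> (f has_derivative (\<lambda>v. fd f x v)) (at x)"
  using frechet_derivative_works by blast

lemma fd_unique: "(f has_derivative f') (at x) \<Longrightarrow> fd f x v = f' v"
  using frechet_derivative_at by metis

lemma linear_fd: "f differentiable (at x) \<Longrightarrow> linear (\<lambda>v. fd f x v)"
  using has_derivative_fd has_derivative_linear by blast

text \<open>Both functions have the same derivatives at \<open>x\<close>, if any, so the choice
  hidden in \<open>frechet_derivative\<close> returns the same map, differentiable or not.\<close>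

lemma fd_cong:
  assumes "\<forall>\<^sub>F y in nhds x. f y = g y"
  shows "frechet_derivative f (at x) = frechet_derivative g (at x)"
proof -
  obtain V where V: "open V" "x \<in> V" "\<And>y. y \<in> V \<Longrightarrow> f y = g y"
    using assms by (auto simp: eventually_nhds)
  have "(f has_derivative D) (at x) \<longleftrightarrow> (g has_derivative D) (at x)" for D
    using has_derivative_transform_within_open[OF _ V(1,2), of f D UNIV g]
      has_derivative_transform_within_open[OF _ V(1,2), of g D UNIV f] V(3) by auto
  then show ?thesis by (simp add: frechet_derivative_def)
qed

lemma ck_on_subset: "ck_on k X f \<Longrightarrow> Y \<subseteq> X \<Longrightarrow> ck_on k Y f"
  by (induction k arbitrary: f) (auto intro: continuous_on_subset)

lemma ck_on_cong:
  assumes "open X"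
  shows "(\<And>x. x \<in> X \<Longrightarrow> f x = g x) \<Longrightarrow> ck_on k X f \<Longrightarrow> ck_on k X g"
proof (induction k arbitrary: f g)
  case 0
  then show ?case by (metis ck_on.simps(1) continuous_on_cong)
next
  case (Suc k)
  have ev: "\<forall>\<^sub>F y in nhds x. f y = g y" if "x \<in> X" for x
    using assms that Suc.prems(1) by (auto simp: eventually_nhds)
  have "g differentiable (at x)" if "x \<in> X" for x
  proof -
    have "f differentiable (at x)" using Suc.prems(2) that by simp
    then obtain D where "(f has_derivative D) (at x)" unfolding differentiable_def by blast
    then have "(g has_derivative D) (at x)"
      using assms that Suc.prems(1) by (rule has_derivative_transform_within_open)
    then show ?thesis by (auto simp: differentiable_def)
  qed
  moreover have "ck_on k X (\<lambda>x. fd g x v)" for v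
    by (rule Suc.IH[of "\<lambda>x. fd f x v"]) (use Suc.prems fd_cong[OF ev] in auto)
  ultimately show ?case by simp
qed

lemma ck_on_continuous: "ck_on k X f \<Longrightarrow> continuous_on X f"
proof (cases k)
  case (Suc n)
  assume "ck_on k X f"
  then show ?thesis using Suc
    by (auto intro!: continuous_at_imp_continuous_on differentiable_imp_continuous_within)
qed simp

lemma ck_on_SucD: "ck_on (Suc k) X f \<Longrightarrow> ck_on k X f"
proof (induction k arbitrary: f)
  case 0
  show ?case using ck_on_continuous[OF 0] by simp
next
  case (Suc k)
  then show ?case by (metis ck_on.simps(2))
qed

lemma ck_on_const: "ck_on k X (\<lambda>_. a)"
  by (induction k arbitrary: a) (auto simp: continuous_on_const)

lemma ck_on_linear:
  assumes "bounded_linear L"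
  shows "ck_on k X L"
proof (cases k)
  case 0
  then show ?thesis using assms by (simp add: linear_continuous_on)
next
  case (Suc n)
  have "(L has_derivative L) (at x)" for x
    using assms by (rule bounded_linear_imp_has_derivative)
  then have "L differentiable (at x)" "fd L x v = L v" for x v
    by (auto simp: differentiable_def intro: fd_unique)
  then show ?thesis using Suc ck_on_const by auto
qed

lemma ck_on_linear_comp:
  assumes "bounded_linear L"
  shows "open X \<Longrightarrow> ck_on k X f \<Longrightarrow> ck_on k X (\<lambda>x. L (f x))"
proof (induction k arbitrary: f)
  case 0
  then show ?case using bounded_linear.continuous_on[OF assms] by simp
next
  case (Suc k)
  have hd: "((\<lambda>x. L (f x)) has_derivative (\<lambda>v. L (fd f x v))) (at x)" if "x \<in> X" for x
    using that Suc.prems by (auto intro!: bounded_linear.has_derivative[OF assms] has_derivative_fd)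
  have "ck_on k X (\<lambda>x. fd (\<lambda>x. L (f x)) x v)" for v
  proof (rule ck_on_cong[OF Suc.prems(1)])
    show "ck_on k X (\<lambda>x. L (fd f x v))" using Suc by auto
    show "L (fd f x v) = fd (\<lambda>x. L (f x)) x v" if "x \<in> X" for x
      using fd_unique[OF hd[OF that]] by simp
  qed
  then show ?case using hd by (auto simp: differentiable_def)
qed

lemma ck_on_add:
  "open X \<Longrightarrow> ck_on k X f \<Longrightarrow> ck_on k X g \<Longrightarrow> ck_on k X (\<lambda>x. f x + g x)"
proof (induction k arbitrary: f g)
  case 0
  then show ?case by (simp add: continuous_on_add)
next
  case (Suc k)
  have hd: "((\<lambda>x. f x + g x) has_derivative (\<lambda>v. fd f x v + fd g x v)) (at x)" if "x \<in> X" for x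
    using that Suc.prems by (auto intro!: has_derivative_add has_derivative_fd)
  have "ck_on k X (\<lambda>x. fd (\<lambda>x. f x + g x) x v)" for v
  proof (rule ck_on_cong[OF Suc.prems(1)])
    show "ck_on k X (\<lambda>x. fd f x v + fd g x v)" using Suc by auto
    show "fd f x v + fd g x v = fd (\<lambda>x. f x + g x) x v" if "x \<in> X" for x
      using fd_unique[OF hd[OF that]] by simp
  qed
  then show ?case using hd by (auto simp: differentiable_def)
qed

lemma ck_on_sum:
  assumes "open X" "\<And>i. i \<in> I \<Longrightarrow> ck_on k X (f i)"
  shows "ck_on k X (\<lambda>x. \<Sum>i\<in>I. f i x)"
  using assms(2)
  by (induction I rule: infinite_finite_induct) (auto intro: ck_on_const ck_on_add assms(1))

lemma ck_on_bilinear: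
  assumes "bounded_bilinear pr"
  shows "open X \<Longrightarrow> ck_on k X f \<Longrightarrow> ck_on k X g \<Longrightarrow> ck_on k X (\<lambda>x. pr (f x) (g x))"
proof (induction k arbitrary: f g)
  case 0
  then show ?case by (simp add: bounded_bilinear.continuous_on[OF assms])
next
  case (Suc k)
  have hd: "((\<lambda>x. pr (f x) (g x)) has_derivative (\<lambda>v. pr (f x) (fd g x v) + pr (fd f x v) (g x))) (at x)"
    if "x \<in> X" for x
    using that Suc.prems by (auto intro!: bounded_bilinear.FDERIV[OF assms] has_derivative_fd)
  have "ck_on k X (\<lambda>x. fd (\<lambda>x. pr (f x) (g x)) x v)" for v
  proof (rule ck_on_cong[OF Suc.prems(1)])
    show "ck_on k X (\<lambda>x. pr (f x) (fd g x v) + pr (fd f x v) (g x))"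
      using Suc.prems by (intro ck_on_add Suc.IH) (auto intro: ck_on_SucD)
    show "pr (f x) (fd g x v) + pr (fd f x v) (g x) = fd (\<lambda>x. pr (f x) (g x)) x v" if "x \<in> X" for x
      using fd_unique[OF hd[OF that]] by simp
  qed
  then show ?case using hd by (auto simp: differentiable_def)
qed

text \<open>Induction with the chain rule. The direction \<open>fd f x v\<close> moves with
  \<open>x\<close>, while the hypothesis on \<open>g\<close> covers constant directions; expanding
  along \<open>B\<close> turns the derivative into a finite sum of products of Ck functions.\<close>

lemma ck_on_compose:
  fixes f :: "'a::real_normed_vector \<Rightarrow> 'b::real_normed_vector" and g :: "'b \<Rightarrow> 'c::real_normed_vector"
  assumes "findim TYPE('b)" "open X"
  shows "f ` X \<subseteq> Y \<Longrightarrow> ck_on k X f \<Longrightarrow> ck_on k Y g \<Longrightarrow> ck_on k X (\<lambda>x. g (f x))"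
proof (induction k arbitrary: g)
  case 0
  then show ?case using continuous_on_compose2 by (metis ck_on.simps(1))
next
  case (Suc k)
  obtain B :: "'b set" and l where Bl: "coords B l" using findim_coords[OF assms(1)] .
  have hd: "((\<lambda>x. g (f x)) has_derivative (\<lambda>v. fd g (f x) (fd f x v))) (at x)" if "x \<in> X" for x
  proof (rule has_derivative_compose[of f _ x UNIV g])
    show "(f has_derivative (\<lambda>v. fd f x v)) (at x)"
      using that Suc.prems by (intro has_derivative_fd) auto
    show "(g has_derivative (\<lambda>v. fd g (f x) v)) (at (f x))"
      using that Suc.prems by (intro has_derivative_fd) auto
  qed
  have ckl: "ck_on k X (\<lambda>x. l b (fd f x v))" for b v
  proof (rule ck_on_linear_comp[where L="l b", OF _ assms(2)])
    show "bounded_linear (l b)" using Bl by (simp add: coords_def)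
    show "ck_on k X (\<lambda>x. fd f x v)" using Suc.prems by simp
  qed
  have ckg: "ck_on k X (\<lambda>x. fd g (f x) b)" for b
    using Suc.prems by (intro Suc.IH) (auto intro: ck_on_SucD)
  have "ck_on k X (\<lambda>x. fd (\<lambda>x. g (f x)) x v)" for v
  proof (rule ck_on_cong[OF assms(2)])
    show "ck_on k X (\<lambda>x. \<Sum>b\<in>B. l b (fd f x v) *\<^sub>R fd g (f x) b)"
      by (intro ck_on_sum ck_on_bilinear[OF bounded_bilinear_scaleR] assms ckl ckg)
    show "(\<Sum>b\<in>B. l b (fd f x v) *\<^sub>R fd g (f x) b) = fd (\<lambda>x. g (f x)) x v" if "x \<in> X" for x
    proof -
      have "linear (\<lambda>w. fd g (f x) w)" using that Suc.prems by (intro linear_fd) auto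
      then show ?thesis using fd_unique[OF hd[OF that]] coords_linear_expand[OF Bl] by metis
    qed
  qed
  then show ?case using hd by (auto simp: differentiable_def)
qed

lemma ck_on_local:
  "(\<And>x. x \<in> X \<Longrightarrow> \<exists>V. open V \<and> x \<in> V \<and> ck_on k V f) \<Longrightarrow> ck_on k X f"
proof (induction k arbitrary: f)
  case 0
  have "isCont f x" if x: "x \<in> X" for x
  proof -
    from 0[OF x] obtain V where "open V" "x \<in> V" "continuous_on V f" by auto
    then show ?thesis using continuous_on_eq_continuous_at by blast
  qed
  then show ?case by (simp add: continuous_at_imp_continuous_on)
next
  case (Suc k)
  have "f differentiable (at x)" if x: "x \<in> X" for x
    using Suc.prems[OF x] by auto
  moreover have "ck_on k X (\<lambda>x. fd f x v)" for v
  proof (rule Suc.IH)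
    fix x assume "x \<in> X"
    then show "\<exists>V. open V \<and> x \<in> V \<and> ck_on k V (\<lambda>x. fd f x v)"
      using Suc.prems[of x] by auto
  qed
  ultimately show ?case by simp
qed

text \<open>Smoothness of a germ. The open set sits inside \<open>smooth_on\<close>, so maps can be
  composed and modified near a point without tracking domains; \<open>smooth_on\<close> itself is
  recovered pointwise.\<close>

definition smooth_pt :: "('a::real_normed_vector \<Rightarrow> 'b::real_normed_vector) \<Rightarrow> 'a \<Rightarrow> bool" where
  "smooth_pt f x \<longleftrightarrow> (\<exists>V. x \<in> V \<and> smooth_on V f)"

lemma smooth_on_iff_smooth_pt: "smooth_on X f \<longleftrightarrow> open X \<and> (\<forall>x\<in>X. smooth_pt f x)"
proof
  assume "smooth_on X f"
  then show "open X \<and> (\<forall>x\<in>X. smooth_pt f x)" by (auto simp: smooth_pt_def smooth_on_def)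
next
  assume *: "open X \<and> (\<forall>x\<in>X. smooth_pt f x)"
  have "ck_on k X f" for k
  proof (rule ck_on_local)
    fix x assume "x \<in> X"
    then show "\<exists>V. open V \<and> x \<in> V \<and> ck_on k V f"
      using * by (auto simp: smooth_pt_def smooth_on_def)
  qed
  then show "smooth_on X f" using * by (simp add: smooth_on_def)
qed

lemma smooth_on_ck_on: "smooth_on X f \<Longrightarrow> ck_on k X f"
  by (simp add: smooth_on_def)

lemma smooth_on_open: "smooth_on X f \<Longrightarrow> open X"
  by (simp add: smooth_on_def)

lemma smooth_on_subset: "smooth_on X f \<Longrightarrow> Y \<subseteq> X \<Longrightarrow> open Y \<Longrightarrow> smooth_on Y f"
  unfolding smooth_on_def using ck_on_subset by blast

lemma smooth_pt_eventually: "smooth_pt f x \<Longrightarrow> \<forall>\<^sub>F y in nhds x. smooth_pt f y"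
  unfolding smooth_pt_def eventually_nhds by (metis smooth_on_def)

lemma smooth_pt_cong:
  assumes "smooth_pt f x" "\<forall>\<^sub>F y in nhds x. f y = g y"
  shows "smooth_pt g x"
proof -
  obtain V W where V: "x \<in> V" "smooth_on V f" and W: "open W" "x \<in> W" "\<And>y. y \<in> W \<Longrightarrow> f y = g y"
    using assms by (auto simp: smooth_pt_def eventually_nhds)
  have "open (V \<inter> W)" using V W by (simp add: smooth_on_def open_Int)
  moreover have "ck_on k (V \<inter> W) g" for k
  proof (rule ck_on_cong[OF \<open>open (V \<inter> W)\<close>])
    show "ck_on k (V \<inter> W) f" using V ck_on_subset smooth_on_ck_on by (metis Int_lower1)
    show "f x = g x" if "x \<in> V \<inter> W" for x using that W by simp
  qed
  ultimately show ?thesis using V W by (auto simp: smooth_pt_def smooth_on_def)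
qed

lemma smooth_pt_differentiable: "smooth_pt f x \<Longrightarrow> f differentiable (at x)"
  unfolding smooth_pt_def smooth_on_def by (metis ck_on.simps(2))

lemma smooth_pt_isCont: "smooth_pt f x \<Longrightarrow> isCont f x"
  using smooth_pt_differentiable differentiable_imp_continuous_within by blast

lemma smooth_pt_tendsto: "smooth_pt f x \<Longrightarrow> filterlim f (nhds (f x)) (nhds x)"
  using smooth_pt_isCont continuous_at tendsto_at_iff_tendsto_nhds by metis

lemma smooth_pt_eventually_comp:
  "smooth_pt f x \<Longrightarrow> \<forall>\<^sub>F y in nhds (f x). P y \<Longrightarrow> \<forall>\<^sub>F y in nhds x. P (f y)"
  using smooth_pt_tendsto by (rule eventually_compose_filterlim[rotated])

lemma smooth_pt_linear_fd: "smooth_pt f x \<Longrightarrow> linear (\<lambda>v. fd f x v)"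
  by (intro linear_fd smooth_pt_differentiable)

lemma smooth_pt_has_derivative: "smooth_pt f x \<Longrightarrow> (f has_derivative (\<lambda>v. fd f x v)) (at x)"
  by (intro has_derivative_fd smooth_pt_differentiable)

lemma smooth_pt_fd: "smooth_pt f x \<Longrightarrow> smooth_pt (\<lambda>y. fd f y v) x"
  unfolding smooth_pt_def smooth_on_def by (metis ck_on.simps(2))

lemma smooth_pt_const: "smooth_pt (\<lambda>_. a) x"
  unfolding smooth_pt_def smooth_on_def using ck_on_const open_UNIV by blast

lemma smooth_pt_linear: "bounded_linear L \<Longrightarrow> smooth_pt L x"
  unfolding smooth_pt_def smooth_on_def using ck_on_linear open_UNIV by blast

lemma smooth_pt_ident: "smooth_pt (\<lambda>x. x) x"
  by (intro smooth_pt_linear bounded_linear_ident)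

lemma smooth_pt_linear_comp: "bounded_linear L \<Longrightarrow> smooth_pt f x \<Longrightarrow> smooth_pt (\<lambda>x. L (f x)) x"
  unfolding smooth_pt_def smooth_on_def using ck_on_linear_comp by metis

lemma smooth_pt_bilinear:
  assumes "bounded_bilinear pr" "smooth_pt f x" "smooth_pt g x"
  shows "smooth_pt (\<lambda>x. pr (f x) (g x)) x"
proof -
  obtain V W where V: "x \<in> V" "smooth_on V f" "x \<in> W" "smooth_on W g"
    using assms by (auto simp: smooth_pt_def)
  then have "open (V \<inter> W)" by (auto intro: smooth_on_open)
  then have "smooth_on (V \<inter> W) f" "smooth_on (V \<inter> W) g"
    using V by (auto intro: smooth_on_subset)
  then show ?thesis using V ck_on_bilinear[OF assms(1)]
    unfolding smooth_pt_def smooth_on_def by (metis IntI)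
qed

lemma smooth_pt_add: "smooth_pt f x \<Longrightarrow> smooth_pt g x \<Longrightarrow> smooth_pt (\<lambda>x. f x + g x) x"
proof -
  assume "smooth_pt f x" "smooth_pt g x"
  then obtain V W where V: "x \<in> V" "smooth_on V f" "x \<in> W" "smooth_on W g"
    by (auto simp: smooth_pt_def)
  then have "open (V \<inter> W)" by (auto intro: smooth_on_open)
  then have "smooth_on (V \<inter> W) f" "smooth_on (V \<inter> W) g"
    using V by (auto intro: smooth_on_subset)
  then show ?thesis using V ck_on_add
    unfolding smooth_pt_def smooth_on_def by (metis IntI)
qed

lemma smooth_pt_scaleR: "smooth_pt f x \<Longrightarrow> smooth_pt g x \<Longrightarrow> smooth_pt (\<lambda>x. f x *\<^sub>R g x) x"
  by (rule smooth_pt_bilinear[OF bounded_bilinear_scaleR])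

lemma smooth_pt_mult: "smooth_pt f x \<Longrightarrow> smooth_pt g x \<Longrightarrow> smooth_pt (\<lambda>x. f x * g x :: real) x"
  by (rule smooth_pt_bilinear[OF bounded_bilinear_mult])

lemma smooth_pt_blinfun_apply: "smooth_pt f x \<Longrightarrow> smooth_pt g x \<Longrightarrow> smooth_pt (\<lambda>x. blinfun_apply (f x) (g x)) x"
  by (rule smooth_pt_bilinear[OF bounded_bilinear_blinfun_apply])

lemma smooth_pt_minus: "smooth_pt f x \<Longrightarrow> smooth_pt (\<lambda>x. - f x) x"
  using smooth_pt_linear_comp[OF bounded_linear_minus[OF bounded_linear_ident]] by fast

lemma smooth_pt_diff: "smooth_pt f x \<Longrightarrow> smooth_pt g x \<Longrightarrow> smooth_pt (\<lambda>x. f x - g x) x"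
  using smooth_pt_add[OF _ smooth_pt_minus] by fastforce

lemma smooth_pt_sum: "(\<And>i. i \<in> I \<Longrightarrow> smooth_pt (f i) x) \<Longrightarrow> smooth_pt (\<lambda>x. \<Sum>i\<in>I. f i x) x"
  by (induction I rule: infinite_finite_induct) (auto intro: smooth_pt_const smooth_pt_add)

lemma smooth_pt_compose:
  fixes f :: "'a::real_normed_vector \<Rightarrow> 'b::real_normed_vector" and g :: "'b \<Rightarrow> 'c::real_normed_vector"
  assumes "findim TYPE('b)" "smooth_pt f x" "smooth_pt g (f x)"
  shows "smooth_pt (\<lambda>x. g (f x)) x"
proof -
  obtain Y where Y: "f x \<in> Y" "smooth_on Y g" using assms(3) by (auto simp: smooth_pt_def)
  obtain W where W: "x \<in> W" "smooth_on W f" using assms(2) by (auto simp: smooth_pt_def)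
  have "\<forall>\<^sub>F y in nhds x. f y \<in> Y"
    by (rule smooth_pt_eventually_comp[OF assms(2)]) (use Y in \<open>auto simp: smooth_on_def eventually_nhds\<close>)
  then obtain V where V: "open V" "x \<in> V" "\<And>y. y \<in> V \<Longrightarrow> f y \<in> Y"
    by (auto simp: eventually_nhds)
  have "open (V \<inter> W)" using V W by (auto simp: smooth_on_def)
  have "ck_on k (V \<inter> W) (\<lambda>x. g (f x))" for k
  proof (rule ck_on_compose[OF assms(1) \<open>open (V \<inter> W)\<close>])
    show "ck_on k (V \<inter> W) f" using W ck_on_subset smooth_on_ck_on by (metis Int_lower2)
    show "f ` (V \<inter> W) \<subseteq> Y" using V by auto
    show "ck_on k Y g" using Y smooth_on_ck_on by metis
  qed
  then show ?thesis using V W \<open>open (V \<inter> W)\<close> by (auto simp: smooth_pt_def smooth_on_def)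
qed

lemma fd_compose:
  assumes "f differentiable (at x)" "g differentiable (at (f x))"
  shows "fd (\<lambda>x. g (f x)) x v = fd g (f x) (fd f x v)"
  by (rule fd_unique) (rule has_derivative_compose[OF has_derivative_fd[OF assms(1)] has_derivative_fd[OF assms(2)]])

lemma smooth_pt_Pair: "smooth_pt f x \<Longrightarrow> smooth_pt g x \<Longrightarrow> smooth_pt (\<lambda>x. (f x, g x)) x"
proof -
  assume "smooth_pt f x" "smooth_pt g x"
  then have "smooth_pt (\<lambda>x. (f x, 0) + (0, g x)) x"
    by (intro smooth_pt_add smooth_pt_linear_comp[where L="\<lambda>a. (a, 0)"] smooth_pt_linear_comp[where L="\<lambda>a. (0, a)"])
      (auto intro!: bounded_linear_Pair bounded_linear_ident bounded_linear_zero)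
  then show ?thesis by simp
qed

lemma smooth_pt_fst: "smooth_pt f x \<Longrightarrow> smooth_pt (\<lambda>x. fst (f x)) x"
  by (rule smooth_pt_linear_comp[OF bounded_linear_fst])

lemma smooth_pt_snd: "smooth_pt f x \<Longrightarrow> smooth_pt (\<lambda>x. snd (f x)) x"
  by (rule smooth_pt_linear_comp[OF bounded_linear_snd])

text \<open>A linear family is determined by its finitely many values on \<open>B\<close>, so
  smoothness for constant arguments suffices for a moving one. This is how smoothness in constant
  directions, the form in which one-forms and derivatives provide it, is applied to vector
  fields.\<close>

lemma smooth_pt_linear_family:
  fixes L :: "'a::real_normed_vector \<Rightarrow> 'b::real_normed_vector \<Rightarrow> 'c::real_normed_vector"
  assumes "findim TYPE('b)" "\<And>w. smooth_pt (\<lambda>y. L y w) x" "\<forall>\<^sub>F y in nhds x. linear (L y)" "smooth_pt w x"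
  shows "smooth_pt (\<lambda>y. L y (w y)) x"
proof -
  obtain B :: "'b set" and l where Bl: "coords B l" using findim_coords[OF assms(1)] .
  have "smooth_pt (\<lambda>y. \<Sum>b\<in>B. l b (w y) *\<^sub>R L y b) x"
  proof (intro smooth_pt_sum smooth_pt_scaleR assms(2))
    show "smooth_pt (\<lambda>y. l b (w y)) x" for b
      using Bl by (intro smooth_pt_linear_comp[of "l b", OF _ assms(4)]) (auto simp: coords_def)
  qed
  moreover have "\<forall>\<^sub>F y in nhds x. (\<Sum>b\<in>B. l b (w y) *\<^sub>R L y b) = L y (w y)"
    using assms(3) by (rule eventually_mono) (metis coords_linear_expand[OF Bl])
  ultimately show ?thesis by (rule smooth_pt_cong)
qed

lemma smooth_pt_fd_var:
  fixes f :: "'a::real_normed_vector \<Rightarrow> 'b::real_normed_vector" and g :: "'c::real_normed_vector \<Rightarrow> 'a"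
  assumes "findim TYPE('a)" "smooth_pt f (g x)" "smooth_pt w x" "smooth_pt g x"
  shows "smooth_pt (\<lambda>y. fd f (g y) (w y)) x"
proof (rule smooth_pt_linear_family[OF assms(1) _ _ assms(3)])
  show "smooth_pt (\<lambda>y. fd f (g y) v) x" for v
    by (rule smooth_pt_compose[OF assms(1,4) smooth_pt_fd[OF assms(2)]])
  show "\<forall>\<^sub>F y in nhds x. linear (\<lambda>v. fd f (g y) v)"
    using smooth_pt_eventually_comp[OF assms(4) smooth_pt_eventually[OF assms(2)]]
    by (rule eventually_mono) (rule smooth_pt_linear_fd)
qed

text \<open>Passes from pointwise smoothness to smoothness in the operator norm: the family is a
  combination of fixed functionals with smooth coefficients. Fibre coordinates of covectors are of
  this form.\<close>

lemma smooth_pt_Blinfun: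
  fixes L :: "'a::real_normed_vector \<Rightarrow> 'b::real_normed_vector \<Rightarrow> real"
  assumes "findim TYPE('b)" "\<And>w. smooth_pt (\<lambda>y. L y w) x" "\<forall>\<^sub>F y in nhds x. linear (L y)"
  shows "smooth_pt (\<lambda>y. Blinfun (L y)) x"
proof -
  obtain B :: "'b set" and l where Bl: "coords B l" using findim_coords[OF assms(1)] .
  have "smooth_pt (\<lambda>y. \<Sum>b\<in>B. L y b *\<^sub>R Blinfun (l b)) x"
    by (intro smooth_pt_sum smooth_pt_scaleR assms smooth_pt_const)
  moreover have "\<forall>\<^sub>F y in nhds x. (\<Sum>b\<in>B. L y b *\<^sub>R Blinfun (l b)) = Blinfun (L y)"
    using assms(3)
  proof (rule eventually_mono)
    fix y assume lin: "linear (L y)"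
    show "(\<Sum>b\<in>B. L y b *\<^sub>R Blinfun (l b)) = Blinfun (L y)"
    proof (rule blinfun_eqI)
      fix v
      have "L y v = (\<Sum>b\<in>B. l b v *\<^sub>R L y b)" by (rule coords_linear_expand[OF Bl lin])
      then show "(\<Sum>b\<in>B. L y b *\<^sub>R Blinfun (l b)) v = Blinfun (L y) v"
        using Bl findim_linear_bounded[OF assms(1) lin]
        by (simp add: blinfun.sum_left blinfun.scaleR_left coords_def bounded_linear_Blinfun_apply mult.commute)
    qed
  qed
  ultimately show ?thesis by (rule smooth_pt_cong)
qed

text \<open>The mean value theorem twice: in \<open>s\<close> for the increment of \<open>f\<close>
  along \<open>h *\<^sub>R v\<close>, then in \<open>t\<close> for its derivative in direction
  \<open>u\<close>. The left side is symmetric in \<open>u\<close> and \<open>v\<close>, while the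
  right side is one of the two mixed derivatives.\<close>

lemma second_difference_mvt:
  fixes f :: "'a::real_normed_vector \<Rightarrow> real"
  assumes "ck_on 2 (ball x r) f" "h > 0" "h * (norm u + norm v) < r"
  obtains s t where "0 < s" "s < h" "0 < t" "t < h"
    "f (x + h *\<^sub>R u + h *\<^sub>R v) - f (x + h *\<^sub>R u) - f (x + h *\<^sub>R v) + f x
       = h^2 * fd (\<lambda>y. fd f y u) (x + s *\<^sub>R u + t *\<^sub>R v) v"
proof -
  have ball: "x + s *\<^sub>R u + t *\<^sub>R v \<in> ball x r" if "0 \<le> s" "s \<le> h" "0 \<le> t" "t \<le> h" for s t
  proof -
    have "norm (s *\<^sub>R u + t *\<^sub>R v) \<le> \<bar>s\<bar> * norm u + \<bar>t\<bar> * norm v"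
      by (metis norm_scaleR norm_triangle_ineq)
    also have "\<dots> \<le> h * norm u + h * norm v"
      using that by (intro add_mono mult_right_mono) auto
    also have "\<dots> < r" using assms(3) by (simp add: distrib_left)
    finally show ?thesis using norm_minus_cancel[of "s *\<^sub>R u + t *\<^sub>R v"] by (simp add: dist_norm)
  qed
  have d1: "f differentiable (at y)" and d2: "(\<lambda>y. fd f y u) differentiable (at y)" if "y \<in> ball x r" for y
    using that assms(1) by (auto simp: numeral_2_eq_2)
  define g where "g s = f (x + s *\<^sub>R u + h *\<^sub>R v) - f (x + s *\<^sub>R u)" for s
  have g': "(g has_real_derivative fd f (x + s *\<^sub>R u + h *\<^sub>R v) u - fd f (x + s *\<^sub>R u) u) (at s)"
    if "0 \<le> s" "s \<le> h" for s
  proof -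
    have D: "((\<lambda>s. x + s *\<^sub>R u + w) has_derivative (\<lambda>k. k *\<^sub>R u)) (at s)" for w
      by (auto intro!: derivative_eq_intros)
    have 1: "((\<lambda>s. f (x + s *\<^sub>R u + h *\<^sub>R v)) has_derivative (\<lambda>k. fd f (x + s *\<^sub>R u + h *\<^sub>R v) (k *\<^sub>R u))) (at s)"
      using that assms(2) by (intro has_derivative_compose[OF D] has_derivative_fd d1 ball) auto
    have 2: "((\<lambda>s. f (x + s *\<^sub>R u + 0)) has_derivative (\<lambda>k. fd f (x + s *\<^sub>R u + 0) (k *\<^sub>R u))) (at s)"
      using that assms(2) ball[of s 0] by (intro has_derivative_compose[OF D] has_derivative_fd d1) auto
    have l1: "linear (\<lambda>w. fd f (x + s *\<^sub>R u + h *\<^sub>R v) w)" "linear (\<lambda>w. fd f (x + s *\<^sub>R u) w)"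
      using that assms(2) ball[of s 0] ball[of s h] by (auto intro!: linear_fd d1 simp del: mem_ball)
    have "(\<lambda>k. fd f (x + s *\<^sub>R u + h *\<^sub>R v) (k *\<^sub>R u) - fd f (x + s *\<^sub>R u + 0) (k *\<^sub>R u))
        = (*) (fd f (x + s *\<^sub>R u + h *\<^sub>R v) u - fd f (x + s *\<^sub>R u) u)"
      using l1 by (auto simp: linear_scale algebra_simps fun_eq_iff)
    then show ?thesis
      using has_derivative_diff[OF 1 2] by (simp add: has_field_derivative_def g_def[abs_def])
  qed
  obtain s where s: "0 < s" "s < h" "g h - g 0 = (h - 0) * (fd f (x + s *\<^sub>R u + h *\<^sub>R v) u - fd f (x + s *\<^sub>R u) u)"
    using MVT2[OF assms(2) g'] by auto
  have k': "((\<lambda>t. fd f (x + s *\<^sub>R u + t *\<^sub>R v) u) has_real_derivative fd (\<lambda>y. fd f y u) (x + s *\<^sub>R u + t *\<^sub>R v) v) (at t)"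
    if "0 \<le> t" "t \<le> h" for t
  proof -
    have D: "((\<lambda>t. x + s *\<^sub>R u + t *\<^sub>R v) has_derivative (\<lambda>k. k *\<^sub>R v)) (at t)"
      by (auto intro!: derivative_eq_intros)
    have 1: "((\<lambda>t. fd f (x + s *\<^sub>R u + t *\<^sub>R v) u) has_derivative
        (\<lambda>k. fd (\<lambda>y. fd f y u) (x + s *\<^sub>R u + t *\<^sub>R v) (k *\<^sub>R v))) (at t)"
      using that s by (intro has_derivative_compose[OF D] has_derivative_fd d2 ball) auto
    have l1: "linear (\<lambda>w. fd (\<lambda>y. fd f y u) (x + s *\<^sub>R u + t *\<^sub>R v) w)"
      using that s by (intro linear_fd d2 ball) auto
    have "(\<lambda>k. fd (\<lambda>y. fd f y u) (x + s *\<^sub>R u + t *\<^sub>R v) (k *\<^sub>R v))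
        = (*) (fd (\<lambda>y. fd f y u) (x + s *\<^sub>R u + t *\<^sub>R v) v)"
      using l1 by (auto simp: linear_scale algebra_simps fun_eq_iff)
    then show ?thesis using 1 by (simp add: has_field_derivative_def)
  qed
  obtain t where t: "0 < t" "t < h" "fd f (x + s *\<^sub>R u + h *\<^sub>R v) u - fd f (x + s *\<^sub>R u + 0 *\<^sub>R v) u
      = (h - 0) * fd (\<lambda>y. fd f y u) (x + s *\<^sub>R u + t *\<^sub>R v) v"
    using MVT2[OF assms(2) k'] by auto
  show thesis
    by (rule that[OF s(1,2) t(1,2)]) (use s(3) t(3) in \<open>simp add: g_def power2_eq_square\<close>)
qed

text \<open>Schwarz's theorem. The same second difference equals \<open>h^2\<close> times either
  mixed derivative at some point close to \<open>x\<close>; if the two differed at \<open>x\<close>,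
  continuity would keep them apart on a small ball.\<close>

lemma smooth_pt_second_derivative_symmetric:
  fixes f :: "'a::real_normed_vector \<Rightarrow> real"
  assumes "smooth_pt f x"
  shows "fd (\<lambda>y. fd f y u) x v = fd (\<lambda>y. fd f y v) x u"
proof (rule ccontr)
  define P where "P = (\<lambda>y. fd (\<lambda>y. fd f y u) y v)"
  define Q where "Q = (\<lambda>y. fd (\<lambda>y. fd f y v) y u)"
  assume "\<not> ?thesis"
  then have e: "\<bar>P x - Q x\<bar> / 2 > 0" (is "?e > 0") by (simp add: P_def Q_def)
  have "isCont P x" "isCont Q x" unfolding P_def Q_def by (intro smooth_pt_isCont smooth_pt_fd assms)+
  then have "\<exists>d>0. \<forall>y. dist y x < d \<longrightarrow> dist (P y) (P x) < ?e" "\<exists>d>0. \<forall>y. dist y x < d \<longrightarrow> dist (Q y) (Q x) < ?e"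
    using e unfolding continuous_at_eps_delta by blast+
  then obtain d1 d2 where d: "d1 > 0" "\<And>y. dist y x < d1 \<Longrightarrow> dist (P y) (P x) < ?e"
      "d2 > 0" "\<And>y. dist y x < d2 \<Longrightarrow> dist (Q y) (Q x) < ?e"
    by auto
  obtain V where V: "x \<in> V" "smooth_on V f" using assms by (auto simp: smooth_pt_def)
  then obtain r0 where r0: "r0 > 0" "ball x r0 \<subseteq> V" by (metis openE smooth_on_def)
  define r where "r = min r0 (min d1 d2)"
  have r: "r > 0" using r0 d by (simp add: r_def)
  \<comment> \<open>Keeps both parallelograms inside the ball of radius \<open>r\<close>; the
    \<open>+ 1\<close> guards against \<open>u = v = 0\<close>.\<close>
  define h where "h = r / (2 * (norm u + norm v + 1))"
  have pos: "norm u + norm v + 1 > 0" using norm_ge_zero[of u] norm_ge_zero[of v] by linarith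
  have h: "h > 0" "h * (norm u + norm v) < r"
  proof -
    show "h > 0" using r pos by (simp add: h_def)
    have "h * (norm u + norm v) \<le> h * (norm u + norm v + 1)" using \<open>h > 0\<close> by simp
    also have "\<dots> = r / 2" using pos by (simp add: h_def field_simps)
    finally show "h * (norm u + norm v) < r" using r by simp
  qed
  have ck: "ck_on 2 (ball x r) f"
  proof (rule ck_on_subset)
    show "ck_on 2 V f" using V smooth_on_ck_on by metis
    show "ball x r \<subseteq> V" using r0 by (auto simp: r_def)
  qed
  obtain s t where st: "0 < s" "s < h" "0 < t" "t < h"
    "f (x + h *\<^sub>R u + h *\<^sub>R v) - f (x + h *\<^sub>R u) - f (x + h *\<^sub>R v) + f x = h^2 * P (x + s *\<^sub>R u + t *\<^sub>R v)"
    unfolding P_def by (rule second_difference_mvt[OF ck h])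
  have h2: "h * (norm v + norm u) < r" using h by (simp add: add.commute)
  obtain s' t' where st': "0 < s'" "s' < h" "0 < t'" "t' < h"
    "f (x + h *\<^sub>R v + h *\<^sub>R u) - f (x + h *\<^sub>R v) - f (x + h *\<^sub>R u) + f x = h^2 * Q (x + s' *\<^sub>R v + t' *\<^sub>R u)"
    unfolding Q_def by (rule second_difference_mvt[OF ck h(1) h2])
  have eq: "P (x + s *\<^sub>R u + t *\<^sub>R v) = Q (x + s' *\<^sub>R v + t' *\<^sub>R u)"
  proof -
    have "h^2 * P (x + s *\<^sub>R u + t *\<^sub>R v) = h^2 * Q (x + s' *\<^sub>R v + t' *\<^sub>R u)"
      unfolding st(5)[symmetric] st'(5)[symmetric] by (simp add: algebra_simps)
    then show ?thesis using h by simp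
  qed
  have near: "dist (x + a *\<^sub>R p + b *\<^sub>R q) x < r"
    if "0 < a" "a < h" "0 < b" "b < h" "h * (norm p + norm q) < r" for a b and p q :: 'a
  proof -
    have "norm (a *\<^sub>R p + b *\<^sub>R q) \<le> \<bar>a\<bar> * norm p + \<bar>b\<bar> * norm q"
      by (metis norm_scaleR norm_triangle_ineq)
    also have "\<dots> \<le> h * norm p + h * norm q"
      using that by (intro add_mono mult_right_mono) auto
    also have "\<dots> < r" using that by (simp add: distrib_left)
    finally show ?thesis by (simp add: dist_norm add.assoc)
  qed
  have "dist (P (x + s *\<^sub>R u + t *\<^sub>R v)) (P x) < ?e"
    using near[OF st(1-4) h(2)] by (intro d) (simp add: r_def)
  moreover have "dist (Q (x + s' *\<^sub>R v + t' *\<^sub>R u)) (Q x) < ?e"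
    using near[OF st'(1-4) h2] by (intro d) (simp add: r_def)
  ultimately have "\<bar>P x - Q x\<bar> < \<bar>P x - Q x\<bar> / 2 + \<bar>P x - Q x\<bar> / 2"
    using eq unfolding dist_real_def by linarith
  then show False by simp
qed

section \<open>Charts and smooth maps\<close>

definition good_chart :: "('a, 'e::real_normed_vector) chart \<Rightarrow> bool" where
  "good_chart c \<longleftrightarrow> inj_on (snd c) (fst c) \<and> open (snd c ` fst c)"

text \<open>That \<open>F\<close> stays in the target chart near \<open>x\<close> is demanded
  separately, because the coordinate expression carries no information where \<open>F\<close> leaves
  \<open>fst d\<close>. With this clause composition works on germs.\<close>

definition chart_smooth :: "('a, 'e::real_normed_vector) chart \<Rightarrow> ('b, 'f::real_normed_vector) chart \<Rightarrow> ('a \<Rightarrow> 'b) \<Rightarrow> 'a \<Rightarrow> bool" where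
  "chart_smooth c d F x \<longleftrightarrow> x \<in> fst c \<and> F x \<in> fst d \<and>
     (\<forall>\<^sub>F y in nhds (snd c x). F (chart_inv c y) \<in> fst d) \<and>
     smooth_pt (\<lambda>y. snd d (F (chart_inv c y))) (snd c x)"

text \<open>A smooth manifold without the separation and countability axioms. Only this part of the
  structure is established for products and cotangent bundles.\<close>

definition mfd :: "('a, 'e::real_normed_vector) atlas \<Rightarrow> bool" where
  "mfd M \<longleftrightarrow> findim TYPE('e) \<and> (\<forall>c\<in>M. good_chart c) \<and>
     (\<forall>c\<in>M. \<forall>d\<in>M. \<forall>x. x \<in> fst c \<and> x \<in> fst d \<longrightarrow> chart_smooth c d (\<lambda>x. x) x)"

definition smooth_at :: "('a, 'e::real_normed_vector) atlas \<Rightarrow> ('b, 'f::real_normed_vector) atlas \<Rightarrow> ('a \<Rightarrow> 'b) \<Rightarrow> 'a \<Rightarrow> bool" where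
  "smooth_at M N F x \<longleftrightarrow> (\<exists>c\<in>M. \<exists>d\<in>N. chart_smooth c d F x)"

lemma pointsI: "c \<in> M \<Longrightarrow> x \<in> fst c \<Longrightarrow> x \<in> points M"
  by (auto simp: points_def)

lemma pointsE:
  assumes "x \<in> points M"
  obtains c where "c \<in> M" "x \<in> fst c"
  using assms unfolding points_def by blast

lemma chart_inv_chart: "good_chart c \<Longrightarrow> x \<in> fst c \<Longrightarrow> chart_inv c (snd c x) = x"
  by (simp add: good_chart_def chart_inv_def)

lemma chart_chart_inv: "y \<in> snd c ` fst c \<Longrightarrow> snd c (chart_inv c y) = y"
  by (simp add: chart_inv_def f_inv_into_f)

lemma chart_inv_in: "y \<in> snd c ` fst c \<Longrightarrow> chart_inv c y \<in> fst c"
  by (simp add: chart_inv_def inv_into_into)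

lemma eventually_in_chart: "good_chart c \<Longrightarrow> x \<in> fst c \<Longrightarrow> \<forall>\<^sub>F y in nhds (snd c x). y \<in> snd c ` fst c"
  by (auto simp: good_chart_def eventually_nhds)

lemma eventually_chart_inv:
  assumes "good_chart c" "x \<in> fst c" "\<And>y. y \<in> snd c ` fst c \<Longrightarrow> P y"
  shows "\<forall>\<^sub>F y in nhds (snd c x). P y"
  using eventually_in_chart[OF assms(1,2)] by (rule eventually_mono) (rule assms(3))

lemma chart_eqI: "good_chart c \<Longrightarrow> x \<in> fst c \<Longrightarrow> snd c x = y \<Longrightarrow> chart_inv c y = x"
  by (auto simp: chart_inv_chart)

lemma mfd_findim: "mfd (M :: ('a, 'e::real_normed_vector) atlas) \<Longrightarrow> findim TYPE('e)"
  by (simp add: mfd_def)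

lemma mfd_good_chart: "mfd M \<Longrightarrow> c \<in> M \<Longrightarrow> good_chart c"
  by (simp add: mfd_def)

lemma chart_smoothD:
  assumes "chart_smooth c d F x"
  shows "x \<in> fst c" "F x \<in> fst d" "\<forall>\<^sub>F y in nhds (snd c x). F (chart_inv c y) \<in> fst d"
    "smooth_pt (\<lambda>y. snd d (F (chart_inv c y))) (snd c x)"
  using assms by (auto simp: chart_smooth_def)

lemma chart_smooth_cong:
  assumes "good_chart c" "chart_smooth c d F x" "\<And>z. z \<in> fst c \<Longrightarrow> F z = F' z"
  shows "chart_smooth c d F' x"
proof -
  have ev: "\<forall>\<^sub>F y in nhds (snd c x). F (chart_inv c y) = F' (chart_inv c y)"
    using assms(1) chart_smoothD(1)[OF assms(2)] by (rule eventually_chart_inv) (simp add: assms(3) chart_inv_in)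
  show ?thesis unfolding chart_smooth_def
  proof (intro conjI)
    show "x \<in> fst c" "F' x \<in> fst d" using chart_smoothD(1,2)[OF assms(2)] assms(3) by auto
    show "\<forall>\<^sub>F y in nhds (snd c x). F' (chart_inv c y) \<in> fst d"
      using ev chart_smoothD(3)[OF assms(2)] by eventually_elim auto
    show "smooth_pt (\<lambda>y. snd d (F' (chart_inv c y))) (snd c x)"
      by (rule smooth_pt_cong[OF chart_smoothD(4)[OF assms(2)]]) (use ev in eventually_elim, auto)
  qed
qed

lemma chart_smooth_compose:
  fixes e :: "('b, 'f::real_normed_vector) chart"
  assumes "good_chart c" "findim TYPE('f)" "good_chart e" "chart_smooth c e F x" "chart_smooth e d F' (F x)"
  shows "chart_smooth c d (\<lambda>x. F' (F x)) x"
proof -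
  note [simp] = chart_inv_chart[OF assms(1) chart_smoothD(1)[OF assms(4)]]
  have ev: "\<forall>\<^sub>F y in nhds (snd c x). chart_inv e (snd e (F (chart_inv c y))) = F (chart_inv c y)"
    using chart_smoothD(3)[OF assms(4)] by (rule eventually_mono) (rule chart_inv_chart[OF assms(3)])
  have ev2: "\<forall>\<^sub>F y in nhds (snd c x). F' (chart_inv e (snd e (F (chart_inv c y)))) \<in> fst d"
    by (rule smooth_pt_eventually_comp[OF chart_smoothD(4)[OF assms(4)]]) (use chart_smoothD(3)[OF assms(5)] in simp)
  show ?thesis unfolding chart_smooth_def
  proof (intro conjI)
    show "x \<in> fst c" "F' (F x) \<in> fst d" using chart_smoothD[OF assms(4)] chart_smoothD[OF assms(5)] by auto
    show "\<forall>\<^sub>F y in nhds (snd c x). F' (F (chart_inv c y)) \<in> fst d"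
      using ev ev2 by eventually_elim simp
    have "smooth_pt (\<lambda>y. snd d (F' (chart_inv e (snd e (F (chart_inv c y)))))) (snd c x)"
      by (rule smooth_pt_compose[OF assms(2) chart_smoothD(4)[OF assms(4)]]) (use chart_smoothD(4)[OF assms(5)] in simp)
    then show "smooth_pt (\<lambda>y. snd d (F' (F (chart_inv c y)))) (snd c x)"
      by (rule smooth_pt_cong) (use ev in eventually_elim, simp)
  qed
qed

lemma mfd_cs_ident: "mfd M \<Longrightarrow> c \<in> M \<Longrightarrow> d \<in> M \<Longrightarrow> x \<in> fst c \<Longrightarrow> x \<in> fst d \<Longrightarrow> chart_smooth c d (\<lambda>x. x) x"
  by (simp add: mfd_def)

text \<open>\<open>smooth_at\<close> provides one pair of charts; composing with the identity on
  either side, which is smooth between any two charts of an atlas, reaches every other pair.\<close>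

lemma smooth_at_chart_smooth:
  assumes "mfd M" "mfd N" "smooth_at M N F x" "c \<in> M" "x \<in> fst c" "d \<in> N" "F x \<in> fst d"
  shows "chart_smooth c d F x"
proof -
  obtain c' d' where c': "c' \<in> M" "d' \<in> N" "chart_smooth c' d' F x" using assms(3) by (auto simp: smooth_at_def)
  have "chart_smooth c c' (\<lambda>x. x) x" using assms c' chart_smoothD(1)[OF c'(3)] by (auto intro: mfd_cs_ident)
  then have "chart_smooth c d' F x"
    using chart_smooth_compose[of c c' "\<lambda>x. x" x d' F, OF mfd_good_chart[OF assms(1,4)] mfd_findim[OF assms(1)]
        mfd_good_chart[OF assms(1) c'(1)]] c'(3) by simp
  moreover have "chart_smooth d' d (\<lambda>x. x) (F x)" using assms c' chart_smoothD(2)[OF c'(3)] by (auto intro: mfd_cs_ident)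
  ultimately show ?thesis
    using chart_smooth_compose[of c d' F x d "\<lambda>x. x", OF mfd_good_chart[OF assms(1,4)] mfd_findim[OF assms(2)]
        mfd_good_chart[OF assms(2) c'(2)]] by simp
qed

lemma chart_smooth_eventually:
  assumes "good_chart c" "chart_smooth c d F x"
  shows "\<forall>\<^sub>F y in nhds (snd c x). chart_smooth c d F (chart_inv c y)"
proof -
  have "\<forall>\<^sub>F y in nhds (snd c x). \<forall>\<^sub>F y in nhds y. F (chart_inv c y) \<in> fst d"
    using chart_smoothD(3)[OF assms(2)] by (simp add: eventually_eventually)
  with chart_smoothD(3)[OF assms(2)] smooth_pt_eventually[OF chart_smoothD(4)[OF assms(2)]]
    eventually_in_chart[OF assms(1) chart_smoothD(1)[OF assms(2)]]
  show ?thesis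
    by eventually_elim (simp add: chart_smooth_def chart_inv_in chart_chart_inv)
qed

lemma smooth_at_points: "smooth_at M N F x \<Longrightarrow> x \<in> points M" "smooth_at M N F x \<Longrightarrow> F x \<in> points N"
  by (auto simp: smooth_at_def points_def chart_smooth_def)

lemma smooth_at_obtain:
  assumes "mfd M" "mfd N" "smooth_at M N F x"
  obtains c d where "c \<in> M" "d \<in> N" "chart_smooth c d F x" "x \<in> fst c" "F x \<in> fst d"
  using assms(3) chart_smoothD(1,2) unfolding smooth_at_def by metis

lemma smooth_at_compose:
  assumes "mfd M" "mfd N" "mfd L" "smooth_at M N F x" "smooth_at N L F' (F x)"
  shows "smooth_at M L (\<lambda>x. F' (F x)) x"
proof -
  obtain c d where c: "c \<in> M" "d \<in> N" "chart_smooth c d F x" using assms(4) by (auto simp: smooth_at_def)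
  obtain e where e: "e \<in> L" "F' (F x) \<in> fst e"
    using smooth_at_points(2)[OF assms(5)] by (auto simp: points_def)
  have "chart_smooth d e F' (F x)"
    using smooth_at_chart_smooth[OF assms(2,3,5) c(2) chart_smoothD(2)[OF c(3)] e] .
  then have "chart_smooth c e (\<lambda>x. F' (F x)) x"
    using chart_smooth_compose[of c d F x e F', OF mfd_good_chart[OF assms(1) c(1)] mfd_findim[OF assms(2)]
        mfd_good_chart[OF assms(2) c(2)] c(3)] by simp
  then show ?thesis using c e by (auto simp: smooth_at_def)
qed

lemma smooth_at_cong:
  assumes "mfd M" "smooth_at M N F x" "\<And>z. z \<in> points M \<Longrightarrow> F z = F' z"
  shows "smooth_at M N F' x"
proof -
  obtain c d where c: "c \<in> M" "d \<in> N" "chart_smooth c d F x" using assms(2) by (auto simp: smooth_at_def)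
  have "chart_smooth c d F' x"
    by (rule chart_smooth_cong[OF mfd_good_chart[OF assms(1) c(1)] c(3)]) (use c assms(3) in \<open>auto simp: points_def\<close>)
  then show ?thesis using c by (auto simp: smooth_at_def)
qed

lemma smooth_at_ident: "mfd M \<Longrightarrow> x \<in> points M \<Longrightarrow> smooth_at M M (\<lambda>x. x) x"
  unfolding points_def smooth_at_def by (blast intro: mfd_cs_ident)

lemma smooth_at_const: "mfd M \<Longrightarrow> x \<in> points M \<Longrightarrow> a \<in> points N \<Longrightarrow> smooth_at M N (\<lambda>_. a) x"
  unfolding points_def smooth_at_def chart_smooth_def by (auto intro: smooth_pt_const)

subsection \<open>Topology\<close>

lemma good_chart_image_Int:
  "good_chart c \<Longrightarrow> snd c ` (fst c \<inter> (V \<inter> W)) = snd c ` (fst c \<inter> V) \<inter> snd c ` (fst c \<inter> W)"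
  unfolding good_chart_def inj_on_def by blast

text \<open>\<open>topology\<close> yields the intended open sets only for a genuine topology.
  Closure under intersection is where the injectivity of charts enters.\<close>

lemma openin_mtop:
  assumes "\<forall>c\<in>M. good_chart c"
  shows "openin (mtop M) W \<longleftrightarrow> W \<subseteq> points M \<and> (\<forall>c\<in>M. open (snd c ` (fst c \<inter> W)))"
proof -
  have "istopology (\<lambda>W. W \<subseteq> points M \<and> (\<forall>c\<in>M. open (snd c ` (fst c \<inter> W))))"
    unfolding istopology_def
  proof (intro conjI allI impI)
    fix V W assume VW: "V \<subseteq> points M \<and> (\<forall>c\<in>M. open (snd c ` (fst c \<inter> V)))"
      "W \<subseteq> points M \<and> (\<forall>c\<in>M. open (snd c ` (fst c \<inter> W)))"
    show "V \<inter> W \<subseteq> points M" using VW by auto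
    show "\<forall>c\<in>M. open (snd c ` (fst c \<inter> (V \<inter> W)))"
      using VW assms by (auto simp: good_chart_image_Int intro!: open_Int)
  next
    fix \<W> assume W: "\<forall>W\<in>\<W>. W \<subseteq> points M \<and> (\<forall>c\<in>M. open (snd c ` (fst c \<inter> W)))"
    show "\<Union>\<W> \<subseteq> points M" using W by auto
    have "snd c ` (fst c \<inter> \<Union>\<W>) = (\<Union>W\<in>\<W>. snd c ` (fst c \<inter> W))" for c :: "('a, 'b) chart" by auto
    then show "\<forall>c\<in>M. open (snd c ` (fst c \<inter> \<Union>\<W>))" using W by (metis (no_types, lifting) open_UN)
  qed
  then show ?thesis unfolding mtop_def by (simp add: topology_inverse')
qed

lemma smooth_manifold_mfd:
  assumes "smooth_manifold M"
  shows "mfd M"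
  unfolding mfd_def
proof (intro conjI ballI allI impI)
  show "findim TYPE('b)" using assms by (simp add: smooth_manifold_def findim_def)
  fix c assume c: "c \<in> M"
  then show g: "good_chart c" using assms by (simp add: smooth_manifold_def good_chart_def)
  fix d x assume d: "d \<in> M" and x: "x \<in> fst c \<and> x \<in> fst d"
  have s: "smooth_on (snd c ` (fst c \<inter> fst d)) (snd d \<circ> chart_inv c)"
    using assms c d by (simp add: smooth_manifold_def)
  have [simp]: "chart_inv c (snd c x) = x" using g x by (simp add: chart_inv_chart)
  show "chart_smooth c d (\<lambda>x. x) x" unfolding chart_smooth_def
  proof (intro conjI)
    show "x \<in> fst c" "x \<in> fst d" using x by auto
    have "\<forall>\<^sub>F y in nhds (snd c x). y \<in> snd c ` (fst c \<inter> fst d)"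
      using x smooth_on_open[OF s] by (auto simp: eventually_nhds)
    then show "\<forall>\<^sub>F y in nhds (snd c x). chart_inv c y \<in> fst d"
      by (rule eventually_mono) (use g in \<open>auto simp: chart_inv_chart\<close>)
    show "smooth_pt (\<lambda>y. snd d (chart_inv c y)) (snd c x)"
      using s x by (auto simp: smooth_on_iff_smooth_pt o_def)
  qed
qed

lemma topspace_mtop:
  assumes "mfd M"
  shows "topspace (mtop M) = points M"
proof -
  have "\<forall>c\<in>M. good_chart c" using assms by (simp add: mfd_def)
  note o = openin_mtop[OF this]
  have "open (snd c ` (fst c \<inter> points M))" if "c \<in> M" for c
  proof -
    have "snd c ` (fst c \<inter> points M) = snd c ` fst c" using that by (auto simp: points_def)
    then show ?thesis using that mfd_good_chart[OF assms] by (simp add: good_chart_def)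
  qed
  then have "openin (mtop M) (points M)" using o by auto
  then show ?thesis using o by (metis openin_subset openin_topspace subset_antisym)
qed

text \<open>Openness seen in the chart \<open>c\<close> has to be transported to every other chart
  \<open>d\<close>: a point of the image in \<open>d\<close> keeps a neighbourhood because the
  transition map to \<open>c\<close> is defined near it and continuous.\<close>

lemma openin_chart_preimage:
  assumes "mfd M" "c \<in> M" "open V"
  shows "openin (mtop M) {x \<in> fst c. snd c x \<in> V}"
proof -
  have g: "\<forall>c\<in>M. good_chart c" using assms by (simp add: mfd_def)
  show ?thesis unfolding openin_mtop[OF g]
  proof (intro conjI ballI)
    show "{x \<in> fst c. snd c x \<in> V} \<subseteq> points M" using assms by (auto simp: points_def)
    fix d assume d: "d \<in> M"
    show "open (snd d ` (fst d \<inter> {x \<in> fst c. snd c x \<in> V}))"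
    proof (subst open_subopen, intro ballI)
      fix y assume "y \<in> snd d ` (fst d \<inter> {x \<in> fst c. snd c x \<in> V})"
      then obtain x where x: "x \<in> fst d" "x \<in> fst c" "snd c x \<in> V" "y = snd d x" by auto
      note css = mfd_cs_ident[OF assms(1) d assms(2) x(1,2)]
      note [simp] = chart_inv_chart[OF mfd_good_chart[OF assms(1) d] x(1)]
      have 1: "\<forall>\<^sub>F y in nhds y. chart_inv d y \<in> fst c"
        using chart_smoothD(3)[OF css] x by simp
      have 2: "\<forall>\<^sub>F y in nhds y. y \<in> snd d ` fst d"
        unfolding x(4) using mfd_good_chart[OF assms(1) d] x(1) by (rule eventually_in_chart)
      have 3: "\<forall>\<^sub>F y in nhds y. snd c (chart_inv d y) \<in> V"
        unfolding x(4) by (rule smooth_pt_eventually_comp[OF chart_smoothD(4)[OF css]])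
          (use assms(3) x in \<open>auto simp: eventually_nhds\<close>)
      from 1 2 3 have "\<forall>\<^sub>F y in nhds y. y \<in> snd d ` (fst d \<inter> {x \<in> fst c. snd c x \<in> V})"
      proof eventually_elim
        case (elim y)
        then show ?case using chart_chart_inv[of y d] chart_inv_in[of y d]
          by (intro image_eqI[of _ _ "chart_inv d y"]) auto
      qed
      then show "\<exists>T. open T \<and> y \<in> T \<and> T \<subseteq> snd d ` (fst d \<inter> {x \<in> fst c. snd c x \<in> V})"
        by (auto simp: eventually_nhds)
    qed
  qed
qed

lemma smooth_map_smooth_at:
  assumes "mfd M" "mfd N" "smooth_map M N F" "x \<in> points M"
  shows "smooth_at M N F x"
proof -
  have "F x \<in> points N"
  proof -
    have "continuous_map (mtop M) (mtop N) F" using assms(3) by (simp add: smooth_map_def)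
    then have "F \<in> topspace (mtop M) \<rightarrow> topspace (mtop N)" by (rule continuous_map_funspace)
    then show ?thesis using assms(4) topspace_mtop[OF assms(1)] topspace_mtop[OF assms(2)] by auto
  qed
  then obtain c d where cd: "c \<in> M" "d \<in> N" "x \<in> fst c" "F x \<in> fst d"
    using assms(4) by (auto simp: points_def)
  note g = mfd_good_chart[OF assms(1) cd(1)]
  have s: "smooth_on (snd c ` {x \<in> fst c. F x \<in> fst d}) (snd d \<circ> F \<circ> chart_inv c)"
    using assms cd by (simp add: smooth_map_def)
  have "chart_smooth c d F x" unfolding chart_smooth_def
  proof (intro conjI)
    have "\<forall>\<^sub>F y in nhds (snd c x). y \<in> snd c ` {x \<in> fst c. F x \<in> fst d}"
      using cd smooth_on_open[OF s] by (auto simp: eventually_nhds)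
    then show "\<forall>\<^sub>F y in nhds (snd c x). F (chart_inv c y) \<in> fst d"
      by (rule eventually_mono) (use g in \<open>auto simp: chart_inv_chart\<close>)
    show "smooth_pt (\<lambda>y. snd d (F (chart_inv c y))) (snd c x)"
      using s cd by (auto simp: smooth_on_iff_smooth_pt o_def)
  qed (use cd in auto)
  then show ?thesis using cd by (auto simp: smooth_at_def)
qed

subsection \<open>Real-valued functions\<close>

lemma chart_inv_real [simp]: "chart_inv (UNIV, id) = (\<lambda>x::'a. x)"
  by (auto simp: chart_inv_def fun_eq_iff)

lemma chart_smooth_real: "chart_smooth c (UNIV, id) g x \<longleftrightarrow> x \<in> fst c \<and> smooth_pt (\<lambda>y. g (chart_inv c y)) (snd c x)"
  by (simp add: chart_smooth_def)

lemma mfd_real_line: "mfd real_line"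
  by (auto simp: mfd_def real_line_def good_chart_def chart_smooth_real findim_real smooth_pt_ident)

lemma points_real_line [simp]: "points real_line = UNIV"
  by (simp add: points_def real_line_def)

text \<open>Connects the open set and all charts of \<open>smooth_near\<close> with a germ in a
  single chart. For the converse, the neighbourhood is the chart preimage of an open set on which
  the coordinate expression stays smooth, and transition maps carry smoothness to the remaining
  charts.\<close>

lemma smooth_near_iff:
  assumes "mfd M"
  shows "x \<in> points M \<and> smooth_near M x g \<longleftrightarrow> smooth_at M real_line g x"
proof
  assume *: "x \<in> points M \<and> smooth_near M x g"
  then obtain W where W: "x \<in> W" "\<forall>c\<in>M. smooth_on (snd c ` (fst c \<inter> W)) (g \<circ> chart_inv c)"
    by (auto simp: smooth_near_def)
  obtain c where "c \<in> M" "x \<in> fst c" using * by (auto simp: points_def)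
  then have "chart_smooth c (UNIV, id) g x" using W by (auto simp: chart_smooth_real smooth_on_iff_smooth_pt o_def)
  then show "smooth_at M real_line g x" using \<open>c \<in> M\<close> by (auto simp: smooth_at_def real_line_def)
next
  assume *: "smooth_at M real_line g x"
  then obtain c where c: "c \<in> M" "chart_smooth c (UNIV, id) g x" by (auto simp: smooth_at_def real_line_def)
  have "\<forall>\<^sub>F y in nhds (snd c x). y \<in> snd c ` fst c \<and> smooth_pt (\<lambda>y. g (chart_inv c y)) y"
    using eventually_in_chart[OF mfd_good_chart[OF assms c(1)] chart_smoothD(1)[OF c(2)]]
      smooth_pt_eventually[OF chart_smoothD(4)[OF c(2)]] by eventually_elim simp
  then obtain V where V: "open V" "snd c x \<in> V" "\<And>y. y \<in> V \<Longrightarrow> smooth_pt (\<lambda>y. g (chart_inv c y)) y"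
    by (auto simp: eventually_nhds)
  let ?W = "{x \<in> fst c. snd c x \<in> V}"
  have "smooth_on (snd d ` (fst d \<inter> ?W)) (g \<circ> chart_inv d)" if d: "d \<in> M" for d
    unfolding smooth_on_iff_smooth_pt
  proof (intro conjI ballI)
    have "\<forall>c\<in>M. good_chart c" using assms by (simp add: mfd_def)
    then show "open (snd d ` (fst d \<inter> ?W))"
      using openin_chart_preimage[OF assms c(1) V(1)] openin_mtop[of M] d by metis
    fix y assume "y \<in> snd d ` (fst d \<inter> ?W)"
    then obtain z where z: "z \<in> fst d" "z \<in> fst c" "snd c z \<in> V" "y = snd d z" by auto
    then have "chart_smooth c (UNIV, id) g z" using V by (simp add: chart_smooth_real)
    then have "smooth_at M real_line g z" using c by (auto simp: smooth_at_def real_line_def)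
    then have "chart_smooth d (UNIV, id) g z"
      by (rule smooth_at_chart_smooth[OF assms mfd_real_line]) (use d z in \<open>auto simp: real_line_def\<close>)
    then show "smooth_pt (g \<circ> chart_inv d) y" using z by (simp add: chart_smooth_real o_def)
  qed
  then show "x \<in> points M \<and> smooth_near M x g"
    using openin_chart_preimage[OF assms c(1) V(1)] V chart_smoothD(1)[OF c(2)] smooth_at_points(1)[OF *]
    unfolding smooth_near_def by blast
qed

lemma smooth_at_real_chart:
  assumes "mfd M" "smooth_at M real_line g x" "c \<in> M" "x \<in> fst c"
  shows "smooth_pt (\<lambda>y. g (chart_inv c y)) (snd c x)"
  using smooth_at_chart_smooth[OF assms(1) mfd_real_line assms(2-4), of "(UNIV, id)"]
  by (simp add: real_line_def chart_smooth_real)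

lemma smooth_at_realI:
  assumes "mfd M" "c \<in> M" "x \<in> fst c" "smooth_pt (\<lambda>y. g (chart_inv c y)) (snd c x)"
  shows "smooth_at M real_line g x"
  using assms unfolding smooth_at_def real_line_def by (auto simp: chart_smooth_real)

lemma smooth_fun_iff:
  assumes "mfd M"
  shows "smooth_fun M g \<longleftrightarrow> (\<forall>x\<in>points M. smooth_at M real_line g x)"
proof
  assume *: "smooth_fun M g"
  show "\<forall>x\<in>points M. smooth_at M real_line g x"
  proof
    fix x assume "x \<in> points M"
    then obtain c where c: "c \<in> M" "x \<in> fst c" by (auto simp: points_def)
    have "smooth_pt (\<lambda>y. g (chart_inv c y)) (snd c x)"
      using * c unfolding smooth_fun_def smooth_on_iff_smooth_pt o_def by blast
    then show "smooth_at M real_line g x" by (rule smooth_at_realI[OF assms c])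
  qed
next
  assume *: "\<forall>x\<in>points M. smooth_at M real_line g x"
  show "smooth_fun M g" unfolding smooth_fun_def smooth_on_iff_smooth_pt
  proof (intro ballI conjI)
    fix c assume c: "c \<in> M"
    show "open (snd c ` fst c)" using mfd_good_chart[OF assms c] by (simp add: good_chart_def)
    fix y assume "y \<in> snd c ` fst c"
    then obtain x where x: "x \<in> fst c" "y = snd c x" by auto
    then have "smooth_at M real_line g x" using c * by (auto simp: points_def)
    then show "smooth_pt (g \<circ> chart_inv c) y" using smooth_at_real_chart[OF assms _ c x(1)] x by (simp add: o_def)
  qed
qed

lemma smooth_near_compose:
  assumes "mfd M" "mfd N" "smooth_at M N F x" "smooth_near N (F x) g"
  shows "smooth_near M x (\<lambda>x. g (F x))"
proof -
  have "smooth_at N real_line g (F x)" using smooth_near_iff[OF assms(2)] smooth_at_points[OF assms(3)] assms(4) by blast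
  then have "smooth_at M real_line (\<lambda>x. g (F x)) x"
    by (rule smooth_at_compose[OF assms(1,2) mfd_real_line assms(3)])
  then show ?thesis using smooth_near_iff[OF assms(1)] by blast
qed

section \<open>Tangent vectors and tangent maps\<close>

lemma smooth_near_smooth_pt:
  assumes "mfd M" "c \<in> M" "x \<in> fst c" "smooth_near M x g"
  shows "smooth_pt (\<lambda>y. g (chart_inv c y)) (snd c x)"
  using assms smooth_near_iff[OF assms(1)] by (intro smooth_at_real_chart) (auto simp: points_def)

lemma coord_vec_apply:
  "coord_vec M c x w g = (if smooth_near M x g then fd (\<lambda>y. g (chart_inv c y)) (snd c x) w else 0)"
  by (simp add: coord_vec_def o_def)

lemma coord_vec_linear:
  assumes "mfd M" "c \<in> M" "x \<in> fst c"
  shows "(\<lambda>g. a * coord_vec M c x u g + b * coord_vec M c x v g) = coord_vec M c x (a *\<^sub>R u + b *\<^sub>R v)"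
proof
  fix g
  show "a * coord_vec M c x u g + b * coord_vec M c x v g = coord_vec M c x (a *\<^sub>R u + b *\<^sub>R v) g"
    using smooth_pt_linear_fd[OF smooth_near_smooth_pt[OF assms, of g]]
    by (auto simp: coord_vec_apply linear_add linear_scale)
qed

lemma coord_vec_zero:
  assumes "mfd M" "c \<in> M" "x \<in> fst c"
  shows "coord_vec M c x 0 = (\<lambda>_. 0)"
  using coord_vec_linear[OF assms, of 0 0 0 0] by simp

text \<open>Chain rule for \<open>g\<close>, read in the chart \<open>d\<close>, after the
  coordinate expression of \<open>F\<close>. A test function that is not smooth near
  \<open>F x\<close> gives 0 on both sides.\<close>

lemma tmap_coord_vec:
  assumes "mfd M" "mfd N" "c \<in> M" "d \<in> N" "chart_smooth c d F x"
  shows "tmap N F x (coord_vec M c x w) = coord_vec N d (F x) (fd (\<lambda>y. snd d (F (chart_inv c y))) (snd c x) w)"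
proof
  fix g
  note gc = mfd_good_chart[OF assms(1,3)] and gd = mfd_good_chart[OF assms(2,4)]
  note [simp] = chart_inv_chart[OF gc chart_smoothD(1)[OF assms(5)]] chart_inv_chart[OF gd chart_smoothD(2)[OF assms(5)]]
  show "tmap N F x (coord_vec M c x w) g = coord_vec N d (F x) (fd (\<lambda>y. snd d (F (chart_inv c y))) (snd c x) w) g"
  proof (cases "smooth_near N (F x) g")
    case True
    have "smooth_near M x (\<lambda>x. g (F x))"
      using True by (intro smooth_near_compose[OF assms(1,2)]) (use assms in \<open>auto simp: smooth_at_def\<close>)
    moreover have "fd (\<lambda>y. g (F (chart_inv c y))) (snd c x) =
        fd (\<lambda>y. g (chart_inv d (snd d (F (chart_inv c y))))) (snd c x)"
      by (rule fd_cong, use chart_smoothD(3)[OF assms(5)] in eventually_elim) (simp add: chart_inv_chart[OF gd])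
    moreover have "fd (\<lambda>y. g (chart_inv d (snd d (F (chart_inv c y))))) (snd c x) w
        = fd (\<lambda>z. g (chart_inv d z)) (snd d (F (chart_inv c (snd c x)))) (fd (\<lambda>y. snd d (F (chart_inv c y))) (snd c x) w)"
      using smooth_near_smooth_pt[OF assms(2,4) chart_smoothD(2)[OF assms(5)] True] chart_smoothD(4)[OF assms(5)]
      by (intro fd_compose[where g="\<lambda>z. g (chart_inv d z)"] smooth_pt_differentiable) auto
    ultimately show ?thesis using True by (simp add: tmap_def coord_vec_apply o_def)
  qed (simp add: tmap_def coord_vec_apply)
qed

lemma coord_vec_tangent: "c \<in> M \<Longrightarrow> x \<in> fst c \<Longrightarrow> coord_vec M c x w \<in> tangent_space M x"
  unfolding tangent_space_def by blast

lemma tangent_points: "v \<in> tangent_space M x \<Longrightarrow> x \<in> points M"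
  unfolding tangent_space_def points_def by blast

lemma coord_vec_smooth_near: "\<not> smooth_near M x g \<Longrightarrow> coord_vec M c x w g = 0"
  by (simp add: coord_vec_apply)

lemma tangent_smooth_near: "v \<in> tangent_space M x \<Longrightarrow> \<not> smooth_near M x g \<Longrightarrow> v g = 0"
  by (auto simp: tangent_space_def coord_vec_smooth_near)

text \<open>The cutoff in \<open>tmap\<close> changes nothing, as a tangent vector already vanishes
  on functions that are not smooth near its base point.\<close>

lemma tmap_ident:
  assumes "v \<in> tangent_space M x"
  shows "tmap M (\<lambda>x. x) x v = v"
  using tangent_smooth_near[OF assms] by (auto simp: tmap_def fun_eq_iff o_def)

text \<open>The coordinate change of vectors is the tangent map of the identity, computed between
  two charts.\<close>

lemma coord_vec_change:
  assumes "mfd M" "c \<in> M" "d \<in> M" "x \<in> fst c" "x \<in> fst d"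
  shows "coord_vec M c x w = coord_vec M d x (fd (\<lambda>y. snd d (chart_inv c y)) (snd c x) w)"
proof -
  have "coord_vec M c x w \<in> tangent_space M x" using assms by (intro coord_vec_tangent)
  then show ?thesis
    using tmap_coord_vec[OF assms(1,1,2,3) mfd_cs_ident[OF assms], of w] tmap_ident by metis
qed

lemma tangent_space_chart:
  assumes "mfd M" "c \<in> M" "x \<in> fst c"
  shows "tangent_space M x = range (coord_vec M c x)"
  unfolding tangent_space_def using coord_vec_change[OF assms(1) _ assms(2)] assms by blast

lemma tangent_obtain:
  assumes "mfd M" "c \<in> M" "x \<in> fst c" "v \<in> tangent_space M x"
  obtains w where "v = coord_vec M c x w"
  using assms(4) that unfolding tangent_space_chart[OF assms(1-3)] by auto

lemma tangent_linear:
  assumes "mfd M" "u \<in> tangent_space M x" "v \<in> tangent_space M x"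
  shows "(\<lambda>g. a * u g + b * v g) \<in> tangent_space M x"
proof -
  obtain c where c: "c \<in> M" "x \<in> fst c" using assms(2) by (auto simp: tangent_space_def)
  obtain u' v' where "u = coord_vec M c x u'" "v = coord_vec M c x v'"
    using tangent_obtain[OF assms(1) c assms(2)] tangent_obtain[OF assms(1) c assms(3)] by metis
  then show ?thesis by (simp add: coord_vec_linear[OF assms(1) c] coord_vec_tangent[OF c])
qed

lemma tangent_zero:
  assumes "mfd M" "x \<in> points M"
  shows "(\<lambda>_. 0) \<in> tangent_space M x"
proof -
  obtain c where c: "c \<in> M" "x \<in> fst c" using assms(2) by (auto simp: points_def)
  then show ?thesis using coord_vec_zero[OF assms(1) c] coord_vec_tangent[OF c] by metis
qed

text \<open>The functions \<open>l b \<circ> snd c\<close> are smooth near \<open>x\<close>, and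
  testing a tangent vector on them recovers the coordinates of its components. This justifies the
  definite description in \<open>coord_rep\<close>.\<close>

lemma coord_vec_inj:
  fixes M :: "('a, 'e::real_normed_vector) atlas"
  assumes "mfd M" "c \<in> M" "x \<in> fst c" "coord_vec M c x w = coord_vec M c x w'"
  shows "w = w'"
proof -
  obtain B :: "'e set" and l where Bl: "coords B l" using findim_coords[OF mfd_findim[OF assms(1)]] .
  have lin: "bounded_linear (l b)" for b using Bl by (simp add: coords_def)
  have ev: "\<forall>\<^sub>F y in nhds (snd c x). l b y = l b (snd c (chart_inv c y))" for b
    by (rule eventually_chart_inv[OF mfd_good_chart[OF assms(1,2)] assms(3)]) (simp add: chart_chart_inv)
  have "smooth_pt (\<lambda>y. l b (snd c (chart_inv c y))) (snd c x)" for b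
    using smooth_pt_linear[OF lin] ev by (rule smooth_pt_cong)
  then have "smooth_near M x (\<lambda>x. l b (snd c x))" for b
    using smooth_at_realI[OF assms(1-3), of "\<lambda>x. l b (snd c x)"]
      smooth_near_iff[OF assms(1), of x "\<lambda>x. l b (snd c x)"] by simp
  moreover have "fd (\<lambda>y. l b (snd c (chart_inv c y))) (snd c x) v = l b v" for b v
    unfolding fd_cong[OF ev, symmetric] by (rule fd_unique) (rule bounded_linear_imp_has_derivative[OF lin])
  ultimately have "coord_vec M c x v (\<lambda>x. l b (snd c x)) = l b v" for b v
    by (simp add: coord_vec_apply)
  then have "l b w = l b w'" for b using assms(4) by metis
  then have "(\<Sum>b\<in>B. l b w *\<^sub>R b) = (\<Sum>b\<in>B. l b w' *\<^sub>R b)" by simp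
  then show ?thesis using Bl by (simp add: coords_def)
qed

lemma coord_rep_coord_vec [simp]:
  assumes "mfd M" "c \<in> M" "x \<in> fst c"
  shows "coord_rep M c x (coord_vec M c x w) = w"
  unfolding coord_rep_def by (rule the_equality) (auto dest: coord_vec_inj[OF assms])

lemma coord_vec_coord_rep:
  assumes "mfd M" "c \<in> M" "x \<in> fst c" "v \<in> tangent_space M x"
  shows "coord_vec M c x (coord_rep M c x v) = v"
  using tangent_obtain[OF assms] coord_rep_coord_vec[OF assms(1-3)] by metis

lemma coord_rep_linear:
  assumes "mfd M" "c \<in> M" "x \<in> fst c" "u \<in> tangent_space M x" "v \<in> tangent_space M x"
  shows "coord_rep M c x (\<lambda>g. a * u g + b * v g) = a *\<^sub>R coord_rep M c x u + b *\<^sub>R coord_rep M c x v"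
proof -
  obtain u' v' where "u = coord_vec M c x u'" "v = coord_vec M c x v'"
    using tangent_obtain[OF assms(1-3) assms(4)] tangent_obtain[OF assms(1-3) assms(5)] by metis
  then show ?thesis using coord_vec_linear[OF assms(1-3)] coord_rep_coord_vec[OF assms(1-3)] by simp
qed

lemma tmap_tangent:
  assumes "mfd M" "mfd N" "smooth_at M N F x" "v \<in> tangent_space M x"
  shows "tmap N F x v \<in> tangent_space N (F x)"
proof -
  obtain c d where cd: "c \<in> M" "d \<in> N" "chart_smooth c d F x" "x \<in> fst c" "F x \<in> fst d"
    using smooth_at_obtain[OF assms(1-3)] .
  obtain w where "v = coord_vec M c x w" using tangent_obtain[OF assms(1) cd(1,4) assms(4)] .
  then show ?thesis using tmap_coord_vec[OF assms(1,2) cd(1-3)] coord_vec_tangent cd by metis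
qed

text \<open>If \<open>g\<close> is smooth near \<open>F' (F x)\<close>, then
  \<open>g \<circ> F'\<close> is smooth near \<open>F x\<close>, so the inner cutoff lets it pass;
  otherwise both sides are 0.\<close>

lemma tmap_compose:
  assumes "mfd N" "mfd L" "smooth_at N L F' (F x)"
  shows "tmap L (\<lambda>x. F' (F x)) x v = tmap L F' (F x) (tmap N F x v)"
proof
  fix g
  show "tmap L (\<lambda>x. F' (F x)) x v g = tmap L F' (F x) (tmap N F x v) g"
    using smooth_near_compose[OF assms, of g] by (simp add: tmap_def o_def)
qed

text \<open>HOL functions on the point type may differ off the manifold. Neither smoothness near
  \<open>x\<close> nor the derivative in a chart sees those values.\<close>

lemma tangent_apply_cong:
  assumes "mfd M" "v \<in> tangent_space M x" "\<And>z. z \<in> points M \<Longrightarrow> g z = g' z"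
  shows "v g = v g'"
proof -
  have near: "smooth_near M x g' = smooth_near M x g"
  proof -
    have "smooth_at M real_line g' x = smooth_at M real_line g x"
      using smooth_at_cong[OF assms(1)] assms(3) by metis
    moreover have "x \<in> points M" using assms(2) by (rule tangent_points)
    ultimately show ?thesis using smooth_near_iff[OF assms(1)] by metis
  qed
  obtain c w where c: "c \<in> M" "x \<in> fst c" "v = coord_vec M c x w"
    using assms(2) by (auto simp: tangent_space_def)
  have "frechet_derivative (\<lambda>y. g (chart_inv c y)) (at (snd c x)) = frechet_derivative (\<lambda>y. g' (chart_inv c y)) (at (snd c x))"
    by (rule fd_cong, rule eventually_chart_inv[OF mfd_good_chart[OF assms(1) c(1)] c(2)])
      (rule assms(3), rule pointsI[OF c(1)], erule chart_inv_in)
  then show ?thesis using near c(3) by (simp add: coord_vec_apply)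
qed

lemma tmap_cong:
  assumes "mfd M" "v \<in> tangent_space M x" "\<And>z. z \<in> points M \<Longrightarrow> F z = F' z"
  shows "tmap N F x v = tmap N F' x v"
proof -
  have "x \<in> points M" using assms(2) by (rule tangent_points)
  then have "F x = F' x" by (rule assms(3))
  moreover have "v (g \<circ> F) = v (g \<circ> F')" for g
    by (rule tangent_apply_cong[OF assms(1,2)]) (simp add: assms(3))
  ultimately show ?thesis by (simp add: tmap_def fun_eq_iff)
qed

lemma tmap_linear:
  "tmap N F x (\<lambda>g. a * u g + b * v g) = (\<lambda>g. a * tmap N F x u g + b * tmap N F x v g)"
  by (auto simp: tmap_def)

text \<open>Velocities become images of the unit vector of the real line, which makes the chain rule
  for \<open>tmap\<close> applicable to curves.\<close>

lemma velocity_tmap: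
  assumes "mfd M" "smooth_at real_line M \<gamma> t"
  shows "velocity M \<gamma> t = tmap M \<gamma> t (coord_vec real_line (UNIV, id) t 1)"
proof
  fix g
  have "deriv (\<lambda>s. g (\<gamma> s)) t = fd (\<lambda>s. g (\<gamma> s)) t 1" if "smooth_near M (\<gamma> t) g"
  proof -
    have "smooth_near real_line t (\<lambda>s. g (\<gamma> s))"
      using smooth_near_compose[OF mfd_real_line assms that] .
    then have "smooth_pt (\<lambda>s. g (\<gamma> s)) t"
      using smooth_near_smooth_pt[OF mfd_real_line, of "(UNIV, id)" t] by (simp add: real_line_def)
    then have d: "((\<lambda>s. g (\<gamma> s)) has_derivative (\<lambda>v. fd (\<lambda>s. g (\<gamma> s)) t v)) (at t)"
      by (rule smooth_pt_has_derivative)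
    have eq: "(\<lambda>v. fd (\<lambda>s. g (\<gamma> s)) t v) = (*) (fd (\<lambda>s. g (\<gamma> s)) t 1)"
    proof
      fix v
      show "fd (\<lambda>s. g (\<gamma> s)) t v = fd (\<lambda>s. g (\<gamma> s)) t 1 * v"
        using linear_scale[OF has_derivative_linear[OF d], of v 1] by simp
    qed
    have "((\<lambda>s. g (\<gamma> s)) has_real_derivative fd (\<lambda>s. g (\<gamma> s)) t 1) (at t)"
      unfolding has_field_derivative_def
      by (rule subst[OF eq, where P="\<lambda>D. ((\<lambda>s. g (\<gamma> s)) has_derivative D) (at t)"]) (rule d)
    then show ?thesis by (rule DERIV_imp_deriv)
  qed
  then show "velocity M \<gamma> t g = tmap M \<gamma> t (coord_vec real_line (UNIV, id) t 1) g"
    using smooth_near_compose[OF mfd_real_line assms, of g]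
    by (simp add: velocity_def tmap_def coord_vec_apply o_def)
qed

section \<open>Products\<close>

abbreviation prod_chart :: "('a, 'e) chart \<Rightarrow> ('b, 'f) chart \<Rightarrow> ('a \<times> 'b, 'e \<times> 'f) chart" where
  "prod_chart c d \<equiv> (fst c \<times> fst d, map_prod (snd c) (snd d))"

lemma prod_chart_in: "c \<in> M \<Longrightarrow> d \<in> N \<Longrightarrow> prod_chart c d \<in> prod_mfd M N"
  unfolding prod_mfd_def by (rule image_eqI[of _ _ "(c, d)"]) auto

lemma prod_mfdE:
  assumes "e \<in> prod_mfd M N"
  obtains c d where "c \<in> M" "d \<in> N" "e = prod_chart c d"
proof -
  obtain x where "x \<in> M \<times> N" "e = prod_chart (fst x) (snd x)"
    using assms unfolding prod_mfd_def case_prod_beta by (rule imageE)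
  then show thesis using that[of "fst x" "snd x"] by (simp add: mem_Times_iff)
qed

lemma points_prod [simp]: "points (prod_mfd M N) = points M \<times> points N"
  by (auto simp: points_def prod_mfd_def)

lemma good_chart_prod_chart:
  assumes "good_chart c" "good_chart d"
  shows "good_chart (prod_chart c d)"
proof -
  have "map_prod (snd c) (snd d) ` (fst c \<times> fst d) = (snd c ` fst c) \<times> (snd d ` fst d)"
    by (rule map_prod_surj_on) auto
  then show ?thesis using assms by (auto simp: good_chart_def open_Times map_prod_inj_on)
qed

text \<open>\<open>inv_into\<close> is specified only on the image of the chart, hence a statement
  about points near the given one.\<close>

lemma chart_inv_prod_chart:
  assumes "good_chart c" "good_chart d" "x \<in> fst c" "y \<in> fst d"
  shows "\<forall>\<^sub>F z in nhds (snd c x, snd d y).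
    chart_inv (prod_chart c d) z = (chart_inv c (fst z), chart_inv d (snd z)) \<and>
    fst z \<in> snd c ` fst c \<and> snd z \<in> snd d ` fst d"
proof -
  have "\<forall>\<^sub>F z in nhds (snd c x, snd d y). z \<in> (snd c ` fst c) \<times> (snd d ` fst d)"
    using assms by (auto simp: eventually_nhds good_chart_def intro!: open_Times exI[of _ "(snd c ` fst c) \<times> (snd d ` fst d)"])
  then show ?thesis
  proof (rule eventually_mono)
    fix z assume z: "z \<in> (snd c ` fst c) \<times> (snd d ` fst d)"
    have "chart_inv (prod_chart c d) z = (chart_inv c (fst z), chart_inv d (snd z))"
      by (rule chart_eqI[OF good_chart_prod_chart[OF assms(1,2)]])
        (use z in \<open>auto simp: chart_inv_in chart_chart_inv mem_Times_iff prod_eq_iff\<close>)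
    then show "chart_inv (prod_chart c d) z = (chart_inv c (fst z), chart_inv d (snd z)) \<and>
      fst z \<in> snd c ` fst c \<and> snd z \<in> snd d ` fst d" using z by (simp add: mem_Times_iff)
  qed
qed

lemma chart_inv_pc_eq:
  assumes "good_chart c" "good_chart d" "y \<in> snd c ` fst c" "z \<in> fst d"
  shows "chart_inv (prod_chart c d) (y, snd d z) = (chart_inv c y, z)"
  by (rule chart_eqI[OF good_chart_prod_chart[OF assms(1,2)]])
    (use assms in \<open>auto simp: chart_inv_in chart_chart_inv\<close>)

lemma chart_smooth_Pair:
  assumes "chart_smooth c d F x" "chart_smooth c e F' x"
  shows "chart_smooth c (prod_chart d e) (\<lambda>x. (F x, F' x)) x"
proof -
  have "\<forall>\<^sub>F y in nhds (snd c x). (F (chart_inv c y), F' (chart_inv c y)) \<in> fst d \<times> fst e"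
    using chart_smoothD(3)[OF assms(1)] chart_smoothD(3)[OF assms(2)] by eventually_elim simp
  then show ?thesis
    using assms smooth_pt_Pair[OF chart_smoothD(4)[OF assms(1)] chart_smoothD(4)[OF assms(2)]] by (simp add: chart_smooth_def)
qed

lemma chart_smooth_fst:
  assumes "good_chart c" "good_chart d" "z \<in> fst c \<times> fst d"
  shows "chart_smooth (prod_chart c d) c fst z"
    and "\<forall>\<^sub>F y in nhds (snd (prod_chart c d) z). snd c (fst (chart_inv (prod_chart c d) y)) = fst y"
proof -
  have z: "fst z \<in> fst c" "snd z \<in> fst d" using assms(3) by auto
  have zz: "snd (prod_chart c d) z = (snd c (fst z), snd d (snd z))" by (simp add: map_prod_def case_prod_beta)
  note ev = chart_inv_prod_chart[OF assms(1,2) z, folded zz]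
  show 1: "\<forall>\<^sub>F y in nhds (snd (prod_chart c d) z). snd c (fst (chart_inv (prod_chart c d) y)) = fst y"
    using ev by eventually_elim (simp add: chart_chart_inv)
  show "chart_smooth (prod_chart c d) c fst z" unfolding chart_smooth_def
  proof (intro conjI)
    show "z \<in> fst (prod_chart c d)" "fst z \<in> fst c" using assms(3) by auto
    show "\<forall>\<^sub>F y in nhds (snd (prod_chart c d) z). fst (chart_inv (prod_chart c d) y) \<in> fst c"
      using ev by eventually_elim (simp add: chart_inv_in)
    show "smooth_pt (\<lambda>y. snd c (fst (chart_inv (prod_chart c d) y))) (snd (prod_chart c d) z)"
      by (rule smooth_pt_cong[OF smooth_pt_linear[OF bounded_linear_fst]]) (use 1 in eventually_elim, simp)
  qed
qed

lemma chart_smooth_snd: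
  assumes "good_chart c" "good_chart d" "z \<in> fst c \<times> fst d"
  shows "chart_smooth (prod_chart c d) d snd z"
proof -
  have z: "fst z \<in> fst c" "snd z \<in> fst d" using assms(3) by auto
  have zz: "snd (prod_chart c d) z = (snd c (fst z), snd d (snd z))" by (simp add: map_prod_def case_prod_beta)
  note ev = chart_inv_prod_chart[OF assms(1,2) z, folded zz]
  have 1: "\<forall>\<^sub>F y in nhds (snd (prod_chart c d) z). snd d (snd (chart_inv (prod_chart c d) y)) = snd y"
    using ev by eventually_elim (simp add: chart_chart_inv)
  show "chart_smooth (prod_chart c d) d snd z" unfolding chart_smooth_def
  proof (intro conjI)
    show "z \<in> fst (prod_chart c d)" "snd z \<in> fst d" using assms(3) by auto
    show "\<forall>\<^sub>F y in nhds (snd (prod_chart c d) z). snd (chart_inv (prod_chart c d) y) \<in> fst d"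
      using ev by eventually_elim (simp add: chart_inv_in)
    show "smooth_pt (\<lambda>y. snd d (snd (chart_inv (prod_chart c d) y))) (snd (prod_chart c d) z)"
      by (rule smooth_pt_cong[OF smooth_pt_linear[OF bounded_linear_snd]]) (use 1 in eventually_elim, simp)
  qed
qed

lemma mfd_prod:
  fixes M :: "('a, 'e::real_normed_vector) atlas" and N :: "('b, 'f::real_normed_vector) atlas"
  assumes "mfd M" "mfd N"
  shows "mfd (prod_mfd M N)"
  unfolding mfd_def
proof (intro conjI ballI allI impI)
  show "findim TYPE('e \<times> 'f)" using assms by (intro findim_prod mfd_findim)
  fix e assume "e \<in> prod_mfd M N"
  then obtain c d where cd: "c \<in> M" "d \<in> N" "e = prod_chart c d" by (rule prod_mfdE)
  note g = mfd_good_chart[OF assms(1) cd(1)] mfd_good_chart[OF assms(2) cd(2)]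
  show gpc: "good_chart e" unfolding cd(3) by (rule good_chart_prod_chart[OF g])
  fix e' z assume e': "e' \<in> prod_mfd M N" and z: "z \<in> fst e \<and> z \<in> fst e'"
  obtain c' d' where cd': "c' \<in> M" "d' \<in> N" "e' = prod_chart c' d'" using e' by (rule prod_mfdE)
  have zc: "z \<in> fst c \<times> fst d" "z \<in> fst c' \<times> fst d'" using z cd cd' by auto
  have 1: "chart_smooth e c' (\<lambda>z. fst z) z"
    using chart_smooth_compose[of e c fst z c' "\<lambda>x. x", OF gpc mfd_findim[OF assms(1)] g(1)] zc
      chart_smooth_fst(1)[OF g zc(1)] mfd_cs_ident[OF assms(1) cd(1) cd'(1), of "fst z"] by (auto simp: cd(3))
  have 2: "chart_smooth e d' (\<lambda>z. snd z) z"
    using chart_smooth_compose[of e d snd z d' "\<lambda>x. x", OF gpc mfd_findim[OF assms(2)] g(2)] zc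
      chart_smooth_snd[OF g zc(1)] mfd_cs_ident[OF assms(2) cd(2) cd'(2), of "snd z"] by (auto simp: cd(3))
  show "chart_smooth e e' (\<lambda>x. x) z" using chart_smooth_Pair[OF 1 2] by (simp add: cd'(3))
qed

lemma smooth_at_Pair:
  assumes "mfd L" "mfd M" "mfd N" "smooth_at L M F x" "smooth_at L N F' x"
  shows "smooth_at L (prod_mfd M N) (\<lambda>x. (F x, F' x)) x"
proof -
  obtain c d where cd: "c \<in> L" "d \<in> M" "chart_smooth c d F x" "x \<in> fst c" "F x \<in> fst d"
    using smooth_at_obtain[OF assms(1,2,4)] .
  obtain e where e: "e \<in> N" "F' x \<in> fst e" using smooth_at_points(2)[OF assms(5)] by (rule pointsE)
  have "chart_smooth c e F' x" using smooth_at_chart_smooth[OF assms(1,3,5) cd(1,4) e] .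
  from chart_smooth_Pair[OF cd(3) this] show ?thesis
    unfolding smooth_at_def using prod_chart_in[OF cd(2) e(1)] cd(1) by blast
qed

lemma smooth_at_fst:
  assumes "mfd M" "mfd N" "z \<in> points (prod_mfd M N)"
  shows "smooth_at (prod_mfd M N) M fst z"
proof -
  obtain c d where cd: "c \<in> M" "fst z \<in> fst c" "d \<in> N" "snd z \<in> fst d"
    using assms(3) unfolding points_prod by (metis mem_Times_iff pointsE)
  then have "chart_smooth (prod_chart c d) c fst z"
    using assms by (intro chart_smooth_fst mfd_good_chart[of M] mfd_good_chart[of N]) (auto simp: mem_Times_iff)
  then show ?thesis unfolding smooth_at_def using prod_chart_in[OF cd(1,3)] cd(1) by blast
qed

lemma smooth_at_snd:
  assumes "mfd M" "mfd N" "z \<in> points (prod_mfd M N)"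
  shows "smooth_at (prod_mfd M N) N snd z"
proof -
  obtain c d where cd: "c \<in> M" "fst z \<in> fst c" "d \<in> N" "snd z \<in> fst d"
    using assms(3) unfolding points_prod by (metis mem_Times_iff pointsE)
  then have "chart_smooth (prod_chart c d) d snd z"
    using assms by (intro chart_smooth_snd mfd_good_chart[of M] mfd_good_chart[of N]) (auto simp: mem_Times_iff)
  then show ?thesis unfolding smooth_at_def using prod_chart_in[OF cd(1,3)] cd(3) by blast
qed

lemma tmap_inclusion1:
  assumes "mfd M" "mfd N" "c \<in> M" "d \<in> N" "x \<in> fst c" "b \<in> fst d"
  shows "tmap (prod_mfd M N) (\<lambda>x. (x, b)) x (coord_vec M c x u) = coord_vec (prod_mfd M N) (prod_chart c d) (x, b) (u, 0)"
proof -
  note g = mfd_good_chart[OF assms(1,3)]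
  have css: "chart_smooth c (prod_chart c d) (\<lambda>x. (x, b)) x"
    using assms by (intro chart_smooth_Pair mfd_cs_ident[of M]) (auto simp: chart_smooth_def smooth_pt_const)
  have "frechet_derivative (\<lambda>y. snd (prod_chart c d) (chart_inv c y, b)) (at (snd c x)) = frechet_derivative (\<lambda>y. (y, snd d b)) (at (snd c x))"
    by (rule fd_cong, rule eventually_chart_inv[OF g assms(5)]) (simp add: chart_chart_inv)
  moreover have "fd (\<lambda>y. (y, snd d b)) (snd c x) u = (u, 0)"
    by (rule fd_unique) (auto intro!: derivative_eq_intros)
  ultimately show ?thesis
    using tmap_coord_vec[OF assms(1) mfd_prod[OF assms(1,2)] assms(3) prod_chart_in[OF assms(3,4)] css] by simp
qed

lemma tmap_inclusion2:
  assumes "mfd M" "mfd N" "c \<in> M" "d \<in> N" "a \<in> fst c" "y \<in> fst d"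
  shows "tmap (prod_mfd M N) (\<lambda>y. (a, y)) y (coord_vec N d y u) = coord_vec (prod_mfd M N) (prod_chart c d) (a, y) (0, u)"
proof -
  note g = mfd_good_chart[OF assms(2,4)]
  have css: "chart_smooth d (prod_chart c d) (\<lambda>y. (a, y)) y"
    using assms by (intro chart_smooth_Pair mfd_cs_ident[of N]) (auto simp: chart_smooth_def smooth_pt_const)
  have "frechet_derivative (\<lambda>z. snd (prod_chart c d) (a, chart_inv d z)) (at (snd d y)) = frechet_derivative (\<lambda>z. (snd c a, z)) (at (snd d y))"
    by (rule fd_cong, rule eventually_chart_inv[OF g assms(6)]) (simp add: chart_chart_inv)
  moreover have "fd (\<lambda>z. (snd c a, z)) (snd d y) u = (0, u)"
    by (rule fd_unique) (auto intro!: derivative_eq_intros)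
  ultimately show ?thesis
    using tmap_coord_vec[OF assms(2) mfd_prod[OF assms(1,2)] assms(4) prod_chart_in[OF assms(3,4)] css] by simp
qed

lemma tpair_coord_vec:
  assumes "mfd M" "mfd N" "c \<in> M" "d \<in> N" "fst z \<in> fst c" "snd z \<in> fst d"
  shows "tpair M N z (coord_vec M c (fst z) u) (coord_vec N d (snd z) w) = coord_vec (prod_mfd M N) (prod_chart c d) z (u, w)"
proof -
  have z: "z \<in> fst (prod_chart c d)" using assms by (simp add: mem_Times_iff)
  show ?thesis
    using coord_vec_linear[OF mfd_prod[OF assms(1,2)] prod_chart_in[OF assms(3,4)] z, of 1 "(u, 0)" 1 "(0, w)"]
    unfolding tpair_def tmap_inclusion1[OF assms] tmap_inclusion2[OF assms] by simp
qed

lemma tmap_fst_coord_vec: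
  assumes "mfd M" "mfd N" "c \<in> M" "d \<in> N" "fst z \<in> fst c" "snd z \<in> fst d"
  shows "tmap M fst z (coord_vec (prod_mfd M N) (prod_chart c d) z w) = coord_vec M c (fst z) (fst w)"
proof -
  note g = mfd_good_chart[OF assms(1,3)] mfd_good_chart[OF assms(2,4)]
  have z: "z \<in> fst c \<times> fst d" using assms by (simp add: mem_Times_iff)
  have "fd (\<lambda>y. snd c (fst (chart_inv (prod_chart c d) y))) (snd (prod_chart c d) z) w = fst w"
    unfolding fd_cong[OF chart_smooth_fst(2)[OF g z]]
    by (rule fd_unique) (rule bounded_linear_imp_has_derivative[OF bounded_linear_fst])
  then show ?thesis
    using tmap_coord_vec[OF mfd_prod[OF assms(1,2)] assms(1) prod_chart_in[OF assms(3,4)] assms(3) chart_smooth_fst(1)[OF g z]] by simp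
qed

lemma tpair_cases:
  assumes "mfd M" "mfd N" "v \<in> tangent_space M (fst z)" "w \<in> tangent_space N (snd z)"
  obtains c d a b where "c \<in> M" "d \<in> N" "fst z \<in> fst c" "snd z \<in> fst d"
    "v = coord_vec M c (fst z) a" "w = coord_vec N d (snd z) b"
    "tpair M N z v w = coord_vec (prod_mfd M N) (prod_chart c d) z (a, b)"
proof -
  obtain c where c: "c \<in> M" "fst z \<in> fst c" using tangent_points[OF assms(3)] by (rule pointsE)
  obtain d where d: "d \<in> N" "snd z \<in> fst d" using tangent_points[OF assms(4)] by (rule pointsE)
  obtain a where a: "v = coord_vec M c (fst z) a" using tangent_obtain[OF assms(1) c assms(3)] .
  obtain b where b: "w = coord_vec N d (snd z) b" using tangent_obtain[OF assms(2) d assms(4)] .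
  show thesis using that[OF c(1) d(1) c(2) d(2) a b] tpair_coord_vec[OF assms(1,2) c(1) d(1) c(2) d(2)] a b by simp
qed

lemma tmap_fst_tpair:
  assumes "mfd M" "mfd N" "v \<in> tangent_space M (fst z)" "w \<in> tangent_space N (snd z)"
  shows "tmap M fst z (tpair M N z v w) = v"
proof -
  obtain c d a b where "c \<in> M" "d \<in> N" "fst z \<in> fst c" "snd z \<in> fst d" "v = coord_vec M c (fst z) a"
    "tpair M N z v w = coord_vec (prod_mfd M N) (prod_chart c d) z (a, b)"
    using tpair_cases[OF assms] by metis
  then show ?thesis using tmap_fst_coord_vec[OF assms(1,2)] by simp
qed

lemma tpair_tangent:
  assumes "mfd M" "mfd N" "v \<in> tangent_space M (fst z)" "w \<in> tangent_space N (snd z)"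
  shows "tpair M N z v w \<in> tangent_space (prod_mfd M N) z"
proof -
  obtain c d a b where "c \<in> M" "d \<in> N" "fst z \<in> fst c" "snd z \<in> fst d"
    "tpair M N z v w = coord_vec (prod_mfd M N) (prod_chart c d) z (a, b)"
    using tpair_cases[OF assms] by metis
  then show ?thesis by (simp add: coord_vec_tangent prod_chart_in mem_Times_iff)
qed

text \<open>\<open>tpair\<close> is the sum of the images under the two slice inclusions, and
  \<open>F\<close> after a slice inclusion is \<open>F\<close> with one variable frozen; the
  summands are the two partial derivatives.\<close>

lemma tmap_tpair:
  assumes "mfd M" "mfd N" "mfd L" "smooth_at (prod_mfd M N) L F z"
  shows "tmap L F z (tpair M N z v w) =
    (\<lambda>h. tmap L (\<lambda>x. F (x, snd z)) (fst z) v h + tmap L (\<lambda>y. F (fst z, y)) (snd z) w h)"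
proof -
  have "tmap L F z (tpair M N z v w) = (\<lambda>h. 1 * tmap L F z (tmap (prod_mfd M N) (\<lambda>x. (x, snd z)) (fst z) v) h +
      1 * tmap L F z (tmap (prod_mfd M N) (\<lambda>y. (fst z, y)) (snd z) w) h)"
    unfolding tmap_linear[symmetric] by (simp add: tpair_def)
  also have "tmap L F z (tmap (prod_mfd M N) (\<lambda>x. (x, snd z)) (fst z) v) = tmap L (\<lambda>x. F (x, snd z)) (fst z) v"
    using tmap_compose[OF mfd_prod[OF assms(1,2)] assms(3), of F "\<lambda>x. (x, snd z)" "fst z" v] assms(4) by simp
  also have "tmap L F z (tmap (prod_mfd M N) (\<lambda>y. (fst z, y)) (snd z) w) = tmap L (\<lambda>y. F (fst z, y)) (snd z) w"
    using tmap_compose[OF mfd_prod[OF assms(1,2)] assms(3), of F "\<lambda>y. (fst z, y)" "snd z" w] assms(4) by simp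
  finally show ?thesis by simp
qed

section \<open>Cotangent bundles\<close>

definition cot_chart :: "('a, 'e::real_normed_vector) atlas \<Rightarrow> ('a, 'e) chart \<Rightarrow> ('a \<times> 'a covec, 'e \<times> ('e \<Rightarrow>\<^sub>L real)) chart" where
  "cot_chart M c = ({(q, p). q \<in> fst c \<and> p \<in> cotangent_space M q},
     \<lambda>(q, p). (snd c q, Blinfun (\<lambda>w. p (coord_vec M c q w))))"

lemma cotangent_mfd_cot_chart: "cotangent_mfd M = cot_chart M ` M"
  unfolding cotangent_mfd_def cot_chart_def ..

lemma fst_cot_chart: "z \<in> fst (cot_chart M c) \<longleftrightarrow> fst z \<in> fst c \<and> snd z \<in> cotangent_space M (fst z)"
  by (auto simp: cot_chart_def)

lemma points_cotangent: "z \<in> points (cotangent_mfd M) \<longleftrightarrow> fst z \<in> points M \<and> snd z \<in> cotangent_space M (fst z)"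
  unfolding points_def cotangent_mfd_cot_chart by (auto simp: fst_cot_chart)

lemma covector_linear:
  "p \<in> cotangent_space M x \<Longrightarrow> u \<in> tangent_space M x \<Longrightarrow> v \<in> tangent_space M x \<Longrightarrow>
    p (\<lambda>g. a * u g + b * v g) = a * p u + b * p v"
  by (simp add: cotangent_space_def)

lemma covector_add:
  "p \<in> cotangent_space M x \<Longrightarrow> u \<in> tangent_space M x \<Longrightarrow> v \<in> tangent_space M x \<Longrightarrow>
    p (\<lambda>g. u g + v g) = p u + p v"
  using covector_linear[of p M x u v 1 1] by simp

lemma covector_outside: "p \<in> cotangent_space M x \<Longrightarrow> v \<notin> tangent_space M x \<Longrightarrow> p v = 0"
  by (simp add: cotangent_space_def)

lemma covector_coord_linear:
  assumes "mfd M" "c \<in> M" "q \<in> fst c" "p \<in> cotangent_space M q"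
  shows "linear (\<lambda>w. p (coord_vec M c q w))"
proof (rule linearI)
  show "p (coord_vec M c q (u + v)) = p (coord_vec M c q u) + p (coord_vec M c q v)" for u v
    using covector_linear[OF assms(4) coord_vec_tangent[OF assms(2,3)] coord_vec_tangent[OF assms(2,3)], of 1 u 1 v]
      coord_vec_linear[OF assms(1-3), of 1 u 1 v] by simp
  show "p (coord_vec M c q (r *\<^sub>R u)) = r *\<^sub>R p (coord_vec M c q u)" for r u
    using covector_linear[OF assms(4) coord_vec_tangent[OF assms(2,3)] coord_vec_tangent[OF assms(2,3)], of r u 0 u]
      coord_vec_linear[OF assms(1-3), of r u 0 u] by simp
qed

lemma snd_cot_chart: "snd (cot_chart M c) z = (snd c (fst z), Blinfun (\<lambda>w. snd z (coord_vec M c (fst z) w)))"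
  by (simp add: cot_chart_def case_prod_beta)

lemma fst_snd_cot_chart: "fst (snd (cot_chart M c) z) = snd c (fst z)"
  by (simp add: cot_chart_def case_prod_beta)

lemma snd_cot_chart_apply:
  assumes "mfd M" "c \<in> M" "z \<in> fst (cot_chart M c)"
  shows "blinfun_apply (snd (snd (cot_chart M c) z)) w = snd z (coord_vec M c (fst z) w)"
proof -
  have "bounded_linear (\<lambda>w. snd z (coord_vec M c (fst z) w))"
    using assms by (intro findim_linear_bounded mfd_findim[OF assms(1)] covector_coord_linear) (auto simp: fst_cot_chart)
  then show ?thesis by (simp add: cot_chart_def case_prod_beta bounded_linear_Blinfun_apply)
qed

text \<open>Inverse of the fibre coordinate of \<open>cot_chart\<close>: the covector with
  coordinate functional \<open>\<phi>\<close>, cut off to 0 so that it lies in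
  \<open>cotangent_space\<close>.\<close>

definition covec_of :: "('a, 'e::real_normed_vector) atlas \<Rightarrow> ('a, 'e) chart \<Rightarrow> 'a \<Rightarrow> ('e \<Rightarrow> real) \<Rightarrow> 'a covec" where
  "covec_of M c q \<phi> = (\<lambda>v. if v \<in> tangent_space M q then \<phi> (coord_rep M c q v) else 0)"

lemma covec_of_cotangent:
  assumes "mfd M" "c \<in> M" "q \<in> fst c" "linear \<phi>"
  shows "covec_of M c q \<phi> \<in> cotangent_space M q"
  using assms tangent_linear[OF assms(1), of _ q]
  by (simp add: cotangent_space_def covec_of_def coord_rep_linear linear_add linear_scale)

lemma covec_of_coord_vec:
  assumes "mfd M" "c \<in> M" "q \<in> fst c"
  shows "covec_of M c q \<phi> (coord_vec M c q w) = \<phi> w"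
  using assms by (simp add: covec_of_def coord_vec_tangent)

lemma cotangent_eqI:
  assumes "mfd M" "c \<in> M" "q \<in> fst c" "p \<in> cotangent_space M q" "p' \<in> cotangent_space M q"
    "\<And>w. p (coord_vec M c q w) = p' (coord_vec M c q w)"
  shows "p = p'"
proof
  fix v show "p v = p' v"
  proof (cases "v \<in> tangent_space M q")
    case True
    obtain w where "v = coord_vec M c q w" using tangent_obtain[OF assms(1-3) True] .
    then show ?thesis using assms(6) by simp
  qed (use assms(4,5) in \<open>simp add: covector_outside\<close>)
qed

text \<open>Every functional on the model space is the coordinate of a covector, so the image is a
  full cylinder over the image of \<open>c\<close>; openness of the bundle chart follows from
  this.\<close>

lemma image_cot_chart:
  assumes "mfd M" "c \<in> M"
  shows "snd (cot_chart M c) ` fst (cot_chart M c) = (snd c ` fst c) \<times> UNIV"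
proof (intro equalityI subsetI)
  fix y assume "y \<in> snd (cot_chart M c) ` fst (cot_chart M c)"
  then obtain z where z: "z \<in> fst (cot_chart M c)" "y = snd (cot_chart M c) z" by blast
  have "fst y \<in> snd c ` fst c" using z(1) unfolding z(2) fst_snd_cot_chart fst_cot_chart by blast
  then show "y \<in> (snd c ` fst c) \<times> UNIV" by (simp add: mem_Times_iff)
next
  fix y :: "'b \<times> ('b \<Rightarrow>\<^sub>L real)"
  assume "y \<in> (snd c ` fst c) \<times> UNIV"
  then obtain q where q: "q \<in> fst c" "fst y = snd c q" by (auto simp: mem_Times_iff)
  let ?z = "(q, covec_of M c q (blinfun_apply (snd y)))"
  have z: "?z \<in> fst (cot_chart M c)"
    using covec_of_cotangent[OF assms q(1), of "blinfun_apply (snd y)"] q(1)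
    by (simp add: fst_cot_chart bounded_linear.linear blinfun.bounded_linear_right)
  have "snd (snd (cot_chart M c) ?z) = snd y"
    by (rule blinfun_eqI) (simp add: snd_cot_chart_apply[OF assms z] covec_of_coord_vec[OF assms q(1)])
  then have "snd (cot_chart M c) ?z = y" using fst_snd_cot_chart[of M c ?z] q by (simp add: prod_eq_iff)
  then show "y \<in> snd (cot_chart M c) ` fst (cot_chart M c)" using z by (metis image_eqI)
qed

lemma good_chart_cot_chart:
  assumes "mfd M" "c \<in> M"
  shows "good_chart (cot_chart M c)"
  unfolding good_chart_def
proof
  show "open (snd (cot_chart M c) ` fst (cot_chart M c))"
    unfolding image_cot_chart[OF assms] using mfd_good_chart[OF assms] by (simp add: good_chart_def open_Times)
  show "inj_on (snd (cot_chart M c)) (fst (cot_chart M c))"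
  proof (rule inj_onI)
    fix z z' assume z: "z \<in> fst (cot_chart M c)" "z' \<in> fst (cot_chart M c)" "snd (cot_chart M c) z = snd (cot_chart M c) z'"
    have "snd c (fst z) = snd c (fst z')" using fst_snd_cot_chart z(3) by metis
    then have eq: "fst z = fst z'"
      using z(1,2) mfd_good_chart[OF assms] by (auto simp: fst_cot_chart good_chart_def inj_on_def)
    have "snd z = snd z'"
    proof (rule cotangent_eqI[OF assms])
      show "fst z \<in> fst c" "snd z \<in> cotangent_space M (fst z)" "snd z' \<in> cotangent_space M (fst z)"
        using z(1,2) eq by (auto simp: fst_cot_chart)
      show "snd z (coord_vec M c (fst z) w) = snd z' (coord_vec M c (fst z) w)" for w
        using snd_cot_chart_apply[OF assms z(1), of w] snd_cot_chart_apply[OF assms z(2), of w] z(3) eq by simp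
    qed
    then show "z = z'" using eq by (simp add: prod_eq_iff)
  qed
qed

lemma chart_inv_cot_chart:
  assumes "mfd M" "c \<in> M" "z \<in> fst (cot_chart M c)"
  shows "\<forall>\<^sub>F y in nhds (snd (cot_chart M c) z). fst y \<in> snd c ` fst c \<and>
     chart_inv (cot_chart M c) y = (chart_inv c (fst y), covec_of M c (chart_inv c (fst y)) (blinfun_apply (snd y)))
     \<and> chart_inv (cot_chart M c) y \<in> fst (cot_chart M c)"
proof (rule eventually_chart_inv[OF good_chart_cot_chart[OF assms(1,2)] assms(3)])
  fix y assume y: "y \<in> snd (cot_chart M c) ` fst (cot_chart M c)"
  let ?z = "chart_inv (cot_chart M c) y"
  note z = chart_inv_in[OF y] and zy = chart_chart_inv[OF y]
  have q: "fst ?z \<in> fst c" "snd ?z \<in> cotangent_space M (fst ?z)" using z by (auto simp: fst_cot_chart)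
  have fsty: "fst y = snd c (fst ?z)" using zy fst_snd_cot_chart by metis
  then have 1: "chart_inv c (fst y) = fst ?z" using q chart_inv_chart[OF mfd_good_chart[OF assms(1,2)]] by simp
  have "covec_of M c (fst ?z) (blinfun_apply (snd y)) = snd ?z"
  proof (rule cotangent_eqI[OF assms(1,2) q(1) _ q(2)])
    show "covec_of M c (fst ?z) (blinfun_apply (snd y)) \<in> cotangent_space M (fst ?z)"
      using q by (intro covec_of_cotangent assms bounded_linear.linear blinfun.bounded_linear_right)
    show "covec_of M c (fst ?z) (blinfun_apply (snd y)) (coord_vec M c (fst ?z) w) = snd ?z (coord_vec M c (fst ?z) w)" for w
      using snd_cot_chart_apply[OF assms(1,2) z, of w] zy q by (simp add: covec_of_coord_vec assms(1,2))
  qed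
  then show "fst y \<in> snd c ` fst c \<and>
     ?z = (chart_inv c (fst y), covec_of M c (chart_inv c (fst y)) (blinfun_apply (snd y))) \<and> ?z \<in> fst (cot_chart M c)"
    using 1 fsty q z by (simp add: prod_eq_iff)
qed

text \<open>The transition map is \<open>\<tau>\<close> on the base and, on the fibres, composition
  with the derivative of the reversed transition; smoothness of the second comes from
  \<open>smooth_pt_Blinfun\<close>.\<close>

lemma mfd_cotangent:
  fixes M :: "('a, 'e::real_normed_vector) atlas"
  assumes "mfd M"
  shows "mfd (cotangent_mfd M)"
  unfolding mfd_def
proof (intro conjI ballI allI impI)
  note fin = mfd_findim[OF assms]
  show findim: "findim TYPE('e \<times> ('e \<Rightarrow>\<^sub>L real))" by (intro findim_prod findim_dual fin)
  fix e assume "e \<in> cotangent_mfd M"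
  then obtain c where c: "c \<in> M" "e = cot_chart M c" by (auto simp: cotangent_mfd_cot_chart)
  show "good_chart e" using good_chart_cot_chart[OF assms c(1)] c by simp
  fix e' z assume "e' \<in> cotangent_mfd M" and "z \<in> fst e \<and> z \<in> fst e'"
  then obtain d where d: "d \<in> M" "e' = cot_chart M d" and z: "z \<in> fst (cot_chart M c)" "z \<in> fst (cot_chart M d)"
    using c by (auto simp: cotangent_mfd_cot_chart)
  have q: "fst z \<in> fst c" "fst z \<in> fst d" "snd z \<in> cotangent_space M (fst z)" using z by (auto simp: fst_cot_chart)
  define y0 where "y0 = snd (cot_chart M c) z"
  have y0: "fst y0 = snd c (fst z)" by (simp add: y0_def fst_snd_cot_chart)
  note ev = chart_inv_cot_chart[OF assms c(1) z(1), folded y0_def]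
  note css = mfd_cs_ident[OF assms c(1) d(1) q(1,2)] and css' = mfd_cs_ident[OF assms d(1) c(1) q(2,1)]
  have smfst: "smooth_pt fst y0" by (rule smooth_pt_linear[OF bounded_linear_fst])
  define \<tau> where "\<tau> = (\<lambda>y::'e \<times> ('e \<Rightarrow>\<^sub>L real). snd d (chart_inv c (fst y)))"
  have smooth_pt\<tau>: "smooth_pt \<tau> y0" unfolding \<tau>_def
    by (rule smooth_pt_compose[OF fin smfst]) (use chart_smoothD(4)[OF css] y0 in simp)
  have \<tau>0: "\<tau> y0 = snd d (fst z)"
    using chart_inv_chart[OF mfd_good_chart[OF assms c(1)] q(1)] by (simp add: \<tau>_def y0)
  have evd: "\<forall>\<^sub>F y in nhds y0. chart_inv c (fst y) \<in> fst d"
    using smooth_pt_eventually_comp[OF smfst] chart_smoothD(3)[OF css] y0 by simp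
  have ev1: "\<forall>\<^sub>F y in nhds y0. chart_inv (cot_chart M c) y \<in> fst (cot_chart M d)"
    using ev evd by eventually_elim (auto simp: fst_cot_chart)
  \<comment> \<open>The covector evaluated on the vector with components \<open>w\<close> in the
    chart \<open>d\<close>, rewritten through the chart \<open>c\<close>.\<close>
  define L where "L = (\<lambda>(y::'e \<times> ('e \<Rightarrow>\<^sub>L real)) w. blinfun_apply (snd y) (fd (\<lambda>y. snd c (chart_inv d y)) (\<tau> y) w))"
  have smc: "smooth_pt (\<lambda>y. snd c (chart_inv d y)) (\<tau> y0)" using chart_smoothD(4)[OF css'] \<tau>0 by simp
  have "smooth_pt (\<lambda>y. L y w) y0" for w unfolding L_def
    by (intro smooth_pt_blinfun_apply smooth_pt_snd smooth_pt_ident smooth_pt_fd_var[where g=\<tau> and x=y0, OF fin smc] smooth_pt_const smooth_pt\<tau>)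
  moreover have linL: "\<forall>\<^sub>F y in nhds y0. linear (L y)"
    using smooth_pt_eventually_comp[OF smooth_pt\<tau> smooth_pt_eventually[OF smc]]
  proof eventually_elim
    case (elim y)
    have "linear (blinfun_apply (snd y) \<circ> (\<lambda>w. fd (\<lambda>y. snd c (chart_inv d y)) (\<tau> y) w))"
      by (rule linear_compose[OF smooth_pt_linear_fd[OF elim]]) (simp add: bounded_linear.linear blinfun.bounded_linear_right)
    then show ?case by (simp add: L_def o_def)
  qed
  ultimately have smL: "smooth_pt (\<lambda>y. Blinfun (L y)) y0" by (rule smooth_pt_Blinfun[OF fin])
  have "\<forall>\<^sub>F y in nhds y0. (\<tau> y, Blinfun (L y)) = snd (cot_chart M d) (chart_inv (cot_chart M c) y)"
    using ev ev1
  proof eventually_elim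
    case (elim y)
    let ?z = "chart_inv (cot_chart M c) y"
    have fz: "fst ?z = chart_inv c (fst y)" using elim by simp
    have q: "fst ?z \<in> fst c" "fst ?z \<in> fst d" using elim by (auto simp: fst_cot_chart)
    have "snd ?z (coord_vec M d (fst ?z) w) = L y w" for w
    proof -
      have "snd ?z (coord_vec M d (fst ?z) w)
          = snd ?z (coord_vec M c (fst ?z) (fd (\<lambda>y. snd c (chart_inv d y)) (snd d (fst ?z)) w))"
        using coord_vec_change[OF assms d(1) c(1) q(2,1)] by simp
      also have "\<dots> = blinfun_apply (snd y) (fd (\<lambda>y. snd c (chart_inv d y)) (snd d (fst ?z)) w)"
        using elim q by (simp add: covec_of_coord_vec[OF assms c(1)])
      finally show ?thesis by (simp add: L_def \<tau>_def fz)
    qed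
    then show ?case by (simp add: snd_cot_chart \<tau>_def fz)
  qed
  then have "smooth_pt (\<lambda>y. snd (cot_chart M d) (chart_inv (cot_chart M c) y)) y0"
    by (rule smooth_pt_cong[OF smooth_pt_Pair[OF smooth_pt\<tau> smL]])
  then show "chart_smooth e e' (\<lambda>x. x) z" unfolding chart_smooth_def c d
    using z ev1 by (simp add: y0_def)
qed

lemma cot_chart_in: "c \<in> M \<Longrightarrow> cot_chart M c \<in> cotangent_mfd M"
  by (simp add: cotangent_mfd_cot_chart)

lemma cotangent_points_obtain:
  assumes "z \<in> points (cotangent_mfd M)"
  obtains c where "c \<in> M" "z \<in> fst (cot_chart M c)"
  using assms unfolding points_def cotangent_mfd_cot_chart by blast

lemma chart_smooth_cotangent_fst:
  assumes "mfd M" "c \<in> M" "z \<in> fst (cot_chart M c)"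
  shows "chart_smooth (cot_chart M c) c fst z"
    and "\<forall>\<^sub>F y in nhds (snd (cot_chart M c) z). snd c (fst (chart_inv (cot_chart M c) y)) = fst y"
proof -
  note ev = chart_inv_cot_chart[OF assms]
  show 1: "\<forall>\<^sub>F y in nhds (snd (cot_chart M c) z). snd c (fst (chart_inv (cot_chart M c) y)) = fst y"
    using ev by eventually_elim (simp add: chart_chart_inv)
  show "chart_smooth (cot_chart M c) c fst z" unfolding chart_smooth_def
  proof (intro conjI)
    show "z \<in> fst (cot_chart M c)" "fst z \<in> fst c" using assms by (auto simp: fst_cot_chart)
    show "\<forall>\<^sub>F y in nhds (snd (cot_chart M c) z). fst (chart_inv (cot_chart M c) y) \<in> fst c"
      using ev by eventually_elim (simp add: chart_inv_in)
    show "smooth_pt (\<lambda>y. snd c (fst (chart_inv (cot_chart M c) y))) (snd (cot_chart M c) z)"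
      by (rule smooth_pt_cong[OF smooth_pt_linear[OF bounded_linear_fst]]) (use 1 in eventually_elim, simp)
  qed
qed

lemma smooth_at_cotangent_fst:
  assumes "mfd M" "z \<in> points (cotangent_mfd M)"
  shows "smooth_at (cotangent_mfd M) M fst z"
proof -
  obtain c where c: "c \<in> M" "z \<in> fst (cot_chart M c)" using assms(2) by (rule cotangent_points_obtain)
  then show ?thesis using chart_smooth_cotangent_fst(1)[OF assms(1) c] cot_chart_in unfolding smooth_at_def by blast
qed

section \<open>The canonical one-form\<close>

text \<open>This is \<Theta> = p dq in a bundle chart: the projection to the base reads as the first
  coordinate there.\<close>

lemma canonical_form_coord:
  assumes "mfd M" "c \<in> M" "z \<in> fst (cot_chart M c)"
  shows "canonical_form M z (coord_vec (cotangent_mfd M) (cot_chart M c) z w) = blinfun_apply (snd (snd (cot_chart M c) z)) (fst w)"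
proof -
  have "fd (\<lambda>y. snd c (fst (chart_inv (cot_chart M c) y))) (snd (cot_chart M c) z) w = fst w"
    unfolding fd_cong[OF chart_smooth_cotangent_fst(2)[OF assms]]
    by (rule fd_unique) (rule bounded_linear_imp_has_derivative[OF bounded_linear_fst])
  then have "tmap M fst z (coord_vec (cotangent_mfd M) (cot_chart M c) z w) = coord_vec M c (fst z) (fst w)"
    using tmap_coord_vec[OF mfd_cotangent[OF assms(1)] assms(1) cot_chart_in[OF assms(2)] assms(2) chart_smooth_cotangent_fst(1)[OF assms]]
    by simp
  then show ?thesis
    using snd_cot_chart_apply[OF assms] coord_vec_tangent[OF cot_chart_in[OF assms(2)] assms(3)] pointsI[OF cot_chart_in[OF assms(2)] assms(3)]
    by (simp add: canonical_form_def)
qed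

text \<open>In a bundle chart the coefficients of \<Theta> are linear in p, so d\<Theta> is the
  constant form dp \<and> dq. The chart delivered is the one that \<open>ext_deriv\<close> itself
  selects, which avoids comparing charts.\<close>

lemma ext_deriv_canonical:
  assumes "mfd M" "z \<in> points (cotangent_mfd M)"
  obtains c where "c \<in> M" "z \<in> fst (cot_chart M c)"
    "\<And>a b. ext_deriv (cotangent_mfd M) (canonical_form M) z
        (coord_vec (cotangent_mfd M) (cot_chart M c) z a) (coord_vec (cotangent_mfd M) (cot_chart M c) z b)
      = blinfun_apply (snd a) (fst b) - blinfun_apply (snd b) (fst a)"
proof -
  define e where "e = (SOME e. e \<in> cotangent_mfd M \<and> z \<in> fst e)"
  have "\<exists>e. e \<in> cotangent_mfd M \<and> z \<in> fst e" using assms(2) unfolding points_def by blast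
  then have "e \<in> cotangent_mfd M \<and> z \<in> fst e" unfolding e_def by (rule someI_ex)
  then obtain c where c: "c \<in> M" "e = cot_chart M c" "z \<in> fst (cot_chart M c)" by (auto simp: cotangent_mfd_cot_chart)
  have D: "fd (\<lambda>y. canonical_form M (chart_inv e y) (coord_vec (cotangent_mfd M) e (chart_inv e y) w)) (snd e z) a
      = blinfun_apply (snd a) (fst w)" for w a
  proof -
    have "\<forall>\<^sub>F y in nhds (snd e z). canonical_form M (chart_inv e y) (coord_vec (cotangent_mfd M) e (chart_inv e y) w)
        = blinfun_apply (snd y) (fst w)"
      unfolding c(2)
    proof (rule eventually_chart_inv[OF good_chart_cot_chart[OF assms(1) c(1)] c(3)])
      fix y assume y: "y \<in> snd (cot_chart M c) ` fst (cot_chart M c)"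
      show "canonical_form M (chart_inv (cot_chart M c) y) (coord_vec (cotangent_mfd M) (cot_chart M c) (chart_inv (cot_chart M c) y) w)
        = blinfun_apply (snd y) (fst w)"
        using canonical_form_coord[OF assms(1) c(1) chart_inv_in[OF y]] chart_chart_inv[OF y] by simp
    qed
    then have "frechet_derivative (\<lambda>y. canonical_form M (chart_inv e y) (coord_vec (cotangent_mfd M) e (chart_inv e y) w)) (at (snd e z))
        = frechet_derivative (\<lambda>y. blinfun_apply (snd y) (fst w)) (at (snd e z))" by (rule fd_cong)
    moreover have "fd (\<lambda>y. blinfun_apply (snd y) (fst w)) (snd e z) a = blinfun_apply (snd a) (fst w)"
      by (rule fd_unique, rule bounded_linear_imp_has_derivative)
        (rule bounded_linear_compose[OF blinfun.bounded_linear_left bounded_linear_snd])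
    ultimately show ?thesis by simp
  qed
  show thesis
  proof (rule that[OF c(1,3)])
    fix a b
    have r: "coord_rep (cotangent_mfd M) e z (coord_vec (cotangent_mfd M) e z w) = w" for w
      using c by (intro coord_rep_coord_vec mfd_cotangent[OF assms(1)]) (auto simp: cot_chart_in)
    show "ext_deriv (cotangent_mfd M) (canonical_form M) z
        (coord_vec (cotangent_mfd M) (cot_chart M c) z a) (coord_vec (cotangent_mfd M) (cot_chart M c) z b)
      = blinfun_apply (snd a) (fst b) - blinfun_apply (snd b) (fst a)"
      unfolding ext_deriv_def e_def[symmetric] c(2)[symmetric] Let_def r D ..
  qed
qed

lemma pullback_canonical:
  assumes "mfd N" "mfd M" "smooth_at N (cotangent_mfd M) f x" "v \<in> tangent_space N x"
  shows "pullback N (cotangent_mfd M) f (canonical_form M) x v = snd (f x) (tmap M (\<lambda>x. fst (f x)) x v)"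
proof -
  note TM = mfd_cotangent[OF assms(2)]
  have "tmap M (\<lambda>x. fst (f x)) x v = tmap M fst (f x) (tmap (cotangent_mfd M) f x v)"
    by (rule tmap_compose[where F=f and x=x and F'=fst, OF TM assms(2) smooth_at_cotangent_fst[OF assms(2) smooth_at_points(2)[OF assms(3)]]])
  then show ?thesis
    using tangent_points[OF assms(4)] assms(4) tmap_tangent[OF assms(1) TM assms(3,4)] smooth_at_points(2)[OF assms(3)]
    by (simp add: pullback_def canonical_form_def)
qed

lemma pullback_canonical_coord:
  assumes "mfd N" "mfd M" "c \<in> N" "d \<in> M" "chart_smooth c (cot_chart M d) f x"
  shows "pullback N (cotangent_mfd M) f (canonical_form M) x (coord_vec N c x w) =
    blinfun_apply (snd (snd (cot_chart M d) (f x))) (fst (fd (\<lambda>y. snd (cot_chart M d) (f (chart_inv c y))) (snd c x) w))"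
  using tmap_coord_vec[OF assms(1) mfd_cotangent[OF assms(2)] assms(3) cot_chart_in[OF assms(4)] assms(5)]
    canonical_form_coord[OF assms(2,4) chart_smoothD(2)[OF assms(5)]]
    pointsI[OF assms(3) chart_smoothD(1)[OF assms(5)]] coord_vec_tangent[OF assms(3) chart_smoothD(1)[OF assms(5)]]
  by (simp add: pullback_def)

lemma pullback_canonical_oneform:
  fixes N :: "('a, 'e::real_normed_vector) atlas"
  assumes "mfd N" "mfd M" "\<And>x. x \<in> points N \<Longrightarrow> smooth_at N (cotangent_mfd M) f x"
  shows "oneform N (pullback N (cotangent_mfd M) f (canonical_form M))"
  unfolding oneform_def
proof (intro conjI ballI allI impI)
  let ?\<alpha> = "pullback N (cotangent_mfd M) f (canonical_form M)"
  note TM = mfd_cotangent[OF assms(2)]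
  show "?\<alpha> x = (\<lambda>_. 0)" if "x \<notin> points N" for x
    using that by (simp add: pullback_def fun_eq_iff)
  show "?\<alpha> x \<in> cotangent_space N x" if x: "x \<in> points N" for x
    unfolding cotangent_space_def
  proof (intro CollectI conjI ballI allI impI)
    fix u v a b assume uv: "u \<in> tangent_space N x" "v \<in> tangent_space N x"
    have s: "smooth_at N M (\<lambda>x. fst (f x)) x"
      using smooth_at_compose[OF assms(1) TM assms(2) assms(3)[OF x]]
        smooth_at_cotangent_fst[OF assms(2)] smooth_at_points(2)[OF assms(3)[OF x]] by blast
    have p: "snd (f x) \<in> cotangent_space M (fst (f x))"
      using smooth_at_points(2)[OF assms(3)[OF x]] by (simp add: points_cotangent)
    show "?\<alpha> x (\<lambda>g. a * u g + b * v g) = a * ?\<alpha> x u + b * ?\<alpha> x v"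
      unfolding pullback_canonical[OF assms(1,2) assms(3)[OF x] uv(1)] pullback_canonical[OF assms(1,2) assms(3)[OF x] uv(2)]
        pullback_canonical[OF assms(1,2) assms(3)[OF x] tangent_linear[OF assms(1) uv]] tmap_linear
      by (rule covector_linear[OF p]) (rule tmap_tangent[OF assms(1,2) s] uv)+
  qed (simp add: pullback_def)
  fix c w assume c: "c \<in> N"
  note g = mfd_good_chart[OF assms(1) c]
  show "smooth_on (snd c ` fst c) (\<lambda>y. ?\<alpha> (chart_inv c y) (coord_vec N c (chart_inv c y) w))"
    unfolding smooth_on_iff_smooth_pt
  proof (intro conjI ballI)
    show "open (snd c ` fst c)" using g by (simp add: good_chart_def)
    fix y assume "y \<in> snd c ` fst c"
    then obtain x where x: "x \<in> fst c" "y = snd c x" by auto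
    note fx = assms(3)[OF pointsI[OF c x(1)]]
    obtain d where d: "d \<in> M" "f x \<in> fst (cot_chart M d)"
      using smooth_at_points(2)[OF fx] by (rule cotangent_points_obtain)
    have css: "chart_smooth c (cot_chart M d) f x" using smooth_at_chart_smooth[OF assms(1) TM fx c x(1) cot_chart_in[OF d(1)] d(2)] .
    \<comment> \<open>With \<open>F\<close> written as (q, p), the coefficient of the pulled-back
      form in direction \<open>w\<close> is p applied to the derivative of q.\<close>
    define F where "F = (\<lambda>y. snd (cot_chart M d) (f (chart_inv c y)))"
    have smF: "smooth_pt F y" using chart_smoothD(4)[OF css] x by (simp add: F_def)
    have "smooth_pt (\<lambda>y. blinfun_apply (snd (F y)) (fst (fd F y w))) y"
      by (intro smooth_pt_blinfun_apply smooth_pt_fst smooth_pt_snd smooth_pt_fd smF)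
    moreover have "\<forall>\<^sub>F y in nhds y. blinfun_apply (snd (F y)) (fst (fd F y w)) = ?\<alpha> (chart_inv c y) (coord_vec N c (chart_inv c y) w)"
      using chart_smooth_eventually[OF g css] eventually_in_chart[OF g x(1)] unfolding x(2)
      by eventually_elim (simp add: pullback_canonical_coord[OF assms(1,2) c d(1)] F_def chart_chart_inv)
    ultimately show "smooth_pt (\<lambda>y. ?\<alpha> (chart_inv c y) (coord_vec N c (chart_inv c y) w)) y"
      by (rule smooth_pt_cong)
  qed
qed

lemma oneform_covector: "oneform N \<alpha> \<Longrightarrow> x \<in> points N \<Longrightarrow> \<alpha> x \<in> cotangent_space N x"
  by (simp add: oneform_def)

lemma oneform_smooth_pt:
  assumes "oneform N \<alpha>" "c \<in> N" "x \<in> fst c"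
  shows "smooth_pt (\<lambda>y. \<alpha> (chart_inv c y) (coord_vec N c (chart_inv c y) w)) (snd c x)"
  using assms unfolding oneform_def smooth_on_iff_smooth_pt by blast

lemma oneform_coord_linear:
  assumes "mfd N" "oneform N \<alpha>" "c \<in> N" "x \<in> fst c"
  shows "\<forall>\<^sub>F y in nhds (snd c x). linear (\<lambda>w. \<alpha> (chart_inv c y) (coord_vec N c (chart_inv c y) w))"
  by (rule eventually_chart_inv[OF mfd_good_chart[OF assms(1,3)] assms(4)])
    (intro covector_coord_linear assms chart_inv_in oneform_covector pointsI[OF assms(3)])

lemma tangent_apply_const:
  assumes "v \<in> tangent_space M x"
  shows "v (\<lambda>_. a) = 0"
proof -
  obtain c w where "v = coord_vec M c x w" using assms unfolding tangent_space_def by blast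
  then show ?thesis by (simp add: coord_vec_apply)
qed

lemma smooth_fun_near:
  assumes "mfd M" "smooth_fun M h" "x \<in> points M"
  shows "smooth_near M x h"
  using assms smooth_fun_iff[OF assms(1)] smooth_near_iff[OF assms(1), of x h] by blast

lemma smooth_fun_linear:
  assumes "smooth_fun M h" "smooth_fun M h'"
  shows "smooth_fun M (\<lambda>x. a * h x + b * h' x)"
  using assms unfolding smooth_fun_def smooth_on_iff_smooth_pt o_def
  by (auto intro!: smooth_pt_add smooth_pt_mult smooth_pt_const)

lemma tangent_apply_linear:
  assumes "mfd M" "smooth_fun M h" "smooth_fun M h'" "v \<in> tangent_space M x"
  shows "v (\<lambda>x. a * h x + b * h' x) = a * v h + b * v h'"
proof -
  note x = tangent_points[OF assms(4)]
  obtain c where c: "c \<in> M" "x \<in> fst c" using x by (rule pointsE)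
  obtain w where w: "v = coord_vec M c x w" using tangent_obtain[OF assms(1) c assms(4)] .
  note near = smooth_fun_near[OF assms(1,2) x] smooth_fun_near[OF assms(1,3) x]
    smooth_fun_near[OF assms(1) smooth_fun_linear[OF assms(2,3)] x]
  have "((\<lambda>y. a * h (chart_inv c y) + b * h' (chart_inv c y)) has_derivative
      (\<lambda>w. a * fd (\<lambda>y. h (chart_inv c y)) (snd c x) w + b * fd (\<lambda>y. h' (chart_inv c y)) (snd c x) w)) (at (snd c x))"
    by (intro has_derivative_add has_derivative_mult_right smooth_pt_has_derivative
        smooth_near_smooth_pt[OF assms(1) c near(1)] smooth_near_smooth_pt[OF assms(1) c near(2)])
  from fd_unique[OF this] show ?thesis
    by (simp add: w coord_vec_apply near)
qed

text \<open>A representative of one class becomes a representative of the other by adding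
  \<open>h\<close> to its potential or subtracting it.\<close>

lemma oneform_class_shift:
  assumes "mfd S" "smooth_fun S h" "\<And>x v. \<beta> x v = \<alpha> x v + differential S h x v"
  shows "oneform_class S \<beta> = oneform_class S \<alpha>"
proof -
  \<comment> \<open>The factors \<open>1 *\<close> keep both potentials in the shape handled by
    \<open>tangent_apply_linear\<close>; \<open>b\<close> becomes 1 in the first identity and -1 in
    the second.\<close>
  have d: "differential S (\<lambda>x. 1 * h x + b * k x) x v = differential S h x v + b * differential S k x v"
    "differential S (\<lambda>x. 1 * k x + b * h x) x v = differential S k x v + b * differential S h x v"
    if "smooth_fun S k" for k b x v
    using tangent_apply_linear[OF assms(1,2) that, of v x 1 b] tangent_apply_linear[OF assms(1) that assms(2), of v x 1 b]
    by (auto simp: differential_def)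
  have 1: "\<exists>k'. smooth_fun S k' \<and> (\<forall>x v. \<gamma> x v = \<alpha> x v + differential S k' x v)"
    if "smooth_fun S k" "\<forall>x v. \<gamma> x v = \<beta> x v + differential S k x v" for \<gamma> k
    by (rule exI[of _ "\<lambda>x. 1 * h x + 1 * k x"], intro conjI smooth_fun_linear assms(2) that(1) allI, subst d[OF that(1)])
      (simp add: that(2) assms(3))
  have 2: "\<exists>k'. smooth_fun S k' \<and> (\<forall>x v. \<gamma> x v = \<beta> x v + differential S k' x v)"
    if "smooth_fun S k" "\<forall>x v. \<gamma> x v = \<alpha> x v + differential S k x v" for \<gamma> k
    by (rule exI[of _ "\<lambda>x. 1 * k x + (-1) * h x"], intro conjI smooth_fun_linear assms(2) that(1) allI, subst d(2)[OF that(1)])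
      (simp add: that(2) assms(3))
  show ?thesis unfolding oneform_class_def using 1 2 by (intro Collect_cong conj_cong refl iffI; elim exE conjE) blast+
qed

section \<open>Equivariant embeddings and their momentum\<close>

locale lie_bundle =
  fixes S :: "('x, 'e::real_normed_vector) atlas" and M :: "('m, 'k::real_normed_vector) atlas"
    and G :: "'g monoid" and K :: "('g, 'h::real_normed_vector) atlas"
  assumes mfd_S: "mfd S" and mfd_M: "mfd M" and lie: "lie_group G K"
begin

abbreviation "PS \<equiv> prod_mfd S K"
abbreviation "P \<equiv> prod_mfd M K"
abbreviation "TP \<equiv> cotangent_mfd P"
abbreviation unit ("\<e>") where "\<e> \<equiv> \<one>\<^bsub>G\<^esub>"

lemma mfd_K: "mfd K"
  using lie by (simp add: lie_group_def smooth_manifold_mfd)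

lemma mfd_PS: "mfd PS" and mfd_P: "mfd P" and mfd_TP: "mfd TP"
  by (simp_all add: mfd_prod mfd_cotangent mfd_S mfd_M mfd_K)

lemma group_G: "group G"
  using lie by (simp add: lie_group_def)

lemma carrier_K: "points K = carrier G"
  using lie by (simp add: lie_group_def)

lemma monoid_G: "monoid G"
  using group_G group_def by blast

lemma unit_carrier [simp]: "\<e> \<in> carrier G"
  using monoid.one_closed[OF monoid_G] .

lemma mult_carrier [simp]: "g \<in> carrier G \<Longrightarrow> h \<in> carrier G \<Longrightarrow> g \<otimes>\<^bsub>G\<^esub> h \<in> carrier G"
  using monoid.m_closed[OF monoid_G] .

lemma inv_carrier [simp]: "g \<in> carrier G \<Longrightarrow> inv\<^bsub>G\<^esub> g \<in> carrier G"
  using group.inv_closed[OF group_G] .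

lemma mult_unit [simp]: "g \<in> carrier G \<Longrightarrow> g \<otimes>\<^bsub>G\<^esub> \<e> = g" "g \<in> carrier G \<Longrightarrow> \<e> \<otimes>\<^bsub>G\<^esub> g = g"
  using monoid.r_one[OF monoid_G] monoid.l_one[OF monoid_G] by auto

lemma inv_unit [simp]: "inv\<^bsub>G\<^esub> \<e> = \<e>"
  using monoid.inv_one[OF monoid_G] .

lemma mult_inv [simp]: "g \<in> carrier G \<Longrightarrow> h \<in> carrier G \<Longrightarrow> h \<otimes>\<^bsub>G\<^esub> g \<otimes>\<^bsub>G\<^esub> inv\<^bsub>G\<^esub> g = h"
  by (simp add: monoid.m_assoc[OF monoid_G] group.r_inv[OF group_G])

lemma ract_apply [simp]: "fst (ract G g p) = fst p" "snd (ract G g p) = snd p \<otimes>\<^bsub>G\<^esub> g"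
  by (simp_all add: ract_def)

lemma ract_points: "p \<in> points (prod_mfd N K) \<Longrightarrow> g \<in> carrier G \<Longrightarrow> ract G g p \<in> points (prod_mfd N K)"
  by (auto simp: mem_Times_iff carrier_K)

lemma ract_ract_inv: "p \<in> points (prod_mfd N K) \<Longrightarrow> g \<in> carrier G \<Longrightarrow> ract G (inv\<^bsub>G\<^esub> g) (ract G g p) = p"
  by (auto simp: mem_Times_iff carrier_K prod_eq_iff)

lemma ract_unit: "x \<in> points N \<Longrightarrow> g \<in> carrier G \<Longrightarrow> ract G g (x, \<e>) = (x, g)"
  by (simp add: prod_eq_iff)

lemma smooth_at_mult:
  assumes "mfd L" "smooth_at L K F x" "smooth_at L K F' x"
  shows "smooth_at L K (\<lambda>x. F x \<otimes>\<^bsub>G\<^esub> F' x) x"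
proof -
  have *: "smooth_at L (prod_mfd K K) (\<lambda>x. (F x, F' x)) x"
    by (rule smooth_at_Pair[OF assms(1) mfd_K mfd_K assms(2,3)])
  have "smooth_at (prod_mfd K K) K (\<lambda>(g, h). g \<otimes>\<^bsub>G\<^esub> h) (F x, F' x)"
    using lie smooth_at_points(2)[OF *] by (intro smooth_map_smooth_at mfd_prod mfd_K) (auto simp: lie_group_def)
  from smooth_at_compose[where F="\<lambda>x. (F x, F' x)" and x=x, OF assms(1) mfd_prod[OF mfd_K mfd_K] mfd_K * this]
  show ?thesis by simp
qed

lemma smooth_at_ract:
  assumes "mfd N" "p \<in> points (prod_mfd N K)" "g \<in> carrier G"
  shows "smooth_at (prod_mfd N K) (prod_mfd N K) (ract G g) p"
proof -
  note NK = mfd_prod[OF assms(1) mfd_K]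
  have "smooth_at (prod_mfd N K) (prod_mfd N K) (\<lambda>p. (fst p, snd p \<otimes>\<^bsub>G\<^esub> g)) p"
    using assms(3) carrier_K
    by (intro smooth_at_Pair NK mfd_K assms(1) smooth_at_fst smooth_at_mult smooth_at_snd smooth_at_const assms(2)) auto
  then show ?thesis by (simp add: ract_def[abs_def])
qed

text \<open>The cotangent lift is defined through the inverse translation; this lets it undo the
  tangent map of the translation.\<close>

lemma tmap_ract_inverse:
  assumes "mfd N" "p \<in> points (prod_mfd N K)" "g \<in> carrier G" "v \<in> tangent_space (prod_mfd N K) p"
  shows "tmap (prod_mfd N K) (ract G (inv\<^bsub>G\<^esub> g)) (ract G g p) (tmap (prod_mfd N K) (ract G g) p v) = v"
proof -
  note NK = mfd_prod[OF assms(1) mfd_K]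
  have "tmap (prod_mfd N K) (\<lambda>p. ract G (inv\<^bsub>G\<^esub> g) (ract G g p)) p v
      = tmap (prod_mfd N K) (ract G (inv\<^bsub>G\<^esub> g)) (ract G g p) (tmap (prod_mfd N K) (ract G g) p v)"
    by (rule tmap_compose[where F="ract G g" and x=p, OF NK NK])
      (intro smooth_at_ract assms(1) ract_points assms(2,3) inv_carrier)
  moreover have "tmap (prod_mfd N K) (\<lambda>p. ract G (inv\<^bsub>G\<^esub> g) (ract G g p)) p v = tmap (prod_mfd N K) (\<lambda>p. p) p v"
    by (rule tmap_cong[OF NK assms(4)]) (rule ract_ract_inv[OF _ assms(3)])
  ultimately show ?thesis using tmap_ident[OF assms(4)] by simp
qed

lemma emb_smooth_at: "f \<in> emb_equiv S M G K \<Longrightarrow> p \<in> points PS \<Longrightarrow> smooth_at PS TP f p"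
  unfolding emb_equiv_def using smooth_map_smooth_at[OF mfd_PS mfd_TP] by blast

lemma emb_points: "f \<in> emb_equiv S M G K \<Longrightarrow> p \<in> points PS \<Longrightarrow> f p \<in> points TP"
  using smooth_at_points(2)[OF emb_smooth_at] .

lemma emb_equivariant:
  "f \<in> emb_equiv S M G K \<Longrightarrow> p \<in> points PS \<Longrightarrow> g \<in> carrier G \<Longrightarrow> f (ract G g p) = cot_ract M G K g (f p)"
  unfolding emb_equiv_def by blast

lemma emb_base_equivariant:
  "f \<in> emb_equiv S M G K \<Longrightarrow> p \<in> points PS \<Longrightarrow> g \<in> carrier G \<Longrightarrow> fst (f (ract G g p)) = ract G g (fst (f p))"
  by (simp add: emb_equivariant cot_ract_def cot_lift_def)

lemma emb_base_points: "f \<in> emb_equiv S M G K \<Longrightarrow> p \<in> points PS \<Longrightarrow> fst (f p) \<in> points P"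
  using emb_points points_cotangent by blast

lemma smooth_at_emb_base:
  assumes "f \<in> emb_equiv S M G K" "p \<in> points PS"
  shows "smooth_at PS P (\<lambda>p. fst (f p)) p"
  using smooth_at_compose[where F=f and x=p, OF mfd_PS mfd_TP mfd_P emb_smooth_at[OF assms]
      smooth_at_cotangent_fst[OF mfd_P emb_points[OF assms]]] .

text \<open>The cotangent lift is dual to the tangent map, so the pairing with a right translated vector is unchanged.\<close>

lemma emb_covector_equivariant:
  assumes "f \<in> emb_equiv S M G K" "p \<in> points PS" "g \<in> carrier G" "w \<in> tangent_space P (fst (f p))"
  shows "snd (f (ract G g p)) (tmap P (ract G g) (fst (f p)) w) = snd (f p) w"
proof -
  note q = emb_base_points[OF assms(1,2)]
  have "tmap P (ract G g) (fst (f p)) w \<in> tangent_space P (ract G g (fst (f p)))"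
    by (rule tmap_tangent[OF mfd_P mfd_P smooth_at_ract[OF mfd_M q assms(3)] assms(4)])
  then show ?thesis
    using tmap_ract_inverse[OF mfd_M q assms(3,4)]
    by (simp add: emb_equivariant[OF assms(1-3)] cot_ract_def cot_lift_def)
qed

section \<open>The pulled-back canonical form and its class\<close>

definition theta :: "('x \<times> 'g \<Rightarrow> ('m \<times> 'g) \<times> ('m \<times> 'g) covec) \<Rightarrow> 'x \<times> 'g \<Rightarrow> ('x \<times> 'g) covec" where
  "theta f = pullback PS TP f (canonical_form P)"

lemma theta_apply:
  assumes "f \<in> emb_equiv S M G K" "v \<in> tangent_space PS p"
  shows "theta f p v = snd (f p) (tmap P (\<lambda>p. fst (f p)) p v)"
  unfolding theta_def
  by (rule pullback_canonical[OF mfd_PS mfd_P emb_smooth_at[OF assms(1) tangent_points[OF assms(2)]] assms(2)])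

lemma inv_oneform_theta:
  assumes "f \<in> emb_equiv S M G K"
  shows "inv_oneform S G K (theta f)"
  unfolding inv_oneform_def
proof (intro conjI ballI ext)
  show "oneform PS (theta f)"
    unfolding theta_def by (rule pullback_canonical_oneform[OF mfd_PS mfd_P emb_smooth_at[OF assms]])
  fix g p v assume g: "g \<in> carrier G"
  show "pullback PS PS (ract G g) (theta f) p v = theta f p v"
  proof (cases "p \<in> points PS \<and> v \<in> tangent_space PS p")
    case True
    then have p: "p \<in> points PS" and v: "v \<in> tangent_space PS p" by auto
    note pg = ract_points[OF p g] and s = smooth_at_ract[OF mfd_S p g]
    have Tv: "tmap P (\<lambda>p. fst (f p)) p v \<in> tangent_space P (fst (f p))"
      by (rule tmap_tangent[OF mfd_PS mfd_P smooth_at_emb_base[OF assms p] v])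
    \<comment> \<open>Two factorizations of one map: the base projection of \<open>f\<close>
      commutes with right translation, and the chain rule is applied to either side.\<close>
    have "tmap P (\<lambda>p. fst (f p)) (ract G g p) (tmap PS (ract G g) p v) = tmap P (\<lambda>p. fst (f (ract G g p))) p v"
      by (rule tmap_compose[where F'="\<lambda>p. fst (f p)" and F="ract G g", OF mfd_PS mfd_P smooth_at_emb_base[OF assms pg], symmetric])
    also have "\<dots> = tmap P (\<lambda>p. ract G g (fst (f p))) p v"
      by (rule tmap_cong[OF mfd_PS v]) (rule emb_base_equivariant[OF assms _ g])
    also have "\<dots> = tmap P (ract G g) (fst (f p)) (tmap P (\<lambda>p. fst (f p)) p v)"
      by (rule tmap_compose[where F="\<lambda>p. fst (f p)" and x=p, OF mfd_P mfd_P smooth_at_ract[OF mfd_M emb_base_points[OF assms p] g]])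
    finally have "theta f (ract G g p) (tmap PS (ract G g) p v) = theta f p v"
      using theta_apply[OF assms v] theta_apply[OF assms tmap_tangent[OF mfd_PS mfd_PS s v]]
        emb_covector_equivariant[OF assms p g Tv] by simp
    then show ?thesis using True by (simp add: pullback_def)
  next
    case False
    then show ?thesis by (auto simp: pullback_def theta_def)
  qed
qed

lemma J_R_theta: "J_R S M G K f = inv_class S G K (theta f)"
  by (simp add: J_R_def theta_def)

lemma J_R_dual: "f \<in> emb_equiv S M G K \<Longrightarrow> J_R S M G K f \<in> aut_vol_dual S G K"
  unfolding J_R_theta aut_vol_dual_def using inv_oneform_theta by blast

lemma inv_class_self:
  assumes "inv_oneform S G K \<alpha>"
  shows "\<alpha> \<in> inv_class S G K \<alpha>"
proof -
  have "smooth_fun PS (\<lambda>_. 0)"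
    by (simp add: smooth_fun_def smooth_on_iff_smooth_pt o_def smooth_pt_const mfd_good_chart[OF mfd_PS, unfolded good_chart_def])
  then have "inv_fun S G K (\<lambda>_. 0)" by (simp add: inv_fun_def)
  moreover have "differential PS (\<lambda>_. 0) p v = 0" for p v
    using tangent_apply_const[of v PS p 0] by (simp add: differential_def)
  ultimately show ?thesis using assms unfolding inv_class_def by force
qed

lemma inv_classE:
  assumes "\<beta> \<in> inv_class S G K \<alpha>"
  obtains h where "inv_fun S G K h" "\<And>p v. \<beta> p v = \<alpha> p v + differential PS h p v"
  using assms unfolding inv_class_def by blast

subsection \<open>Splitting by the connection\<close>

lemma inv_fun_base:
  assumes "inv_fun S G K h" "x \<in> points S" "g \<in> points K"
  shows "h (x, g) = h (x, \<e>)"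
proof -
  have "h (ract G g (x, \<e>)) = h (x, \<e>)"
    using assms by (auto simp: inv_fun_def carrier_K)
  then show ?thesis using assms by (simp add: ract_unit carrier_K)
qed

lemma smooth_at_unit_section:
  assumes "x \<in> points S"
  shows "smooth_at S PS (\<lambda>x. (x, \<e>)) x"
  by (intro smooth_at_Pair mfd_S mfd_K smooth_at_ident smooth_at_const assms) (simp add: carrier_K)

lemma smooth_fun_inv_fun_base:
  assumes "inv_fun S G K h"
  shows "smooth_fun S (\<lambda>x. h (x, \<e>))"
  unfolding smooth_fun_iff[OF mfd_S]
proof
  fix x assume x: "x \<in> points S"
  have "smooth_at PS real_line h (x, \<e>)"
    using assms x smooth_fun_iff[OF mfd_PS, of h] by (auto simp: inv_fun_def carrier_K)
  from smooth_at_compose[where F="\<lambda>x. (x, \<e>)" and x=x, OF mfd_S mfd_PS mfd_real_line smooth_at_unit_section[OF x] this]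
  show "smooth_at S real_line (\<lambda>x. h (x, \<e>)) x" .
qed

lemma tpair_unit_tangent:
  assumes "x \<in> points S" "v \<in> tangent_space S x" "\<xi> \<in> lie_alg G K"
  shows "tpair S K (x, \<e>) v \<xi> \<in> tangent_space PS (x, \<e>)"
  using assms by (intro tpair_tangent mfd_S mfd_K) (auto simp: lie_alg_def)

text \<open>An invariant function is constant along the group direction, so the vertical component
  \<open>\<xi>\<close> contributes nothing.\<close>

lemma differential_inv_fun:
  assumes "inv_fun S G K h" "x \<in> points S" "v \<in> tangent_space S x" "\<xi> \<in> lie_alg G K"
  shows "differential PS h (x, \<e>) (tpair S K (x, \<e>) v \<xi>) = v (\<lambda>x. h (x, \<e>))"
proof -
  have near: "smooth_near PS (x, \<e>) h"
    using assms by (intro smooth_fun_near mfd_PS) (auto simp: inv_fun_def carrier_K)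
  have \<xi>: "\<xi> \<in> tangent_space K \<e>" using assms(4) by (simp add: lie_alg_def)
  have "\<xi> (\<lambda>y. h (x, y)) = \<xi> (\<lambda>_. h (x, \<e>))"
    by (rule tangent_apply_cong[OF mfd_K \<xi>]) (rule inv_fun_base[OF assms(1,2)])
  then have "\<xi> (\<lambda>y. h (x, y)) = 0" using tangent_apply_const[OF \<xi>] by simp
  then have "tpair S K (x, \<e>) v \<xi> h = v (\<lambda>x. h (x, \<e>))"
    using near by (simp add: tpair_def tmap_def o_def)
  then show ?thesis
    using tpair_unit_tangent[OF assms(2-4)] assms(2) by (simp add: differential_def carrier_K)
qed

lemma lie_alg_oneform_minus:
  assumes "lie_alg_oneform S G K A" "x \<in> points S" "v \<in> tangent_space S x"
  shows "(\<lambda>g. - A x v g) \<in> lie_alg G K"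
proof -
  have "A x v \<in> tangent_space K \<e>" using assms by (simp add: lie_alg_oneform_def lie_alg_def)
  from tangent_linear[OF mfd_K this this, of "-1" 0] show ?thesis by (simp add: lie_alg_def)
qed

text \<open>The exact correction does not see the connection, since the vertical part of the
  horizontal lift drops out.\<close>

lemma bar_form_shift:
  assumes "lie_alg_oneform S G K A" "inv_fun S G K h" "\<And>p v. \<beta> p v = \<alpha> p v + differential PS h p v"
  shows "bar_form S G K A \<beta> x v = bar_form S G K A \<alpha> x v + differential S (\<lambda>x. h (x, \<e>)) x v"
  using differential_inv_fun[OF assms(2) _ _ lie_alg_oneform_minus[OF assms(1)], of x v]
  by (auto simp: bar_form_def assms(3) differential_def[of S])

lemma bar_fun_shift:
  assumes "inv_fun S G K h" "\<And>p v. \<beta> p v = \<alpha> p v + differential PS h p v"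
  shows "bar_fun S G K \<beta> = bar_fun S G K \<alpha>"
proof -
  have "differential PS h (x, \<e>) (tpair S K (x, \<e>) (\<lambda>_. 0) \<xi>) = 0" if "x \<in> points S" "\<xi> \<in> lie_alg G K" for x \<xi>
    using differential_inv_fun[OF assms(1) that(1) tangent_zero[OF mfd_S that(1)] that(2)] .
  then show ?thesis by (auto simp: bar_fun_def fun_eq_iff assms(2) restrict_def)
qed

text \<open>Well-definedness of the definite description: changing the representative by an
  invariant exact form moves the one-form part inside its class and fixes the vertical part.\<close>

lemma dual_ident_inv_class:
  assumes "lie_alg_oneform S G K A" "inv_oneform S G K \<alpha>"
  shows "dual_ident S G K A (inv_class S G K \<alpha>) = (oneform_class S (bar_form S G K A \<alpha>), bar_fun S G K \<alpha>)"
  unfolding dual_ident_def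
proof (rule the_equality)
  show "\<exists>\<beta>\<in>inv_class S G K \<alpha>. (oneform_class S (bar_form S G K A \<alpha>), bar_fun S G K \<alpha>) =
      (oneform_class S (bar_form S G K A \<beta>), bar_fun S G K \<beta>)"
    using inv_class_self[OF assms(2)] by blast
  fix z assume "\<exists>\<beta>\<in>inv_class S G K \<alpha>. z = (oneform_class S (bar_form S G K A \<beta>), bar_fun S G K \<beta>)"
  then obtain \<beta> where \<beta>: "\<beta> \<in> inv_class S G K \<alpha>" "z = (oneform_class S (bar_form S G K A \<beta>), bar_fun S G K \<beta>)"
    by blast
  obtain h where h: "inv_fun S G K h" "\<And>p v. \<beta> p v = \<alpha> p v + differential PS h p v"
    using inv_classE[OF \<beta>(1)] by blast
  show "z = (oneform_class S (bar_form S G K A \<alpha>), bar_fun S G K \<alpha>)"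
    unfolding \<beta>(2) bar_fun_shift[OF h]
      oneform_class_shift[OF mfd_S smooth_fun_inv_fun_base[OF h(1)] bar_form_shift[OF assms(1) h]] ..
qed

lemma unit_chart: obtains k where "k \<in> K" "\<e> \<in> fst k"
  using pointsE[of \<e> K] carrier_K unit_carrier by metis

text \<open>The coefficients of a form on the bundle are smooth in a product chart; freezing the
  group coordinate at \<open>snd k \<e>\<close> leaves smooth functions of the base
  coordinate.\<close>

lemma oneform_unit_section:
  assumes "oneform PS \<alpha>" "c \<in> S" "k \<in> K" "\<e> \<in> fst k" "x \<in> fst c"
  shows "smooth_pt (\<lambda>y. \<alpha> (chart_inv c y, \<e>) (coord_vec PS (prod_chart c k) (chart_inv c y, \<e>) w)) (snd c x)"
    and "y \<in> snd c ` fst c \<Longrightarrow> linear (\<lambda>w. \<alpha> (chart_inv c y, \<e>) (coord_vec PS (prod_chart c k) (chart_inv c y, \<e>) w))"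
proof -
  note g = mfd_good_chart[OF mfd_S assms(2)] mfd_good_chart[OF mfd_K assms(3)]
  note pck = prod_chart_in[OF assms(2,3)]
  have z: "(x, \<e>) \<in> fst (prod_chart c k)" using assms by simp
  let ?g = "\<lambda>y. (y, snd k \<e>)"
  have 1: "smooth_pt ?g (snd c x)" by (intro smooth_pt_Pair smooth_pt_ident smooth_pt_const)
  have 2: "smooth_pt (\<lambda>z. \<alpha> (chart_inv (prod_chart c k) z) (coord_vec PS (prod_chart c k) (chart_inv (prod_chart c k) z) w)) (?g (snd c x))"
    using oneform_smooth_pt[OF assms(1) pck z, of w] by simp
  have "smooth_pt (\<lambda>y. \<alpha> (chart_inv (prod_chart c k) (?g y)) (coord_vec PS (prod_chart c k) (chart_inv (prod_chart c k) (?g y)) w)) (snd c x)"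
    by (rule smooth_pt_compose[where f="?g" and x="snd c x", OF findim_prod[OF mfd_findim[OF mfd_S] mfd_findim[OF mfd_K]] 1 2])
  moreover have "\<forall>\<^sub>F y in nhds (snd c x). \<alpha> (chart_inv (prod_chart c k) (?g y)) (coord_vec PS (prod_chart c k) (chart_inv (prod_chart c k) (?g y)) w)
    = \<alpha> (chart_inv c y, \<e>) (coord_vec PS (prod_chart c k) (chart_inv c y, \<e>) w)"
    by (rule eventually_chart_inv[OF g(1) assms(5)]) (simp add: chart_inv_pc_eq[OF g] assms(4))
  ultimately show "smooth_pt (\<lambda>y. \<alpha> (chart_inv c y, \<e>) (coord_vec PS (prod_chart c k) (chart_inv c y, \<e>) w)) (snd c x)"
    by (rule smooth_pt_cong)
  show "linear (\<lambda>w. \<alpha> (chart_inv c y, \<e>) (coord_vec PS (prod_chart c k) (chart_inv c y, \<e>) w))"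
    if "y \<in> snd c ` fst c"
  proof -
    have zz: "(chart_inv c y, \<e>) \<in> fst (prod_chart c k)" using chart_inv_in[OF that] assms(4) by simp
    show ?thesis by (rule covector_coord_linear[OF mfd_PS pck zz oneform_covector[OF assms(1) pointsI[OF pck zz]]])
  qed
qed

lemma tpair_unit_coord:
  assumes "c \<in> S" "k \<in> K" "\<e> \<in> fst k" "x \<in> fst c"
  shows "tpair S K (x, \<e>) (coord_vec S c x a) (coord_vec K k \<e> b) = coord_vec PS (prod_chart c k) (x, \<e>) (a, b)"
  using tpair_coord_vec[OF mfd_S mfd_K assms(1,2), of "(x, \<e>)"] assms by simp

lemma bar_form_covector:
  assumes "lie_alg_oneform S G K A" "oneform PS \<alpha>" "x \<in> points S"
  shows "bar_form S G K A \<alpha> x \<in> cotangent_space S x"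
  unfolding cotangent_space_def
proof (intro CollectI conjI ballI allI impI)
  fix u v a b assume uv: "u \<in> tangent_space S x" "v \<in> tangent_space S x"
  let ?z = "(x, \<e>)"
  have lin: "A x (\<lambda>g. a * u g + b * v g) = (\<lambda>g. a * A x u g + b * A x v g)"
    using assms uv by (simp add: lie_alg_oneform_def)
  have "tpair S K ?z (\<lambda>g. a * u g + b * v g) (\<lambda>g. - A x (\<lambda>g. a * u g + b * v g) g) =
      (\<lambda>h. a * tpair S K ?z u (\<lambda>g. - A x u g) h + b * tpair S K ?z v (\<lambda>g. - A x v g) h)"
    unfolding lin tpair_def by (auto simp: tmap_def algebra_simps)
  moreover have "\<alpha> ?z \<in> cotangent_space PS ?z"
    using assms(3) by (intro oneform_covector[OF assms(2)]) (simp add: carrier_K)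
  ultimately show "bar_form S G K A \<alpha> x (\<lambda>g. a * u g + b * v g) = a * bar_form S G K A \<alpha> x u + b * bar_form S G K A \<alpha> x v"
    using covector_linear[of "\<alpha> ?z" PS ?z "tpair S K ?z u (\<lambda>g. - A x u g)" "tpair S K ?z v (\<lambda>g. - A x v g)" a b]
      tpair_unit_tangent[OF assms(3) uv(1) lie_alg_oneform_minus[OF assms(1,3) uv(1)]]
      tpair_unit_tangent[OF assms(3) uv(2) lie_alg_oneform_minus[OF assms(1,3) uv(2)]]
      tangent_linear[OF mfd_S uv, of a b] uv assms(3)
    by (simp add: bar_form_def)
qed (simp add: bar_form_def)

text \<open>In coordinates the form is the coefficient family of \<open>\<alpha>\<close> along the
  unit section, applied to \<open>(w, - a y)\<close> with \<open>a\<close> the components of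
  \<open>A\<close>. This argument moves with the point, hence
  \<open>smooth_pt_linear_family\<close>.\<close>

lemma bar_form_oneform:
  assumes "lie_alg_oneform S G K A" "oneform PS \<alpha>"
  shows "oneform S (bar_form S G K A \<alpha>)"
  unfolding oneform_def
proof (intro conjI ballI allI impI)
  show "bar_form S G K A \<alpha> x \<in> cotangent_space S x" if "x \<in> points S" for x
    by (rule bar_form_covector[OF assms that])
  show "bar_form S G K A \<alpha> x = (\<lambda>_. 0)" if "x \<notin> points S" for x
    using that by (simp add: bar_form_def fun_eq_iff)
  fix c w assume c: "c \<in> S"
  note gc = mfd_good_chart[OF mfd_S c]
  obtain k where k: "k \<in> K" "\<e> \<in> fst k" by (rule unit_chart)
  obtain B :: "'h set" and l where Bl: "coords B l" using findim_coords[OF mfd_findim[OF mfd_K]] .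
  define v where "v = (\<lambda>y. coord_vec S c (chart_inv c y) w)"
  define a where "a = (\<lambda>y. coord_rep K k \<e> (A (chart_inv c y) (v y)))"
  have v: "v y \<in> tangent_space S (chart_inv c y)" if "y \<in> snd c ` fst c" for y
    unfolding v_def by (rule coord_vec_tangent[OF c chart_inv_in[OF that]])
  have Av: "A (chart_inv c y) (v y) \<in> tangent_space K \<e>" if "y \<in> snd c ` fst c" for y
    using assms(1) v[OF that] pointsI[OF c chart_inv_in[OF that]] by (simp add: lie_alg_oneform_def lie_alg_def)
  have coordA: "A (chart_inv c y) (v y) = coord_vec K k \<e> (a y)" if "y \<in> snd c ` fst c" for y
    unfolding a_def using coord_vec_coord_rep[OF mfd_K k Av[OF that]] by simp
  show "smooth_on (snd c ` fst c) (\<lambda>y. bar_form S G K A \<alpha> (chart_inv c y) (coord_vec S c (chart_inv c y) w))"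
    unfolding smooth_on_iff_smooth_pt
  proof (intro conjI ballI)
    show "open (snd c ` fst c)" using gc by (simp add: good_chart_def)
    fix y0 assume y0: "y0 \<in> snd c ` fst c"
    then obtain x where x: "x \<in> fst c" "y0 = snd c x" by blast
    have ev: "\<forall>\<^sub>F y in nhds y0. y \<in> snd c ` fst c" unfolding x(2) by (rule eventually_in_chart[OF gc x(1)])
    \<comment> \<open>Smoothness of \<open>A\<close> is stated through functionals on the Lie
      algebra; those with coordinate form \<open>l b\<close> extract its components.\<close>
    have sml: "smooth_pt (\<lambda>y. l b (a y)) y0" for b
    proof -
      have "linear (l b)" using Bl by (simp add: coords_def bounded_linear.linear)
      then have "covec_of K k \<e> (l b) \<in> lie_alg_dual G K"
        unfolding lie_alg_dual_def by (rule covec_of_cotangent[OF mfd_K k])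
      then have "smooth_pt (\<lambda>y. covec_of K k \<e> (l b) (A (chart_inv c y) (v y))) y0"
        using assms(1) c y0 unfolding lie_alg_oneform_def v_def smooth_on_iff_smooth_pt by blast
      then show ?thesis
        by (rule smooth_pt_cong) (use ev in eventually_elim, simp add: coordA covec_of_coord_vec[OF mfd_K k])
    qed
    have "smooth_pt (\<lambda>y. \<Sum>b\<in>B. l b (a y) *\<^sub>R b) y0" by (intro smooth_pt_sum smooth_pt_scaleR sml smooth_pt_const)
    then have sma: "smooth_pt a y0" using Bl by (simp add: coords_def)
    define L where "L = (\<lambda>y w. \<alpha> (chart_inv c y, \<e>) (coord_vec PS (prod_chart c k) (chart_inv c y, \<e>) w))"
    have "smooth_pt (\<lambda>y. L y (w, - a y)) y0"
    proof (rule smooth_pt_linear_family[OF findim_prod[OF mfd_findim[OF mfd_S] mfd_findim[OF mfd_K]]])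
      show "smooth_pt (\<lambda>y. L y w) y0" for w
        unfolding L_def x(2) by (rule oneform_unit_section(1)[OF assms(2) c k x(1)])
      show "\<forall>\<^sub>F y in nhds y0. linear (L y)"
        using ev by eventually_elim (simp add: L_def oneform_unit_section(2)[OF assms(2) c k x(1)])
      show "smooth_pt (\<lambda>y. (w, - a y)) y0" by (intro smooth_pt_Pair smooth_pt_const smooth_pt_minus sma)
    qed
    then show "smooth_pt (\<lambda>y. bar_form S G K A \<alpha> (chart_inv c y) (coord_vec S c (chart_inv c y) w)) y0"
    proof (rule smooth_pt_cong)
      show "\<forall>\<^sub>F y in nhds y0. L y (w, - a y) = bar_form S G K A \<alpha> (chart_inv c y) (coord_vec S c (chart_inv c y) w)"
        using ev
      proof eventually_elim
        case (elim y)
        have m: "(\<lambda>g. - coord_vec K k \<e> (a y) g) = coord_vec K k \<e> (- a y)"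
          using coord_vec_linear[OF mfd_K k, of "-1" "a y" 0 0] by simp
        have "tpair S K (chart_inv c y, \<e>) (v y) (\<lambda>g. - A (chart_inv c y) (v y) g) =
            coord_vec PS (prod_chart c k) (chart_inv c y, \<e>) (w, - a y)"
          unfolding coordA[OF elim] m unfolding v_def
          by (rule tpair_unit_coord[OF c k chart_inv_in[OF elim]])
        then show ?case
          using pointsI[OF c chart_inv_in[OF elim]] v[OF elim] by (simp add: bar_form_def L_def v_def)
      qed
    qed
  qed
qed

lemma bar_fun_dual_funs:
  assumes "oneform PS \<alpha>"
  shows "bar_fun S G K \<alpha> \<in> dual_funs S G K"
proof -
  obtain k where k: "k \<in> K" "\<e> \<in> fst k" by (rule unit_chart)
  have 1: "bar_fun S G K \<alpha> x \<in> lie_alg_dual G K" if x: "x \<in> points S" for x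
    unfolding lie_alg_dual_def cotangent_space_def
  proof (intro CollectI conjI ballI allI impI)
    fix u v a b assume uv: "u \<in> tangent_space K \<e>" "v \<in> tangent_space K \<e>"
    let ?z = "(x, \<e>)"
    have "tpair S K ?z (\<lambda>_. 0) (\<lambda>g. a * u g + b * v g) =
        (\<lambda>h. a * tpair S K ?z (\<lambda>_. 0) u h + b * tpair S K ?z (\<lambda>_. 0) v h)"
      unfolding tpair_def by (auto simp: tmap_def algebra_simps)
    moreover have "\<alpha> ?z \<in> cotangent_space PS ?z"
      using x by (intro oneform_covector[OF assms]) (simp add: carrier_K)
    ultimately show "bar_fun S G K \<alpha> x (\<lambda>g. a * u g + b * v g) = a * bar_fun S G K \<alpha> x u + b * bar_fun S G K \<alpha> x v"
      using covector_linear[of "\<alpha> ?z" PS ?z "tpair S K ?z (\<lambda>_. 0) u" "tpair S K ?z (\<lambda>_. 0) v" a b]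
        tpair_unit_tangent[OF x tangent_zero[OF mfd_S x], of u] tpair_unit_tangent[OF x tangent_zero[OF mfd_S x], of v]
        tangent_linear[OF mfd_K uv, of a b] uv x
      by (simp add: bar_fun_def lie_alg_def)
  qed (use x in \<open>simp add: bar_fun_def lie_alg_def\<close>)
  have 2: "smooth_fun S (\<lambda>x. bar_fun S G K \<alpha> x \<xi>)" if \<xi>: "\<xi> \<in> lie_alg G K" for \<xi>
    unfolding smooth_fun_iff[OF mfd_S]
  proof
    fix x assume "x \<in> points S"
    then obtain c where c: "c \<in> S" "x \<in> fst c" by (rule pointsE)
    obtain b where b: "\<xi> = coord_vec K k \<e> b"
      using tangent_obtain[OF mfd_K k] \<xi> unfolding lie_alg_def by blast
    show "smooth_at S real_line (\<lambda>x. bar_fun S G K \<alpha> x \<xi>) x"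
    proof (rule smooth_at_realI[OF mfd_S c], rule smooth_pt_cong[OF oneform_unit_section(1)[OF assms c(1) k c(2)]],
        rule eventually_chart_inv[OF mfd_good_chart[OF mfd_S c(1)] c(2)])
      fix y assume y: "y \<in> snd c ` fst c"
      note xy = chart_inv_in[OF y]
      have "tpair S K (chart_inv c y, \<e>) (\<lambda>_. 0) \<xi> = coord_vec PS (prod_chart c k) (chart_inv c y, \<e>) (0, b)"
        using tpair_unit_coord[OF c(1) k xy, of 0 b] coord_vec_zero[OF mfd_S c(1) xy] b by simp
      then show "\<alpha> (chart_inv c y, \<e>) (coord_vec PS (prod_chart c k) (chart_inv c y, \<e>) (0, b)) =
          bar_fun S G K \<alpha> (chart_inv c y) \<xi>"
        using \<xi> pointsI[OF c(1) xy] by (simp add: bar_fun_def)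
    qed
  qed
  have "bar_fun S G K \<alpha> \<in> points S \<rightarrow>\<^sub>E lie_alg_dual G K"
    using 1 by (intro PiE_I) (auto simp: bar_fun_def)
  then show ?thesis using 2 by (simp add: dual_funs_def)
qed

subsection \<open>The expression of the momentum\<close>

text \<open>Removes the translation by the unit when \<open>f\<close> is evaluated at
  \<open>(x, \<e>)\<close>. A covector already vanishes off its tangent space, so the cutoff in the
  lift is harmless.\<close>

lemma cot_ract_group_unit:
  assumes "z \<in> points (cotangent_mfd K)"
  shows "cot_ract_group G K \<e> z = z"
proof -
  have z: "fst z \<in> carrier G" "snd z \<in> cotangent_space K (fst z)" using assms by (auto simp: points_cotangent carrier_K)
  have "tmap K (\<lambda>h. h \<otimes>\<^bsub>G\<^esub> \<e>) (fst z) w = w" if w: "w \<in> tangent_space K (fst z)" for w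
  proof -
    have "tmap K (\<lambda>h. h \<otimes>\<^bsub>G\<^esub> \<e>) (fst z) w = tmap K (\<lambda>h. h) (fst z) w"
      by (rule tmap_cong[OF mfd_K w]) (simp add: carrier_K)
    then show ?thesis using tmap_ident[OF w] by simp
  qed
  then have "(\<lambda>w. if w \<in> tangent_space K (fst z) then snd z (tmap K (\<lambda>h. h \<otimes>\<^bsub>G\<^esub> \<e>) (fst z) w) else 0) = snd z"
    using covector_outside[OF z(2)] by (intro ext) simp
  then show ?thesis
    unfolding cot_ract_group_def cot_lift_def inv_unit mult_unit(1)[OF z(1)] by simp
qed

text \<open>\<open>cot_pair\<close> splits the pairing into a base term and a group term. The base
  component of the projected map depends on \<open>x\<close> alone and sees only \<open>v\<close>;
  the group component is a product, whose derivative splits by \<open>tmap_tpair\<close> into the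
  pullback along \<open>\<kappa>\<close> and the term of left translation.\<close>

lemma theta_tpair:
  assumes f: "f \<in> emb_equiv S M G K"
    and PQ: "smooth_map S (cotangent_mfd M) PQ" and \<kappa>: "smooth_map S (cotangent_mfd K) \<kappa>"
    and eq: "\<And>x g. x \<in> points S \<Longrightarrow> g \<in> carrier G \<Longrightarrow> f (x, g) = cot_pair M K (PQ x) (cot_ract_group G K g (\<kappa> x))"
    and x: "x \<in> points S" and v: "v \<in> tangent_space S x" and \<xi>: "\<xi> \<in> lie_alg G K"
  shows "theta f (x, \<e>) (tpair S K (x, \<e>) v \<xi>) =
    pullback S (cotangent_mfd M) PQ (canonical_form M) x v + pullback S (cotangent_mfd K) \<kappa> (canonical_form K) x v
    + snd (\<kappa> x) (tmap K (\<lambda>k. fst (\<kappa> x) \<otimes>\<^bsub>G\<^esub> k) \<e> \<xi>)"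
proof -
  note sPQ = smooth_map_smooth_at[OF mfd_S mfd_cotangent[OF mfd_M] PQ]
  note s\<kappa> = smooth_map_smooth_at[OF mfd_S mfd_cotangent[OF mfd_K] \<kappa>]
  let ?p = "(x, \<e>)" and ?V = "tpair S K (x, \<e>) v \<xi>"
  have p: "?p \<in> points PS" using x by (simp add: carrier_K)
  have \<xi>': "\<xi> \<in> tangent_space K \<e>" using \<xi> by (simp add: lie_alg_def)
  have V: "?V \<in> tangent_space PS ?p" by (rule tpair_unit_tangent[OF x v \<xi>])
  define W where "W = tmap P (\<lambda>p. fst (f p)) ?p ?V"
  have sQ: "smooth_at S M (\<lambda>x. fst (PQ x)) x"
    using smooth_at_compose[where F=PQ and x=x, OF mfd_S mfd_cotangent[OF mfd_M] mfd_M sPQ[OF x]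
        smooth_at_cotangent_fst[OF mfd_M smooth_at_points(2)[OF sPQ[OF x]]]] .
  have s\<theta>: "smooth_at S K (\<lambda>x. fst (\<kappa> x)) x"
    using smooth_at_compose[where F=\<kappa> and x=x, OF mfd_S mfd_cotangent[OF mfd_K] mfd_K s\<kappa>[OF x]
        smooth_at_cotangent_fst[OF mfd_K smooth_at_points(2)[OF s\<kappa>[OF x]]]] .
  have \<theta>: "fst (\<kappa> x) \<in> carrier G" if "x \<in> points S" for x
    using smooth_at_points(2)[OF s\<kappa>[OF that]] by (simp add: points_cotangent carrier_K)
  have fx: "f ?p = cot_pair M K (PQ x) (\<kappa> x)"
    using eq[OF x unit_carrier] cot_ract_group_unit[OF smooth_at_points(2)[OF s\<kappa>[OF x]]] by simp
  then have fst_fx: "fst (f ?p) = (fst (PQ x), fst (\<kappa> x))" by (simp add: cot_pair_def)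
  have W: "W \<in> tangent_space P (fst (PQ x), fst (\<kappa> x))"
    using tmap_tangent[OF mfd_PS mfd_P smooth_at_emb_base[OF f p] V] by (simp add: W_def fst_fx)
  have base: "fst (f q) = (fst (PQ (fst q)), fst (\<kappa> (fst q)) \<otimes>\<^bsub>G\<^esub> snd q)" if "q \<in> points PS" for q
    using eq[of "fst q" "snd q"] that
    by (simp add: mem_Times_iff carrier_K cot_pair_def cot_ract_group_def cot_lift_def)
  have Ppt: "(fst (PQ x), fst (\<kappa> x)) \<in> points P" using emb_base_points[OF f p] by (simp only: fst_fx)
  have "tmap M fst (fst (PQ x), fst (\<kappa> x)) W = tmap M (\<lambda>x. fst (PQ x)) x v"
  proof -
    have "tmap M fst (fst (f ?p)) W = tmap M (\<lambda>p. fst (fst (f p))) ?p ?V"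
      unfolding W_def using Ppt fst_fx
      by (intro tmap_compose[where F="\<lambda>p. fst (f p)" and x="?p", symmetric] mfd_P mfd_M smooth_at_fst mfd_K) simp
    also have "\<dots> = tmap M (\<lambda>p. fst (PQ (fst p))) ?p ?V"
      by (rule tmap_cong[OF mfd_PS V]) (simp add: base del: points_prod)
    also have "\<dots> = tmap M (\<lambda>x. fst (PQ x)) (fst ?p) (tmap S fst ?p ?V)"
      by (rule tmap_compose[where F=fst and x="?p" and F'="\<lambda>x. fst (PQ x)", OF mfd_S mfd_M]) (simp add: sQ)
    also have "tmap S fst ?p ?V = v" by (rule tmap_fst_tpair[OF mfd_S mfd_K]) (simp_all add: v \<xi>')
    finally show ?thesis by (simp add: fst_fx)
  qed
  moreover have "tmap K snd (fst (PQ x), fst (\<kappa> x)) W =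
      (\<lambda>h. tmap K (\<lambda>x. fst (\<kappa> x)) x v h + tmap K (\<lambda>k. fst (\<kappa> x) \<otimes>\<^bsub>G\<^esub> k) \<e> \<xi> h)"
  proof -
    have "tmap K snd (fst (f ?p)) W = tmap K (\<lambda>p. snd (fst (f p))) ?p ?V"
      unfolding W_def using Ppt fst_fx
      by (intro tmap_compose[where F="\<lambda>p. fst (f p)" and x="?p", symmetric] mfd_P mfd_K smooth_at_snd mfd_M) simp
    also have "\<dots> = tmap K (\<lambda>p. fst (\<kappa> (fst p)) \<otimes>\<^bsub>G\<^esub> snd p) ?p ?V"
      by (rule tmap_cong[OF mfd_PS V]) (simp add: base del: points_prod)
    also have "\<dots> = (\<lambda>h. tmap K (\<lambda>x. fst (\<kappa> x) \<otimes>\<^bsub>G\<^esub> \<e>) x v h + tmap K (\<lambda>k. fst (\<kappa> x) \<otimes>\<^bsub>G\<^esub> k) \<e> \<xi> h)"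
    proof -
      have "smooth_at PS K (\<lambda>p. fst (\<kappa> (fst p))) ?p"
        by (rule smooth_at_compose[where F=fst and x="?p" and F'="\<lambda>x. fst (\<kappa> x)", OF mfd_PS mfd_S mfd_K smooth_at_fst[OF mfd_S mfd_K p]])
          (simp add: s\<theta>)
      then have "smooth_at PS K (\<lambda>p. fst (\<kappa> (fst p)) \<otimes>\<^bsub>G\<^esub> snd p) ?p"
        by (intro smooth_at_mult mfd_PS smooth_at_snd mfd_S mfd_K p)
      from tmap_tpair[OF mfd_S mfd_K mfd_K this] show ?thesis by simp
    qed
    also have "tmap K (\<lambda>x. fst (\<kappa> x) \<otimes>\<^bsub>G\<^esub> \<e>) x v = tmap K (\<lambda>x. fst (\<kappa> x)) x v"
      by (rule tmap_cong[OF mfd_S v]) (simp add: \<theta>)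
    finally show ?thesis by (simp add: fst_fx)
  qed
  moreover have "snd (\<kappa> x) (\<lambda>h. tmap K (\<lambda>x. fst (\<kappa> x)) x v h + tmap K (\<lambda>k. fst (\<kappa> x) \<otimes>\<^bsub>G\<^esub> k) \<e> \<xi> h)
      = snd (\<kappa> x) (tmap K (\<lambda>x. fst (\<kappa> x)) x v) + snd (\<kappa> x) (tmap K (\<lambda>k. fst (\<kappa> x) \<otimes>\<^bsub>G\<^esub> k) \<e> \<xi>)"
  proof (rule covector_add)
    show "snd (\<kappa> x) \<in> cotangent_space K (fst (\<kappa> x))"
      using smooth_at_points(2)[OF s\<kappa>[OF x]] by (simp add: points_cotangent)
    show "tmap K (\<lambda>x. fst (\<kappa> x)) x v \<in> tangent_space K (fst (\<kappa> x))"
      by (rule tmap_tangent[OF mfd_S mfd_K s\<theta> v])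
    have "smooth_at K K (\<lambda>k. fst (\<kappa> x) \<otimes>\<^bsub>G\<^esub> k) \<e>"
      using \<theta>[OF x] by (intro smooth_at_mult mfd_K smooth_at_const smooth_at_ident) (simp_all add: carrier_K)
    from tmap_tangent[OF mfd_K mfd_K this \<xi>'] show "tmap K (\<lambda>k. fst (\<kappa> x) \<otimes>\<^bsub>G\<^esub> k) \<e> \<xi> \<in> tangent_space K (fst (\<kappa> x))"
      using \<theta>[OF x] by simp
  qed
  ultimately show ?thesis
    unfolding theta_apply[OF f V] W_def[symmetric] pullback_canonical[OF mfd_S mfd_M sPQ[OF x] v]
      pullback_canonical[OF mfd_S mfd_K s\<kappa>[OF x] v]
    using W by (simp add: fx cot_pair_def)
qed

text \<open>The vertical part is \<open>theta_tpair\<close> at \<open>v = 0\<close>, where the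
  pullbacks vanish; the horizontal part is the case \<open>\<xi> = - A x v\<close>, where linearity
  of the covector produces the minus sign before the contraction.\<close>

theorem dual_ident_momentum:
  assumes f: "f \<in> emb_equiv S M G K" and A: "lie_alg_oneform S G K A"
    and PQ: "smooth_map S (cotangent_mfd M) PQ" and \<kappa>: "smooth_map S (cotangent_mfd K) \<kappa>"
    and eq: "\<And>x g. x \<in> points S \<Longrightarrow> g \<in> carrier G \<Longrightarrow> f (x, g) = cot_pair M K (PQ x) (cot_ract_group G K g (\<kappa> x))"
  shows "dual_ident S G K A (J_R S M G K f) =
      (oneform_class S (\<lambda>x v. pullback S (cotangent_mfd M) PQ (canonical_form M) x v
                             + pullback S (cotangent_mfd K) \<kappa> (canonical_form K) x v
                             - contract S (left_triv S G K \<kappa>) A x v), left_triv S G K \<kappa>)"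
    and "dual_ident S G K A (J_R S M G K f) \<in> oneform_quotient S \<times> dual_funs S G K"
proof -
  have tp: "theta f (x, \<e>) (tpair S K (x, \<e>) v \<xi>) =
    pullback S (cotangent_mfd M) PQ (canonical_form M) x v + pullback S (cotangent_mfd K) \<kappa> (canonical_form K) x v
    + snd (\<kappa> x) (tmap K (\<lambda>k. fst (\<kappa> x) \<otimes>\<^bsub>G\<^esub> k) \<e> \<xi>)"
    if "x \<in> points S" "v \<in> tangent_space S x" "\<xi> \<in> lie_alg G K" for x v \<xi>
    by (rule theta_tpair[OF f PQ \<kappa> _ that]) (rule eq)
  note inv = inv_oneform_theta[OF f]
  have cov: "snd (\<kappa> x) \<in> cotangent_space K (fst (\<kappa> x))" "fst (\<kappa> x) \<in> carrier G" if "x \<in> points S" for x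
    using smooth_at_points(2)[OF smooth_map_smooth_at[OF mfd_S mfd_cotangent[OF mfd_K] \<kappa> that]]
    by (simp_all add: points_cotangent carrier_K)
  have smooth_pt: "smooth_at K K (\<lambda>k. fst (\<kappa> x) \<otimes>\<^bsub>G\<^esub> k) \<e>" if "x \<in> points S" for x
    using cov[OF that] by (intro smooth_at_mult mfd_K smooth_at_const smooth_at_ident) (simp_all add: carrier_K)
  have neg: "snd (\<kappa> x) (tmap K (\<lambda>k. fst (\<kappa> x) \<otimes>\<^bsub>G\<^esub> k) \<e> (\<lambda>g. - \<xi> g)) = - snd (\<kappa> x) (tmap K (\<lambda>k. fst (\<kappa> x) \<otimes>\<^bsub>G\<^esub> k) \<e> \<xi>)"
    if x: "x \<in> points S" and \<xi>: "\<xi> \<in> tangent_space K \<e>" for x \<xi>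
  proof -
    have T: "tmap K (\<lambda>k. fst (\<kappa> x) \<otimes>\<^bsub>G\<^esub> k) \<e> \<xi> \<in> tangent_space K (fst (\<kappa> x))"
      using tmap_tangent[OF mfd_K mfd_K smooth_pt[OF x] \<xi>] cov[OF x] by simp
    show ?thesis
      using covector_linear[OF cov(1)[OF x] T T, of "-1" 0]
        tmap_linear[of K "\<lambda>k. fst (\<kappa> x) \<otimes>\<^bsub>G\<^esub> k" \<e> "-1" \<xi> 0 \<xi>] by simp
  qed
  have zero: "pullback S (cotangent_mfd M) PQ (canonical_form M) x (\<lambda>_. 0) = 0"
      "pullback S (cotangent_mfd K) \<kappa> (canonical_form K) x (\<lambda>_. 0) = 0" if x: "x \<in> points S" for x
  proof -
    \<comment> \<open>Stated for an arbitrary target manifold, so that it serves both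
      \<open>M\<close> and \<open>K\<close> despite their different types.\<close>
    have z: "pullback S (cotangent_mfd N) F (canonical_form N) x (\<lambda>_. 0) = 0"
      if "mfd N" "smooth_map S (cotangent_mfd N) F" for N :: "('n, 'l::real_normed_vector) atlas" and F
    proof -
      have "oneform S (pullback S (cotangent_mfd N) F (canonical_form N))"
        by (rule pullback_canonical_oneform[OF mfd_S that(1)])
          (rule smooth_map_smooth_at[OF mfd_S mfd_cotangent[OF that(1)] that(2)])
      from covector_linear[OF oneform_covector[OF this x] tangent_zero[OF mfd_S x] tangent_zero[OF mfd_S x], of 0 0]
      show ?thesis by simp
    qed
    show "pullback S (cotangent_mfd M) PQ (canonical_form M) x (\<lambda>_. 0) = 0" by (rule z[OF mfd_M PQ])
    show "pullback S (cotangent_mfd K) \<kappa> (canonical_form K) x (\<lambda>_. 0) = 0" by (rule z[OF mfd_K \<kappa>])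
  qed
  have 1: "bar_fun S G K (theta f) = left_triv S G K \<kappa>"
    unfolding bar_fun_def left_triv_def
    by (intro restrict_ext ext) (simp add: tp[OF _ tangent_zero[OF mfd_S]] zero)
  have 2: "bar_form S G K A (theta f) = (\<lambda>x v. pullback S (cotangent_mfd M) PQ (canonical_form M) x v
                             + pullback S (cotangent_mfd K) \<kappa> (canonical_form K) x v
                             - contract S (left_triv S G K \<kappa>) A x v)"
  proof (intro ext)
    fix x v
    show "bar_form S G K A (theta f) x v = pullback S (cotangent_mfd M) PQ (canonical_form M) x v
                             + pullback S (cotangent_mfd K) \<kappa> (canonical_form K) x v
                             - contract S (left_triv S G K \<kappa>) A x v"
    proof (cases "x \<in> points S \<and> v \<in> tangent_space S x")
      case True
      then have Av: "A x v \<in> tangent_space K \<e>" using A by (simp add: lie_alg_oneform_def lie_alg_def)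
      show ?thesis
        using True tp[OF _ _ lie_alg_oneform_minus[OF A], of x v] neg[OF _ Av, of x] Av
        by (simp add: bar_form_def contract_def left_triv_def lie_alg_def)
    next
      case False
      then show ?thesis by (auto simp: bar_form_def contract_def pullback_def)
    qed
  qed
  have 3: "dual_ident S G K A (J_R S M G K f) = (oneform_class S (bar_form S G K A (theta f)), bar_fun S G K (theta f))"
    unfolding J_R_theta by (rule dual_ident_inv_class[OF A inv])
  show "dual_ident S G K A (J_R S M G K f) =
      (oneform_class S (\<lambda>x v. pullback S (cotangent_mfd M) PQ (canonical_form M) x v
                             + pullback S (cotangent_mfd K) \<kappa> (canonical_form K) x v
                             - contract S (left_triv S G K \<kappa>) A x v), left_triv S G K \<kappa>)"
    using 1 2 3 by simp
  have "oneform PS (theta f)" using inv by (simp add: inv_oneform_def)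
  then show "dual_ident S G K A (J_R S M G K f) \<in> oneform_quotient S \<times> dual_funs S G K"
    unfolding 3 oneform_quotient_def using bar_form_oneform[OF A] bar_fun_dual_funs by blast
qed

end

section \<open>Functions of class C1\<close>

text \<open>One continuous derivative is what integration by parts consumes, and explicit cutoff
  functions of this class can be built from squares.\<close>

definition C1_at :: "('a::real_normed_vector \<Rightarrow> 'b::real_normed_vector) \<Rightarrow> 'a \<Rightarrow> bool" where
  "C1_at f x \<longleftrightarrow> (\<exists>V. open V \<and> x \<in> V \<and> ck_on 1 V f)"

lemma smooth_pt_C1_at: "smooth_pt f x \<Longrightarrow> C1_at f x"
  unfolding smooth_pt_def C1_at_def by (metis smooth_on_ck_on smooth_on_open)

lemma C1_at_cong:
  assumes "C1_at f x" "\<forall>\<^sub>F y in nhds x. f y = g y"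
  shows "C1_at g x"
proof -
  obtain V W where V: "open V" "x \<in> V" "ck_on 1 V f" and W: "open W" "x \<in> W" "\<And>y. y \<in> W \<Longrightarrow> f y = g y"
    using assms by (auto simp: C1_at_def eventually_nhds simp del: One_nat_def)
  have "ck_on 1 (V \<inter> W) g"
  proof (rule ck_on_cong)
    show "open (V \<inter> W)" using V W by auto
    show "ck_on 1 (V \<inter> W) f" by (rule ck_on_subset[OF V(3)]) auto
  qed (use W in auto)
  then show ?thesis using V W unfolding C1_at_def by (metis IntI open_Int)
qed

lemma C1_at_differentiable: "C1_at f x \<Longrightarrow> f differentiable (at x)"
  unfolding C1_at_def by auto

lemma C1_at_isCont: "C1_at f x \<Longrightarrow> isCont f x"
  using C1_at_differentiable differentiable_imp_continuous_within by blast

lemma C1_at_isCont_fd: "C1_at f x \<Longrightarrow> isCont (\<lambda>y. fd f y v) x"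
  unfolding C1_at_def using continuous_on_eq_continuous_at by auto

lemma C1_at_const: "C1_at (\<lambda>_. a) x"
  by (rule smooth_pt_C1_at[OF smooth_pt_const])

lemma C1_at_mult:
  fixes f g :: "'a::real_normed_vector \<Rightarrow> real"
  assumes "C1_at f x" "C1_at g x"
  shows "C1_at (\<lambda>x. f x * g x) x"
proof -
  obtain V W where V: "open V" "x \<in> V" "ck_on 1 V f" "open W" "x \<in> W" "ck_on 1 W g"
    using assms unfolding C1_at_def by blast
  have "ck_on 1 (V \<inter> W) (\<lambda>x. f x * g x)"
    by (rule ck_on_bilinear[OF bounded_bilinear_mult])
      (use V in \<open>auto intro: ck_on_subset simp del: One_nat_def\<close>)
  then show ?thesis using V unfolding C1_at_def by (metis IntI open_Int)
qed

lemma C1_at_add: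
  assumes "C1_at f x" "C1_at g x"
  shows "C1_at (\<lambda>x. f x + g x) x"
proof -
  obtain V W where V: "open V" "x \<in> V" "ck_on 1 V f" "open W" "x \<in> W" "ck_on 1 W g"
    using assms unfolding C1_at_def by blast
  have "ck_on 1 (V \<inter> W) (\<lambda>x. f x + g x)"
    by (rule ck_on_add)
      (use V in \<open>auto intro: ck_on_subset simp del: One_nat_def\<close>)
  then show ?thesis using V unfolding C1_at_def by (metis IntI open_Int)
qed

lemma C1_at_diff:
  fixes f g :: "'a::real_normed_vector \<Rightarrow> real"
  assumes "C1_at f x" "C1_at g x"
  shows "C1_at (\<lambda>x. f x - g x) x"
  using C1_at_add[OF assms(1) C1_at_mult[OF C1_at_const[of "-1"] assms(2)]] by simp

lemma C1_at_prod:
  fixes f :: "'i \<Rightarrow> 'a::real_normed_vector \<Rightarrow> real"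
  shows "(\<And>i. i \<in> I \<Longrightarrow> C1_at (f i) x) \<Longrightarrow> C1_at (\<lambda>x. \<Prod>i\<in>I. f i x) x"
  by (induction I rule: infinite_finite_induct) (auto intro: C1_at_const C1_at_mult)

lemma C1_at_compose:
  fixes f :: "'a::real_normed_vector \<Rightarrow> 'b::real_normed_vector" and g :: "'b \<Rightarrow> 'c::real_normed_vector"
  assumes "findim TYPE('b)" "C1_at f x" "C1_at g (f x)"
  shows "C1_at (\<lambda>x. g (f x)) x"
proof -
  obtain Y where Y: "open Y" "f x \<in> Y" "ck_on 1 Y g" using assms(3) unfolding C1_at_def by blast
  obtain W where W: "open W" "x \<in> W" "ck_on 1 W f" using assms(2) unfolding C1_at_def by blast
  have "continuous_on W f" by (rule ck_on_continuous[OF W(3)])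
  then have oW: "open (W \<inter> f -` Y)" using continuous_on_open_vimage[OF W(1)] Y(1) by (metis Int_commute)
  have "ck_on 1 (W \<inter> f -` Y) (\<lambda>x. g (f x))"
    by (rule ck_on_compose[OF assms(1) oW _ ck_on_subset[OF W(3)] Y(3)]) auto
  then show ?thesis using W Y oW unfolding C1_at_def by blast
qed

text \<open>The squared positive part vanishes on the negative half-line and is C1 across 0, which
  makes it the building block of the cutoffs.\<close>

definition qpos :: "real \<Rightarrow> real" where
  "qpos s = (max 0 s)^2"

lemma qpos_deriv: "(qpos has_real_derivative 2 * max 0 s) (at s)"
proof -
  consider "s > 0" | "s < 0" | "s = 0" by linarith
  then show ?thesis
  proof cases
    case 1
    have "((\<lambda>s. s^2) has_real_derivative 2 * s) (at s)" by (auto intro!: derivative_eq_intros)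
    moreover have "\<forall>\<^sub>F t in nhds s. t^2 = qpos t"
      unfolding eventually_nhds using 1 by (intro exI[of _ "{0<..}"]) (auto simp: qpos_def)
    ultimately show ?thesis using 1 DERIV_cong_ev[of s s "\<lambda>s. s^2" qpos "2 * s" "2 * max 0 s"] by simp
  next
    case 2
    have "((\<lambda>s. 0) has_real_derivative 0) (at s)" by simp
    moreover have "\<forall>\<^sub>F t in nhds s. 0 = qpos t"
      unfolding eventually_nhds using 2 by (intro exI[of _ "{..<0}"]) (auto simp: qpos_def)
    ultimately show ?thesis using 2 DERIV_cong_ev[of s s "\<lambda>s. 0" qpos "0" "2 * max 0 s"] by simp
  next
    case 3
    have "((\<lambda>h. (qpos (0 + h) - qpos 0) / h) \<longlongrightarrow> 0) (at 0)"
    proof (rule tendsto_rabs_zero_cancel, rule tendsto_sandwich[where f="\<lambda>_. 0" and h="\<lambda>h. \<bar>h\<bar>"])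
      show "\<forall>\<^sub>F h in at 0. \<bar>(qpos (0 + h) - qpos 0) / h\<bar> \<le> \<bar>h\<bar>"
        by (rule always_eventually) (auto simp: qpos_def abs_divide power2_eq_square max_def divide_simps)
      show "((\<lambda>h. \<bar>h\<bar>) \<longlongrightarrow> (0::real)) (at 0)" by (rule tendsto_rabs_zero) (rule tendsto_ident_at)
    qed auto
    then show ?thesis using 3 by (simp add: DERIV_def)
  qed
qed

lemma C1_at_qpos: "C1_at qpos s"
proof -
  have hd: "(qpos has_derivative (*) (2 * max 0 s)) (at s)" for s
    using qpos_deriv by (simp add: has_field_derivative_def)
  have "fd qpos s v = 2 * max 0 s * v" for s v by (rule fd_unique[OF hd])
  moreover have "continuous_on UNIV (\<lambda>s. 2 * max 0 s * v)" for v :: real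
    by (intro continuous_intros)
  moreover have "qpos differentiable (at s)" for s using hd by (auto simp: differentiable_def)
  ultimately have "ck_on 1 UNIV qpos" by simp
  then show ?thesis unfolding C1_at_def by blast
qed

section \<open>Integration in linear coordinates\<close>

text \<open>A basis numbered by \<open>i < n\<close> with its dual coordinates. The numbering
  matches \<open>volume_measure\<close>, where densities are taken against Lebesgue measure on
  families indexed by \<open>{..<n}\<close>.\<close>

locale frame =
  fixes n :: nat and bs :: "nat \<Rightarrow> 'e::real_normed_vector" and crd :: "nat \<Rightarrow> 'e \<Rightarrow> real"
  assumes crd_linear: "\<And>i. bounded_linear (crd i)"
    and crd_sum: "\<And>y. (\<Sum>i<n. crd i y *\<^sub>R bs i) = y"
    and crd_bs: "\<And>i j. i < n \<Longrightarrow> j < n \<Longrightarrow> crd i (bs j) = (if i = j then 1 else 0)"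

lemma frame_exists:
  assumes "findim TYPE('e::real_normed_vector)"
  shows "\<exists>(bs :: nat \<Rightarrow> 'e::real_normed_vector) crd. frame (dim (UNIV :: 'e set)) bs crd \<and>
    inj_on bs {..<dim (UNIV :: 'e set)} \<and> independent (bs ` {..<dim (UNIV :: 'e set)})"
proof -
  obtain B :: "'e set" where B: "finite B" "independent B" "span B = UNIV" using findim_basis[OF assms] .
  have card: "card B = dim (UNIV :: 'e set)" using dim_span_eq_card_independent[OF B(2)] B(3) by simp
  obtain bs where bs: "bij_betw bs {..<card B} B"
    using ex_bij_betw_nat_finite[OF B(1)] by (auto simp: atLeast0LessThan)
  define crd where "crd i y = representation B y (bs i)" for i y
  have co: "coords B (\<lambda>b x. representation B x b)" by (rule coords_representation[OF B])
  have "frame (card B) bs crd"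
    unfolding frame_def
  proof (intro conjI allI impI)
    show "bounded_linear (crd i)" for i using co unfolding crd_def coords_def by blast
    show "(\<Sum>i<card B. crd i y *\<^sub>R bs i) = y" for y
    proof -
      have "(\<Sum>i<card B. crd i y *\<^sub>R bs i) = (\<Sum>b\<in>B. representation B y b *\<^sub>R b)"
        unfolding crd_def by (rule sum.reindex_bij_betw[OF bs])
      then show ?thesis using co by (simp add: coords_def)
    qed
    show "crd i (bs j) = (if i = j then 1 else 0)" if "i < card B" "j < card B" for i j
    proof -
      have "bs j \<in> B" using bs that by (auto simp: bij_betw_def)
      moreover have "bs i = bs j \<longleftrightarrow> i = j" using bs that by (auto simp: bij_betw_def inj_on_def)
      ultimately show ?thesis using representation_basis[OF B(2), of "bs j"] by (auto simp: crd_def)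
    qed
  qed
  moreover have "bs ` {..<card B} = B" "inj_on bs {..<card B}" using bs by (auto simp: bij_betw_def)
  ultimately show ?thesis using B(2) card by metis
qed

context frame
begin

definition lin :: "(nat \<Rightarrow> real) \<Rightarrow> 'e" where
  "lin a = (\<Sum>i<n. a i *\<^sub>R bs i)"

abbreviation LN :: "(nat \<Rightarrow> real) measure" where
  "LN \<equiv> \<Pi>\<^sub>M i\<in>{..<n}. lborel"

lemma findim_frame: "findim TYPE('e)"
proof -
  have "y \<in> span (bs ` {..<n})" for y
  proof -
    have "(\<Sum>i<n. crd i y *\<^sub>R bs i) \<in> span (bs ` {..<n})"
      by (intro span_sum span_scale span_base) auto
    then show ?thesis by (simp add: crd_sum)
  qed
  then show ?thesis unfolding findim_def by (intro exI[of _ "bs ` {..<n}"]) auto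
qed

lemma linear_frame_expand:
  assumes "linear f"
  shows "f y = (\<Sum>i<n. crd i y *\<^sub>R f (bs i))"
proof -
  have "f y = f (\<Sum>i<n. crd i y *\<^sub>R bs i)" by (simp add: crd_sum)
  then show ?thesis using assms by (simp add: linear_sum linear_scale)
qed

lemma crd_lin: "i < n \<Longrightarrow> crd i (lin a) = a i"
  using bounded_linear.linear[OF crd_linear[of i]]
  by (simp add: lin_def linear_sum linear_scale crd_bs if_distrib[of "\<lambda>x. _ * x"] cong: if_cong)

lemma lin_cong: "(\<And>i. i < n \<Longrightarrow> a i = b i) \<Longrightarrow> lin a = lin b"
  by (simp add: lin_def)

lemma lin_crd: "lin (\<lambda>i. crd i y) = y"
  by (simp add: lin_def crd_sum)

lemma continuous_lin: "continuous_on UNIV lin"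
  unfolding lin_def[abs_def]
  by (intro continuous_on_sum continuous_on_scaleR continuous_on_const continuous_on_product_coordinates)

text \<open>Points of \<open>space LN\<close> are \<open>undefined\<close> from index
  \<open>n\<close> on. Replacing those entries by 0 gives a measurable map into the full function
  space, on which \<open>lin\<close> is continuous, and \<open>lin\<close> does not see the
  change.\<close>

lemma lin_measurable [measurable]: "lin \<in> LN \<rightarrow>\<^sub>M borel"
proof -
  define z :: "(nat \<Rightarrow> real) \<Rightarrow> nat \<Rightarrow> real" where "z a = (\<lambda>i. if i < n then a i else 0)" for a
  have "z \<in> borel_measurable LN"
  proof (rule measurable_coordinatewise_then_product)
    show "(\<lambda>x. z x i) \<in> borel_measurable LN" for i
    proof (cases "i < n")
      case True
      then have "(\<lambda>x. x i) \<in> LN \<rightarrow>\<^sub>M lborel" by (intro measurable_component_singleton) auto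
      then show ?thesis using True by (simp add: z_def)
    qed (simp add: z_def)
  qed
  moreover have "lin \<in> borel_measurable borel" by (rule borel_measurable_continuous_onI[OF continuous_lin])
  ultimately have "(\<lambda>a. lin (z a)) \<in> LN \<rightarrow>\<^sub>M borel" by (rule measurable_compose)
  moreover have "lin (z a) = lin a" for a by (rule lin_cong) (simp add: z_def)
  ultimately show ?thesis by simp
qed

section \<open>Coordinate boxes and functions supported in them\<close>

definition box :: "'e \<Rightarrow> real \<Rightarrow> 'e set" where
  "box y0 r = {y. \<forall>j<n. \<bar>crd j (y - y0)\<bar> \<le> r}"

definition obox :: "'e \<Rightarrow> real \<Rightarrow> 'e set" where
  "obox y0 r = {y. \<forall>j<n. \<bar>crd j (y - y0)\<bar> < r}"

lemma crd_diff: "crd j (x - y) = crd j x - crd j y"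
  using linear_diff[OF bounded_linear.linear[OF crd_linear]] .

lemma crd_zero [simp]: "crd j 0 = 0"
  using linear_0[OF bounded_linear.linear[OF crd_linear]] .

lemma continuous_crd: "continuous_on X (\<lambda>y. crd j (y - y0))"
  by (intro bounded_linear.continuous_on[OF crd_linear] continuous_intros)

text \<open>Presents the box as a continuous image of a product of compact sets; indices from
  \<open>n\<close> on get the factor \<open>{0}\<close>.\<close>

lemma box_image: "box y0 r = (\<lambda>a. y0 + lin a) ` (PiE UNIV (\<lambda>i. if i < n then {-r..r} else {0}))"
proof (intro equalityI subsetI)
  fix y assume "y \<in> box y0 r"
  then have 1: "(\<lambda>i. if i < n then crd i (y - y0) else 0) \<in> PiE UNIV (\<lambda>i. if i < n then {-r..r} else {0})"
    by (auto simp: box_def abs_le_iff minus_le_iff)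
  have 2: "y0 + lin (\<lambda>i. if i < n then crd i (y - y0) else 0) = y"
    using lin_cong[of "\<lambda>i. if i < n then crd i (y - y0) else 0" "\<lambda>i. crd i (y - y0)"] lin_crd by simp
  show "y \<in> (\<lambda>a. y0 + lin a) ` (PiE UNIV (\<lambda>i. if i < n then {-r..r} else {0}))"
    by (rule image_eqI[where f="\<lambda>a. y0 + lin a", OF 2[symmetric] 1])
next
  fix y assume "y \<in> (\<lambda>a. y0 + lin a) ` (PiE UNIV (\<lambda>i. if i < n then {-r..r} else {0}))"
  then obtain a where a: "y = y0 + lin a" "\<And>i. i < n \<Longrightarrow> a i \<in> {-r..r}"
    by (auto simp: PiE_iff split: if_splits)
  then show "y \<in> box y0 r" by (auto simp: box_def crd_lin abs_le_iff minus_le_iff)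
qed

lemma compact_box: "compact (box y0 r)"
proof -
  have "compactin (product_topology (\<lambda>_. euclidean) UNIV) (PiE UNIV (\<lambda>i. if i < n then {-r..r} else {0}))"
    by (subst compactin_PiE) auto
  then have "compact (PiE UNIV (\<lambda>i. if i < n then {-r..r} else {0}))"
    by (simp add: euclidean_product_topology)
  then show ?thesis unfolding box_image
    by (intro compact_continuous_image continuous_on_add continuous_on_const continuous_on_subset[OF continuous_lin]) auto
qed

lemma open_obox: "open (obox y0 r)"
proof -
  have "obox y0 r = (\<Inter>j\<in>{..<n}. {y. \<bar>crd j (y - y0)\<bar> < r})" by (auto simp: obox_def)
  moreover have "open {y. \<bar>crd j (y - y0)\<bar> < r}" for j
    by (intro open_Collect_less continuous_on_rabs continuous_crd continuous_on_const)
  ultimately show ?thesis by (simp add: open_INT)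
qed

lemma obox_subset: "obox y0 r \<subseteq> box y0 r"
  by (auto simp: obox_def box_def intro: less_imp_le)

lemma obox_center: "r > 0 \<Longrightarrow> y0 \<in> obox y0 r"
  by (simp add: obox_def)

lemma box_in_open:
  assumes "open X" "y0 \<in> X"
  obtains r where "r > 0" "box y0 r \<subseteq> X"
proof -
  obtain e where e: "e > 0" "ball y0 e \<subseteq> X" using assms by (meson openE)
  \<comment> \<open>Half-width \<open>e / (2 * N)\<close> gives distance at most
    \<open>e / 2\<close> by the triangle inequality; the \<open>+ 1\<close> keeps \<open>N\<close>
    positive even for \<open>n = 0\<close>.\<close>
  define N where "N = (\<Sum>i<n. norm (bs i)) + 1"
  have "N \<ge> 1" by (simp add: N_def sum_nonneg)
  then have N: "N > 0" by simp
  have "box y0 (e / (2 * N)) \<subseteq> X"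
  proof
    fix y assume y: "y \<in> box y0 (e / (2 * N))"
    have "norm (y - y0) = norm (\<Sum>i<n. crd i (y - y0) *\<^sub>R bs i)" by (simp add: crd_sum)
    also have "\<dots> \<le> (\<Sum>i<n. norm (crd i (y - y0) *\<^sub>R bs i))" by (rule norm_sum)
    also have "\<dots> \<le> (\<Sum>i<n. (e / (2 * N)) * norm (bs i))"
    proof (intro sum_mono)
      fix i assume "i \<in> {..<n}"
      then have "\<bar>crd i (y - y0)\<bar> \<le> e / (2 * N)" using y by (simp add: box_def)
      then show "norm (crd i (y - y0) *\<^sub>R bs i) \<le> (e / (2 * N)) * norm (bs i)"
        unfolding norm_scaleR by (rule mult_right_mono) simp
    qed
    also have "\<dots> = (e / (2 * N)) * (\<Sum>i<n. norm (bs i))" by (rule sum_distrib_left[symmetric])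
    also have "\<dots> \<le> (e / (2 * N)) * N" using e N by (intro mult_left_mono) (auto simp: N_def)
    also have "\<dots> = e / 2" using N by simp
    finally have "dist y0 y < e" using e by (simp add: dist_norm norm_minus_commute)
    then show "y \<in> X" using e by auto
  qed
  then show thesis using that[of "e / (2 * N)"] e N by simp
qed

lemma emeasure_box_finite: "emeasure LN (PiE {..<n} (\<lambda>_. {-R..R})) < \<infinity>"
proof -
  interpret product_sigma_finite "\<lambda>_::nat. lborel :: real measure"
    by (simp add: product_sigma_finite_def lborel.sigma_finite_measure_axioms)
  have "emeasure LN (PiE {..<n} (\<lambda>_. {-R..R})) = (\<Prod>i<n. emeasure lborel {-R..R})"
    by (rule emeasure_PiM) auto
  also have "\<dots> < \<infinity>"
    using emeasure_lborel_cbox_finite[of "-R" R]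
    by (simp add: cbox_interval less_top[symmetric] ennreal_prod_eq_top del: prod_constant)
  finally show ?thesis .
qed

text \<open>A box around \<open>y0\<close> lies in a cube centred at the origin; the sum of the
  absolute coordinates bounds every coordinate of the centre at once. It dominates integrands
  supported in the box.\<close>

lemma lin_in_box:
  assumes "a \<in> space LN" "lin a \<in> box y0 r"
  shows "a \<in> PiE {..<n} (\<lambda>_. {-(r + (\<Sum>j<n. \<bar>crd j y0\<bar>))..r + (\<Sum>j<n. \<bar>crd j y0\<bar>)})"
proof (rule PiE_I)
  fix i assume i: "i \<in> {..<n}"
  have "\<bar>a i - crd i y0\<bar> \<le> r" using assms(2) i by (simp add: box_def crd_diff crd_lin)
  moreover have "\<bar>crd i y0\<bar> \<le> (\<Sum>j<n. \<bar>crd j y0\<bar>)" using i by (intro member_le_sum) auto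
  ultimately show "a i \<in> {-(r + (\<Sum>j<n. \<bar>crd j y0\<bar>))..r + (\<Sum>j<n. \<bar>crd j y0\<bar>)}" by auto
qed (use assms in \<open>auto simp: space_PiM PiE_def extensional_def\<close>)

lemma bounded_of_box:
  fixes f :: "'e \<Rightarrow> real"
  assumes "continuous_on (box y0 r) f"
  obtains C where "C \<ge> 0" "\<And>y. y \<in> box y0 r \<Longrightarrow> \<bar>f y\<bar> \<le> C"
proof -
  have "bounded (f ` box y0 r)"
    by (intro compact_imp_bounded compact_continuous_image assms compact_box)
  then obtain C where "\<forall>y\<in>box y0 r. \<bar>f y\<bar> \<le> C" by (auto simp: bounded_iff)
  then show thesis using that[of "max 0 C"] by fastforce
qed

lemma integrable_box:
  fixes f :: "'e \<Rightarrow> real"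
  assumes "continuous_on UNIV f" "\<And>y. y \<notin> box y0 r \<Longrightarrow> f y = 0"
  shows "integrable LN (\<lambda>a. f (lin a))"
proof -
  obtain C where C: "C \<ge> 0" "\<And>y. y \<in> box y0 r \<Longrightarrow> \<bar>f y\<bar> \<le> C"
    using bounded_of_box[OF continuous_on_subset[OF assms(1) subset_UNIV]] by blast
  define R where "R = r + (\<Sum>j<n. \<bar>crd j y0\<bar>)"
  let ?B = "PiE {..<n} (\<lambda>_. {-R..R})"
  have mB: "?B \<in> sets LN" by (intro sets_PiM_I_finite) auto
  have "integrable LN (\<lambda>a. C * indicator ?B a)"
    using emeasure_box_finite[of R] mB by (intro integrable_mult_right integrable_real_indicator) auto
  moreover have "(\<lambda>a. f (lin a)) \<in> borel_measurable LN"
    by (rule measurable_compose[OF lin_measurable borel_measurable_continuous_onI[OF assms(1)]])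
  moreover have "AE a in LN. norm (f (lin a)) \<le> norm (C * indicator ?B a)"
  proof (rule AE_I2)
    fix a assume a: "a \<in> space LN"
    show "norm (f (lin a)) \<le> norm (C * indicator ?B a)"
    proof (cases "lin a \<in> box y0 r")
      case True
      then have "a \<in> ?B" using lin_in_box[OF a] by (simp add: R_def)
      then show ?thesis using C True by simp
    qed (simp add: assms(2))
  qed
  ultimately show ?thesis by (rule Bochner_Integration.integrable_bound)
qed

text \<open>Fubini, with the fundamental theorem of calculus in the \<open>i\<close>-th variable.\<close>

lemma integral_partial_derivative:
  fixes f :: "'e \<Rightarrow> real"
  assumes "\<And>y. C1_at f y" "\<And>y. y \<notin> box y0 r \<Longrightarrow> f y = 0" "i < n"
  shows "(\<integral>a. fd f (lin a) (bs i) \<partial>LN) = 0"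
proof -
  interpret product_sigma_finite "\<lambda>_::nat. lborel :: real measure"
    by (simp add: product_sigma_finite_def lborel.sigma_finite_measure_axioms)
  let ?g = "\<lambda>y. fd f y (bs i)"
  have cont: "continuous_on UNIV ?g"
    using C1_at_isCont_fd[OF assms(1)] by (simp add: continuous_at_imp_continuous_on)
  have zero: "?g y = 0" if "y \<notin> box y0 r" for y
  proof -
    have "open (- box y0 r)" using compact_imp_closed[OF compact_box] by (simp add: open_Compl)
    then have "\<forall>\<^sub>F z in nhds y. f z = 0"
      unfolding eventually_nhds using that assms(2) by (intro exI[of _ "- box y0 r"]) auto
    from fd_cong[OF this] show ?thesis by simp
  qed
  define I where "I = {..<n} - {i}"
  have I: "finite I" "i \<notin> I" "insert i I = {..<n}" using assms(3) by (auto simp: I_def)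
  have int: "integrable (Pi\<^sub>M (insert i I) (\<lambda>_. lborel)) (\<lambda>a. ?g (lin a))"
    unfolding I(3) by (rule integrable_box[OF cont zero])
  have inner: "(\<integral>t. ?g (lin (x(i := t))) \<partial>lborel) = 0" for x
  proof -
    define F where "F t = f (lin (x(i := t)))" for t
    \<comment> \<open>Beyond \<open>R\<close> the line in direction \<open>i\<close> has left the
      box, so \<open>F\<close> vanishes at both ends of \<open>{-R..R}\<close>; the
      \<open>+ 1\<close> makes the comparison strict and \<open>R\<close> positive.\<close>
    define R where "R = \<bar>r\<bar> + \<bar>crd i y0\<bar> + 1"
    define y1 where "y1 = lin (x(i := 0))"
    have lin_upd: "lin (x(i := t)) = y1 + t *\<^sub>R bs i" for t
    proof -
      have "lin (x(i := t)) = (\<Sum>j<n. (if j = i then t else x j) *\<^sub>R bs j)" by (simp add: lin_def fun_upd_def)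
      also have "\<dots> = (\<Sum>j<n. (if j = i then 0 else x j) *\<^sub>R bs j + (if j = i then t *\<^sub>R bs i else 0))"
        by (intro sum.cong) auto
      finally show ?thesis using assms(3) by (simp add: y1_def sum.distrib lin_def fun_upd_def)
    qed
    have deriv: "(F has_real_derivative ?g (lin (x(i := t)))) (at t)" for t
    proof -
      have 1: "((\<lambda>t. lin (x(i := t))) has_derivative (\<lambda>s. s *\<^sub>R bs i)) (at t)"
        unfolding lin_upd[abs_def] by (auto intro!: derivative_eq_intros)
      have 2: "(F has_derivative (\<lambda>s. fd f (lin (x(i := t))) (s *\<^sub>R bs i))) (at t)"
        unfolding F_def[abs_def]
        by (rule has_derivative_compose[OF 1 has_derivative_fd[OF C1_at_differentiable[OF assms(1)]]])
      have "(\<lambda>s. fd f (lin (x(i := t))) (s *\<^sub>R bs i)) = (*) (?g (lin (x(i := t))))"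
        using linear_fd[OF C1_at_differentiable[OF assms(1)]] by (auto simp: linear_scale fun_eq_iff)
      then show ?thesis using 2 by (simp add: has_field_derivative_def)
    qed
    have out: "lin (x(i := t)) \<notin> box y0 r" if "\<bar>t\<bar> \<ge> R" for t
    proof
      assume "lin (x(i := t)) \<in> box y0 r"
      then have "\<bar>t - crd i y0\<bar> \<le> r" using assms(3) crd_lin[OF assms(3), of "x(i := t)"] by (auto simp: box_def crd_diff)
      then show False using that by (auto simp: R_def)
    qed
    have contlin: "isCont (\<lambda>t. ?g (lin (x(i := t)))) t" for t
    proof (rule isCont_o2[where g="?g"])
      show "isCont (\<lambda>t. lin (x(i := t))) t" unfolding lin_upd[abs_def] by (intro continuous_intros)
      show "isCont ?g (lin (x(i := t)))" using cont by (simp add: continuous_on_eq_continuous_at)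
    qed
    have "R > 0" by (simp add: R_def add_pos_nonneg add_nonneg_pos)
    have "(\<integral>t. ?g (lin (x(i := t))) \<partial>lborel) = (\<integral>t. ?g (lin (x(i := t))) * indicator {-R..R} t \<partial>lborel)"
    proof (rule Bochner_Integration.integral_cong[OF refl])
      fix t show "?g (lin (x(i := t))) = ?g (lin (x(i := t))) * indicator {-R..R} t"
        using zero[OF out[of t]] by (cases "\<bar>t\<bar> \<ge> R") (auto simp: indicator_def abs_le_iff)
    qed
    also have "\<dots> = F R - F (-R)"
      using \<open>R > 0\<close> by (intro integral_FTC_Icc_real deriv contlin) auto
    also have "\<dots> = 0" using assms(2)[OF out] \<open>R > 0\<close> by (simp add: F_def)
    finally show ?thesis .
  qed
  show ?thesis
    using product_integral_insert[OF I(1,2) int] unfolding I(3) inner by simp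
qed

text \<open>The product of \<open>qpos (1 - (q j y * q j y))\<close> over the coordinates vanishes
  off the open box and is 1 at the centre. The plateau with value exactly 1 comes from
  \<open>1 - qpos (1 - 2 * b y)\<close>, which is 0 where \<open>b\<close> is 0 and 1 where
  \<open>b\<close> is at least 1/2.\<close>

lemma bump_exists:
  assumes "r > 0"
  shows "\<exists>(\<phi> :: 'e \<Rightarrow> real) V. (\<forall>y. C1_at \<phi> y) \<and> (\<forall>y. y \<notin> box y0 r \<longrightarrow> \<phi> y = 0) \<and>
    open V \<and> y0 \<in> V \<and> (\<forall>y\<in>V. \<phi> y = 1)"
proof -
  define q where "q j y = crd j (y - y0) / r" for j y
  define b where "b y = (\<Prod>j<n. qpos (1 - (q j y * q j y)))" for y
  define \<phi> where "\<phi> y = 1 - qpos (1 - 2 * b y)" for y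
  define V where "V = {y. 1/2 < b y} \<inter> obox y0 r"
  have c1q: "C1_at (q j) y" for j y
  proof (rule smooth_pt_C1_at)
    have "smooth_pt (\<lambda>y. (1/r) * crd j (y - y0)) y"
      by (intro smooth_pt_mult smooth_pt_const smooth_pt_linear_comp[OF crd_linear] smooth_pt_diff smooth_pt_ident)
    then show "smooth_pt (q j) y" by (simp add: q_def[abs_def])
  qed
  have c1b: "C1_at b y" for y unfolding b_def[abs_def]
    by (intro C1_at_prod C1_at_compose[where g=qpos, OF findim_real _ C1_at_qpos] C1_at_diff C1_at_mult C1_at_const c1q)
  have C1_at\<phi>: "C1_at \<phi> y" for y unfolding \<phi>_def[abs_def]
    by (intro C1_at_compose[where g=qpos, OF findim_real _ C1_at_qpos] C1_at_diff C1_at_mult C1_at_const c1b)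
  have b0: "b y0 = 1" by (simp add: b_def q_def qpos_def)
  have bout: "b y = 0" if out: "y \<notin> obox y0 r" for y
  proof -
    obtain j where j: "j < n" "\<bar>crd j (y - y0)\<bar> \<ge> r" using out by (auto simp: obox_def not_less)
    then have "\<bar>q j y\<bar> \<ge> 1" using assms by (simp add: q_def abs_divide)
    then have "q j y * q j y \<ge> 1" using abs_le_square_iff[of 1 "q j y"] by (simp add: power2_eq_square)
    then have "qpos (1 - (q j y * q j y)) = 0" by (simp add: qpos_def)
    then show ?thesis unfolding b_def using j(1) by (intro prod_zero) auto
  qed
  have "continuous_on UNIV b" using C1_at_isCont[OF c1b] by (simp add: continuous_at_imp_continuous_on)
  then have "open V" unfolding V_def by (intro open_Int open_obox open_Collect_less continuous_on_const)
  moreover have "y0 \<in> V" using b0 obox_center[OF assms] by (simp add: V_def)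
  moreover have "\<phi> y = 1" if "y \<in> V" for y using that by (simp add: V_def \<phi>_def qpos_def)
  moreover have "\<phi> y = 0" if "y \<notin> box y0 r" for y
  proof -
    have "y \<notin> obox y0 r" using that obox_subset by blast
    then show ?thesis by (simp add: \<phi>_def qpos_def bout)
  qed
  ultimately show ?thesis using C1_at\<phi> by blast
qed

end

section \<open>Alternating forms on a frame\<close>

text \<open>Prepares two facts about densities: a form that vanishes on one basis vanishes
  identically, and replacing single frame vectors produces a trace.\<close>

locale alternating_frame = frame n bs crd for n and bs :: "nat \<Rightarrow> 'e::real_normed_vector" and crd +
  fixes \<Omega> :: "(nat \<Rightarrow> 'e) \<Rightarrow> real"
  assumes \<Omega>_cong: "\<And>w w'. (\<And>i. i < n \<Longrightarrow> w i = w' i) \<Longrightarrow> \<Omega> w = \<Omega> w'"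
    and \<Omega>_linear: "\<And>w i. i < n \<Longrightarrow> linear (\<lambda>u. \<Omega> (w(i := u)))"
    and \<Omega>_alt: "\<And>w i j. i < n \<Longrightarrow> j < n \<Longrightarrow> i \<noteq> j \<Longrightarrow> w i = w j \<Longrightarrow> \<Omega> w = 0"
begin

text \<open>Polarization: the value with \<open>w i + w j\<close> in both slots is 0, and its
  bilinear expansion leaves the two mixed terms.\<close>

lemma \<Omega>_swap:
  assumes "i < n" "j < n" "i \<noteq> j"
  shows "\<Omega> (w(i := w j, j := w i)) = - \<Omega> w"
proof -
  let ?s = "w i + w j"
  have l: "\<Omega> (v(i := a + b)) = \<Omega> (v(i := a)) + \<Omega> (v(i := b))"
    "\<Omega> (v(j := a + b)) = \<Omega> (v(j := a)) + \<Omega> (v(j := b))" for v a b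
    using linear_add[OF \<Omega>_linear[OF assms(1)]] linear_add[OF \<Omega>_linear[OF assms(2)]] by auto
  have z: "\<Omega> (w(i := a, j := a)) = 0" for a by (rule \<Omega>_alt[OF assms]) (use assms in auto)
  have c: "w(i := a, j := b) = w(j := b, i := a)" for a b using assms(3) by (rule fun_upd_twist)
  have "0 = \<Omega> (w(i := ?s, j := ?s))" by (rule z[symmetric])
  also have "\<dots> = \<Omega> (w(i := ?s, j := w i)) + \<Omega> (w(i := ?s, j := w j))" by (rule l(2))
  also have "\<dots> = \<Omega> (w(i := w i, j := w i)) + \<Omega> (w(i := w j, j := w i))
      + (\<Omega> (w(i := w i, j := w j)) + \<Omega> (w(i := w j, j := w j)))"
    unfolding c by (simp only: l(1))
  also have "w(i := w i, j := w j) = w" by simp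
  finally show ?thesis using z[of "w i"] z[of "w j"] by linarith
qed

lemma \<Omega>_permutes:
  assumes "p permutes {..<n}"
  shows "\<bar>\<Omega> (w \<circ> p)\<bar> = \<bar>\<Omega> w\<bar>"
  using assms finite_lessThan
proof (induction arbitrary: w rule: permutes_induct)
  case id
  then show ?case by simp
next
  case (swap a b p)
  have eq: "w \<circ> Transposition.transpose a b = w(a := w b, b := w a)"
    using swap(3) by (auto simp: fun_eq_iff Transposition.transpose_def)
  have "\<bar>\<Omega> (w \<circ> (Transposition.transpose a b \<circ> p))\<bar> = \<bar>\<Omega> (w \<circ> Transposition.transpose a b)\<bar>"
    using swap.IH[of "w \<circ> Transposition.transpose a b"] unfolding o_assoc .
  also have "\<dots> = \<bar>\<Omega> w\<bar>" unfolding eq using swap(1-3) by (simp add: \<Omega>_swap)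
  finally show ?case .
qed

text \<open>A selection of frame vectors either permutes the frame, which preserves the absolute
  value, or repeats a vector.\<close>

lemma \<Omega>_basis_selection:
  assumes "\<Omega> bs = 0" "\<And>i. i < n \<Longrightarrow> \<sigma> i < n"
  shows "\<Omega> (\<lambda>i. bs (\<sigma> i)) = 0"
proof (cases "inj_on \<sigma> {..<n}")
  case True
  define p where "p i = (if i < n then \<sigma> i else i)" for i
  have "inj_on p {..<n}" using True by (auto simp: inj_on_def p_def)
  moreover have "p ` {..<n} \<subseteq> {..<n}" using assms(2) by (auto simp: p_def)
  ultimately have "bij_betw p {..<n} {..<n}"
    by (simp add: bij_betw_def endo_inj_surj)
  then have "p permutes {..<n}" by (rule bij_imp_permutes) (simp add: p_def)
  then have "\<Omega> (bs \<circ> p) = 0" using \<Omega>_permutes[of p bs] assms(1) by simp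
  moreover have "\<Omega> (bs \<circ> p) = \<Omega> (\<lambda>i. bs (\<sigma> i))" by (rule \<Omega>_cong) (simp add: p_def)
  ultimately show ?thesis by simp
next
  case False
  then obtain i j where "i < n" "j < n" "i \<noteq> j" "\<sigma> i = \<sigma> j" by (auto simp: inj_on_def)
  then show ?thesis by (intro \<Omega>_alt[of i j]) auto
qed

text \<open>Multilinear expansion, one slot at a time, down to selections of frame vectors.\<close>

lemma \<Omega>_zero_of_basis:
  assumes "\<Omega> bs = 0"
  shows "\<Omega> w = 0"
proof -
  \<comment> \<open>The first \<open>m\<close> slots are free and the others hold frame vectors:
    \<open>m = 0\<close> is a selection of frame vectors, \<open>m = n\<close> the claim.\<close>
  have "\<forall>w. (\<forall>i. m \<le> i \<and> i < n \<longrightarrow> w i \<in> bs ` {..<n}) \<longrightarrow> \<Omega> w = 0" if "m \<le> n" for m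
    using that
  proof (induction m)
    case 0
    show ?case
    proof (intro allI impI)
      fix w assume "\<forall>i. 0 \<le> i \<and> i < n \<longrightarrow> w i \<in> bs ` {..<n}"
      then have "\<forall>i. \<exists>k. i < n \<longrightarrow> k < n \<and> w i = bs k" by auto
      then obtain \<sigma> where \<sigma>: "\<And>i. i < n \<Longrightarrow> \<sigma> i < n \<and> w i = bs (\<sigma> i)" by metis
      then have "\<Omega> w = \<Omega> (\<lambda>i. bs (\<sigma> i))" by (intro \<Omega>_cong) auto
      then show "\<Omega> w = 0" using \<Omega>_basis_selection[OF assms, of \<sigma>] \<sigma> by simp
    qed
  next
    case (Suc m)
    show ?case
    proof (intro allI impI)
      fix w assume w: "\<forall>i. Suc m \<le> i \<and> i < n \<longrightarrow> w i \<in> bs ` {..<n}"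
      have "\<Omega> (w(m := w m)) = (\<Sum>j<n. crd j (w m) *\<^sub>R \<Omega> (w(m := bs j)))"
        by (rule linear_frame_expand[OF \<Omega>_linear]) (use Suc in simp)
      also have "\<dots> = 0"
      proof (intro sum.neutral ballI)
        fix j assume j: "j \<in> {..<n}"
        have "\<forall>i. m \<le> i \<and> i < n \<longrightarrow> (w(m := bs j)) i \<in> bs ` {..<n}"
        proof (intro allI impI)
          fix i assume i: "m \<le> i \<and> i < n"
          show "(w(m := bs j)) i \<in> bs ` {..<n}"
          proof (cases "i = m")
            case False
            then have "Suc m \<le> i" using i by simp
            then show ?thesis using w i False by simp
          qed (use j in simp)
        qed
        then have "\<Omega> (w(m := bs j)) = 0" using Suc.IH Suc.prems by (meson Suc_leD)
        then show "crd j (w m) *\<^sub>R \<Omega> (w(m := bs j)) = 0" by simp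
      qed
      finally show "\<Omega> w = 0" by simp
    qed
  qed
  from this[of n] show ?thesis by auto
qed

text \<open>In the expansion of \<open>v\<close>, every frame vector other than \<open>bs i\<close>
  occurs twice among the arguments. Summed over \<open>i\<close>, with \<open>v\<close> the image of
  \<open>bs i\<close> under a linear map, this yields the trace of that map times the value on the
  frame.\<close>

lemma \<Omega>_replace:
  assumes "i < n"
  shows "\<Omega> (bs(i := v)) = crd i v * \<Omega> bs"
proof -
  have "\<Omega> (bs(i := v)) = (\<Sum>j<n. crd j v *\<^sub>R \<Omega> (bs(i := bs j)))"
    by (rule linear_frame_expand[OF \<Omega>_linear[OF assms]])
  also have "\<dots> = (\<Sum>j<n. if j = i then crd i v * \<Omega> bs else 0)"
  proof (intro sum.cong refl)
    fix j assume j: "j \<in> {..<n}"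
    show "crd j v *\<^sub>R \<Omega> (bs(i := bs j)) = (if j = i then crd i v * \<Omega> bs else 0)"
      using \<Omega>_alt[of i j "bs(i := bs j)"] assms j by auto
  qed
  finally show ?thesis using assms by simp
qed

end

section \<open>The divergence theorem on a compact manifold\<close>

lemma eventually_openin_mtop:
  assumes "mfd S" "openin (mtop S) W" "d \<in> S" "x \<in> fst d" "x \<in> W"
  shows "\<forall>\<^sub>F y in nhds (snd d x). chart_inv d y \<in> W"
proof -
  have g: "\<forall>c\<in>S. good_chart c" using assms(1) by (simp add: mfd_def)
  have "open (snd d ` (fst d \<inter> W))" using openin_mtop[OF g] assms(2,3) by blast
  then have "\<forall>\<^sub>F y in nhds (snd d x). y \<in> snd d ` (fst d \<inter> W)"
    using assms(4,5) by (auto simp: eventually_nhds)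
  then show ?thesis
    by (rule eventually_mono) (use chart_inv_chart mfd_good_chart[OF assms(1,3)] in fastforce)
qed

definition continuous_mfd :: "('a, 'e::real_normed_vector) atlas \<Rightarrow> ('a \<Rightarrow> real) \<Rightarrow> bool" where
  "continuous_mfd S \<phi> \<longleftrightarrow> (\<forall>c\<in>S. \<forall>x\<in>fst c. isCont (\<lambda>y. \<phi> (chart_inv c y)) (snd c x))"

definition C1_mfd :: "('a, 'e::real_normed_vector) atlas \<Rightarrow> ('a \<Rightarrow> real) \<Rightarrow> bool" where
  "C1_mfd S f \<longleftrightarrow> (\<forall>c\<in>S. \<forall>x\<in>fst c. C1_at (\<lambda>y. f (chart_inv c y)) (snd c x))"

text \<open>Extends the action of \<open>u\<close> to C1 functions, on which the derivation
  \<open>u x\<close> returns 0 by convention wherever they are not smooth. For C1 functions and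
  tangent \<open>u x\<close> the value does not depend on the chosen chart.\<close>

definition field_deriv :: "('a, 'e::real_normed_vector) atlas \<Rightarrow> ('a \<Rightarrow> 'a tvec) \<Rightarrow> ('a \<Rightarrow> real) \<Rightarrow> 'a \<Rightarrow> real" where
  "field_deriv S u f x = (let c = (SOME c. c \<in> S \<and> x \<in> fst c) in
     fd (\<lambda>y. f (chart_inv c y)) (snd c x) (coord_rep S c x (u x)))"

lemma continuous_mfd_continuous_map:
  assumes "mfd S" "continuous_mfd S \<phi>"
  shows "continuous_map (mtop S) euclidean \<phi>"
  unfolding continuous_map_def
proof (intro conjI allI impI)
  fix U :: "real set" assume "openin euclidean U"
  then have U: "open U" by simp
  have g: "\<forall>c\<in>S. good_chart c" using assms(1) by (simp add: mfd_def)
  show "openin (mtop S) {x \<in> topspace (mtop S). \<phi> x \<in> U}"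
    unfolding openin_mtop[OF g] topspace_mtop[OF assms(1)]
  proof (intro conjI ballI)
    fix c assume c: "c \<in> S"
    show "open (snd c ` (fst c \<inter> {x \<in> points S. \<phi> x \<in> U}))"
    proof (subst open_subopen, intro ballI)
      fix y assume "y \<in> snd c ` (fst c \<inter> {x \<in> points S. \<phi> x \<in> U})"
      then obtain x where x: "x \<in> fst c" "\<phi> x \<in> U" "y = snd c x" by blast
      have "isCont (\<lambda>y. \<phi> (chart_inv c y)) y" using assms(2) c x by (auto simp: continuous_mfd_def)
      then have "filterlim (\<lambda>y. \<phi> (chart_inv c y)) (nhds (\<phi> (chart_inv c y))) (nhds y)"
        using continuous_at tendsto_at_iff_tendsto_nhds by metis
      then have "\<forall>\<^sub>F z in nhds y. \<phi> (chart_inv c z) \<in> U"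
        using U x chart_inv_chart[OF mfd_good_chart[OF assms(1) c] x(1)] by (intro topological_tendstoD) auto
      moreover have "\<forall>\<^sub>F z in nhds y. z \<in> snd c ` fst c"
        unfolding x(3) by (rule eventually_in_chart[OF mfd_good_chart[OF assms(1) c] x(1)])
      ultimately have "\<forall>\<^sub>F z in nhds y. z \<in> snd c ` (fst c \<inter> {x \<in> points S. \<phi> x \<in> U})"
      proof eventually_elim
        case (elim z)
        then show ?case using chart_chart_inv[of z c] chart_inv_in[of z c] pointsI[OF c]
          by (intro image_eqI[of _ _ "chart_inv c z"]) auto
      qed
      then show "\<exists>T. open T \<and> y \<in> T \<and> T \<subseteq> snd c ` (fst c \<inter> {x \<in> points S. \<phi> x \<in> U})"
        by (auto simp: eventually_nhds)
    qed
  qed auto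
qed auto

lemma C1_mfd_mult: "C1_mfd S f \<Longrightarrow> C1_mfd S g \<Longrightarrow> C1_mfd S (\<lambda>x. f x * g x)"
  by (simp add: C1_mfd_def C1_at_mult)

lemma C1_mfd_diff: "C1_mfd S f \<Longrightarrow> C1_mfd S g \<Longrightarrow> C1_mfd S (\<lambda>x. f x - g x)"
  by (simp add: C1_mfd_def C1_at_diff)

lemma C1_mfd_const: "C1_mfd S (\<lambda>_. a)"
  by (simp add: C1_mfd_def C1_at_const)

text \<open>The chain rule through the transition map matches the coordinate change of the
  vector.\<close>

lemma field_deriv_chart:
  assumes "mfd S" "C1_mfd S f" "u x \<in> tangent_space S x" "c \<in> S" "x \<in> fst c"
  shows "field_deriv S u f x = fd (\<lambda>y. f (chart_inv c y)) (snd c x) (coord_rep S c x (u x))"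
proof -
  define d where "d = (SOME c. c \<in> S \<and> x \<in> fst c)"
  have "d \<in> S \<and> x \<in> fst d" unfolding d_def by (rule someI[of _ c]) (use assms in simp)
  then have d: "d \<in> S" "x \<in> fst d" by auto
  note css = mfd_cs_ident[OF assms(1) d(1) assms(4) d(2) assms(5)]
  note [simp] = chart_inv_chart[OF mfd_good_chart[OF assms(1) d(1)] d(2)]
  have "u x = coord_vec S c x (fd (\<lambda>y. snd c (chart_inv d y)) (snd d x) (coord_rep S d x (u x)))"
    using coord_vec_change[OF assms(1) d(1) assms(4) d(2) assms(5)] coord_vec_coord_rep[OF assms(1) d assms(3)] by metis
  then have rep: "coord_rep S c x (u x) = fd (\<lambda>y. snd c (chart_inv d y)) (snd d x) (coord_rep S d x (u x))"
    using coord_rep_coord_vec[OF assms(1,4,5)] by metis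
  have "\<forall>\<^sub>F y in nhds (snd d x). f (chart_inv d y) = f (chart_inv c (snd c (chart_inv d y)))"
    using chart_smoothD(3)[OF css] by (rule eventually_mono) (simp add: chart_inv_chart[OF mfd_good_chart[OF assms(1,4)]])
  from fd_cong[OF this]
  have "field_deriv S u f x = fd (\<lambda>y. f (chart_inv c (snd c (chart_inv d y)))) (snd d x) (coord_rep S d x (u x))"
    unfolding field_deriv_def d_def[symmetric] Let_def by simp
  also have "\<dots> = fd (\<lambda>y. f (chart_inv c y)) (snd c (chart_inv d (snd d x)))
      (fd (\<lambda>y. snd c (chart_inv d y)) (snd d x) (coord_rep S d x (u x)))"
    using assms(2,4,5) by (intro fd_compose[where g="\<lambda>y. f (chart_inv c y)"] smooth_pt_differentiable[OF chart_smoothD(4)[OF css]] C1_at_differentiable)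
      (simp add: C1_mfd_def)
  finally show ?thesis using rep by simp
qed

lemma smooth_fun_C1_mfd:
  assumes "smooth_fun S h"
  shows "C1_mfd S h"
  using assms unfolding smooth_fun_def smooth_on_iff_smooth_pt C1_mfd_def o_def by (blast intro: smooth_pt_C1_at)

lemma field_deriv_smooth_fun:
  assumes "mfd S" "smooth_fun S h" "u x \<in> tangent_space S x"
  shows "field_deriv S u h x = u x h"
proof -
  obtain c where c: "c \<in> S" "x \<in> fst c" using tangent_points[OF assms(3)] by (rule pointsE)
  have "u x h = coord_vec S c x (coord_rep S c x (u x)) h" using coord_vec_coord_rep[OF assms(1) c assms(3)] by simp
  then show ?thesis
    using field_deriv_chart[where u=u, OF assms(1) smooth_fun_C1_mfd[OF assms(2)] assms(3) c] smooth_fun_near[OF assms(1,2) pointsI[OF c]]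
    by (simp add: coord_vec_apply)
qed

lemma compact_finite_subcover:
  assumes mfd_S: "mfd S" and compact: "compact_space (mtop S)"
    and "\<And>x. x \<in> points S \<Longrightarrow> \<exists>W. openin (mtop S) W \<and> x \<in> W \<and> P W"
  obtains F where "finite F" "\<And>W. W \<in> F \<Longrightarrow> openin (mtop S) W \<and> P W" "points S = \<Union>F"
proof -
  let ?U = "{W. openin (mtop S) W \<and> P W}"
  have "compactin (mtop S) (points S)" using compact by (simp add: compact_space_def topspace_mtop[OF mfd_S])
  moreover have "points S \<subseteq> \<Union>?U" using assms(3) by blast
  ultimately obtain F where F: "finite F" "F \<subseteq> ?U" "points S \<subseteq> \<Union>F"
    unfolding compactin_def by (metis (mono_tags, lifting) mem_Collect_eq)
  moreover have "\<Union>F \<subseteq> points S"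
  proof
    fix x assume "x \<in> \<Union>F"
    then obtain W where W: "W \<in> F" "x \<in> W" by blast
    then have "openin (mtop S) W" using F(2) by blast
    then show "x \<in> points S" using openin_subset W(2) topspace_mtop[OF mfd_S] by blast
  qed
  ultimately show thesis using that[of F] by auto
qed

section \<open>Integration against a volume form on a compact manifold\<close>

locale compact_volume = frame n bs crd
  for n and bs :: "nat \<Rightarrow> 'e::real_normed_vector" and crd +
  fixes S :: "('x, 'e) atlas" and \<mu> :: "'x \<Rightarrow> (nat \<Rightarrow> 'x tvec) \<Rightarrow> real" and \<nu> :: "'x measure"
  assumes manifold: "smooth_manifold S" and compact: "compact_space (mtop S)"
    and vol: "volume_form S \<mu>" and meas: "volume_measure S \<mu> \<nu>"
    and dim_n: "dim (UNIV :: 'e set) = n"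
    and inj_bs: "inj_on bs {..<n}" and indep_bs: "independent (bs ` {..<n})"
begin

lemma mfd_S: "mfd S"
  by (rule smooth_manifold_mfd[OF manifold])

lemma sets_\<nu>: "sets \<nu> = sets (borel_of (mtop S))"
  using meas by (simp add: volume_measure_def)

lemma space_\<nu>: "space \<nu> = points S"
  using sets_eq_imp_space_eq[OF sets_\<nu>] by (simp add: borel_of_def space_measure_of_conv topspace_mtop[OF mfd_S])

lemma openin_sets: "openin (mtop S) W \<Longrightarrow> W \<in> sets \<nu>"
  unfolding sets_\<nu> borel_of_def by (subst sets_measure_of) (auto dest: openin_subset intro: sigma_sets.Basic)

lemma chart_openin: "c \<in> S \<Longrightarrow> openin (mtop S) (fst c)"
  using openin_chart_preimage[OF mfd_S _ open_UNIV, of c] by simp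

lemma measurable_\<nu>I:
  assumes "\<And>x. x \<in> space N \<Longrightarrow> f x \<in> points S" "\<And>W. openin (mtop S) W \<Longrightarrow> f -` W \<inter> space N \<in> sets N"
  shows "f \<in> N \<rightarrow>\<^sub>M \<nu>"
proof -
  have "f \<in> N \<rightarrow>\<^sub>M borel_of (mtop S)" unfolding borel_of_def
  proof (rule measurable_measure_of)
    show "{W. openin (mtop S) W} \<subseteq> Pow (topspace (mtop S))" using openin_subset by blast
    show "f \<in> space N \<rightarrow> topspace (mtop S)" using assms(1) topspace_mtop[OF mfd_S] by simp
    show "f -` W \<inter> space N \<in> sets N" if "W \<in> {W. openin (mtop S) W}" for W using assms(2) that by simp
  qed
  then show ?thesis using measurable_cong_sets[OF refl sets_\<nu>] by blast
qed

lemma continuous_mfd_measurable: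
  assumes "continuous_mfd S \<phi>"
  shows "\<phi> \<in> borel_measurable \<nu>"
proof (rule borel_measurableI)
  fix U :: "real set" assume "open U"
  then have "openin (mtop S) {x \<in> topspace (mtop S). \<phi> x \<in> U}"
    using continuous_mfd_continuous_map[OF mfd_S assms] by (simp add: continuous_map_def)
  moreover have "{x \<in> topspace (mtop S). \<phi> x \<in> U} = \<phi> -` U \<inter> space \<nu>"
    by (auto simp: space_\<nu> topspace_mtop[OF mfd_S])
  ultimately show "\<phi> -` U \<inter> space \<nu> \<in> sets \<nu>" using openin_sets by metis
qed

lemma continuous_mfd_bounded:
  assumes "continuous_mfd S \<phi>"
  obtains C where "C \<ge> 0" "\<And>x. x \<in> points S \<Longrightarrow> \<bar>\<phi> x\<bar> \<le> C"
proof -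
  have "compactin euclidean (\<phi> ` points S)"
    using image_compactin[OF _ continuous_mfd_continuous_map[OF mfd_S assms]] compact
    by (metis compact_space_def topspace_mtop[OF mfd_S])
  then have "bounded (\<phi> ` points S)" by (simp add: compact_imp_bounded)
  then obtain C where "\<forall>x\<in>points S. \<bar>\<phi> x\<bar> \<le> C" by (auto simp: bounded_iff)
  then show thesis using that[of "max 0 C"] by fastforce
qed

abbreviation "\<rho> c \<equiv> coord_density S \<mu> c bs"

lemma density_smooth_pt: "c \<in> S \<Longrightarrow> y \<in> snd c ` fst c \<Longrightarrow> smooth_pt (\<rho> c) y"
  using vol unfolding volume_form_def smooth_on_iff_smooth_pt by blast

lemma density_alternating:
  assumes "c \<in> S" "y \<in> snd c ` fst c"
  shows "alternating_frame n bs crd (\<lambda>w. coord_density S \<mu> c w y)"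
proof -
  let ?x = "chart_inv c y"
  have x: "?x \<in> fst c" using chart_inv_in[OF assms(2)] .
  note cv = coord_vec_tangent[OF assms(1) x]
  have alt: "alternating_form S ?x n (\<mu> ?x)" using vol pointsI[OF assms(1) x] by (simp add: volume_form_def dim_n)
  have upd: "(\<lambda>j. coord_vec S c ?x ((w(i := u)) j)) = (\<lambda>j. coord_vec S c ?x (w j))(i := coord_vec S c ?x u)" for w i u
    by auto
  show ?thesis
  proof (unfold alternating_frame_def alternating_frame_axioms_def, intro conjI allI impI)
    show "frame n bs crd" by (rule frame_axioms)
    show "coord_density S \<mu> c w y = coord_density S \<mu> c w' y" if "\<forall>i. i < n \<longrightarrow> w i = w' i" for w w'
      using conjunct1[OF alt[unfolded alternating_form_def], rule_format,
          of "\<lambda>i. coord_vec S c ?x (w i)" "\<lambda>i. coord_vec S c ?x (w' i)"] that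
      by (simp add: coord_density_def)
    show "linear (\<lambda>u. coord_density S \<mu> c (w(i := u)) y)" if i: "i < n" for w i
    proof -
      have l: "\<mu> ?x ((\<lambda>j. coord_vec S c ?x (w j))(i := (\<lambda>g. a * coord_vec S c ?x u g + b * coord_vec S c ?x v g)))
        = a * \<mu> ?x ((\<lambda>j. coord_vec S c ?x (w j))(i := coord_vec S c ?x u)) + b * \<mu> ?x ((\<lambda>j. coord_vec S c ?x (w j))(i := coord_vec S c ?x v))"
        for a b u v
        using alt i cv unfolding alternating_form_def by simp
      define D where "D u = \<mu> ?x ((\<lambda>j. coord_vec S c ?x (w j))(i := coord_vec S c ?x u))" for u
      have "coord_density S \<mu> c (w(i := u)) y = D u" for u
        unfolding coord_density_def upd D_def ..
      moreover have "D (a *\<^sub>R u + b *\<^sub>R v) = a * D u + b * D v" for a b u v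
        unfolding D_def coord_vec_linear[OF mfd_S assms(1) x, symmetric] by (rule l)
      from this[of 1 _ 1] this[of _ _ 0] have "linear D"
        by (intro linearI) simp_all
      ultimately show ?thesis by simp
    qed
    show "coord_density S \<mu> c w y = 0" if "i < n" "j < n" "i \<noteq> j" "w i = w j" for w i j
    proof -
      have "\<forall>i<n. \<forall>j<n. i \<noteq> j \<and> coord_vec S c ?x (w i) = coord_vec S c ?x (w j) \<longrightarrow> \<mu> ?x (\<lambda>i. coord_vec S c ?x (w i)) = 0"
        by (rule conjunct2[OF mp[OF spec[OF conjunct2[OF alt[unfolded alternating_form_def]],
                of "\<lambda>i. coord_vec S c ?x (w i)"]]]) (simp add: cv)
      from this[rule_format, OF that(1,2)] show ?thesis unfolding coord_density_def that(4) using that(3) by blast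
    qed
  qed
qed

text \<open>A volume form is nonzero on some tuple, hence on the frame by
  \<open>\<Omega>_zero_of_basis\<close>. This keeps the sign of the density locally
  constant.\<close>

lemma density_nonzero:
  assumes "c \<in> S" "y \<in> snd c ` fst c"
  shows "\<rho> c y \<noteq> 0"
proof
  assume z: "\<rho> c y = 0"
  interpret alternating_frame n bs crd "\<lambda>w. coord_density S \<mu> c w y" by (rule density_alternating[OF assms])
  let ?x = "chart_inv c y"
  have x: "?x \<in> fst c" using chart_inv_in[OF assms(2)] .
  obtain ws where ws: "\<And>i. i < n \<Longrightarrow> ws i \<in> tangent_space S ?x" "\<mu> ?x ws \<noteq> 0"
    using vol pointsI[OF assms(1) x] unfolding volume_form_def dim_n by blast
  have "coord_density S \<mu> c (\<lambda>i. coord_rep S c ?x (ws i)) y = \<mu> ?x ws"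
  proof -
    have "alternating_form S ?x n (\<mu> ?x)" using vol pointsI[OF assms(1) x] by (simp add: volume_form_def dim_n)
    from conjunct1[OF this[unfolded alternating_form_def], rule_format,
          of "\<lambda>i. coord_vec S c ?x (coord_rep S c ?x (ws i))" ws]
    show ?thesis unfolding coord_density_def
      using coord_vec_coord_rep[OF mfd_S assms(1) x ws(1)] by simp
  qed
  then show False using \<Omega>_zero_of_basis[OF z] ws(2) by simp
qed

lemma emeasure_chart:
  assumes "c \<in> S" "B \<in> sets \<nu>" "B \<subseteq> fst c"
  shows "emeasure \<nu> B = (\<integral>\<^sup>+ a. ennreal \<bar>\<rho> c (lin a)\<bar> * indicator (snd c ` B) (lin a) \<partial>LN)"
  using meas assms inj_bs indep_bs unfolding volume_measure_def Let_def lin_def dim_n by blast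

lemma box_chart:
  assumes "c \<in> S" "x \<in> fst c"
  obtains r where "r > 0" "box (snd c x) r \<subseteq> snd c ` fst c"
  using box_in_open[of "snd c ` fst c" "snd c x"] mfd_good_chart[OF mfd_S assms(1)] assms(2)
  unfolding good_chart_def by blast

lemma density_continuous: "c \<in> S \<Longrightarrow> X \<subseteq> snd c ` fst c \<Longrightarrow> continuous_on X (\<rho> c)"
  by (intro continuous_at_imp_continuous_on ballI smooth_pt_isCont density_smooth_pt) auto

text \<open>Finiteness of the measure has to be derived: on a small box the density is bounded, and
  the box lies in a cube of finite Lebesgue measure. Compactness then bounds the total mass.\<close>

lemma locally_finite:
  assumes "x \<in> points S"
  shows "\<exists>W. openin (mtop S) W \<and> x \<in> W \<and> emeasure \<nu> W < \<infinity>"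
proof -
  obtain c where c: "c \<in> S" "x \<in> fst c" using assms by (rule pointsE)
  obtain r where r: "r > 0" "box (snd c x) r \<subseteq> snd c ` fst c" using box_chart[OF c] .
  define W where "W = {z \<in> fst c. snd c z \<in> obox (snd c x) r}"
  have W: "openin (mtop S) W" unfolding W_def by (rule openin_chart_preimage[OF mfd_S c(1) open_obox])
  obtain C where C: "C \<ge> 0" "\<And>y. y \<in> box (snd c x) r \<Longrightarrow> \<bar>\<rho> c y\<bar> \<le> C"
    using bounded_of_box[OF density_continuous[OF c(1) r(2)]] by blast
  define R where "R = r + (\<Sum>j<n. \<bar>crd j (snd c x)\<bar>)"
  let ?B = "PiE {..<n} (\<lambda>_. {-R..R})"
  have mB: "?B \<in> sets LN" by (intro sets_PiM_I_finite) auto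
  have "emeasure \<nu> W = (\<integral>\<^sup>+ a. ennreal \<bar>\<rho> c (lin a)\<bar> * indicator (snd c ` W) (lin a) \<partial>LN)"
    by (rule emeasure_chart[OF c(1) openin_sets[OF W]]) (simp add: W_def)
  also have "\<dots> \<le> (\<integral>\<^sup>+ a. ennreal C * indicator ?B a \<partial>LN)"
  proof (rule nn_integral_mono)
    fix a assume a: "a \<in> space LN"
    show "ennreal \<bar>\<rho> c (lin a)\<bar> * indicator (snd c ` W) (lin a) \<le> ennreal C * indicator ?B a"
    proof (cases "lin a \<in> snd c ` W")
      case True
      then have "lin a \<in> obox (snd c x) r" by (auto simp: W_def)
      then have "lin a \<in> box (snd c x) r" using obox_subset by blast
      then show ?thesis using C lin_in_box[OF a] True by (auto simp: R_def intro: ennreal_leI)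
    qed simp
  qed
  also have "\<dots> = ennreal C * emeasure LN ?B" using mB by (rule nn_integral_cmult_indicator)
  also have "\<dots> < \<infinity>" using emeasure_box_finite[of R] by (simp add: ennreal_mult_less_top)
  finally show ?thesis using W c(2) obox_center[OF r(1), of "snd c x"] by (intro exI[of _ W]) (simp add: W_def)
qed

lemma finite_\<nu>: "finite_measure \<nu>"
proof
  obtain F where F: "finite F" "\<And>W. W \<in> F \<Longrightarrow> openin (mtop S) W \<and> emeasure \<nu> W < \<infinity>" "points S = \<Union>F"
    using compact_finite_subcover[OF mfd_S compact locally_finite] by blast
  have "emeasure \<nu> (\<Union>W\<in>F. W) \<le> (\<Sum>W\<in>F. emeasure \<nu> W)"
    using F by (intro emeasure_subadditive_finite) (auto intro: openin_sets)
  also have "\<dots> < \<infinity>" using F by (simp add: less_top)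
  finally show "emeasure \<nu> (space \<nu>) \<noteq> \<infinity>" by (simp add: space_\<nu> F(3))
qed

lemma continuous_mfd_integrable:
  assumes "continuous_mfd S \<phi>"
  shows "integrable \<nu> \<phi>"
proof -
  interpret finite_measure \<nu> by (rule finite_\<nu>)
  obtain C where "\<And>x. x \<in> points S \<Longrightarrow> \<bar>\<phi> x\<bar> \<le> C" using continuous_mfd_bounded[OF assms] by blast
  then show ?thesis
    by (intro integrable_const_bound[where B=C] continuous_mfd_measurable assms AE_I2) (simp add: space_\<nu>)
qed

text \<open>\<open>volume_measure\<close> speaks of the measure of sets in a chart domain. To reach
  integrals, the weighted Lebesgue measure is pushed forward by the inverse chart and identified
  with the restriction of \<open>\<nu>\<close> to the domain; then change of variables
  applies.\<close>

lemma integral_chart: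
  fixes F :: "'x \<Rightarrow> real"
  assumes c: "c \<in> S" and F: "F \<in> borel_measurable \<nu>" and out: "\<And>x. x \<notin> fst c \<Longrightarrow> F x = 0"
  shows "(\<integral>x. F x \<partial>\<nu>) = (\<integral>a. (if lin a \<in> snd c ` fst c then \<bar>\<rho> c (lin a)\<bar> * F (chart_inv c (lin a)) else 0) \<partial>LN)"
proof (cases "fst c = {}")
  case True
  then show ?thesis using out by simp
next
  case False
  then obtain x0 where x0: "x0 \<in> fst c" by blast
  let ?O = "snd c ` fst c"
  have oO: "open ?O" using mfd_good_chart[OF mfd_S c] by (simp add: good_chart_def)
  then have mO: "?O \<in> sets borel" by simp
  define g0 where "g0 y = indicator ?O y *\<^sub>R \<bar>\<rho> c y\<bar>" for y
  have "g0 \<in> borel_measurable borel" unfolding g0_def[abs_def]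
    by (intro borel_measurable_continuous_on_indicator mO continuous_on_rabs density_continuous[OF c]) simp
  then have g0m: "(\<lambda>a. g0 (lin a)) \<in> borel_measurable LN" by (rule measurable_compose[OF lin_measurable])
  have g0nn: "g0 y \<ge> 0" for y by (simp add: g0_def)
  \<comment> \<open>The value \<open>x0\<close> off the chart image makes \<open>T\<close> a total
    map into the manifold; the weight \<open>g0\<close> vanishes there.\<close>
  define T where "T a = (if lin a \<in> ?O then chart_inv c (lin a) else x0)" for a
  have T: "T \<in> LN \<rightarrow>\<^sub>M \<nu>"
  proof (rule measurable_\<nu>I)
    show "T a \<in> points S" for a
      using pointsI[OF c x0] pointsI[OF c chart_inv_in[of "lin a" c]] by (auto simp: T_def)
    fix W assume W: "openin (mtop S) W"
    have g: "\<forall>c\<in>S. good_chart c" using mfd_S by (simp add: mfd_def)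
    have oW: "open (snd c ` (fst c \<inter> W))" using W c openin_mtop[OF g] by blast
    have "T -` W \<inter> space LN = (lin -` (snd c ` (fst c \<inter> W)) \<inter> space LN) \<union>
        (if x0 \<in> W then lin -` (- ?O) \<inter> space LN else {})"
    proof -
      have "chart_inv c y \<in> W \<longleftrightarrow> y \<in> snd c ` (fst c \<inter> W)" if "y \<in> ?O" for y
        using that chart_inv_in[OF that] chart_chart_inv[OF that] chart_inv_chart[OF mfd_good_chart[OF mfd_S c]]
        by (metis (no_types, lifting) IntD2 IntI imageE image_eqI Int_iff)
      then show ?thesis by (auto simp: T_def split: if_splits)
    qed
    moreover have "lin -` (snd c ` (fst c \<inter> W)) \<inter> space LN \<in> sets LN"
      by (rule measurable_sets[OF lin_measurable]) (simp add: oW)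
    moreover have "lin -` (- ?O) \<inter> space LN \<in> sets LN"
      by (rule measurable_sets[OF lin_measurable]) (simp add: mO borel_comp)
    ultimately show "T -` W \<inter> space LN \<in> sets LN" by simp
  qed
  define N where "N = density LN (\<lambda>a. ennreal (g0 (lin a)))"
  have TN: "T \<in> N \<rightarrow>\<^sub>M \<nu>" using T by (simp add: N_def)
  have mc: "fst c \<in> sets \<nu>" by (rule openin_sets[OF chart_openin[OF c]])
  have eq: "distr N \<nu> T = density \<nu> (\<lambda>x. ennreal (indicator (fst c) x))"
  proof (rule measure_eqI)
    fix B assume "B \<in> sets (distr N \<nu> T)"
    then have B: "B \<in> sets \<nu>" by simp
    have "emeasure (distr N \<nu> T) B = emeasure N (T -` B \<inter> space LN)"
      using emeasure_distr[OF TN B] by (simp add: N_def)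
    also have "\<dots> = (\<integral>\<^sup>+ a. ennreal (g0 (lin a)) * indicator (T -` B \<inter> space LN) a \<partial>LN)"
      unfolding N_def using g0m measurable_sets[OF T B] by (intro emeasure_density) auto
    also have "\<dots> = (\<integral>\<^sup>+ a. ennreal \<bar>\<rho> c (lin a)\<bar> * indicator (snd c ` (B \<inter> fst c)) (lin a) \<partial>LN)"
    proof (rule nn_integral_cong)
      fix a assume a: "a \<in> space LN"
      show "ennreal (g0 (lin a)) * indicator (T -` B \<inter> space LN) a
          = ennreal \<bar>\<rho> c (lin a)\<bar> * indicator (snd c ` (B \<inter> fst c)) (lin a)"
      proof (cases "lin a \<in> ?O")
        case True
        have "T a \<in> B \<longleftrightarrow> lin a \<in> snd c ` (B \<inter> fst c)"
          using True chart_inv_in[OF True] chart_chart_inv[OF True] chart_inv_chart[OF mfd_good_chart[OF mfd_S c]]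
          unfolding T_def by (metis (no_types, lifting) IntD1 IntD2 IntI imageE image_eqI)
        then show ?thesis using True a by (simp add: g0_def indicator_def)
      next
        case False
        then have "lin a \<notin> snd c ` (B \<inter> fst c)" by blast
        then show ?thesis using False by (simp add: g0_def)
      qed
    qed
    also have "\<dots> = emeasure \<nu> (B \<inter> fst c)"
      using B mc by (intro emeasure_chart[OF c, symmetric]) auto
    also have "\<dots> = (\<integral>\<^sup>+ x. ennreal (indicator (fst c) x) * indicator B x \<partial>\<nu>)"
    proof -
      have "ennreal (indicator (fst c) x) * indicator B x = indicator (B \<inter> fst c) x" for x
        by (auto simp: indicator_def)
      then show ?thesis using B mc by simp
    qed
    also have "\<dots> = emeasure (density \<nu> (\<lambda>x. ennreal (indicator (fst c) x))) B"
      using B mc by (intro emeasure_density[symmetric]) auto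
    finally show "emeasure (distr N \<nu> T) B = emeasure (density \<nu> (\<lambda>x. ennreal (indicator (fst c) x))) B" .
  qed simp
  have "(\<integral>x. F x \<partial>\<nu>) = (\<integral>x. indicator (fst c) x *\<^sub>R F x \<partial>\<nu>)"
    by (rule Bochner_Integration.integral_cong[OF refl]) (auto simp: indicator_def out)
  also have "\<dots> = (\<integral>x. F x \<partial>density \<nu> (\<lambda>x. ennreal (indicator (fst c) x)))"
    using mc by (intro integral_density[symmetric] F) auto
  also have "\<dots> = (\<integral>x. F x \<partial>distr N \<nu> T)" by (simp add: eq)
  also have "\<dots> = (\<integral>a. F (T a) \<partial>N)" by (rule integral_distr[OF TN F])
  also have "\<dots> = (\<integral>a. g0 (lin a) *\<^sub>R F (T a) \<partial>LN)"
    unfolding N_def using g0nn by (intro integral_density g0m measurable_compose[OF T F]) auto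
  also have "\<dots> = (\<integral>a. (if lin a \<in> snd c ` fst c then \<bar>\<rho> c (lin a)\<bar> * F (chart_inv c (lin a)) else 0) \<partial>LN)"
    by (rule Bochner_Integration.integral_cong[OF refl]) (simp add: g0_def T_def)
  finally show ?thesis .
qed

text \<open>The preimage of a compact box is compact, hence closed in a Hausdorff space. A function
  supported in the box therefore vanishes on an open set that contains everything outside the chart,
  and extends by 0.\<close>

lemma chart_box_complement_openin:
  assumes "c \<in> S" "box y0 r \<subseteq> snd c ` fst c"
  shows "openin (mtop S) (points S - {x \<in> fst c. snd c x \<in> box y0 r})"
proof -
  let ?O = "snd c ` fst c"
  have g: "\<forall>c\<in>S. good_chart c" using mfd_S by (simp add: mfd_def)
  note gc = mfd_good_chart[OF mfd_S assms(1)]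
  have cm: "continuous_map (top_of_set ?O) (mtop S) (chart_inv c)"
    unfolding continuous_map_def
  proof (intro conjI allI impI)
    show "chart_inv c \<in> topspace (top_of_set ?O) \<rightarrow> topspace (mtop S)"
      using pointsI[OF assms(1) chart_inv_in] by (auto simp: topspace_mtop[OF mfd_S])
    fix W assume "openin (mtop S) W"
    then have "open (snd c ` (fst c \<inter> W))" using assms(1) openin_mtop[OF g] by blast
    moreover have "{y \<in> topspace (top_of_set ?O). chart_inv c y \<in> W} = snd c ` (fst c \<inter> W)"
      using chart_inv_chart[OF gc] by auto
    ultimately show "openin (top_of_set ?O) {y \<in> topspace (top_of_set ?O). chart_inv c y \<in> W}"
      by (auto intro!: open_subset)
  qed
  have "compactin (top_of_set ?O) (box y0 r)"
    using compact_box assms(2) by (simp add: compactin_subtopology)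
  from image_compactin[OF this cm] have "compactin (mtop S) (chart_inv c ` box y0 r)" .
  then have "closedin (mtop S) (chart_inv c ` box y0 r)"
    using manifold by (intro compactin_imp_closedin) (auto simp: smooth_manifold_def)
  moreover have "chart_inv c ` box y0 r = {x \<in> fst c. snd c x \<in> box y0 r}"
  proof (intro equalityI subsetI)
    fix x assume "x \<in> chart_inv c ` box y0 r"
    then obtain y where y: "y \<in> box y0 r" "x = chart_inv c y" by blast
    then have "y \<in> ?O" using assms(2) by blast
    then show "x \<in> {x \<in> fst c. snd c x \<in> box y0 r}" using y chart_inv_in[of y c] chart_chart_inv[of y c] by simp
  next
    fix x assume "x \<in> {x \<in> fst c. snd c x \<in> box y0 r}"
    then show "x \<in> chart_inv c ` box y0 r" using chart_inv_chart[OF gc, of x] by (metis (mono_tags, lifting) image_eqI mem_Collect_eq)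
  qed
  ultimately show ?thesis by (simp add: closedin_def topspace_mtop[OF mfd_S])
qed

end

section \<open>Divergence free fields and cutoffs\<close>

locale divergence_free_field = compact_volume n bs crd S \<mu> \<nu>
  for n and bs :: "nat \<Rightarrow> 'e::real_normed_vector" and crd and S :: "('x, 'e) atlas" and \<mu> \<nu> +
  fixes u :: "'x \<Rightarrow> 'x tvec"
  assumes div: "divergence_free S \<mu> u"
begin

lemma u_tangent: "x \<in> points S \<Longrightarrow> u x \<in> tangent_space S x"
  using div by (simp add: divergence_free_def smooth_vector_field_def)

abbreviation uc where "uc c \<equiv> (\<lambda>y. coord_rep S c (chart_inv c y) (u (chart_inv c y)))"

lemma uc_smooth_pt: "c \<in> S \<Longrightarrow> y \<in> snd c ` fst c \<Longrightarrow> smooth_pt (uc c) y"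
  using div unfolding divergence_free_def smooth_vector_field_def smooth_on_iff_smooth_pt by blast

text \<open>By \<open>\<Omega>_replace\<close> the sum in the definition is the trace of the
  derivative of \<open>uc c\<close> times the density: the condition reads div(\<rho> u) = 0 in
  coordinates.\<close>

lemma divergence_coord:
  assumes "c \<in> S" "y \<in> snd c ` fst c"
  shows "fd (\<rho> c) y (uc c y) + (\<Sum>i<n. crd i (fd (uc c) y (bs i))) * \<rho> c y = 0"
proof -
  interpret alternating_frame n bs crd "\<lambda>w. coord_density S \<mu> c w y" by (rule density_alternating[OF assms])
  have "fd (\<rho> c) y (uc c y) + (\<Sum>i<n. coord_density S \<mu> c (bs(i := fd (uc c) y (bs i))) y) = 0"
    using div assms unfolding divergence_free_def Let_def dim_n by blast
  then show ?thesis by (simp add: \<Omega>_replace sum_distrib_right)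
qed

lemma field_deriv_coord:
  assumes "C1_mfd S f" "c \<in> S" "y \<in> snd c ` fst c"
  shows "field_deriv S u f (chart_inv c y) = fd (\<lambda>y. f (chart_inv c y)) y (uc c y)"
  using field_deriv_chart[where u=u, OF mfd_S assms(1) u_tangent assms(2) chart_inv_in[OF assms(3)]]
    pointsI[OF assms(2) chart_inv_in[OF assms(3)]] chart_chart_inv[OF assms(3)] by simp

lemma C1_mfd_C1_at: "C1_mfd S f \<Longrightarrow> c \<in> S \<Longrightarrow> y \<in> snd c ` fst c \<Longrightarrow> C1_at (\<lambda>y. f (chart_inv c y)) y"
  by (auto simp: C1_mfd_def)

lemma field_deriv_continuous_mfd:
  assumes "C1_mfd S f"
  shows "continuous_mfd S (field_deriv S u f)"
  unfolding continuous_mfd_def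
proof (intro ballI)
  fix c x assume c: "c \<in> S" "x \<in> fst c"
  let ?y = "snd c x"
  have y: "?y \<in> snd c ` fst c" using c by blast
  have "isCont (\<lambda>y. \<Sum>i<n. crd i (uc c y) * fd (\<lambda>y. f (chart_inv c y)) y (bs i)) ?y"
    by (intro continuous_sum continuous_mult C1_at_isCont_fd C1_mfd_C1_at[OF assms c(1) y]
        smooth_pt_isCont[OF smooth_pt_linear_comp[OF crd_linear uc_smooth_pt[OF c(1) y]]])
  moreover have "\<forall>\<^sub>F y in nhds ?y. (\<Sum>i<n. crd i (uc c y) * fd (\<lambda>y. f (chart_inv c y)) y (bs i)) = field_deriv S u f (chart_inv c y)"
    using eventually_in_chart[OF mfd_good_chart[OF mfd_S c(1)] c(2)]
  proof eventually_elim
    case (elim y)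
    have "linear (\<lambda>v. fd (\<lambda>y. f (chart_inv c y)) y v)"
      by (rule linear_fd[OF C1_at_differentiable[OF C1_mfd_C1_at[OF assms c(1) elim]]])
    from linear_frame_expand[OF this, of "uc c y"] show ?case by (simp add: field_deriv_coord[OF assms c(1) elim])
  qed
  ultimately show "isCont (\<lambda>y. field_deriv S u f (chart_inv c y)) ?y" by (rule isCont_cong[THEN iffD1, rotated])
qed

lemma field_deriv_add:
  assumes "C1_mfd S f" "C1_mfd S g" "x \<in> points S"
  shows "field_deriv S u (\<lambda>x. f x + g x) x = field_deriv S u f x + field_deriv S u g x"
proof -
  obtain c where c: "c \<in> S" "x \<in> fst c" using assms(3) by (rule pointsE)
  have y: "snd c x \<in> snd c ` fst c" using c by blast
  have C: "C1_mfd S (\<lambda>x. f x + g x)" using assms by (simp add: C1_mfd_def C1_at_add)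
  note hd = has_derivative_fd[OF C1_at_differentiable[OF C1_mfd_C1_at[OF _ c(1) y]]]
  show ?thesis
    unfolding field_deriv_chart[where u=u, OF mfd_S assms(1) u_tangent[OF assms(3)] c] field_deriv_chart[where u=u, OF mfd_S assms(2) u_tangent[OF assms(3)] c]
      field_deriv_chart[where u=u, OF mfd_S C u_tangent[OF assms(3)] c]
    by (rule fd_unique[OF has_derivative_add[OF hd[OF assms(1)] hd[OF assms(2)]]])
qed

lemma field_deriv_zero_near:
  assumes "C1_mfd S f" "openin (mtop S) W" "x \<in> W" "\<And>z. z \<in> W \<Longrightarrow> f z = 0"
  shows "field_deriv S u f x = 0"
proof -
  have x: "x \<in> points S" using openin_subset[OF assms(2)] assms(3) topspace_mtop[OF mfd_S] by blast
  obtain c where c: "c \<in> S" "x \<in> fst c" using x by (rule pointsE)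
  have "\<forall>\<^sub>F y in nhds (snd c x). f (chart_inv c y) = 0"
    using eventually_openin_mtop[OF mfd_S assms(2) c assms(3)] by (rule eventually_mono) (rule assms(4))
  from fd_cong[OF this] show ?thesis by (simp add: field_deriv_chart[where u=u, OF mfd_S assms(1) u_tangent[OF x] c])
qed

context
  fixes c and \<phi> :: "'e \<Rightarrow> real" and y0 r
  assumes c: "c \<in> S" and box_O: "box y0 r \<subseteq> snd c ` fst c"
    and \<phi>_c1: "\<And>y. C1_at \<phi> y" and \<phi>_out: "\<And>y. y \<notin> box y0 r \<Longrightarrow> \<phi> y = 0"
begin

abbreviation "cutoff \<equiv> (\<lambda>x. if x \<in> fst c then \<phi> (snd c x) else 0)"

lemma cutoff_out: "x \<in> points S - {x \<in> fst c. snd c x \<in> box y0 r} \<Longrightarrow> cutoff x = 0"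
  using \<phi>_out by auto

text \<open>At points of the chart it is a C1 function of the coordinates; a point off the chart has
  a neighbourhood avoiding the box, where the function is 0.\<close>

lemma cutoff_C1_mfd: "C1_mfd S cutoff"
  unfolding C1_mfd_def
proof (intro ballI)
  fix d x assume d: "d \<in> S" "x \<in> fst d"
  show "C1_at (\<lambda>y. cutoff (chart_inv d y)) (snd d x)"
  proof (cases "x \<in> fst c")
    case True
    note css = mfd_cs_ident[OF mfd_S d(1) c d(2) True]
    have "C1_at (\<lambda>y. \<phi> (snd c (chart_inv d y))) (snd d x)"
      by (rule C1_at_compose[OF findim_frame smooth_pt_C1_at[OF chart_smoothD(4)[OF css]] \<phi>_c1])
    then show ?thesis by (rule C1_at_cong) (use chart_smoothD(3)[OF css] in eventually_elim, simp)
  next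
    case False
    then have "x \<in> points S - {x \<in> fst c. snd c x \<in> box y0 r}" using pointsI[OF d] by simp
    note ev = eventually_openin_mtop[OF mfd_S chart_box_complement_openin[OF c box_O] d this]
    show ?thesis by (rule C1_at_cong[OF C1_at_const[of 0]]) (use ev in eventually_elim, use cutoff_out in auto)
  qed
qed

text \<open>In the chart, the absolute density times the derivative of \<open>g\<close> along
  \<open>u\<close> is the coordinate divergence of the functions \<open>\<Psi> i\<close>, because
  the weighted field is divergence free by \<open>divergence_coord\<close>. Each summand integrates
  to 0 by \<open>integral_partial_derivative\<close>.\<close>

lemma integral_cutoff:
  assumes "C1_mfd S f"
  shows "(\<integral>x. field_deriv S u (\<lambda>x. f x * cutoff x) x \<partial>\<nu>) = 0"
proof -
  let ?O = "snd c ` fst c"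
  define g where "g = (\<lambda>x. f x * cutoff x)"
  have gC: "C1_mfd S g" unfolding g_def by (rule C1_mfd_mult[OF assms cutoff_C1_mfd])
  define H where "H = (\<lambda>y. g (chart_inv c y))"
  have Hc1: "C1_at H y" if "y \<in> ?O" for y unfolding H_def by (rule C1_mfd_C1_at[OF gC c that])
  have Hout: "H y = 0" if "y \<in> ?O" "y \<notin> box y0 r" for y
    using that \<phi>_out chart_chart_inv[OF that(1)] by (simp add: H_def g_def)
  have opO: "open ?O" using mfd_good_chart[OF mfd_S c] by (simp add: good_chart_def)
  have opQ: "open (- box y0 r)" using compact_imp_closed[OF compact_box] by (simp add: open_Compl)
  \<comment> \<open>The components of the weighted field times \<open>H\<close>, extended by 0 off
    the chart image; since \<open>H\<close> vanishes on the chart image outside the box, the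
    extension is C1 on the whole model space.\<close>
  define \<Psi> where "\<Psi> i y = (if y \<in> ?O then crd i (uc c y) * \<bar>\<rho> c y\<bar> * H y else 0)" for i y
  have \<Psi>out: "\<Psi> i y = 0" if "y \<notin> box y0 r" for i y using Hout that by (simp add: \<Psi>_def)
  have ev0: "\<forall>\<^sub>F z in nhds y. \<Psi> i z = 0" if "y \<notin> box y0 r" for i y
    unfolding eventually_nhds using that opQ \<Psi>out by (intro exI[of _ "- box y0 r"]) auto
  \<comment> \<open>The absolute value is not differentiable at 0, but a nonvanishing density keeps
    its sign near \<open>y\<close>, so there it may be replaced by the smooth function
    \<open>s y * \<rho> c z\<close> of \<open>z\<close>.\<close>
  define s where "s y = sgn (\<rho> c y)" for y
  have evO: "\<forall>\<^sub>F z in nhds y. \<Psi> i z = (s y * (crd i (uc c z) * \<rho> c z)) * H z" if y: "y \<in> ?O" for i y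
  proof -
    have "\<forall>\<^sub>F z in nhds y. z \<in> ?O" using opO y by (auto simp: eventually_nhds)
    moreover have "\<forall>\<^sub>F z in nhds y. s y * \<rho> c z > 0"
    proof (rule smooth_pt_eventually_comp[OF density_smooth_pt[OF c y], where P="\<lambda>t. s y * t > 0"])
      have "open {t. s y * t > 0}" by (intro open_Collect_less continuous_intros)
      moreover have "s y * \<rho> c y > 0" using density_nonzero[OF c y] by (simp add: s_def sgn_mult_self_eq[symmetric] sgn_if)
      ultimately show "\<forall>\<^sub>F t in nhds (\<rho> c y). s y * t > 0" unfolding eventually_nhds by (intro exI[of _ "{t. s y * t > 0}"]) auto
    qed
    ultimately show ?thesis
    proof eventually_elim
      case (elim z)
      have "\<bar>\<rho> c z\<bar> = s y * \<rho> c z"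
        using elim(2) by (auto simp: s_def sgn_if split: if_splits)
      then show ?case using elim(1) by (simp add: \<Psi>_def)
    qed
  qed
  have smu: "smooth_pt (\<lambda>z. crd i (uc c z)) y" if "y \<in> ?O" for i y
    by (rule smooth_pt_linear_comp[OF crd_linear uc_smooth_pt[OF c that]])
  have \<Psi>C1_at: "C1_at (\<Psi> i) y" for i y
  proof (cases "y \<in> ?O")
    case True
    have "C1_at (\<lambda>z. (s y * (crd i (uc c z) * \<rho> c z)) * H z) y"
      by (intro C1_at_mult smooth_pt_C1_at smooth_pt_mult smooth_pt_const smu density_smooth_pt[OF c] True Hc1)
    then show ?thesis by (rule C1_at_cong) (rule eventually_mono[OF evO[OF True]], rule sym)
  next
    case False
    then have "y \<notin> box y0 r" using box_O by blast
    show ?thesis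
      by (rule C1_at_cong[OF C1_at_const[of 0]], rule eventually_mono[OF ev0[OF \<open>y \<notin> box y0 r\<close>]], rule sym)
  qed
  have div\<Psi>: "(\<Sum>i<n. fd (\<Psi> i) y (bs i)) = (if y \<in> ?O then \<bar>\<rho> c y\<bar> * field_deriv S u g (chart_inv c y) else 0)" for y
  proof (cases "y \<in> ?O")
    case True
    have fdu: "fd (\<lambda>z. crd i (uc c z)) y v = crd i (fd (uc c) y v)" for i v
      by (rule fd_unique) (rule bounded_linear.has_derivative[OF crd_linear smooth_pt_has_derivative[OF uc_smooth_pt[OF c True]]])
    have term_eq: "fd (\<Psi> i) y (bs i) = s y * (crd i (uc c y) * fd (\<rho> c) y (bs i) * H y
        + crd i (fd (uc c) y (bs i)) * \<rho> c y * H y + crd i (uc c y) * \<rho> c y * fd H y (bs i))" for i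
    proof -
      have "((\<lambda>z. (s y * (crd i (uc c z) * \<rho> c z)) * H z) has_derivative
          (\<lambda>v. (s y * (crd i (uc c y) * \<rho> c y)) * fd H y v
            + (s y * (crd i (uc c y) * fd (\<rho> c) y v + fd (\<lambda>z. crd i (uc c z)) y v * \<rho> c y)) * H y)) (at y)"
        by (intro has_derivative_mult has_derivative_mult_right has_derivative_fd[OF C1_at_differentiable[OF Hc1[OF True]]]
            smooth_pt_has_derivative smu[OF True] density_smooth_pt[OF c True])
      from fd_unique[OF this, of "bs i"] fd_cong[OF evO[OF True, of i]] show ?thesis
        by (simp add: fdu algebra_simps)
    qed
    have lin1: "fd (\<rho> c) y (uc c y) = (\<Sum>i<n. crd i (uc c y) * fd (\<rho> c) y (bs i))"
      using linear_frame_expand[OF smooth_pt_linear_fd[OF density_smooth_pt[OF c True]], of "uc c y"] unfolding real_scaleR_def .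
    have lin2: "fd H y (uc c y) = (\<Sum>i<n. crd i (uc c y) * fd H y (bs i))"
      using linear_frame_expand[OF linear_fd[OF C1_at_differentiable[OF Hc1[OF True]]], of "uc c y"] unfolding real_scaleR_def .
    have "(\<Sum>i<n. fd (\<Psi> i) y (bs i)) = s y * H y * (fd (\<rho> c) y (uc c y) + (\<Sum>i<n. crd i (fd (uc c) y (bs i))) * \<rho> c y)
        + s y * \<rho> c y * fd H y (uc c y)"
      unfolding term_eq lin1 lin2
      by (simp add: sum.distrib sum_distrib_left sum_distrib_right distrib_left algebra_simps)
    also have "\<dots> = \<bar>\<rho> c y\<bar> * fd H y (uc c y)"
      using divergence_coord[OF c True] by (simp add: s_def abs_sgn mult.commute)
    finally show ?thesis using field_deriv_coord[OF gC c True] True by (simp add: H_def)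
  next
    case False
    then have "y \<notin> box y0 r" using box_O by blast
    then show ?thesis using False fd_cong[OF ev0] by simp
  qed
  have "field_deriv S u g x = 0" if "x \<notin> fst c" "x \<in> points S" for x
  proof (rule field_deriv_zero_near[OF gC chart_box_complement_openin[OF c box_O]])
    show "x \<in> points S - {x \<in> fst c. snd c x \<in> box y0 r}" using that by simp
    show "g z = 0" if "z \<in> points S - {x \<in> fst c. snd c x \<in> box y0 r}" for z
      using cutoff_out[OF that] by (simp add: g_def)
  qed
  then have "(\<integral>x. field_deriv S u g x \<partial>\<nu>) = (\<integral>x. (if x \<in> fst c then field_deriv S u g x else 0) \<partial>\<nu>)"
    by (intro Bochner_Integration.integral_cong[OF refl]) (simp add: space_\<nu>)
  also have "\<dots> = (\<integral>a. (if lin a \<in> ?O then \<bar>\<rho> c (lin a)\<bar> * (if chart_inv c (lin a) \<in> fst c then field_deriv S u g (chart_inv c (lin a)) else 0) else 0) \<partial>LN)"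
  proof (rule integral_chart[OF c])
    have "fst c \<in> sets \<nu>" by (rule openin_sets[OF chart_openin[OF c]])
    then show "(\<lambda>x. if x \<in> fst c then field_deriv S u g x else 0) \<in> borel_measurable \<nu>"
      by (intro measurable_If_set[OF continuous_mfd_measurable[OF field_deriv_continuous_mfd[OF gC]] borel_measurable_const]) simp
  qed simp
  also have "\<dots> = (\<integral>a. (\<Sum>i<n. fd (\<Psi> i) (lin a) (bs i)) \<partial>LN)"
    by (rule Bochner_Integration.integral_cong[OF refl]) (simp add: div\<Psi> chart_inv_in)
  also have "\<dots> = (\<Sum>i<n. (\<integral>a. fd (\<Psi> i) (lin a) (bs i) \<partial>LN))"
  proof (rule Bochner_Integration.integral_sum)
    fix i
    show "integrable LN (\<lambda>a. fd (\<Psi> i) (lin a) (bs i))"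
    proof (rule integrable_box)
      show "continuous_on UNIV (\<lambda>y. fd (\<Psi> i) y (bs i))"
        using C1_at_isCont_fd[OF \<Psi>C1_at] by (simp add: continuous_at_imp_continuous_on)
      show "fd (\<Psi> i) y (bs i) = 0" if "y \<notin> box y0 r" for y using fd_cong[OF ev0[OF that]] by simp
    qed
  qed
  also have "\<dots> = 0"
    using integral_partial_derivative[OF \<Psi>C1_at \<Psi>out] by (intro sum.neutral) auto
  finally show ?thesis by (simp add: g_def)
qed

end

text \<open>Instead of a partition of unity, the factor \<open>1\<close> is replaced by \<open>\<Prod>(1 - b)\<close> over bump functions \<open>b\<close>,
  one at a time; the integral does not change, and the product vanishes once the bumps cover \<open>S\<close>.\<close>

lemma integral_field_deriv_zero:
  assumes "C1_mfd S f"
  shows "(\<integral>x. field_deriv S u f x \<partial>\<nu>) = 0"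
proof -
  \<comment> \<open>The quantification over all \<open>f\<close> matters: the induction applies it
    to \<open>f x * p x\<close>, with \<open>p\<close> the product of the factors collected so
    far.\<close>
  define good where "good W \<longleftrightarrow> (\<exists>b. C1_mfd S b \<and> (\<forall>x\<in>W. b x = 1) \<and>
      (\<forall>f. C1_mfd S f \<longrightarrow> (\<integral>x. field_deriv S u (\<lambda>x. f x * b x) x \<partial>\<nu>) = 0))" for W
  have "\<exists>W. openin (mtop S) W \<and> x \<in> W \<and> good W" if "x \<in> points S" for x
  proof -
    obtain c where c: "c \<in> S" "x \<in> fst c" using \<open>x \<in> points S\<close> by (rule pointsE)
    obtain r where r: "r > 0" "box (snd c x) r \<subseteq> snd c ` fst c" using box_chart[OF c] .
    obtain \<phi> :: "'e \<Rightarrow> real" and V where "\<forall>y. C1_at \<phi> y" "\<forall>y. y \<notin> box (snd c x) r \<longrightarrow> \<phi> y = 0"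
      and \<phi>: "open V" "snd c x \<in> V" "\<forall>y\<in>V. \<phi> y = 1"
      using bump_exists[OF r(1), of "snd c x"] by auto
    then have \<phi>c: "\<And>y. C1_at \<phi> y" "\<And>y. y \<notin> box (snd c x) r \<Longrightarrow> \<phi> y = 0" by auto
    let ?W = "{x \<in> fst c. snd c x \<in> V}"
    have "good ?W" unfolding good_def
      by (rule exI[of _ "\<lambda>x. if x \<in> fst c then \<phi> (snd c x) else 0"])
        (use cutoff_C1_mfd[OF c(1) r(2) \<phi>c] integral_cutoff[OF c(1) r(2) \<phi>c] \<phi>(3) in simp)
    then show ?thesis using openin_chart_preimage[OF mfd_S c(1) \<phi>(1)] c(2) \<phi>(2) by (intro exI[of _ ?W]) simp
  qed
  then obtain F where F: "finite F" "\<And>W. W \<in> F \<Longrightarrow> openin (mtop S) W \<and> good W" "points S = \<Union>F"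
    using compact_finite_subcover[OF mfd_S compact, of good] by blast
  have "\<exists>p. C1_mfd S p \<and> (\<forall>x\<in>\<Union>F. p x = 0) \<and>
      (\<forall>f. C1_mfd S f \<longrightarrow> (\<integral>x. field_deriv S u f x \<partial>\<nu>) = (\<integral>x. field_deriv S u (\<lambda>x. f x * p x) x \<partial>\<nu>))"
    using F(1,2)
  proof (induction F)
    case empty
    show ?case by (rule exI[of _ "\<lambda>_. 1"]) (simp add: C1_mfd_const)
  next
    case (insert W F)
    then obtain p where p: "C1_mfd S p" "\<And>x. x \<in> \<Union>F \<Longrightarrow> p x = 0"
      "\<And>f. C1_mfd S f \<Longrightarrow> (\<integral>x. field_deriv S u f x \<partial>\<nu>) = (\<integral>x. field_deriv S u (\<lambda>x. f x * p x) x \<partial>\<nu>)" by auto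
    obtain b where b: "C1_mfd S b" "\<And>x. x \<in> W \<Longrightarrow> b x = 1"
      "\<And>f. C1_mfd S f \<Longrightarrow> (\<integral>x. field_deriv S u (\<lambda>x. f x * b x) x \<partial>\<nu>) = 0"
      using insert.prems[of W] unfolding good_def by auto
    let ?p = "\<lambda>x. p x * (1 - b x)"
    have "(\<integral>x. field_deriv S u f x \<partial>\<nu>) = (\<integral>x. field_deriv S u (\<lambda>x. f x * ?p x) x \<partial>\<nu>)" if f: "C1_mfd S f" for f
    proof -
      note fp = C1_mfd_mult[OF f p(1)]
      have C1: "C1_mfd S (\<lambda>x. (f x * p x) * b x)" "C1_mfd S (\<lambda>x. f x * ?p x)"
        by (intro C1_mfd_mult C1_mfd_diff C1_mfd_const f p(1) b(1))+
      have "(\<integral>x. field_deriv S u (\<lambda>x. f x * p x) x \<partial>\<nu>) = (\<integral>x. field_deriv S u (\<lambda>x. (f x * p x) * b x) x + field_deriv S u (\<lambda>x. f x * ?p x) x \<partial>\<nu>)"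
      proof (rule Bochner_Integration.integral_cong[OF refl])
        fix x assume "x \<in> space \<nu>"
        then have x: "x \<in> points S" by (simp add: space_\<nu>)
        have "(\<lambda>x. f x * p x) = (\<lambda>x. (f x * p x) * b x + f x * ?p x)" by (auto simp: algebra_simps)
        then show "field_deriv S u (\<lambda>x. f x * p x) x = field_deriv S u (\<lambda>x. (f x * p x) * b x) x + field_deriv S u (\<lambda>x. f x * ?p x) x"
          using field_deriv_add[OF C1 x] by simp
      qed
      also have "\<dots> = (\<integral>x. field_deriv S u (\<lambda>x. (f x * p x) * b x) x \<partial>\<nu>) + (\<integral>x. field_deriv S u (\<lambda>x. f x * ?p x) x \<partial>\<nu>)"
        by (intro Bochner_Integration.integral_add continuous_mfd_integrable field_deriv_continuous_mfd C1)
      finally show ?thesis using p(3)[OF f] b(3)[OF fp] by simp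
    qed
    moreover have "C1_mfd S ?p" by (intro C1_mfd_mult C1_mfd_diff C1_mfd_const p(1) b(1))
    moreover have "?p x = 0" if "x \<in> \<Union>(insert W F)" for x using that p(2) b(2) by auto
    ultimately show ?case by blast
  qed
  then obtain p where p: "C1_mfd S p" "\<And>x. x \<in> points S \<Longrightarrow> p x = 0"
      "\<And>f. C1_mfd S f \<Longrightarrow> (\<integral>x. field_deriv S u f x \<partial>\<nu>) = (\<integral>x. field_deriv S u (\<lambda>x. f x * p x) x \<partial>\<nu>)"
    unfolding F(3)[symmetric] by blast
  have op: "openin (mtop S) (points S)" using openin_topspace[of "mtop S"] by (simp add: topspace_mtop[OF mfd_S])
  have "(\<integral>x. field_deriv S u (\<lambda>x. f x * p x) x \<partial>\<nu>) = (\<integral>x. 0 \<partial>\<nu>)"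
    by (rule Bochner_Integration.integral_cong[OF refl], rule field_deriv_zero_near[OF C1_mfd_mult[OF assms p(1)] op])
      (simp_all add: space_\<nu> p(2))
  then show ?thesis using p(3)[OF assms] by simp
qed

end

text \<open>On a smooth function \<open>field_deriv\<close> agrees with the derivation, and any
  frame of the model space gives entry to the locale.\<close>

theorem integral_divergence_free:
  fixes S :: "('x, 'e::real_normed_vector) atlas"
  assumes "smooth_manifold S" "compact_space (mtop S)" "volume_form S \<mu>" "volume_measure S \<mu> \<nu>"
    and "divergence_free S \<mu> u" "smooth_fun S h"
  shows "(\<integral>x. u x h \<partial>\<nu>) = 0"
proof -
  obtain bs :: "nat \<Rightarrow> 'e" and crd where b: "frame (dim (UNIV :: 'e set)) bs crd"
    "inj_on bs {..<dim (UNIV :: 'e set)}" "independent (bs ` {..<dim (UNIV :: 'e set)})"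
    using frame_exists[OF mfd_findim[OF smooth_manifold_mfd[OF assms(1)]]] by blast
  interpret divergence_free_field "dim (UNIV :: 'e set)" bs crd S \<mu> \<nu> u
    using b assms by (simp add: divergence_free_field_def divergence_free_field_axioms_def
        compact_volume_def compact_volume_axioms_def)
  have "(\<integral>x. u x h \<partial>\<nu>) = (\<integral>x. field_deriv S u h x \<partial>\<nu>)"
    by (rule Bochner_Integration.integral_cong[OF refl])
      (simp add: space_\<nu> field_deriv_smooth_fun[OF mfd_S assms(6)] u_tangent)
  then show ?thesis using integral_field_deriv_zero[OF smooth_fun_C1_mfd[OF assms(6)]] by simp
qed

theorem volume_measure_compact:
  fixes S :: "('x, 'e::real_normed_vector) atlas"
  assumes "smooth_manifold S" "compact_space (mtop S)" "volume_form S \<mu>" "volume_measure S \<mu> \<nu>"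
  shows "finite_measure \<nu>" and "space \<nu> = points S"
    and "continuous_mfd S \<phi> \<Longrightarrow> integrable \<nu> \<phi>"
proof -
  obtain bs :: "nat \<Rightarrow> 'e" and crd where b: "frame (dim (UNIV :: 'e set)) bs crd"
    "inj_on bs {..<dim (UNIV :: 'e set)}" "independent (bs ` {..<dim (UNIV :: 'e set)})"
    using frame_exists[OF mfd_findim[OF smooth_manifold_mfd[OF assms(1)]]] by blast
  interpret compact_volume "dim (UNIV :: 'e set)" bs crd S \<mu> \<nu>
    using b assms by (simp add: compact_volume_def compact_volume_axioms_def)
  show "finite_measure \<nu>" "space \<nu> = points S" by (rule finite_\<nu>, rule space_\<nu>)
  show "continuous_mfd S \<phi> \<Longrightarrow> integrable \<nu> \<phi>" by (rule continuous_mfd_integrable)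
qed

section \<open>Differentiation under the integral sign\<close>

lemma fd_slice1:
  assumes "smooth_pt \<Phi> (t, y)"
  shows "((\<lambda>t. \<Phi> (t, y)) has_derivative (\<lambda>s. fd \<Phi> (t, y) (s, 0))) (at t)"
proof -
  have "((\<lambda>t. (t, y)) has_derivative (\<lambda>s. (s, 0))) (at t)"
    by (auto intro!: derivative_eq_intros)
  from has_derivative_compose[OF this, of \<Phi> "\<lambda>v. fd \<Phi> (t, y) v"] smooth_pt_has_derivative[OF assms]
  show ?thesis by simp
qed

lemma fd_slice2:
  assumes "smooth_pt \<Phi> (t, y)"
  shows "((\<lambda>y. \<Phi> (t, y)) has_derivative (\<lambda>w. fd \<Phi> (t, y) (0, w))) (at y)"
proof -
  have "((\<lambda>y. (t, y)) has_derivative (\<lambda>w. (0, w))) (at y)"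
    by (auto intro!: derivative_eq_intros)
  from has_derivative_compose[OF this, of \<Phi> "\<lambda>v. fd \<Phi> (t, y) v"] smooth_pt_has_derivative[OF assms]
  show ?thesis by simp
qed

lemma real_derivative_slice:
  fixes J :: "real \<times> 'e::real_normed_vector \<Rightarrow> real"
  assumes "smooth_pt J (t, y)"
  shows "((\<lambda>t. J (t, y)) has_real_derivative fd J (t, y) (1, 0)) (at t)"
proof -
  have "(\<lambda>s. fd J (t, y) (s, 0)) = (*) (fd J (t, y) (1, 0))"
  proof
    fix s show "fd J (t, y) (s, 0) = fd J (t, y) (1, 0) * s"
      using linear_scale[OF smooth_pt_linear_fd[OF assms], of s "(1, 0)"] by (simp add: mult.commute)
  qed
  then show ?thesis using fd_slice1[OF assms] by (simp add: has_field_derivative_def)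
qed

lemma eventually_slice1:
  fixes t :: "'a::real_normed_vector" and y :: "'b::real_normed_vector"
  assumes "\<forall>\<^sub>F z in nhds (t, y). P z"
  shows "\<forall>\<^sub>F s in nhds t. P (s, y)"
  by (rule smooth_pt_eventually_comp[where f="\<lambda>s. (s, y)", OF smooth_pt_Pair[OF smooth_pt_ident smooth_pt_const]]) (rule assms)

lemma eventually_slice2:
  fixes t :: "'a::real_normed_vector" and y :: "'b::real_normed_vector"
  assumes "\<forall>\<^sub>F z in nhds (t, y). P z"
  shows "\<forall>\<^sub>F y in nhds y. P (t, y)"
  by (rule smooth_pt_eventually_comp[where f="\<lambda>y. (t, y)", OF smooth_pt_Pair[OF smooth_pt_const smooth_pt_ident]]) (rule assms)

text \<open>Dominated convergence for difference quotients along sequences: the Lipschitz bound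
  dominates them by the constant \<open>B\<close>, which is integrable for a finite measure.\<close>

lemma derivative_under_integral:
  fixes I :: "real \<Rightarrow> 'x \<Rightarrow> real"
  assumes "finite_measure \<nu>" and int: "\<And>t. integrable \<nu> (I t)"
    and der: "\<And>x. x \<in> space \<nu> \<Longrightarrow> ((\<lambda>t. I t x) has_real_derivative I' x) (at 0)"
    and I': "I' \<in> borel_measurable \<nu>" and \<delta>: "\<delta> > 0"
    and bd: "\<And>x t. x \<in> space \<nu> \<Longrightarrow> \<bar>t\<bar> < \<delta> \<Longrightarrow> \<bar>I t x - I 0 x\<bar> \<le> B * \<bar>t\<bar>"
  shows "((\<lambda>t. \<integral>x. I t x \<partial>\<nu>) has_real_derivative (\<integral>x. I' x \<partial>\<nu>)) (at 0)"
proof -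
  interpret finite_measure \<nu> by fact
  have "((\<lambda>h. ((\<integral>x. I (0 + h) x \<partial>\<nu>) - (\<integral>x. I 0 x \<partial>\<nu>)) / h) \<longlongrightarrow> (\<integral>x. I' x \<partial>\<nu>)) (at 0)"
    unfolding tendsto_at_iff_sequentially
  proof (intro allI impI)
    fix X :: "nat \<Rightarrow> real" assume X: "\<forall>i. X i \<in> UNIV - {0}" "X \<longlonglongrightarrow> 0"
    have "\<forall>\<^sub>F k in sequentially. \<bar>X k\<bar> < \<delta>" using tendstoD[OF X(2) \<delta>] by simp
    \<comment> \<open>Drops an initial segment of the sequence, since the bound is available only
      for times below \<open>\<delta>\<close>.\<close>
    then obtain N where N: "\<And>k. k \<ge> N \<Longrightarrow> \<bar>X k\<bar> < \<delta>" by (auto simp: eventually_sequentially)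
    define s where "s k x = (I (X (k + N)) x - I 0 x) / X (k + N)" for k x
    have "(\<lambda>k. \<integral>x. s k x \<partial>\<nu>) \<longlonglongrightarrow> (\<integral>x. I' x \<partial>\<nu>)"
    proof (rule integral_dominated_convergence[where w="\<lambda>_. B"])
      show "I' \<in> borel_measurable \<nu>" by fact
      show "s k \<in> borel_measurable \<nu>" for k
        unfolding s_def[abs_def] using int by (intro borel_measurable_divide borel_measurable_diff) auto
      show "integrable \<nu> (\<lambda>_. B)" by simp
      show "AE x in \<nu>. (\<lambda>k. s k x) \<longlonglongrightarrow> I' x"
      proof (rule AE_I2)
        fix x assume "x \<in> space \<nu>"
        from der[OF this] have "((\<lambda>h. (I (0 + h) x - I 0 x) / h) \<longlongrightarrow> I' x) (at 0)" by (simp add: DERIV_def)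
        then have "(\<lambda>k. (I (0 + X k) x - I 0 x) / X k) \<longlonglongrightarrow> I' x"
          unfolding tendsto_at_iff_sequentially using X by (auto simp: o_def)
        from LIMSEQ_ignore_initial_segment[OF this, of N] show "(\<lambda>k. s k x) \<longlonglongrightarrow> I' x" by (simp add: s_def)
      qed
      show "AE x in \<nu>. norm (s k x) \<le> B" for k
      proof (rule AE_I2)
        fix x assume x: "x \<in> space \<nu>"
        have "\<bar>X (k + N)\<bar> > 0" using X(1) by simp
        then show "norm (s k x) \<le> B" using bd[OF x N[of "k + N"]] by (simp add: s_def abs_divide divide_le_eq)
      qed
    qed
    moreover have "(\<integral>x. s k x \<partial>\<nu>) = ((\<integral>x. I (0 + X (k + N)) x \<partial>\<nu>) - (\<integral>x. I 0 x \<partial>\<nu>)) / X (k + N)" for k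
      unfolding s_def using int by simp
    ultimately have "(\<lambda>k. ((\<integral>x. I (0 + X (k + N)) x \<partial>\<nu>) - (\<integral>x. I 0 x \<partial>\<nu>)) / X (k + N)) \<longlonglongrightarrow> (\<integral>x. I' x \<partial>\<nu>)" by simp
    from LIMSEQ_offset[OF this]
    show "((\<lambda>h. ((\<integral>x. I (0 + h) x \<partial>\<nu>) - (\<integral>x. I 0 x \<partial>\<nu>)) / h) \<circ> X) \<longlonglongrightarrow> (\<integral>x. I' x \<partial>\<nu>)"
      by (simp add: o_def)
  qed
  then show ?thesis by (simp add: DERIV_def)
qed

text \<open>Joint smoothness in time and base coordinates, demanded only of the germ at time 0,
  where the derivative is taken. The witness \<open>J\<close> is unconstrained away from
  \<open>(0, snd c x)\<close>.\<close>

definition smooth_family :: "('a, 'e::real_normed_vector) atlas \<Rightarrow> (real \<Rightarrow> 'a \<Rightarrow> real) \<Rightarrow> bool" where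
  "smooth_family S I \<longleftrightarrow> (\<forall>c\<in>S. \<forall>x\<in>fst c. \<exists>J. smooth_pt J (0, snd c x) \<and>
     (\<forall>\<^sub>F z in nhds (0, snd c x). J z = I (fst z) (chart_inv c (snd z))))"

lemma smooth_familyE:
  fixes S :: "('a, 'e::real_normed_vector) atlas"
  assumes "smooth_family S I" "c \<in> S" "x \<in> fst c"
  obtains J :: "real \<times> 'e \<Rightarrow> real" where "smooth_pt J (0, snd c x)"
    "\<forall>\<^sub>F z in nhds (0, snd c x). J z = I (fst z) (chart_inv c (snd z))"
  using assms unfolding smooth_family_def by blast

lemma smooth_family_derivative:
  assumes "smooth_family S I" "mfd S" "x \<in> points S"
  shows "((\<lambda>t. I t x) has_real_derivative deriv (\<lambda>t. I t x) 0) (at 0)"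
proof -
  obtain c where c: "c \<in> S" "x \<in> fst c" using assms(3) by (rule pointsE)
  obtain J where J: "smooth_pt J (0, snd c x)" "\<forall>\<^sub>F z in nhds (0, snd c x). J z = I (fst z) (chart_inv c (snd z))"
    using smooth_familyE[OF assms(1) c] .
  have "\<forall>\<^sub>F t in nhds 0. J (t, snd c x) = I t x"
    using eventually_slice1[OF J(2)] chart_inv_chart[OF mfd_good_chart[OF assms(2) c(1)] c(2)] by simp
  then have "((\<lambda>t. I t x) has_real_derivative fd J (0, snd c x) (1, 0)) (at 0)"
    using real_derivative_slice[OF J(1)] DERIV_cong_ev[of 0 0 "\<lambda>t. J (t, snd c x)" "\<lambda>t. I t x"] by blast
  then show ?thesis using DERIV_imp_deriv by fastforce
qed

text \<open>The time derivative at a neighbouring \<open>y\<close> is the partial derivative of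
  \<open>J\<close> at \<open>(0, y)\<close>, which is continuous in \<open>y\<close>. For this
  \<open>J\<close> must agree with the family near each such \<open>(0, y)\<close>, which
  \<open>eventually_eventually\<close> provides.\<close>

lemma smooth_family_deriv_continuous_mfd:
  assumes "smooth_family S I" "mfd S"
  shows "continuous_mfd S (\<lambda>x. deriv (\<lambda>t. I t x) 0)"
  unfolding continuous_mfd_def
proof (intro ballI)
  fix c x assume c: "c \<in> S" "x \<in> fst c"
  obtain J where J: "smooth_pt J (0, snd c x)" "\<forall>\<^sub>F z in nhds (0, snd c x). J z = I (fst z) (chart_inv c (snd z))"
    using smooth_familyE[OF assms(1) c] .
  have "\<forall>\<^sub>F z in nhds (0, snd c x). smooth_pt J z \<and> (\<forall>\<^sub>F z in nhds z. J z = I (fst z) (chart_inv c (snd z)))"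
    using smooth_pt_eventually[OF J(1)] iffD2[OF eventually_eventually J(2)] by (rule eventually_conj)
  from eventually_slice2[OF this]
  have ev: "\<forall>\<^sub>F y in nhds (snd c x). fd J (0, y) (1, 0) = deriv (\<lambda>t. I t (chart_inv c y)) 0"
  proof eventually_elim
    case (elim y)
    then have "\<forall>\<^sub>F t in nhds 0. J (t, y) = I t (chart_inv c y)" using eventually_slice1[where t=0 and y=y, of "\<lambda>z. J z = I (fst z) (chart_inv c (snd z))"] by simp
    then have "((\<lambda>t. I t (chart_inv c y)) has_real_derivative fd J (0, y) (1, 0)) (at 0)"
      using real_derivative_slice[of J 0 y] elim DERIV_cong_ev[of 0 0 "\<lambda>t. J (t, y)" "\<lambda>t. I t (chart_inv c y)"] by blast
    then show ?case using DERIV_imp_deriv by fastforce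
  qed
  have cont: "isCont (\<lambda>z. fd J z (1, 0)) (0, snd c x)" by (rule smooth_pt_isCont[OF smooth_pt_fd[OF J(1)]])
  have "isCont (\<lambda>y. fd J (0, y) (1, 0)) (snd c x)"
    by (rule isCont_o2[where g="\<lambda>z. fd J z (1, 0)" and f="\<lambda>y. (0, y)" and a="snd c x", OF _ cont]) (intro continuous_intros)
  then show "isCont (\<lambda>y. deriv (\<lambda>t. I t (chart_inv c y)) 0) (snd c x)"
    using ev by (rule isCont_cong[THEN iffD1, rotated])
qed

text \<open>On a product neighbourhood the time derivative of \<open>J\<close> is bounded by its
  absolute value at the centre plus 1; the mean value inequality turns this into a Lipschitz bound
  uniform in the point.\<close>

lemma smooth_family_locally_lipschitz:
  assumes "smooth_family S I" "mfd S" "x \<in> points S"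
  shows "\<exists>W. openin (mtop S) W \<and> x \<in> W \<and>
    (\<exists>\<delta>>0. \<exists>B\<ge>0. \<forall>x\<in>W. \<forall>t. \<bar>t\<bar> < \<delta> \<longrightarrow> \<bar>I t x - I 0 x\<bar> \<le> B * \<bar>t\<bar>)"
proof -
  obtain c where c: "c \<in> S" "x \<in> fst c" using assms(3) by (rule pointsE)
  obtain J where J: "smooth_pt J (0, snd c x)" "\<forall>\<^sub>F z in nhds (0, snd c x). J z = I (fst z) (chart_inv c (snd z))"
    using smooth_familyE[OF assms(1) c] .
  let ?D = "\<lambda>z. fd J z (1, 0)"
  define B where "B = \<bar>?D (0, snd c x)\<bar> + 1"
  have "\<forall>\<^sub>F z in nhds (0, snd c x). \<bar>?D z\<bar> \<le> B"
  proof (rule smooth_pt_eventually_comp[OF smooth_pt_fd[OF J(1)], where P="\<lambda>d. \<bar>d\<bar> \<le> B"])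
    show "\<forall>\<^sub>F d in nhds (?D (0, snd c x)). \<bar>d\<bar> \<le> B"
      unfolding eventually_nhds by (intro exI[of _ "ball (?D (0, snd c x)) 1"]) (auto simp: B_def dist_real_def)
  qed
  with J(2) smooth_pt_eventually[OF J(1)]
  have "\<forall>\<^sub>F z in nhds (0, snd c x). J z = I (fst z) (chart_inv c (snd z)) \<and> smooth_pt J z \<and> \<bar>?D z\<bar> \<le> B"
    by eventually_elim simp
  then obtain Z where Z: "open Z" "(0, snd c x) \<in> Z"
    "\<And>z. z \<in> Z \<Longrightarrow> J z = I (fst z) (chart_inv c (snd z)) \<and> smooth_pt J z \<and> \<bar>?D z\<bar> \<le> B"
    by (auto simp: eventually_nhds)
  obtain T V where TV': "open T" "open V" "(0, snd c x) \<in> T \<times> V" "T \<times> V \<subseteq> Z"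
    using open_prod_elim[OF Z(1,2)] .
  then have TV: "open T" "open V" "0 \<in> T" "snd c x \<in> V" "T \<times> V \<subseteq> Z" by simp_all
  obtain \<delta> where \<delta>: "\<delta> > 0" "ball 0 \<delta> \<subseteq> T" using TV(1,3) by (meson openE)
  let ?W = "{x \<in> fst c. snd c x \<in> V}"
  have "\<bar>I t x - I 0 x\<bar> \<le> B * \<bar>t\<bar>" if x: "x \<in> ?W" and t: "\<bar>t\<bar> < \<delta>" for x t
  proof -
    have z: "(s, snd c x) \<in> Z" if "s \<in> ball 0 \<delta>" for s using \<delta> TV that x by auto
    have I: "I s x = J (s, snd c x)" if "s \<in> ball 0 \<delta>" for s
      using Z(3)[OF z[OF that]] chart_inv_chart[OF mfd_good_chart[OF assms(2) c(1)], of x] x by simp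
    have "norm (J (t, snd c x) - J (0, snd c x)) \<le> B * norm (t - 0)"
    proof (rule field_differentiable_bound[where S="ball 0 \<delta>" and f'="\<lambda>s. ?D (s, snd c x)"])
      show "((\<lambda>s. J (s, snd c x)) has_real_derivative ?D (s, snd c x)) (at s within ball 0 \<delta>)" if "s \<in> ball 0 \<delta>" for s
        by (rule has_field_derivative_at_within, rule real_derivative_slice) (use Z(3)[OF z[OF that]] in simp)
      show "norm (?D (s, snd c x)) \<le> B" if "s \<in> ball 0 \<delta>" for s using Z(3)[OF z[OF that]] by simp
    qed (use t \<delta> in auto)
    then show ?thesis using I[of t] I[of 0] t \<delta> by simp
  qed
  moreover have "B \<ge> 0" by (simp add: B_def)
  ultimately show ?thesis
    using openin_chart_preimage[OF assms(2) c(1) TV(2)] c(2) TV(4) \<delta>(1) by (intro exI[of _ ?W]) blast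
qed

text \<open>Compactness reduces the local Lipschitz bounds to a single one: the smallest
  \<open>\<delta>\<close> and the largest \<open>B\<close> over a finite cover.\<close>

lemma smooth_family_integral:
  assumes "smooth_manifold S" "compact_space (mtop S)" "volume_form S \<mu>" "volume_measure S \<mu> \<nu>"
    and fam: "smooth_family S I" and cts: "\<And>t. continuous_mfd S (I t)"
  shows "((\<lambda>t. \<integral>x. I t x \<partial>\<nu>) has_real_derivative (\<integral>x. deriv (\<lambda>t. I t x) 0 \<partial>\<nu>)) (at 0)"
proof -
  note m = smooth_manifold_mfd[OF assms(1)] and vc = volume_measure_compact[OF assms(1-4)]
  obtain F where F: "finite F" "\<And>W. W \<in> F \<Longrightarrow> openin (mtop S) W \<and>
    (\<exists>\<delta>>0. \<exists>B\<ge>0. \<forall>x\<in>W. \<forall>t. \<bar>t\<bar> < \<delta> \<longrightarrow> \<bar>I t x - I 0 x\<bar> \<le> B * \<bar>t\<bar>)" "points S = \<Union>F"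
    using compact_finite_subcover[OF m assms(2) smooth_family_locally_lipschitz[OF fam m]] by blast
  have "\<exists>\<delta>>0. \<exists>B\<ge>0. \<forall>x\<in>\<Union>F. \<forall>t. \<bar>t\<bar> < \<delta> \<longrightarrow> \<bar>I t x - I 0 x\<bar> \<le> B * \<bar>t\<bar>"
    using F(1,2)
  proof (induction F)
    case empty
    show ?case by (intro exI[of _ 1]) auto
  next
    case (insert W F)
    obtain d B where 1: "d > 0" "B \<ge> 0" "\<And>x t. x \<in> \<Union>F \<Longrightarrow> \<bar>t\<bar> < d \<Longrightarrow> \<bar>I t x - I 0 x\<bar> \<le> B * \<bar>t\<bar>"
    proof -
      have "\<exists>\<delta>>0. \<exists>B\<ge>0. \<forall>x\<in>\<Union>F. \<forall>t. \<bar>t\<bar> < \<delta> \<longrightarrow> \<bar>I t x - I 0 x\<bar> \<le> B * \<bar>t\<bar>"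
        using insert.prems by (intro insert.IH) blast
      then show thesis using that by blast
    qed
    obtain d' B' where 2: "d' > 0" "B' \<ge> 0" "\<And>x t. x \<in> W \<Longrightarrow> \<bar>t\<bar> < d' \<Longrightarrow> \<bar>I t x - I 0 x\<bar> \<le> B' * \<bar>t\<bar>"
      using insert.prems[of W] by auto
    have "\<bar>I t x - I 0 x\<bar> \<le> max B B' * \<bar>t\<bar>" if x: "x \<in> \<Union>(insert W F)" and t: "\<bar>t\<bar> < min d d'" for x t
    proof -
      have le: "B * \<bar>t\<bar> \<le> max B B' * \<bar>t\<bar>" "B' * \<bar>t\<bar> \<le> max B B' * \<bar>t\<bar>" by (intro mult_right_mono; simp)+
      show ?thesis
      proof (cases "x \<in> W")
        case True
        then show ?thesis using 2(3)[of x t] t le by linarith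
      next
        case False
        then have "x \<in> \<Union>F" using x by blast
        then show ?thesis using 1(3)[of x t] t le by linarith
      qed
    qed
    then show ?case using 1(1,2) 2(1,2) by (intro exI[of _ "min d d'"] conjI exI[of _ "max B B'"]) auto
  qed
  then obtain \<delta> B where \<delta>: "\<delta> > 0" "\<And>x t. x \<in> points S \<Longrightarrow> \<bar>t\<bar> < \<delta> \<Longrightarrow> \<bar>I t x - I 0 x\<bar> \<le> B * \<bar>t\<bar>"
    unfolding F(3) by blast
  show ?thesis
  proof (rule derivative_under_integral[OF vc(1)])
    show "integrable \<nu> (I t)" for t by (rule vc(3)[OF cts])
    show "((\<lambda>t. I t x) has_real_derivative deriv (\<lambda>t. I t x) 0) (at 0)" if "x \<in> space \<nu>" for x
      using that by (intro smooth_family_derivative[OF fam m]) (simp add: vc(2))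
    show "(\<lambda>x. deriv (\<lambda>t. I t x) 0) \<in> borel_measurable \<nu>"
      using vc(3)[OF smooth_family_deriv_continuous_mfd[OF fam m]] by auto
    show "\<delta> > 0" by fact
    show "\<bar>I t x - I 0 x\<bar> \<le> B * \<bar>t\<bar>" if "x \<in> space \<nu>" "\<bar>t\<bar> < \<delta>" for x t
      using that by (intro \<delta>(2)) (simp_all add: vc(2))
  qed
qed

section \<open>The momentum map\<close>

locale momentum_setting = lie_bundle S M G K
  for S :: "('x, 'e::real_normed_vector) atlas" and M :: "('m, 'k::real_normed_vector) atlas"
    and G :: "'g monoid" and K :: "('g, 'h::real_normed_vector) atlas" +
  fixes \<mu> :: "'x \<Rightarrow> (nat \<Rightarrow> 'x tvec) \<Rightarrow> real" and \<nu>S :: "'x measure" and \<nu>G :: "'g measure"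
  assumes manifold_S: "smooth_manifold S" and compact_S: "compact_space (mtop S)"
    and vol: "volume_form S \<mu>" and vol_measure: "volume_measure S \<mu> \<nu>S"
    and haar: "normalized_haar G K \<nu>G"
begin

lemma finite_\<nu>S: "finite_measure \<nu>S" and space_\<nu>S: "space \<nu>S = points S"
  and integrable_\<nu>S: "continuous_mfd S i \<Longrightarrow> integrable \<nu>S i"
  using volume_measure_compact[OF manifold_S compact_S vol vol_measure] by auto

lemma space_\<nu>G: "space \<nu>G = points K"
proof -
  have "sets \<nu>G = sets (borel_of (mtop K))" using haar by (simp add: normalized_haar_def)
  from sets_eq_imp_space_eq[OF this] show ?thesis
    by (simp add: borel_of_def space_measure_of_conv topspace_mtop[OF mfd_K])
qed

lemma emeasure_\<nu>G: "emeasure \<nu>G (space \<nu>G) = 1"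
  using haar by (simp add: normalized_haar_def space_\<nu>G)

text \<open>On the product space \<open>\<phi>\<close> coincides with \<open>i \<circ> fst\<close>,
  so measurability and integrability are inherited from \<open>i\<close>.\<close>

lemma integral_invariant:
  fixes \<phi> :: "'x \<times> 'g \<Rightarrow> real"
  assumes "continuous_mfd S i" "\<And>x g. x \<in> points S \<Longrightarrow> g \<in> points K \<Longrightarrow> \<phi> (x, g) = i x"
  shows "(\<integral>p. \<phi> p \<partial>(\<nu>S \<Otimes>\<^sub>M \<nu>G)) = (\<integral>x. i x \<partial>\<nu>S)"
proof -
  interpret S: finite_measure \<nu>S by (rule finite_\<nu>S)
  interpret G: finite_measure \<nu>G by standard (simp add: emeasure_\<nu>G)
  interpret pair_sigma_finite \<nu>S \<nu>G ..
  have m1: "measure \<nu>G (space \<nu>G) = 1" by (simp add: measure_def emeasure_\<nu>G)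
  have im: "i \<in> borel_measurable \<nu>S" using integrable_\<nu>S[OF assms(1)] by auto
  have int: "integrable (\<nu>S \<Otimes>\<^sub>M \<nu>G) (\<lambda>p. i (fst p))"
  proof (rule Fubini_integrable)
    show "(\<lambda>p. i (fst p)) \<in> borel_measurable (\<nu>S \<Otimes>\<^sub>M \<nu>G)" by (rule measurable_compose[OF measurable_fst im])
    show "integrable \<nu>S (\<lambda>x. \<integral>y. norm (i (fst (x, y))) \<partial>\<nu>G)"
      using integrable_norm[OF integrable_\<nu>S[OF assms(1)]] by (simp add: m1)
  qed simp
  have "(\<integral>p. \<phi> p \<partial>(\<nu>S \<Otimes>\<^sub>M \<nu>G)) = (\<integral>p. i (fst p) \<partial>(\<nu>S \<Otimes>\<^sub>M \<nu>G))"
    by (rule Bochner_Integration.integral_cong[OF refl])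
      (use assms(2) in \<open>auto simp: space_pair_measure space_\<nu>S space_\<nu>G\<close>)
  also have "\<dots> = (\<integral>x. (\<integral>y. i (fst (x, y)) \<partial>\<nu>G) \<partial>\<nu>S)" by (rule integral_fst'[OF int, symmetric])
  also have "\<dots> = (\<integral>x. i x \<partial>\<nu>S)" by (simp add: m1)
  finally show ?thesis .
qed

lemma unit_point: "x \<in> points S \<Longrightarrow> (x, \<e>) \<in> points PS"
  by (simp add: carrier_K)

text \<open>Invariant integrands are determined by their restriction to the unit section; continuity
  of the restriction is what makes it integrable over the compact base.\<close>

lemma continuous_mfd_unit_section:
  fixes \<phi> :: "'x \<times> 'g \<Rightarrow> real"
  assumes "\<And>e p. e \<in> PS \<Longrightarrow> p \<in> fst e \<Longrightarrow> smooth_pt (\<lambda>y. \<phi> (chart_inv e y)) (snd e p)"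
  shows "continuous_mfd S (\<lambda>x. \<phi> (x, \<e>))"
  unfolding continuous_mfd_def
proof (intro ballI)
  fix c x assume c: "c \<in> S" "x \<in> fst c"
  obtain k where k: "k \<in> K" "\<e> \<in> fst k" by (rule unit_chart)
  note g = mfd_good_chart[OF mfd_S c(1)] mfd_good_chart[OF mfd_K k(1)]
  have 1: "smooth_pt (\<lambda>y. \<phi> (chart_inv (prod_chart c k) y)) (snd c x, snd k \<e>)"
    using assms[OF prod_chart_in[OF c(1) k(1)], of "(x, \<e>)"] c k by simp
  have "smooth_pt (\<lambda>y. \<phi> (chart_inv (prod_chart c k) (y, snd k \<e>))) (snd c x)"
    by (rule smooth_pt_compose[where f="\<lambda>y. (y, snd k \<e>)" and x="snd c x", OF findim_prod[OF mfd_findim[OF mfd_S] mfd_findim[OF mfd_K]]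
          smooth_pt_Pair[OF smooth_pt_ident smooth_pt_const] 1])
  then have "smooth_pt (\<lambda>y. \<phi> (chart_inv c y, \<e>)) (snd c x)"
    by (rule smooth_pt_cong) (rule eventually_chart_inv[OF g(1) c(2)], simp add: chart_inv_pc_eq[OF g] k(2))
  then show "isCont (\<lambda>y. \<phi> (chart_inv c y, \<e>)) (snd c x)" by (rule smooth_pt_isCont)
qed

lemma continuous_mfd_diff: "continuous_mfd S i \<Longrightarrow> continuous_mfd S j \<Longrightarrow> continuous_mfd S (\<lambda>x. i x - j x)"
  by (simp add: continuous_mfd_def)

lemma continuous_mfd_cong:
  assumes "continuous_mfd S i" "\<And>x. x \<in> points S \<Longrightarrow> i x = j x"
  shows "continuous_mfd S j"
  unfolding continuous_mfd_def
proof (intro ballI)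
  fix c x assume c: "c \<in> S" "x \<in> fst c"
  have "\<forall>\<^sub>F y in nhds (snd c x). i (chart_inv c y) = j (chart_inv c y)"
    by (rule eventually_chart_inv[OF mfd_good_chart[OF mfd_S c(1)] c(2)])
      (rule assms(2), rule pointsI[OF c(1)], erule chart_inv_in)
  moreover have "isCont (\<lambda>y. i (chart_inv c y)) (snd c x)" using assms(1) c by (simp add: continuous_mfd_def)
  ultimately show "isCont (\<lambda>y. j (chart_inv c y)) (snd c x)" by (rule isCont_cong[THEN iffD1])
qed

section \<open>Pairing with an infinitesimal automorphism\<close>

context
  fixes U
  assumes U: "U \<in> aut_vol S \<mu> G K"
begin

lemma U_tangent: "p \<in> points PS \<Longrightarrow> U p \<in> tangent_space PS p"
  using U by (simp add: aut_vol_def smooth_vector_field_def del: points_prod)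

lemma U_invariant: "p \<in> points PS \<Longrightarrow> g \<in> carrier G \<Longrightarrow> U (ract G g p) = tmap PS (ract G g) p (U p)"
  using U unfolding aut_vol_def by blast

abbreviation Uc where "Uc e \<equiv> (\<lambda>y. coord_rep PS e (chart_inv e y) (U (chart_inv e y)))"

lemma Uc_smooth_pt: "e \<in> PS \<Longrightarrow> p \<in> fst e \<Longrightarrow> smooth_pt (Uc e) (snd e p)"
  using U unfolding aut_vol_def smooth_vector_field_def smooth_on_iff_smooth_pt by blast

lemma base_divergence_free: "divergence_free S \<mu> (base_field S G U)"
  using U by (simp add: aut_vol_def)

lemma invariant_pairing:
  assumes "inv_oneform S G K \<alpha>" "x \<in> points S" "g \<in> points K"
  shows "\<alpha> (x, g) (U (x, g)) = \<alpha> (x, \<e>) (U (x, \<e>))"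
proof -
  note p = unit_point[OF assms(2)]
  have g: "g \<in> carrier G" using assms(3) by (simp add: carrier_K)
  have "pullback PS PS (ract G g) \<alpha> (x, \<e>) (U (x, \<e>)) = \<alpha> (x, \<e>) (U (x, \<e>))"
    using assms(1) g by (simp add: inv_oneform_def)
  then show ?thesis
    using p U_tangent[OF p] U_invariant[OF p g] ract_unit[OF assms(2) g] by (simp add: pullback_def)
qed

lemma oneform_field_smooth_pt:
  assumes "oneform PS \<alpha>" "e \<in> PS" "p \<in> fst e"
  shows "smooth_pt (\<lambda>y. \<alpha> (chart_inv e y) (U (chart_inv e y))) (snd e p)"
proof -
  have "smooth_pt (\<lambda>y. \<alpha> (chart_inv e y) (coord_vec PS e (chart_inv e y) (Uc e y))) (snd e p)"
    by (rule smooth_pt_linear_family[OF mfd_findim[OF mfd_PS] _ _ Uc_smooth_pt[OF assms(2,3)]])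
      (rule oneform_smooth_pt[OF assms], rule oneform_coord_linear[OF mfd_PS assms])
  then show ?thesis
  proof (rule smooth_pt_cong, intro eventually_chart_inv[OF mfd_good_chart[OF mfd_PS assms(2)] assms(3)])
    fix y assume y: "y \<in> snd e ` fst e"
    show "\<alpha> (chart_inv e y) (coord_vec PS e (chart_inv e y) (Uc e y)) = \<alpha> (chart_inv e y) (U (chart_inv e y))"
      using coord_vec_coord_rep[OF mfd_PS assms(2) chart_inv_in[OF y] U_tangent[OF pointsI[OF assms(2) chart_inv_in[OF y]]]]
      by simp
  qed
qed

lemma continuous_mfd_pairing:
  assumes "inv_oneform S G K \<alpha>"
  shows "continuous_mfd S (\<lambda>x. \<alpha> (x, \<e>) (U (x, \<e>)))"
  by (rule continuous_mfd_unit_section[where \<phi>="\<lambda>p. \<alpha> p (U p)"], rule oneform_field_smooth_pt)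
    (use assms in \<open>simp_all add: inv_oneform_def\<close>)

lemma integral_pairing:
  assumes "inv_oneform S G K \<alpha>"
  shows "(\<integral>p. \<alpha> p (U p) \<partial>(\<nu>S \<Otimes>\<^sub>M \<nu>G)) = (\<integral>x. \<alpha> (x, \<e>) (U (x, \<e>)) \<partial>\<nu>S)"
  by (rule integral_invariant[OF continuous_mfd_pairing[OF assms]]) (rule invariant_pairing[OF assms])

text \<open>On the manifold \<open>h\<close> is a function of the base point, so \<open>U\<close>
  acts on it through its projection to the base.\<close>

lemma field_inv_fun:
  assumes "inv_fun S G K h" "x \<in> points S"
  shows "U (x, \<e>) h = base_field S G U x (\<lambda>x. h (x, \<e>))"
proof -
  note p = unit_point[OF assms(2)]
  have "smooth_near S x (\<lambda>x. h (x, \<e>))"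
    by (rule smooth_fun_near[OF mfd_S smooth_fun_inv_fun_base[OF assms(1)] assms(2)])
  then have "base_field S G U x (\<lambda>x. h (x, \<e>)) = U (x, \<e>) (\<lambda>p. h (fst p, \<e>))"
    by (simp add: base_field_def tmap_def o_def)
  also have "\<dots> = U (x, \<e>) h"
    by (rule tangent_apply_cong[OF mfd_PS U_tangent[OF p]])
      (use inv_fun_base[OF assms(1)] in auto)
  finally show ?thesis by simp
qed

lemma integral_field_inv_fun:
  assumes "inv_fun S G K h"
  shows "(\<integral>x. U (x, \<e>) h \<partial>\<nu>S) = 0"
proof -
  have "(\<integral>x. U (x, \<e>) h \<partial>\<nu>S) = (\<integral>x. base_field S G U x (\<lambda>x. h (x, \<e>)) \<partial>\<nu>S)"
    by (rule Bochner_Integration.integral_cong[OF refl]) (simp add: space_\<nu>S field_inv_fun[OF assms])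
  then show ?thesis
    using integral_divergence_free[OF manifold_S compact_S vol vol_measure base_divergence_free smooth_fun_inv_fun_base[OF assms]]
    by simp
qed

lemma pairing_inv_class:
  assumes "inv_oneform S G K \<alpha>"
  shows "pairing \<nu>S \<nu>G (inv_class S G K \<alpha>) U = (\<integral>x. \<alpha> (x, \<e>) (U (x, \<e>)) \<partial>\<nu>S)"
  unfolding pairing_def
proof (rule the_equality)
  show "\<exists>\<beta>\<in>inv_class S G K \<alpha>. (\<integral>x. \<alpha> (x, \<e>) (U (x, \<e>)) \<partial>\<nu>S) = (\<integral>p. \<beta> p (U p) \<partial>(\<nu>S \<Otimes>\<^sub>M \<nu>G))"
    using inv_class_self[OF assms] integral_pairing[OF assms] by metis
  fix r assume "\<exists>\<beta>\<in>inv_class S G K \<alpha>. r = (\<integral>p. \<beta> p (U p) \<partial>(\<nu>S \<Otimes>\<^sub>M \<nu>G))"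
  then obtain \<beta> where \<beta>: "\<beta> \<in> inv_class S G K \<alpha>" "r = (\<integral>p. \<beta> p (U p) \<partial>(\<nu>S \<Otimes>\<^sub>M \<nu>G))" by blast
  obtain h where h: "inv_fun S G K h" "\<And>p v. \<beta> p v = \<alpha> p v + differential PS h p v"
    using inv_classE[OF \<beta>(1)] by blast
  have inv\<beta>: "inv_oneform S G K \<beta>" using \<beta>(1) unfolding inv_class_def by blast
  have eq: "\<beta> (x, \<e>) (U (x, \<e>)) = \<alpha> (x, \<e>) (U (x, \<e>)) + U (x, \<e>) h" if "x \<in> points S" for x
    using U_tangent[OF unit_point[OF that]] that by (simp add: h(2) differential_def carrier_K)
  note cts = continuous_mfd_pairing[OF assms] continuous_mfd_pairing[OF inv\<beta>]
  \<comment> \<open>Continuity of \<open>U h\<close>, and with it integrability, comes from writing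
    it as the difference of two continuous pairings.\<close>
  have ctsU: "continuous_mfd S (\<lambda>x. U (x, \<e>) h)"
    by (rule continuous_mfd_cong[OF continuous_mfd_diff[OF cts(2,1)]]) (simp add: eq)
  have "r = (\<integral>x. \<beta> (x, \<e>) (U (x, \<e>)) \<partial>\<nu>S)" using \<beta>(2) integral_pairing[OF inv\<beta>] by simp
  also have "\<dots> = (\<integral>x. \<alpha> (x, \<e>) (U (x, \<e>)) + U (x, \<e>) h \<partial>\<nu>S)"
    by (rule Bochner_Integration.integral_cong[OF refl]) (simp add: space_\<nu>S eq)
  also have "\<dots> = (\<integral>x. \<alpha> (x, \<e>) (U (x, \<e>)) \<partial>\<nu>S) + (\<integral>x. U (x, \<e>) h \<partial>\<nu>S)"
    by (intro Bochner_Integration.integral_add integrable_\<nu>S cts(1) ctsU)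
  finally show "r = (\<integral>x. \<alpha> (x, \<e>) (U (x, \<e>)) \<partial>\<nu>S)" using integral_field_inv_fun[OF h(1)] by simp
qed

end

text \<open>The chain rule along the curve \<open>\<psi> t p\<close> identifies the map Tf \<circ> U
  as the infinitesimal generator of the right action.\<close>

lemma generator_velocity:
  assumes \<psi>: "smooth_curve_in PS PS (Aut_vol S \<mu> G K) \<psi>" and f: "f \<in> emb_equiv S M G K" and p: "p \<in> points PS"
    and init: "\<psi> 0 p = p" "velocity PS (\<lambda>t. \<psi> t p) 0 = v"
  shows "velocity TP (\<lambda>t. (f \<circ> \<psi> t) p) 0 = tmap TP f p v"
proof -
  note RPS = mfd_prod[OF mfd_real_line mfd_PS]
  have "smooth_at (prod_mfd real_line PS) PS (\<lambda>(t, p). \<psi> t p) (0, p)"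
    using \<psi> p by (intro smooth_map_smooth_at[OF RPS mfd_PS]) (auto simp: smooth_curve_in_def)
  moreover have "smooth_at real_line (prod_mfd real_line PS) (\<lambda>t. (t, p)) 0"
    by (intro smooth_at_Pair mfd_real_line mfd_PS smooth_at_ident smooth_at_const p) simp_all
  ultimately have s: "smooth_at real_line PS (\<lambda>t. \<psi> t p) 0"
    using smooth_at_compose[where F="\<lambda>t. (t, p)" and x=0 and F'="\<lambda>(t, p). \<psi> t p", OF mfd_real_line RPS mfd_PS] by simp
  have sf: "smooth_at PS TP f (\<psi> 0 p)" using emb_smooth_at[OF f p] init(1) by simp
  have "velocity TP (\<lambda>t. f (\<psi> t p)) 0 = tmap TP (\<lambda>t. f (\<psi> t p)) 0 (coord_vec real_line (UNIV, id) 0 1)"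
    by (rule velocity_tmap[OF mfd_TP smooth_at_compose[where F="\<lambda>t. \<psi> t p" and x=0, OF mfd_real_line mfd_PS mfd_TP s sf]])
  also have "\<dots> = tmap TP f (\<psi> 0 p) (tmap PS (\<lambda>t. \<psi> t p) 0 (coord_vec real_line (UNIV, id) 0 1))"
    by (rule tmap_compose[where F="\<lambda>t. \<psi> t p" and x=0, OF mfd_PS mfd_TP sf])
  also have "\<dots> = tmap TP f p v" using init velocity_tmap[OF mfd_PS s] by simp
  finally show ?thesis by (simp add: o_def)
qed

subsection \<open>Curves of embeddings\<close>

context
  fixes F
  assumes curve: "smooth_curve_in PS TP (emb_equiv S M G K) F"
begin

lemma curve_emb: "F t \<in> emb_equiv S M G K"
  using curve by (simp add: smooth_curve_in_def)

lemma curve_smooth_at: "p \<in> points PS \<Longrightarrow> smooth_at (prod_mfd real_line PS) TP (\<lambda>(t, p). F t p) (t, p)"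
  using curve by (intro smooth_map_smooth_at[OF mfd_prod[OF mfd_real_line mfd_PS] mfd_TP]) (auto simp: smooth_curve_in_def)

lemma curve_time_smooth_at:
  assumes "p \<in> points PS"
  shows "smooth_at real_line TP (\<lambda>t. F t p) t"
proof -
  have "smooth_at real_line (prod_mfd real_line PS) (\<lambda>t. (t, p)) t"
    by (intro smooth_at_Pair mfd_real_line mfd_PS smooth_at_ident smooth_at_const assms) simp_all
  then show ?thesis
    using smooth_at_compose[where F="\<lambda>t. (t, p)" and x=t and F'="\<lambda>(t, p). F t p",
        OF mfd_real_line mfd_prod[OF mfd_real_line mfd_PS] mfd_TP] curve_smooth_at[OF assms, of t] by simp
qed

text \<open>Coordinate expression of the curve, jointly in time and bundle coordinates: the first
  component is the base point q, the second the momentum p. Velocities and tangent maps become its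
  partial derivatives, along \<open>(1, 0)\<close> for time and \<open>(0, w)\<close> for
  space.\<close>

definition Phi where
  "Phi e c z = snd (cot_chart P c) (F (fst z) (chart_inv e (snd z)))"

abbreviation (input) dt where "dt t \<equiv> coord_vec real_line (UNIV, id) t 1"

lemma Phi_smooth_pt:
  assumes "e \<in> PS" "p \<in> fst e" "c \<in> P" "F t p \<in> fst (cot_chart P c)"
  shows "smooth_pt (Phi e c) (t, snd e p)"
    and "\<forall>\<^sub>F z in nhds (t, snd e p). F (fst z) (chart_inv e (snd z)) \<in> fst (cot_chart P c) \<and> snd z \<in> snd e ` fst e"
proof -
  note ge = mfd_good_chart[OF mfd_PS assms(1)]
  let ?re = "prod_chart (UNIV :: real set, id) e"
  have R: "(UNIV, id) \<in> real_line" by (simp add: real_line_def)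
  have css: "chart_smooth ?re (cot_chart P c) (\<lambda>(t, p). F t p) (t, p)"
    using smooth_at_chart_smooth[OF mfd_prod[OF mfd_real_line mfd_PS] mfd_TP curve_smooth_at[OF pointsI[OF assms(1,2)], of t]
        prod_chart_in[OF R assms(1)] _ cot_chart_in[OF assms(3)]] assms(2,4) by simp
  have ev: "\<forall>\<^sub>F z in nhds (t, snd e p). chart_inv ?re z = (fst z, chart_inv e (snd z)) \<and> snd z \<in> snd e ` fst e"
    using chart_inv_prod_chart[OF mfd_good_chart[OF mfd_real_line R] ge, of t p] assms(2) by simp
  have 1: "\<forall>\<^sub>F z in nhds (t, snd e p). (\<lambda>(t, p). F t p) (chart_inv ?re z) \<in> fst (cot_chart P c)"
    using chart_smoothD(3)[OF css] by simp
  show "\<forall>\<^sub>F z in nhds (t, snd e p). F (fst z) (chart_inv e (snd z)) \<in> fst (cot_chart P c) \<and> snd z \<in> snd e ` fst e"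
    using ev 1 by eventually_elim simp
  have 2: "smooth_pt (\<lambda>z. snd (cot_chart P c) ((\<lambda>(t, p). F t p) (chart_inv ?re z))) (t, snd e p)"
    using chart_smoothD(4)[OF css] by simp
  show "smooth_pt (Phi e c) (t, snd e p)"
    by (rule smooth_pt_cong[OF 2]) (use ev in eventually_elim, simp add: Phi_def)
qed

lemma curve_chart_smooth:
  assumes "e \<in> PS" "p \<in> fst e" "c \<in> P" "F t p \<in> fst (cot_chart P c)"
  shows "chart_smooth e (cot_chart P c) (F t) p"
  using smooth_at_chart_smooth[OF mfd_PS mfd_TP emb_smooth_at[OF curve_emb pointsI[OF assms(1,2)]] assms(1,2) cot_chart_in[OF assms(3)] assms(4)] .

lemma curve_fd_space:
  assumes "e \<in> PS" "p \<in> fst e" "c \<in> P" "F t p \<in> fst (cot_chart P c)"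
  shows "fd (\<lambda>y. snd (cot_chart P c) (F t (chart_inv e y))) (snd e p) w = fd (Phi e c) (t, snd e p) (0, w)"
  using fd_unique[OF fd_slice2[OF Phi_smooth_pt(1)[OF assms]]] by (simp add: Phi_def)

lemma curve_fd_time:
  assumes "e \<in> PS" "p \<in> fst e" "c \<in> P" "F t p \<in> fst (cot_chart P c)"
  shows "fd (\<lambda>s. snd (cot_chart P c) (F s p)) t 1 = fd (Phi e c) (t, snd e p) (1, 0)"
  using fd_unique[OF fd_slice1[OF Phi_smooth_pt(1)[OF assms]], of 1] chart_inv_chart[OF mfd_good_chart[OF mfd_PS assms(1)] assms(2)]
  by (simp add: Phi_def)

text \<open>The form p dq pulled back at a fixed time: p applied to the spatial derivative of
  q.\<close>

lemma theta_coord: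
  assumes "e \<in> PS" "p \<in> fst e" "c \<in> P" "F t p \<in> fst (cot_chart P c)"
  shows "theta (F t) p (coord_vec PS e p w) =
    blinfun_apply (snd (Phi e c (t, snd e p))) (fst (fd (Phi e c) (t, snd e p) (0, w)))"
  unfolding theta_def pullback_canonical_coord[OF mfd_PS mfd_P assms(1,3) curve_chart_smooth[OF assms]] curve_fd_space[OF assms]
  using chart_inv_chart[OF mfd_good_chart[OF mfd_PS assms(1)] assms(2)] by (simp add: Phi_def)

lemma tmap_coord:
  assumes "e \<in> PS" "p \<in> fst e" "c \<in> P" "F t p \<in> fst (cot_chart P c)"
  shows "tmap TP (F t) p (coord_vec PS e p w) = coord_vec TP (cot_chart P c) (F t p) (fd (Phi e c) (t, snd e p) (0, w))"
  unfolding tmap_coord_vec[OF mfd_PS mfd_TP assms(1) cot_chart_in[OF assms(3)] curve_chart_smooth[OF assms]] curve_fd_space[OF assms] ..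

lemma velocity_coord:
  assumes "e \<in> PS" "p \<in> fst e" "c \<in> P" "F t p \<in> fst (cot_chart P c)"
  shows "velocity TP (\<lambda>t. F t p) t = coord_vec TP (cot_chart P c) (F t p) (fd (Phi e c) (t, snd e p) (1, 0))"
proof -
  have R: "(UNIV, id) \<in> real_line" by (simp add: real_line_def)
  note s = curve_time_smooth_at[OF pointsI[OF assms(1,2)], of t]
  have css: "chart_smooth (UNIV, id) (cot_chart P c) (\<lambda>t. F t p) t"
    by (rule smooth_at_chart_smooth[OF mfd_real_line mfd_TP s R _ cot_chart_in[OF assms(3)] assms(4)]) simp
  show ?thesis
    using tmap_coord_vec[OF mfd_real_line mfd_TP R cot_chart_in[OF assms(3)] css, of 1] curve_fd_time[OF assms]
    by (simp add: velocity_tmap[OF mfd_TP s])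
qed

text \<open>The function \<Theta>(v) of Cartan's formula, for the velocity v of the curve at time 0;
  in coordinates, p applied to the time derivative of q.\<close>

definition velocity_momentum :: "'x \<times> 'g \<Rightarrow> real" where
  "velocity_momentum p = canonical_form P (F 0 p) (velocity TP (\<lambda>t. F t p) 0)"

lemma velocity_momentum_coord:
  assumes "e \<in> PS" "p \<in> fst e" "c \<in> P" "F 0 p \<in> fst (cot_chart P c)"
  shows "velocity_momentum p =
    blinfun_apply (snd (Phi e c (0, snd e p))) (fst (fd (Phi e c) (0, snd e p) (1, 0)))"
  unfolding velocity_momentum_def velocity_coord[OF assms] canonical_form_coord[OF mfd_P assms(3,4)]
  using chart_inv_chart[OF mfd_good_chart[OF mfd_PS assms(1)] assms(2)] by (simp add: Phi_def)

lemma velocity_momentum_near: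
  assumes "e \<in> PS" "p \<in> fst e" "c \<in> P" "F 0 p \<in> fst (cot_chart P c)"
  shows "\<forall>\<^sub>F y in nhds (snd e p). blinfun_apply (snd (Phi e c (0, y))) (fst (fd (Phi e c) (0, y) (1, 0)))
    = velocity_momentum (chart_inv e y)"
  using eventually_slice2[OF Phi_smooth_pt(2)[OF assms]]
proof eventually_elim
  case (elim y)
  then have y: "chart_inv e y \<in> fst e" "snd e (chart_inv e y) = y" by (simp_all add: chart_inv_in chart_chart_inv)
  show ?case using velocity_momentum_coord[OF assms(1) y(1) assms(3)] elim y(2) by simp
qed

lemma base_chart:
  assumes "p \<in> points PS"
  obtains c where "c \<in> P" "F t p \<in> fst (cot_chart P c)"
  using emb_points[OF curve_emb assms] by (rule cotangent_points_obtain)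

text \<open>The base curve through a translated point is the translate of the base curve, so its
  velocity is carried along by the tangent map of the translation, to which the covectors transform
  dually. Smoothness is read off the coordinate formula.\<close>

lemma inv_fun_velocity_momentum: "inv_fun S G K velocity_momentum"
  unfolding inv_fun_def
proof (intro conjI ballI)
  show "smooth_fun PS velocity_momentum"
    unfolding smooth_fun_iff[OF mfd_PS]
  proof
    fix p assume p: "p \<in> points PS"
    then obtain e where e: "e \<in> PS" "p \<in> fst e" by (rule pointsE)
    obtain c where c: "c \<in> P" "F 0 p \<in> fst (cot_chart P c)" using base_chart[OF p] .
    note fin = findim_prod[OF findim_real mfd_findim[OF mfd_PS]]
    have smz: "smooth_pt (\<lambda>z. blinfun_apply (snd (Phi e c z)) (fst (fd (Phi e c) z (1, 0)))) (0, snd e p)"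
      by (intro smooth_pt_blinfun_apply smooth_pt_snd smooth_pt_fst smooth_pt_fd Phi_smooth_pt(1)[OF e c])
    have "smooth_pt (\<lambda>y. blinfun_apply (snd (Phi e c (0, y))) (fst (fd (Phi e c) (0, y) (1, 0)))) (snd e p)"
      by (rule smooth_pt_compose[where f="\<lambda>y. (0, y)" and x="snd e p", OF fin smooth_pt_Pair[OF smooth_pt_const smooth_pt_ident] smz])
    then have "smooth_pt (\<lambda>y. velocity_momentum (chart_inv e y)) (snd e p)"
      using velocity_momentum_near[OF e c] by (rule smooth_pt_cong)
    then show "smooth_at PS real_line velocity_momentum p" by (rule smooth_at_realI[OF mfd_PS e])
  qed
  fix p g assume p: "p \<in> points PS" and g: "g \<in> carrier G"
  have base: "velocity_momentum q = snd (F 0 q) (tmap P (\<lambda>t. fst (F t q)) 0 (dt 0))"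
    and base_tangent: "tmap P (\<lambda>t. fst (F t q)) 0 (dt 0) \<in> tangent_space P (fst (F 0 q))"
    and base_smooth: "smooth_at real_line P (\<lambda>t. fst (F t q)) 0" if q: "q \<in> points PS" for q
  proof -
    note s = curve_time_smooth_at[OF q, of 0] and Fq = emb_points[OF curve_emb[of 0] q]
    note sfst = smooth_at_cotangent_fst[OF mfd_P Fq]
    have dtt: "dt 0 \<in> tangent_space real_line 0"
      by (rule coord_vec_tangent) (simp_all add: real_line_def)
    have "tmap P (\<lambda>t. fst (F t q)) 0 (dt 0) = tmap P fst (F 0 q) (velocity TP (\<lambda>t. F t q) 0)"
      unfolding velocity_tmap[OF mfd_TP s]
      by (rule tmap_compose[where F="\<lambda>t. F t q" and x=0, OF mfd_TP mfd_P sfst])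
    moreover have "velocity TP (\<lambda>t. F t q) 0 \<in> tangent_space TP (F 0 q)"
      unfolding velocity_tmap[OF mfd_TP s] by (rule tmap_tangent[OF mfd_real_line mfd_TP s dtt])
    ultimately show "velocity_momentum q = snd (F 0 q) (tmap P (\<lambda>t. fst (F t q)) 0 (dt 0))"
      using Fq by (simp add: velocity_momentum_def canonical_form_def)
    show sb: "smooth_at real_line P (\<lambda>t. fst (F t q)) 0"
      using smooth_at_compose[where F="\<lambda>t. F t q" and x=0, OF mfd_real_line mfd_TP mfd_P s sfst] .
    show "tmap P (\<lambda>t. fst (F t q)) 0 (dt 0) \<in> tangent_space P (fst (F 0 q))"
      by (rule tmap_tangent[OF mfd_real_line mfd_P sb dtt])
  qed
  have "(\<lambda>t. fst (F t (ract G g p))) = (\<lambda>t. ract G g (fst (F t p)))"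
    using emb_base_equivariant[OF curve_emb p g] by auto
  then have "tmap P (\<lambda>t. fst (F t (ract G g p))) 0 (dt 0) = tmap P (\<lambda>t. ract G g (fst (F t p))) 0 (dt 0)" by simp
  also have "\<dots> = tmap P (ract G g) (fst (F 0 p)) (tmap P (\<lambda>t. fst (F t p)) 0 (dt 0))"
    by (rule tmap_compose[where F="\<lambda>t. fst (F t p)" and x=0, OF mfd_P mfd_P smooth_at_ract[OF mfd_M emb_base_points[OF curve_emb p] g]])
  finally show "velocity_momentum (ract G g p) = velocity_momentum p"
    unfolding base[OF p] base[OF ract_points[OF p g]]
    using emb_covector_equivariant[OF curve_emb p g base_tangent[OF p]] by simp
qed

context
  fixes U
  assumes U: "U \<in> aut_vol S \<mu> G K"
begin

text \<open>Cartan's formula for the variation of \<open>F\<^sup>*\<Theta>\<close>: in coordinates the two mixed second derivatives of \<open>F\<close> cancel.\<close>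

lemma momentum_variation:
  assumes p: "p \<in> points PS"
  shows "((\<lambda>t. theta (F t) p (U p)) has_real_derivative
    - ext_deriv TP (canonical_form P) (F 0 p) (tmap TP (F 0) p (U p)) (velocity TP (\<lambda>t. F t p) 0)
    + U p velocity_momentum) (at 0)"
proof -
  obtain e where e: "e \<in> PS" "p \<in> fst e" using p by (rule pointsE)
  obtain c where c: "c \<in> P" "F 0 p \<in> fst (cot_chart P c)"
    "\<And>a b. ext_deriv TP (canonical_form P) (F 0 p) (coord_vec TP (cot_chart P c) (F 0 p) a) (coord_vec TP (cot_chart P c) (F 0 p) b)
      = blinfun_apply (snd a) (fst b) - blinfun_apply (snd b) (fst a)"
    using ext_deriv_canonical[OF mfd_P emb_points[OF curve_emb p]] by blast
  define U0 where "U0 = coord_rep PS e p (U p)"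
  have U0: "U p = coord_vec PS e p U0"
    unfolding U0_def using coord_vec_coord_rep[OF mfd_PS e U_tangent[OF U p]] by simp
  define z0 where "z0 = (0::real, snd e p)"
  define \<Phi> where "\<Phi> = Phi e c"
  have smooth_pt\<Phi>: "smooth_pt \<Phi> z0" unfolding \<Phi>_def z0_def by (rule Phi_smooth_pt(1)[OF e c(1,2)])
  note hd\<Phi> = smooth_pt_has_derivative[OF smooth_pt\<Phi>]
  \<comment> \<open>With (q, p) the coordinates of the curve, \<open>Q\<close> is p,
    \<open>B\<close> the derivative of q along the constant vector \<open>U0\<close>, and
    \<open>C\<close> its time derivative. Freezing \<open>U0\<close> is legitimate because only the
    value of \<open>U\<close> at \<open>p\<close> enters.\<close>
  define Q where "Q z = snd (\<Phi> z)" for z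
  define B where "B z = fst (fd \<Phi> z (0, U0))" for z
  define C where "C z = fst (fd \<Phi> z (1, 0))" for z
  have smA: "smooth_pt Q z0" and smB: "smooth_pt B z0" and smC: "smooth_pt C z0"
    unfolding Q_def[abs_def] B_def[abs_def] C_def[abs_def] by (intro smooth_pt_snd smooth_pt_fst smooth_pt_fd smooth_pt\<Phi>)+
  have fdA: "fd Q z0 v = snd (fd \<Phi> z0 v)" for v
    unfolding Q_def[abs_def] by (rule fd_unique) (rule bounded_linear.has_derivative[OF bounded_linear_snd hd\<Phi>])
  have prod: "fd (\<lambda>z. blinfun_apply (Q z) (X z)) z0 v = blinfun_apply (Q z0) (fd X z0 v) + blinfun_apply (fd Q z0 v) (X z0)"
    if "smooth_pt X z0" for X v
    by (rule fd_unique) (rule bounded_bilinear.FDERIV[OF bounded_bilinear_blinfun_apply smooth_pt_has_derivative[OF smA] smooth_pt_has_derivative[OF that]])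
  \<comment> \<open>Equality of mixed second derivatives was shown for real-valued functions, so q
    is first composed with the fixed functional \<open>Q z0\<close>, the combination in which the
    second derivatives occur.\<close>
  have symm: "blinfun_apply (Q z0) (fd B z0 (1, 0)) = blinfun_apply (Q z0) (fd C z0 (0, U0))"
  proof -
    let ?l = "\<lambda>a. blinfun_apply (Q z0) (fst a)"
    have bl: "bounded_linear ?l" by (rule bounded_linear_compose[OF blinfun.bounded_linear_right bounded_linear_fst])
    have fl: "fd (\<lambda>z. ?l (\<Phi> z)) z v = ?l (fd \<Phi> z v)" if "smooth_pt \<Phi> z" for z v
      by (rule fd_unique) (rule bounded_linear.has_derivative[OF bl smooth_pt_has_derivative[OF that]])
    have flev: "\<forall>\<^sub>F z in nhds z0. fd (\<lambda>z. ?l (\<Phi> z)) z v = ?l (fd \<Phi> z v)" for v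
      using smooth_pt_eventually[OF smooth_pt\<Phi>] by eventually_elim (rule fl)
    have second: "fd (\<lambda>z. fd (\<lambda>z. ?l (\<Phi> z)) z v) z0 w = ?l (fd (\<lambda>z. fd \<Phi> z v) z0 w)" for v w
      unfolding fd_cong[OF flev]
      by (rule fd_unique) (rule bounded_linear.has_derivative[OF bl smooth_pt_has_derivative[OF smooth_pt_fd[OF smooth_pt\<Phi>]]])
    have first: "fd (\<lambda>z. fst (fd \<Phi> z v)) z0 w = fst (fd (\<lambda>z. fd \<Phi> z v) z0 w)" for v w
      by (rule fd_unique) (rule bounded_linear.has_derivative[OF bounded_linear_fst smooth_pt_has_derivative[OF smooth_pt_fd[OF smooth_pt\<Phi>]]])
    show ?thesis
      using smooth_pt_second_derivative_symmetric[OF smooth_pt_linear_comp[OF bl smooth_pt\<Phi>], of "(0, U0)" "(1, 0)"]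
      unfolding second B_def[abs_def] C_def[abs_def] first by simp
  qed
  have "\<forall>\<^sub>F t in nhds 0. blinfun_apply (Q (t, snd e p)) (B (t, snd e p)) = theta (F t) p (U p)"
    using eventually_slice1[OF Phi_smooth_pt(2)[OF e c(1,2)]]
  proof eventually_elim
    case (elim t)
    then have "F t p \<in> fst (cot_chart P c)" using chart_inv_chart[OF mfd_good_chart[OF mfd_PS e(1)] e(2)] by simp
    then show ?case unfolding U0 using theta_coord[OF e c(1)] by (simp add: Q_def B_def \<Phi>_def)
  qed
  moreover have "((\<lambda>t. blinfun_apply (Q (t, snd e p)) (B (t, snd e p))) has_real_derivative
      fd (\<lambda>z. blinfun_apply (Q z) (B z)) z0 (1, 0)) (at 0)"
    using real_derivative_slice[OF smooth_pt_blinfun_apply[OF smA smB, unfolded z0_def]] by (simp add: z0_def)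
  ultimately have d: "((\<lambda>t. theta (F t) p (U p)) has_real_derivative fd (\<lambda>z. blinfun_apply (Q z) (B z)) z0 (1, 0)) (at 0)"
    using DERIV_cong_ev[of 0 0 "\<lambda>t. blinfun_apply (Q (t, snd e p)) (B (t, snd e p))" "\<lambda>t. theta (F t) p (U p)"] by blast
  have h: "U p velocity_momentum = fd (\<lambda>z. blinfun_apply (Q z) (C z)) z0 (0, U0)"
  proof -
    have "smooth_fun PS velocity_momentum" using inv_fun_velocity_momentum by (simp add: inv_fun_def)
    then have "U p velocity_momentum = fd (\<lambda>y. velocity_momentum (chart_inv e y)) (snd e p) U0"
      unfolding U0 by (simp add: coord_vec_apply smooth_fun_near[OF mfd_PS _ p])
    also have "\<dots> = fd (\<lambda>y. blinfun_apply (Q (0, y)) (C (0, y))) (snd e p) U0"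
      using fd_cong[OF velocity_momentum_near[OF e c(1,2)]] by (simp add: Q_def C_def \<Phi>_def)
    also have "\<dots> = fd (\<lambda>z. blinfun_apply (Q z) (C z)) z0 (0, U0)"
      using fd_unique[OF fd_slice2[OF smooth_pt_blinfun_apply[OF smA smC, unfolded z0_def]]] by (simp add: z0_def)
    finally show ?thesis .
  qed
  \<comment> \<open>The value of dp \<and> dq on the spatial and the time derivative. Compared with
    the two product rules, what remains are the mixed second derivatives of q, which agree by
    \<open>symm\<close>.\<close>
  have x: "ext_deriv TP (canonical_form P) (F 0 p) (tmap TP (F 0) p (U p)) (velocity TP (\<lambda>t. F t p) 0)
      = blinfun_apply (fd Q z0 (0, U0)) (C z0) - blinfun_apply (fd Q z0 (1, 0)) (B z0)"
    unfolding U0 tmap_coord[OF e c(1,2)] velocity_coord[OF e c(1,2)] c(3) fdA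
    by (simp add: C_def B_def \<Phi>_def z0_def)
  show ?thesis
    using d unfolding h x prod[OF smB] prod[OF smC] symm by (simp add: algebra_simps)
qed

text \<open>The expression in \<open>theta_coord\<close>, with the components of \<open>U\<close> as
  direction, is jointly smooth in time and bundle coordinates; freezing the group coordinate at the
  unit gives the family on the base.\<close>

lemma smooth_family_theta: "smooth_family S (\<lambda>t x. theta (F t) (x, \<e>) (U (x, \<e>)))"
  unfolding smooth_family_def
proof (intro ballI)
  fix c x assume c: "c \<in> S" "x \<in> fst c"
  obtain k where k: "k \<in> K" "\<e> \<in> fst k" by (rule unit_chart)
  note g = mfd_good_chart[OF mfd_S c(1)] mfd_good_chart[OF mfd_K k(1)]
  let ?e = "prod_chart c k" and ?p = "(x, \<e>)"
  have e: "?e \<in> PS" "?p \<in> fst ?e" using prod_chart_in[OF c(1) k(1)] c(2) k(2) by simp_all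
  obtain b where b: "b \<in> P" "F 0 ?p \<in> fst (cot_chart P b)" using base_chart[OF pointsI[OF e]] .
  note fin = findim_prod[OF findim_real mfd_findim[OF mfd_PS]]
  define J where "J z = blinfun_apply (snd (Phi ?e b z)) (fst (fd (Phi ?e b) z (0, Uc U ?e (snd z))))" for z
  have p': "snd ?e ?p = (snd c x, snd k \<e>)" by simp
  have smJ: "smooth_pt J (0, snd ?e ?p)" unfolding J_def[abs_def]
  proof (intro smooth_pt_blinfun_apply smooth_pt_snd smooth_pt_fst Phi_smooth_pt(1)[OF e b] smooth_pt_fd_var[where g="\<lambda>z. z", OF fin Phi_smooth_pt(1)[OF e b] _ smooth_pt_ident] smooth_pt_Pair smooth_pt_const)
    show "smooth_pt (\<lambda>z. Uc U ?e (snd z)) (0, snd ?e ?p)"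
      by (rule smooth_pt_compose[where f=snd and g="Uc U ?e", OF mfd_findim[OF mfd_PS] smooth_pt_linear[OF bounded_linear_snd]])
        (use Uc_smooth_pt[OF U e] in simp)
  qed
  have evJ: "\<forall>\<^sub>F z in nhds (0, snd ?e ?p). J z = theta (F (fst z)) (chart_inv ?e (snd z)) (U (chart_inv ?e (snd z)))"
    using Phi_smooth_pt(2)[OF e b]
  proof eventually_elim
    case (elim z)
    let ?q = "chart_inv ?e (snd z)"
    have q: "?q \<in> fst ?e" "snd ?e ?q = snd z" using elim chart_inv_in[of "snd z" ?e] chart_chart_inv[of "snd z" ?e] by blast+
    have "U ?q = coord_vec PS ?e ?q (Uc U ?e (snd z))"
      using coord_vec_coord_rep[OF mfd_PS e(1) q(1) U_tangent[OF U pointsI[OF e(1) q(1)]]] by simp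
    then show ?case using theta_coord[OF e(1) q(1) b(1), of "fst z" "Uc U ?e (snd z)"] elim q(2) by (simp add: J_def)
  qed
  let ?g = "\<lambda>z::real \<times> 'e. (fst z, (snd z, snd k \<e>))"
  have smg: "smooth_pt ?g (0, snd c x)" by (intro smooth_pt_Pair smooth_pt_fst smooth_pt_snd smooth_pt_ident smooth_pt_const)
  have "smooth_pt (\<lambda>z. J (?g z)) (0, snd c x)"
    by (rule smooth_pt_compose[where f="?g", OF fin smg]) (use smJ in simp)
  moreover have "\<forall>\<^sub>F z in nhds (0, snd c x). J (?g z) = theta (F (fst z)) (chart_inv c (snd z), \<e>) (U (chart_inv c (snd z), \<e>))"
  proof -
    have 1: "\<forall>\<^sub>F z in nhds (0, snd c x). J (?g z) = theta (F (fst (?g z))) (chart_inv ?e (snd (?g z))) (U (chart_inv ?e (snd (?g z))))"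
      by (rule smooth_pt_eventually_comp[where f="?g", OF smg]) (use evJ in simp)
    have 2: "\<forall>\<^sub>F z in nhds (0::real, snd c x). snd z \<in> snd c ` fst c"
      by (rule smooth_pt_eventually_comp[where f=snd and P="\<lambda>y. y \<in> snd c ` fst c", OF smooth_pt_linear[OF bounded_linear_snd]])
        (use eventually_in_chart[OF g(1) c(2)] in simp)
    from 1 2 show ?thesis by eventually_elim (simp add: chart_inv_pc_eq[OF g] k(2))
  qed
  ultimately show "\<exists>J. smooth_pt J (0, snd c x) \<and>
     (\<forall>\<^sub>F z in nhds (0, snd c x). J z = theta (F (fst z)) (chart_inv c (snd z), \<e>) (U (chart_inv c (snd z), \<e>)))"
    by blast
qed

text \<open>By \<open>momentum_variation\<close> the symplectic integrand is the time derivative of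
  the pairing integrand minus \<open>U velocity_momentum\<close>. The second part integrates to 0,
  and the first is matched by differentiation under the integral sign.\<close>

lemma momentum_derivative:
  "((\<lambda>t. pairing \<nu>S \<nu>G (J_R S M G K (F t)) U) has_real_derivative
     sympl_form_emb \<nu>S \<nu>G M K (F 0) (\<lambda>p. tmap TP (F 0) p (U p)) (\<lambda>p. velocity TP (\<lambda>t. F t p) 0)) (at 0)"
proof -
  let ?I = "\<lambda>t x. theta (F t) (x, \<e>) (U (x, \<e>))"
  let ?I' = "\<lambda>x. deriv (\<lambda>t. ?I t x) 0"
  let ?h = velocity_momentum
  note inv = inv_oneform_theta[OF curve_emb]
  have cts: "continuous_mfd S (?I t)" for t by (rule continuous_mfd_pairing[OF U inv])
  have pair: "pairing \<nu>S \<nu>G (J_R S M G K (F t)) U = (\<integral>x. ?I t x \<partial>\<nu>S)" for t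
    unfolding J_R_theta by (rule pairing_inv_class[OF U inv])
  have cts': "continuous_mfd S ?I'" by (rule smooth_family_deriv_continuous_mfd[OF smooth_family_theta mfd_S])
  have smh: "smooth_fun PS ?h" using inv_fun_velocity_momentum by (simp add: inv_fun_def)
  have ctsh: "continuous_mfd S (\<lambda>x. U (x, \<e>) ?h)"
  proof (rule continuous_mfd_unit_section[where \<phi>="\<lambda>p. U p ?h"])
    fix e p assume e: "e \<in> PS" "p \<in> fst e"
    note ge = mfd_good_chart[OF mfd_PS e(1)]
    have smhe: "smooth_pt (\<lambda>y. ?h (chart_inv e y)) (snd e p)"
      using smooth_near_smooth_pt[OF mfd_PS e smooth_fun_near[OF mfd_PS smh pointsI[OF e]]] .
    have "smooth_pt (\<lambda>y. fd (\<lambda>y. ?h (chart_inv e y)) y (Uc U e y)) (snd e p)"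
      by (rule smooth_pt_fd_var[where g="\<lambda>y. y", OF mfd_findim[OF mfd_PS] smhe Uc_smooth_pt[OF U e] smooth_pt_ident])
    then show "smooth_pt (\<lambda>y. U (chart_inv e y) ?h) (snd e p)"
    proof (rule smooth_pt_cong, intro eventually_chart_inv[OF ge e(2)])
      fix y assume y: "y \<in> snd e ` fst e"
      let ?q = "chart_inv e y"
      note q = chart_inv_in[OF y] and qp = pointsI[OF e(1) chart_inv_in[OF y]]
      have "U ?q = coord_vec PS e ?q (Uc U e y)"
        using coord_vec_coord_rep[OF mfd_PS e(1) q U_tangent[OF U qp]] by simp
      then have "U ?q ?h = coord_vec PS e ?q (Uc U e y) ?h" by (rule arg_cong)
      then show "fd (\<lambda>y. ?h (chart_inv e y)) y (Uc U e y) = U ?q ?h"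
        using smooth_fun_near[OF mfd_PS smh qp] chart_chart_inv[OF y] by (simp add: coord_vec_apply)
    qed
  qed
  \<comment> \<open>The left side is formed at \<open>(x, g)\<close>, yet it depends on
    \<open>x\<close> alone because both terms on the right are invariant; this is the form that
    \<open>integral_invariant\<close> takes.\<close>
  have ext: "- ext_deriv TP (canonical_form P) (F 0 (x, g)) (tmap TP (F 0) (x, g) (U (x, g))) (velocity TP (\<lambda>t. F t (x, g)) 0)
      = ?I' x - U (x, \<e>) ?h" if x: "x \<in> points S" and g: "g \<in> points K" for x g
  proof -
    have p: "(x, g) \<in> points PS" using x g by simp
    have "(\<lambda>t. theta (F t) (x, g) (U (x, g))) = (\<lambda>t. ?I t x)"
      using invariant_pairing[OF U inv x g] by auto
    then have "?I' x = - ext_deriv TP (canonical_form P) (F 0 (x, g)) (tmap TP (F 0) (x, g) (U (x, g))) (velocity TP (\<lambda>t. F t (x, g)) 0)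
        + U (x, g) ?h"
      using DERIV_imp_deriv[OF momentum_variation[OF p]] by simp
    moreover have "U (x, g) ?h = U (x, \<e>) ?h"
    proof -
      have gc: "g \<in> carrier G" using g by (simp add: carrier_K)
      note u = unit_point[OF x]
      have "U (x, g) = tmap PS (ract G g) (x, \<e>) (U (x, \<e>))"
        using U_invariant[OF U u gc] ract_unit[OF x gc] by simp
      then have "U (x, g) ?h = U (x, \<e>) (\<lambda>p. ?h (ract G g p))"
        using smooth_fun_near[OF mfd_PS smh p] ract_unit[OF x gc] by (simp add: tmap_def o_def)
      also have "\<dots> = U (x, \<e>) ?h"
        by (rule tangent_apply_cong[OF mfd_PS U_tangent[OF U u]])
          (use inv_fun_velocity_momentum gc in \<open>simp add: inv_fun_def del: points_prod\<close>)
      finally show ?thesis .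
    qed
    ultimately show ?thesis by simp
  qed
  have "sympl_form_emb \<nu>S \<nu>G M K (F 0) (\<lambda>p. tmap TP (F 0) p (U p)) (\<lambda>p. velocity TP (\<lambda>t. F t p) 0)
      = (\<integral>x. ?I' x - U (x, \<e>) ?h \<partial>\<nu>S)"
    unfolding sympl_form_emb_def by (rule integral_invariant[OF continuous_mfd_diff[OF cts' ctsh] ext])
  also have "\<dots> = (\<integral>x. ?I' x \<partial>\<nu>S) - (\<integral>x. U (x, \<e>) ?h \<partial>\<nu>S)"
    by (intro Bochner_Integration.integral_diff integrable_\<nu>S cts' ctsh)
  also have "\<dots> = (\<integral>x. ?I' x \<partial>\<nu>S)"
    using integral_field_inv_fun[OF U inv_fun_velocity_momentum] by simp
  finally show ?thesis
    unfolding pair using smooth_family_integral[OF manifold_S compact_S vol vol_measure smooth_family_theta cts] by simp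
qed

end

end

theorem momentum_map_J_R: "momentum_map S \<mu> \<nu>S M G K \<nu>G (J_R S M G K)"
  unfolding momentum_map_def Let_def
proof (intro conjI ballI allI impI)
  show "J_R S M G K f \<in> aut_vol_dual S G K" if "f \<in> emb_equiv S M G K" for f by (rule J_R_dual[OF that])
  fix U assume U: "U \<in> aut_vol S \<mu> G K"
  show "velocity TP (\<lambda>t. (f \<circ> \<psi> t) p) 0 = tmap TP f p (U p)"
    if "smooth_curve_in PS PS (Aut_vol S \<mu> G K) \<psi> \<and> (\<forall>p\<in>points PS. \<psi> 0 p = p \<and> velocity PS (\<lambda>t. \<psi> t p) 0 = U p)"
      "f \<in> emb_equiv S M G K" "p \<in> points PS" for \<psi> f p
    using that by (intro generator_velocity) auto
  show "((\<lambda>t. pairing \<nu>S \<nu>G (J_R S M G K (F t)) U) has_real_derivative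
      sympl_form_emb \<nu>S \<nu>G M K (F 0) (\<lambda>p. tmap TP (F 0) p (U p)) (\<lambda>p. velocity TP (\<lambda>t. F t p) 0)) (at 0)"
    if "smooth_curve_in PS TP (emb_equiv S M G K) F" for F
    by (rule momentum_derivative[OF that U])
qed

end

theorem proposition5p13:
  fixes S :: "('x, 'e::real_normed_vector) atlas"
    and \<mu> :: "'x \<Rightarrow> (nat \<Rightarrow> 'x tvec) \<Rightarrow> real" and \<nu>S :: "'x measure"
    and M :: "('m, 'k::real_normed_vector) atlas"
    and G :: "'g monoid" and K :: "('g, 'h::real_normed_vector) atlas" and \<nu>G :: "'g measure"
    and A :: "'x \<Rightarrow> 'x tvec \<Rightarrow> 'g tvec"
  assumes "smooth_manifold S" and "compact_space (mtop S)"
    and "volume_form S \<mu>" and "volume_measure S \<mu> \<nu>S"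
    and "smooth_manifold M"
    and "lie_group G K" and "compact_space (mtop K)" and "normalized_haar G K \<nu>G"
    and "lie_alg_oneform S G K A"
  shows "momentum_map S \<mu> \<nu>S M G K \<nu>G (J_R S M G K) \<and>
    (\<forall>f PQ \<kappa>.
       f \<in> emb_equiv S M G K \<and>
       smooth_map S (cotangent_mfd M) PQ \<and> smooth_map S (cotangent_mfd K) \<kappa> \<and>
       (\<forall>x\<in>points S. \<forall>g\<in>carrier G.
          f (x, g) = cot_pair M K (PQ x) (cot_ract_group G K g (\<kappa> x))) \<longrightarrow>
       dual_ident S G K A (J_R S M G K f) =
         (oneform_class S (\<lambda>x v. pullback S (cotangent_mfd M) PQ (canonical_form M) x v
                               + pullback S (cotangent_mfd K) \<kappa> (canonical_form K) x v
                               - contract S (left_triv S G K \<kappa>) A x v),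
          left_triv S G K \<kappa>) \<and>
       dual_ident S G K A (J_R S M G K f) \<in> oneform_quotient S \<times> dual_funs S G K)"
proof -
  interpret momentum_setting S M G K \<mu> \<nu>S \<nu>G
    using assms by unfold_locales (simp_all add: smooth_manifold_mfd)
  show ?thesis
  proof (intro conjI allI impI)
    show "momentum_map S \<mu> \<nu>S M G K \<nu>G (J_R S M G K)" by (rule momentum_map_J_R)
  qed (elim conjE, rule dual_ident_momentum; (assumption | rule assms | blast))+
qed

end
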